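(* Let $\Omega\subset\mathbb R^m$ be a bounded open set. Let $\varrho_1:\mathbb R^{1\times m}\to[0,\infty)$ be convex with $\varrho_1(\xi)\le C(1+|\xi|)$ for some $C>0$, and let $\varrho_2:\mathbb R^{m\times m}\to[0,\infty)$ be convex and such that, for some $p\ge1$ and $C_1,C_2>0$, $C_1(|M|^p-1)\le\varrho_2(M)\le C_2(|M|^p+1)$ for all $M\in\mathbb R^{m\times m}$. For $w\in BV(\Omega)$ and $z\in\mathcal D_2$ let $$\widetilde{\mathcal R}(w,z)=\varrho_1(Dw-z^T\mathcal L^m)(\Omega)+\mathcal R_2(z),$$ where $(\mathcal R_2,\mathcal D_2)$ is one of the following: (a) $\mathcal R_2(z)=\varrho_2(Ez)(\Omega)$, $\mathcal D_2=BD(\Omega)$; (b) $\mathcal R_2(z)=\varrho_2(Dz)(\Omega)$, $\mathcal D_2=BV(\Omega)^m$; (c) $\mathcal R_2(z)=\varrho_2(Dz)(\Omega)$, $\mathcal D_2=\{z\in BV(\Omega)^m: z^T=D\widetilde z,\ \widetilde z\in BV(\Omega)\}$. Assume that $\tau\mapsto\varrho_1(A(I+\tau B))$ is differentiable at $\tau=0$ for all $A\in\mathbb R^{1\times m}$, $B\in\mathbb R^{m\times m}$; that $\tau\mapsto\varrho_1^\infty(A(I+\tau B))$ is differentiable at $\tau=0$ for all $A\in\mathbb R^{1\times m}$ of rank $1$ and $B\in\mathbb R^{m\times m}$; that $\varrho_2$ is differentiable; and, if $p=1$, that $\varrho_2^\infty$ is differentiable on $\mathbb R^{m\times m}\setminus\{0\}$.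 For $z\in\mathcal D_2$, $\varphi\in C_c^\infty(\Omega)^m$ and $\tau$ in a neighborhood of $0$ set $$z_{\varphi,\tau}(x)=(I+\tau D\varphi(x))^Tz(x+\tau\varphi(x)),\qquad w_\tau^\varphi(x)=w(x+\tau\varphi(x)).$$ Then for any $w\in BV(\Omega)$, any $z\in\mathcal D_2$ with $\mathcal R_2(z)<\infty$ and any $\varphi\in C_c^\infty(\Omega)^m$, the map $\tau\mapsto\widetilde{\mathcal R}(w^\varphi_\tau,z_{\varphi,\tau})$ is differentiable at $\tau=0$.
   Context: For a convex function $\varrho$, $\varrho^\infty(\xi)=\lim_{t\to\infty}\frac1t\varrho(t\xi)$. For a finite matrix-valued Radon measure $\mu=\mu^a\mathcal L^m+\mu^s$ on $\Omega$ ($\mu^s\perp\mathcal L^m$), $\varrho(\mu)$ is the measure $d\varrho(\mu)=\varrho(\mu^a)\,d\mathcal L^m+\varrho^\infty\big(\tfrac{\mu^s}{|\mu^s|}\big)\,d|\mu^s|$, where $\mu^s/|\mu^s|$ is the polar density; when $\varrho=\varrho_2$ has growth $p>1$, $\varrho_2^\infty=\infty$ away from $0$, so $\varrho_2(\mu)(\Omega)=\infty$ unless $\mu^s=0$. $z$ is a column vector field, $Dw$ is a row-vector-valued measure. $Ez=\frac12(Dz+Dz^T)$ and $BD(\Omega)$ is the space of $z\in L^1(\Omega)^m$ such that $Ez$ is a finite Radon measure on $\Omega$. *)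

theory Defs
  imports "HOL-Analysis.Analysis"
begin

section \<open>Test functions\<close>

primrec C_k :: "nat \<Rightarrow> ('a::euclidean_space \<Rightarrow> 'b::real_normed_vector) \<Rightarrow> bool" where
  "C_k 0 f \<longleftrightarrow> continuous_on UNIV f"
| "C_k (Suc k) f \<longleftrightarrow>
     (\<forall>x. f differentiable (at x)) \<and> (\<forall>v. C_k k (\<lambda>x. frechet_derivative f (at x) v))"

text \<open>Test functions on \<open>\<Omega>\<close> are identified with their extension by zero to the whole space.\<close>

definition test_functions ::
    "'a::euclidean_space set \<Rightarrow> ('a \<Rightarrow> 'b::real_normed_vector) set" where
  "test_functions \<Omega> =
     {\<phi>. (\<forall>k. C_k k \<phi>) \<and> compact (closure {x. \<phi> x \<noteq> 0}) \<and> closure {x. \<phi> x \<noteq> 0} \<subseteq> \<Omega>}"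


section \<open>Finite vector-valued Radon measures\<close>

definition borel_subsets :: "'a::topological_space set \<Rightarrow> 'a set set" where
  "borel_subsets \<Omega> = {A. A \<in> sets borel \<and> A \<subseteq> \<Omega>}"

text \<open>
  On an open subset of a Euclidean space every countably additive Borel set function with values
  in a finite-dimensional space is a finite Radon measure. As for scalar measures in the library,
  the value is 0 outside the \<open>\<sigma>\<close>-algebra, so that equality of measures is equality of functions.
\<close>

definition finite_vector_measure ::
    "'a::euclidean_space set \<Rightarrow> ('a set \<Rightarrow> 'v::euclidean_space) \<Rightarrow> bool" where
  "finite_vector_measure \<Omega> \<mu> \<longleftrightarrow>
     (\<forall>A::nat \<Rightarrow> 'a set. range A \<subseteq> borel_subsets \<Omega> \<and> disjoint_family A \<longrightarrow>
        (\<lambda>i. \<mu> (A i)) sums \<mu> (\<Union>i. A i)) \<and>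
     (\<forall>A. A \<notin> borel_subsets \<Omega> \<longrightarrow> \<mu> A = 0)"

definition total_variation ::
    "'a::euclidean_space set \<Rightarrow> ('a set \<Rightarrow> 'v::euclidean_space) \<Rightarrow> 'a measure" where
  "total_variation \<Omega> \<mu> = measure_of \<Omega> (borel_subsets \<Omega>)
     (\<lambda>E. SUP A \<in> {A::nat \<Rightarrow> 'a set. range A \<subseteq> borel_subsets \<Omega> \<and> disjoint_family A \<and> (\<Union>i. A i) = E}.
        (\<Sum>i. ennreal (norm (\<mu> (A i)))))"

text \<open>The density \<open>\<mu>/|\<mu>|\<close>; it is determined up to \<open>|\<mu>|\<close>-null sets.\<close>

definition polar_density ::
    "'a::euclidean_space set \<Rightarrow> ('a set \<Rightarrow> 'v::euclidean_space) \<Rightarrow> 'a \<Rightarrow> 'v" where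
  "polar_density \<Omega> \<mu> = (SOME \<sigma>. integrable (total_variation \<Omega> \<mu>) \<sigma> \<and>
     (\<forall>A\<in>borel_subsets \<Omega>. \<mu> A = (LINT x:A|total_variation \<Omega> \<mu>. \<sigma> x)))"

definition vm_integral ::
    "'a::euclidean_space set \<Rightarrow> ('a set \<Rightarrow> 'v::euclidean_space) \<Rightarrow> ('a \<Rightarrow> real) \<Rightarrow> 'v" where
  "vm_integral \<Omega> \<mu> \<phi> = (LINT x|total_variation \<Omega> \<mu>. \<phi> x *\<^sub>R polar_density \<Omega> \<mu> x)"

text \<open>The measure \<open>f \<L>\<^sup>m\<close> on \<open>\<Omega>\<close>.\<close>

definition lebesgue_times ::
    "'a::euclidean_space set \<Rightarrow> ('a \<Rightarrow> 'v::euclidean_space) \<Rightarrow> 'a set \<Rightarrow> 'v" where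
  "lebesgue_times \<Omega> f A = (if A \<in> borel_subsets \<Omega> then (LINT x:A|lebesgue. f x) else 0)"

definition is_lebesgue_decomposition ::
    "'a::euclidean_space set \<Rightarrow> ('a set \<Rightarrow> 'v::euclidean_space) \<Rightarrow> ('a \<Rightarrow> 'v) \<Rightarrow> ('a set \<Rightarrow> 'v) \<Rightarrow> bool" where
  "is_lebesgue_decomposition \<Omega> \<mu> f \<nu> \<longleftrightarrow>
     f absolutely_integrable_on \<Omega> \<and> finite_vector_measure \<Omega> \<nu> \<and>
     (\<exists>N\<in>borel_subsets \<Omega>. emeasure lebesgue N = 0 \<and> emeasure (total_variation \<Omega> \<nu>) (\<Omega> - N) = 0) \<and>
     (\<forall>A. \<mu> A = lebesgue_times \<Omega> f A + \<nu> A)"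

text \<open>\<open>\<mu>\<^sup>a\<close> is determined up to Lebesgue-null sets, \<open>\<mu>\<^sup>s\<close> is unique.\<close>

definition ac_density ::
    "'a::euclidean_space set \<Rightarrow> ('a set \<Rightarrow> 'v::euclidean_space) \<Rightarrow> 'a \<Rightarrow> 'v" where
  "ac_density \<Omega> \<mu> = (SOME f. \<exists>\<nu>. is_lebesgue_decomposition \<Omega> \<mu> f \<nu>)"

definition singular_part ::
    "'a::euclidean_space set \<Rightarrow> ('a set \<Rightarrow> 'v::euclidean_space) \<Rightarrow> 'a set \<Rightarrow> 'v" where
  "singular_part \<Omega> \<mu> = (THE \<nu>. \<exists>f. is_lebesgue_decomposition \<Omega> \<mu> f \<nu>)"


section \<open>Convex functions of measures\<close>

text \<open>Intended for convex functions \<open>\<rho> \<ge> 0\<close>; the limit may be \<open>\<infinity>\<close>.\<close>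

definition recession :: "('v::real_vector \<Rightarrow> real) \<Rightarrow> 'v \<Rightarrow> ennreal" where
  "recession \<rho> \<xi> = Lim at_top (\<lambda>t::real. ennreal (\<rho> (t *\<^sub>R \<xi>) / t))"

definition function_of_measure ::
    "'a::euclidean_space set \<Rightarrow> ('v::euclidean_space \<Rightarrow> real) \<Rightarrow> ('a set \<Rightarrow> 'v) \<Rightarrow> 'a set \<Rightarrow> ennreal" where
  "function_of_measure \<Omega> \<rho> \<mu> E =
     (\<integral>\<^sup>+x\<in>E. ennreal (\<rho> (ac_density \<Omega> \<mu> x)) \<partial>lebesgue) +
     (\<integral>\<^sup>+x\<in>E. recession \<rho> (polar_density \<Omega> (singular_part \<Omega> \<mu>) x)
        \<partial>total_variation \<Omega> (singular_part \<Omega> \<mu>))"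


section \<open>Distributional derivatives, BV and BD\<close>

text \<open>
  A (matrix-valued) distribution is given by its action on scalar test functions.
  The Jacobian convention \<open>(Du)\<^sub>i\<^sub>j = \<partial>\<^sub>j u\<^sub>i\<close> is used, so the derivative of a
  scalar function is a row vector.
\<close>

definition distr_D ::
    "(real^'m) set \<Rightarrow> (real^'m \<Rightarrow> real^'k) \<Rightarrow> (real^'m \<Rightarrow> real) \<Rightarrow> real^'m^'k" where
  "distr_D \<Omega> u \<phi> =
     (\<chi> i j. - (LINT x:\<Omega>|lebesgue. u x $ i * frechet_derivative \<phi> (at x) (axis j 1)))"

definition distr_E ::
    "(real^'m) set \<Rightarrow> (real^'m \<Rightarrow> real^'m) \<Rightarrow> (real^'m \<Rightarrow> real) \<Rightarrow> real^'m^'m" where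
  "distr_E \<Omega> z \<phi> = (1/2) *\<^sub>R (distr_D \<Omega> z \<phi> + transpose (distr_D \<Omega> z \<phi>))"

definition represents ::
    "(real^'m) set \<Rightarrow> ((real^'m \<Rightarrow> real) \<Rightarrow> 'v::euclidean_space) \<Rightarrow> ((real^'m) set \<Rightarrow> 'v) \<Rightarrow> bool" where
  "represents \<Omega> T \<mu> \<longleftrightarrow>
     finite_vector_measure \<Omega> \<mu> \<and> (\<forall>\<phi>\<in>test_functions \<Omega>. T \<phi> = vm_integral \<Omega> \<mu> \<phi>)"

definition representing_measure ::
    "(real^'m) set \<Rightarrow> ((real^'m \<Rightarrow> real) \<Rightarrow> 'v::euclidean_space) \<Rightarrow> (real^'m) set \<Rightarrow> 'v" where
  "representing_measure \<Omega> T = (THE \<mu>. represents \<Omega> T \<mu>)"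

definition D_measure ::
    "(real^'m) set \<Rightarrow> (real^'m \<Rightarrow> real^'k) \<Rightarrow> (real^'m) set \<Rightarrow> real^'m^'k" where
  "D_measure \<Omega> u = representing_measure \<Omega> (distr_D \<Omega> u)"

definition E_measure ::
    "(real^'m) set \<Rightarrow> (real^'m \<Rightarrow> real^'m) \<Rightarrow> (real^'m) set \<Rightarrow> real^'m^'m" where
  "E_measure \<Omega> z = representing_measure \<Omega> (distr_E \<Omega> z)"

definition BV_vec :: "(real^'m) set \<Rightarrow> (real^'m \<Rightarrow> real^'k) set" where
  "BV_vec \<Omega> = {u. u absolutely_integrable_on \<Omega> \<and> (\<exists>\<mu>. represents \<Omega> (distr_D \<Omega> u) \<mu>)}"

definition BD :: "(real^'m) set \<Rightarrow> (real^'m \<Rightarrow> real^'m) set" where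
  "BD \<Omega> = {z. z absolutely_integrable_on \<Omega> \<and> (\<exists>\<mu>. represents \<Omega> (distr_E \<Omega> z) \<mu>)}"

text \<open>Scalar functions are treated as vector fields with one component.\<close>

definition BV :: "(real^'m) set \<Rightarrow> (real^'m \<Rightarrow> real) set" where
  "BV \<Omega> = {w. (\<lambda>x. vec (w x) :: real^1) \<in> BV_vec \<Omega>}"

definition D_scalar :: "(real^'m) set \<Rightarrow> (real^'m \<Rightarrow> real) \<Rightarrow> (real^'m) set \<Rightarrow> real^'m^1" where
  "D_scalar \<Omega> w = D_measure \<Omega> (\<lambda>x. vec (w x) :: real^1)"

definition BV_gradients :: "(real^'m) set \<Rightarrow> (real^'m \<Rightarrow> real^'m) set" where
  "BV_gradients \<Omega> =
     {z \<in> BV_vec \<Omega>. \<exists>u\<in>BV \<Omega>. D_scalar \<Omega> u = lebesgue_times \<Omega> (\<lambda>x. rowvector (z x))}"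


section \<open>The functional and inner variations\<close>

definition R_tilde ::
    "(real^'m) set \<Rightarrow> (real^'m^1 \<Rightarrow> real) \<Rightarrow> ((real^'m \<Rightarrow> real^'m) \<Rightarrow> ennreal) \<Rightarrow>
     (real^'m \<Rightarrow> real) \<Rightarrow> (real^'m \<Rightarrow> real^'m) \<Rightarrow> ennreal" where
  "R_tilde \<Omega> \<rho>\<^sub>1 R\<^sub>2 w z =
     function_of_measure \<Omega> \<rho>\<^sub>1
       (\<lambda>A. D_scalar \<Omega> w A - lebesgue_times \<Omega> (\<lambda>x. rowvector (z x)) A) \<Omega> + R\<^sub>2 z"

definition vary_z ::
    "(real^'m \<Rightarrow> real^'m) \<Rightarrow> real \<Rightarrow> (real^'m \<Rightarrow> real^'m) \<Rightarrow> real^'m \<Rightarrow> real^'m" where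
  "vary_z \<phi> \<tau> z x = transpose (mat 1 + \<tau> *\<^sub>R jacobian \<phi> (at x)) *v z (x + \<tau> *\<^sub>R \<phi> x)"

definition vary_w ::
    "(real^'m \<Rightarrow> real^'m) \<Rightarrow> real \<Rightarrow> (real^'m \<Rightarrow> real) \<Rightarrow> real^'m \<Rightarrow> real" where
  "vary_w \<phi> \<tau> w x = w (x + \<tau> *\<^sub>R \<phi> x)"

end

theory Submission
  imports Defs "HOL-Probability.Probability_Measure"
begin

text \<open>Let \<open>\<Phi> x = x + \<tau> \<phi> x\<close> with derivative \<open>A = I + \<tau> D\<phi>\<close> and inverse \<open>\<Psi>\<close>. The field \<open>z\<close> is varied as a
covector field, \<open>A^T (z \<circ> \<Phi>)\<close>, so that for measures
  \<open>D(w \<circ> \<Phi>) - (A^T (z \<circ> \<Phi>))^T = ((Dw - z^T) \<circ> \<Phi>) A\<close> and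
  \<open>D(A^T (z \<circ> \<Phi>)) = A^T (Dz \<circ> \<Phi>) A + \<Sum>\<^sub>k (z\<^sub>k \<circ> \<Phi>) D\<^sup>2\<Phi>\<^sub>k\<close>,
and the second identity also holds with symmetric parts on both sides
(\<open>composition_transport\<close>, \<open>pullback_transport\<close>). In particular gradients are varied into gradients.
After the change of variables \<open>y = \<Phi> x\<close>, both energies take the form
  \<open>\<integral> J \<rho> (F + \<tau> V) dx + \<integral> J \<rho>\<^sup>\<infinity> (g + \<tau> W) d\<Lambda>\<close>,
where \<open>F dx + g \<Lambda>\<close> is the Lebesgue decomposition of the unvaried measure and \<open>\<tau>\<close> enters only through
the smooth factors \<open>J = 1 / det A\<close>, \<open>V\<close> and \<open>W\<close> (\<open>function_of_measure_transport\<close>). It remains to differentiate under the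
integral sign (\<open>energy_differentiable\<close>). The pointwise derivative exists by assumption. A majorant comes from convexity,
  \<open>|\<rho> (F + \<tau> V) - \<rho> F| \<le> |\<tau>| (\<rho> (F + V) + \<rho> (F - V))\<close>,
and the growth of \<open>\<rho>\<close>, provided that \<open>F\<close> and \<open>V\<close> are \<open>p\<close>-integrable.

The only serious point is that \<open>V\<close> contains \<open>z\<close> times second derivatives of \<open>\<phi>\<close>, while \<open>z\<close> is only known to be
integrable. If \<open>p > 1\<close>, finiteness of the energy excludes a singular part and makes the symmetric
gradient \<open>e\<close> of \<open>z\<close> a \<open>p\<close>-integrable function. From
  \<open>(z (x + h) - z x) \<bullet> h = \<integral> h \<bullet> e (x + t h) h dt\<close> (\<open>t\<close> from 0 to 1)
and averages over small balls of displacements \<open>h\<close> it follows that \<open>z\<close> is locally \<open>p\<close>-integrable (\<open>korn_higher_integrability\<close>),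
which is enough because \<open>\<phi>\<close> has compact support.

The remaining parts make this rigorous for measures. Every finite vector measure is a density with respect to
a finite positive measure (\<open>fvm_density\<close>); total variation, polar density and Lebesgue decomposition, and with them functions of measures,
can therefore be computed from any decomposition (\<open>function_of_measure_eq\<close>). A measure is determined by its action on test functions (\<open>represents_unique\<close>), and
the derivatives of transformed functions are computed on test functions by means of Piola's identity (\<open>piola\<close>).\<close>

abbreviation Leb :: "'a::euclidean_space set => 'a measure" where "Leb \<equiv> lebesgue_on"

lemmas bint_bound = Bochner_Integration.integrable_bound
  and bint_cong = Bochner_Integration.integral_cong
  and bint_sum = Bochner_Integration.integrable_sum and bint_of_sum = Bochner_Integration.integral_sum
  and bint_diff = Bochner_Integration.integrable_diff and bint_of_diff = Bochner_Integration.integral_diff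
  and bint_add = Bochner_Integration.integrable_add

section \<open>Smooth functions and test functions\<close>

definition smooth :: "('a::euclidean_space => 'b::real_normed_vector) => bool" where
 "smooth f \<longleftrightarrow> (\<forall>k. C_k k f)"

lemma frechet_derivative_worksI:
 "f differentiable F ==> (f has_derivative frechet_derivative f F) F"
 by (simp add: frechet_derivative_works[symmetric])

lemma smooth_differentiable: "smooth f ==> f differentiable (at x)"
 unfolding smooth_def by (metis C_k.simps(2))

lemma smooth_frechet: "smooth f ==> smooth (%x. frechet_derivative f (at x) v)"
 unfolding smooth_def by (metis C_k.simps(2))

lemma smooth_continuous: "smooth f ==> continuous_on S f"
 unfolding smooth_def by (metis C_k.simps(1) continuous_on_subset subset_UNIV)

lemma smooth_has_derivative: "smooth f ==> (f has_derivative frechet_derivative f (at x)) (at x)"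
 using smooth_differentiable frechet_derivative_works by blast

lemma C_k_bounded_linear:
 assumes "bounded_linear L"
 shows "C_k k f ==> C_k k (%x. L (f x))"
proof (induction k arbitrary: f)
 case 0
 then show ?case using assms by (auto intro: bounded_linear.continuous_on)
next
 case (Suc k)
 have d: "((%x. L (f x)) has_derivative (%v. L (frechet_derivative f (at x) v))) (at x)" for x
  using Suc.prems by (intro bounded_linear.has_derivative[OF assms] frechet_derivative_worksI) auto
 have e: "frechet_derivative (%x. L (f x)) (at x) = (%v. L (frechet_derivative f (at x) v))" for x
  using frechet_derivative_at[OF d] by simp
 show ?case unfolding C_k.simps e using d Suc by (auto simp: differentiable_def)
qed

lemma smooth_bounded_linear: "bounded_linear L ==> smooth f ==> smooth (%x. L (f x))"
 unfolding smooth_def using C_k_bounded_linear by blast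

text \<open>The algebra generated by a set of functions. Smoothness of all the functions below is reduced to
  one closure property of their generators, see \<open>smooth_alg\<close>.\<close>

inductive_set alg :: "('a::euclidean_space => real) set => ('a => real) set" for B where
 base: "f \<in> B ==> f \<in> alg B"
| const: "(%x. c) \<in> alg B"
| add: "f \<in> alg B ==> g \<in> alg B ==> (%x. f x + g x) \<in> alg B"
| mult: "f \<in> alg B ==> g \<in> alg B ==> (%x. f x * g x) \<in> alg B"

lemma alg_sum: "(!!i. i \<in> I ==> f i \<in> alg B) ==> (%x. \<Sum>i\<in>I. f i x) \<in> alg B"
 by (induction I rule: infinite_finite_induct) (auto intro: alg.intros)

lemma alg_prod: "(!!i. i \<in> I ==> f i \<in> alg B) ==> (%x. \<Prod>i\<in>I. f i x) \<in> alg B"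
 by (induction I rule: infinite_finite_induct) (auto intro: alg.intros)

text \<open>If the derivatives of the generators are again in the algebra, then by the product rule so are
  the derivatives of all its elements; induction on the order then gives all orders at once,
  without a higher order chain or product rule.\<close>

lemma smooth_alg:
 assumes dif: "!!f x. f \<in> B ==> f differentiable (at x)"
  and der: "!!f v. f \<in> B ==> (%x. frechet_derivative f (at x) v) \<in> alg B"
  and f: "f \<in> alg B"
 shows "smooth f"
proof -
 have D: "(\<forall>x. f differentiable (at x)) \<and> (\<forall>v. (%x. frechet_derivative f (at x) v) \<in> alg B)"
  if "f \<in> alg B" for f
  using that
 proof induction
  case (base f)
  then show ?case using dif der by blast
 next
  case (const c)
  then show ?case by (auto intro: alg.const)
 next
  case (add f g)
  have d: "((%x. f x + g x) has_derivative
   (%v. frechet_derivative f (at x) v + frechet_derivative g (at x) v)) (at x)" for x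
   using add.IH by (intro has_derivative_add frechet_derivative_worksI) auto
  have e: "frechet_derivative (%x. f x + g x) (at x) =
   (%v. frechet_derivative f (at x) v + frechet_derivative g (at x) v)" for x
   using frechet_derivative_at[OF d] by simp
  show ?case unfolding e using d add by (auto simp: differentiable_def intro: alg.add)
 next
  case (mult f g)
  have d: "((%x. f x * g x) has_derivative
   (%v. f x * frechet_derivative g (at x) v + frechet_derivative f (at x) v * g x)) (at x)" for x
   using mult.IH by (intro has_derivative_mult frechet_derivative_worksI) auto
  have e: "frechet_derivative (%x. f x * g x) (at x) =
   (%v. f x * frechet_derivative g (at x) v + frechet_derivative f (at x) v * g x)" for x
   using frechet_derivative_at[OF d] by simp
  have "(%x. f x * g x) differentiable (at x)" for x
   using d by (auto simp: differentiable_def)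
  moreover have "(%x. f x * frechet_derivative g (at x) v + frechet_derivative f (at x) v * g x) \<in> alg B" for v
   using mult by (intro alg.add alg.mult) auto
  ultimately show ?case unfolding e by blast
 qed
 have "C_k k f" if "f \<in> alg B" for k f
  using that
 proof (induction k arbitrary: f)
  case 0
  then show ?case using D differentiable_imp_continuous_on
   by (metis C_k.simps(1) differentiable_at_imp_differentiable_on)
 next
  case (Suc k)
  then show ?case using D by simp
 qed
 then show ?thesis using f by (simp add: smooth_def)
qed

lemma smooth_algI: "f \<in> alg {f. smooth f} ==> smooth f"
 by (erule smooth_alg[rotated 2]) (auto intro: smooth_differentiable smooth_frechet alg.base)

lemma smooth_const [simp, intro]: "smooth (%x. c :: real)"
 by (intro smooth_algI alg.const)
lemma smooth_add [intro]: "smooth f ==> smooth g ==> smooth (%x. f x + g x :: real)"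
 by (intro smooth_algI alg.add alg.base) auto
lemma smooth_mult [intro]: "smooth f ==> smooth g ==> smooth (%x. f x * g x :: real)"
 by (intro smooth_algI alg.mult alg.base) auto
lemma smooth_sum [intro]: "(!!i. i \<in> I ==> smooth (f i)) ==> smooth (%x. \<Sum>i\<in>I. f i x :: real)"
 by (intro smooth_algI alg_sum alg.base) auto
lemma smooth_prod [intro]: "(!!i. i \<in> I ==> smooth (f i)) ==> smooth (%x. \<Prod>i\<in>I. f i x :: real)"
 by (intro smooth_algI alg_prod alg.base) auto

lemma smooth_component: "smooth f ==> smooth (%x. f x $ i)"
 by (rule smooth_bounded_linear[OF bounded_linear_vec_nth])

lemma smooth_coordinate [intro]: "smooth (%x::real^'m. x $ i)"
proof (rule smooth_alg[of "{%x. x $ i}"])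
 have d: "((%x::real^'m. x $ i) has_derivative (%x. x $ i)) (at x)" for x
  by (intro bounded_linear.has_derivative[OF bounded_linear_vec_nth] derivative_intros)
 show "f differentiable (at x)" if "f \<in> {%x::real^'m. x $ i}" for f x
  using d that by (auto simp: differentiable_def)
 show "(%x. frechet_derivative f (at x) v) \<in> alg {%x. x $ i}" if "f \<in> {%x::real^'m. x $ i}" for f v
  using frechet_derivative_at[OF d] that by (auto intro: alg.const)
qed (auto intro: alg.base)

lemma smooth_inverse:
 assumes h: "smooth h" and nz: "!!x. h x \<noteq> (0::real)"
 shows "smooth (%x. inverse (h x))"
proof (rule smooth_alg[of "insert (%x. inverse (h x)) {f. smooth f}"])
 let ?B = "insert (%x. inverse (h x)) {f. smooth f}"
 have d: "((%x. inverse (h x)) has_derivative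
  (%v. - (inverse (h x) * frechet_derivative h (at x) v * inverse (h x)))) (at x)" for x
  by (rule Deriv.has_derivative_inverse[OF nz smooth_has_derivative[OF h]])
 show "f differentiable (at x)" if "f \<in> ?B" for f x
  using d that by (auto simp: differentiable_def intro: smooth_has_derivative)
 have "(%x. - (inverse (h x) * frechet_derivative h (at x) v * inverse (h x))) \<in> alg ?B" for v
 proof -
  have "(%x. (-1) * (inverse (h x) * frechet_derivative h (at x) v * inverse (h x))) \<in> alg ?B"
   using h by (intro alg.mult alg.const alg.base) (auto intro: smooth_frechet)
  then show ?thesis by simp
 qed
 then show "(%x. frechet_derivative f (at x) v) \<in> alg ?B" if "f \<in> ?B" for f v
  using frechet_derivative_at[OF d, symmetric] that by (auto intro: alg.base smooth_frechet)
qed (auto intro: alg.base)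

definition pd :: "'m => (real^'m => real) => real^'m => real" where
 "pd j f x = frechet_derivative f (at x) (axis j 1)"

lemma smooth_pd: "smooth f ==> smooth (pd j f)"
 unfolding pd_def by (rule smooth_frechet)

lemma linear_pd_sum:
 fixes L :: "real^'m => real"
 assumes "linear L" shows "L v = (\<Sum>i\<in>UNIV. L (axis i 1) * v $ i)"
proof -
 have "L v = L (\<Sum>i\<in>UNIV. v $ i *\<^sub>R axis i 1)"
  using basis_expansion[of v] by (simp add: scalar_mult_eq_scaleR)
 also have "... = (\<Sum>i\<in>UNIV. v $ i *\<^sub>R L (axis i 1))"
  using assms by (simp add: linear_sum linear_cmul)
 finally show ?thesis by (simp add: mult.commute)
qed

lemma frechet_pd:
 fixes f :: "real^'m => real"
 assumes "f differentiable (at x)"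
 shows "frechet_derivative f (at x) v = (\<Sum>i\<in>UNIV. pd i f x * v $ i)"
 unfolding pd_def by (rule linear_pd_sum, rule has_derivative_linear, rule frechet_derivative_worksI[OF assms])

lemma has_derivative_pd:
 fixes f :: "real^'m => real"
 assumes "f differentiable (at x)"
 shows "(f has_derivative (%v. \<Sum>i\<in>UNIV. pd i f x * v $ i)) (at x)"
 using frechet_derivative_worksI[OF assms] unfolding frechet_pd[OF assms, THEN ext] .

lemma pd_eqI:
 fixes f :: "real^'m => real"
 assumes "(f has_derivative f') (at x)" shows "pd j f x = f' (axis j 1)"
 unfolding pd_def using frechet_derivative_at[OF assms] by simp

lemma pd_mult:
 assumes "f differentiable (at x)" "g differentiable (at x)"
 shows "pd j (%x. f x * g x) x = pd j f x * g x + f x * pd j g x"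
proof -
 have "((%x. f x * g x) has_derivative
   (%v. f x * frechet_derivative g (at x) v + frechet_derivative f (at x) v * g x)) (at x)"
  using assms by (intro has_derivative_mult frechet_derivative_worksI) auto
 from pd_eqI[OF this] show ?thesis by (simp add: pd_def)
qed

text \<open>A map whose derivative is a smooth function of its own values, as is the case for the inverse of
  a diffeomorphism: \<open>D\<Psi> = (D\<Phi>)\<inverse> \<circ> \<Psi>\<close>. The functions
  \<open>f \<circ> \<Psi>\<close> generate an algebra that is closed under derivatives.\<close>

lemma smooth_compose_self_similar:
 fixes \<Psi> :: "real^'m => real^'n"
 assumes d: "!!y. (\<Psi> has_derivative (%v. \<chi> i. \<Sum>j\<in>UNIV. F i j (\<Psi> y) * v $ j)) (at y)"
  and F: "!!i j. smooth (F i j)" and f: "smooth f"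
 shows "smooth (%y. f (\<Psi> y) :: real)"
proof (rule smooth_alg[of "{%y. f (\<Psi> y) | f. smooth f}"])
 let ?B = "{%y. f (\<Psi> y) | f. smooth f} :: (real^'m => real) set"
 have D: "((%y. f (\<Psi> y)) has_derivative
   (%v. \<Sum>i\<in>UNIV. pd i f (\<Psi> y) * (\<Sum>j\<in>UNIV. F i j (\<Psi> y) * v $ j))) (at y)" if "smooth f" for f y
  using has_derivative_compose[OF d has_derivative_pd[OF smooth_differentiable[OF that]]] by simp
 show "f differentiable (at x)" if "f \<in> ?B" for f x
  using D that by (auto simp: differentiable_def)
 show "(%x. frechet_derivative f (at x) v) \<in> alg ?B" if fB: "f \<in> ?B" for f v
 proof -
  obtain g where g: "smooth g" "f = (%y. g (\<Psi> y))"
   using fB by blast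
  have "(%x. frechet_derivative f (at x) v) =
    (%y. \<Sum>i\<in>UNIV. pd i g (\<Psi> y) * (\<Sum>j\<in>UNIV. F i j (\<Psi> y) * v $ j))"
   unfolding g(2) using frechet_derivative_at[OF D[OF g(1)], symmetric] by simp
  moreover have "(%y. pd i g (\<Psi> y)) \<in> alg ?B" for i
   by (rule alg.base, rule CollectI, rule exI[of _ "pd i g"]) (simp add: g smooth_pd)
  moreover have "(%y. F i j (\<Psi> y)) \<in> alg ?B" for i j
   by (rule alg.base, rule CollectI, rule exI[of _ "F i j"]) (simp add: F)
  ultimately show ?thesis by (auto intro!: alg_sum alg.mult alg.const)
 qed
 show "(%y. f (\<Psi> y)) \<in> alg ?B" by (rule alg.base, rule CollectI, rule exI[of _ f]) (simp add: f)
qed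

definition supp :: "('a::topological_space => 'b::zero) => 'a set" where
 "supp f = closure {x. f x \<noteq> 0}"

lemma not_supp: "x \<notin> supp f ==> f x = 0"
 unfolding supp_def using closure_subset[of "{x. f x \<noteq> 0}"] by blast

lemma closed_supp [simp]: "closed (supp f)"
 by (simp add: supp_def)

lemma test_functionsD:
 assumes "f \<in> test_functions U"
 shows "smooth f" "compact (supp f)" "supp f \<subseteq> U"
 using assms unfolding test_functions_def smooth_def supp_def by blast+

lemma test_functionsI:
 assumes "smooth f" "compact K" "K \<subseteq> U" "!!x. x \<notin> K ==> f x = 0"
 shows "f \<in> test_functions U"
proof -
 have sub: "supp f \<subseteq> K"
  unfolding supp_def
 proof (rule closure_minimal)
  show "{x. f x \<noteq> 0} \<subseteq> K" using assms(4) by blast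
  show "closed K" using assms(2) by (rule compact_imp_closed)
 qed
 then have eq: "K \<inter> supp f = supp f" by (rule Int_absorb1)
 have "compact (supp f)"
  using compact_Int_closed[OF assms(2) closed_supp, of f] unfolding eq .
 then show ?thesis
  using assms(1,3) sub unfolding test_functions_def smooth_def supp_def by blast
qed

lemma test_mult:
 assumes "f \<in> test_functions U" "smooth g"
 shows "(%x. f x * g x :: real) \<in> test_functions U"
 by (rule test_functionsI[of _ "supp f"])
  (use test_functionsD[OF assms(1)] assms(2) in \<open>auto simp: not_supp\<close>)

lemma frechet_eq_0_outside:
 assumes "smooth f" "x \<notin> supp f"
 shows "frechet_derivative f (at x) = (%v. 0)"
proof -
 have "frechet_derivative f (at x) = frechet_derivative (%_. 0) (at x)"
  by (rule frechet_derivative_transform_within_open[of _ _ "- supp f"])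
   (use assms in \<open>auto intro: smooth_differentiable simp: not_supp\<close>)
 then show ?thesis by simp
qed

lemma test_pd: "f \<in> test_functions U ==> pd j f \<in> test_functions U"
 by (rule test_functionsI[of _ "supp f"])
  (use test_functionsD[of f U] frechet_eq_0_outside[of f] in \<open>auto intro: smooth_pd simp: pd_def\<close>)

text \<open>The functions \<open>t^-n exp (-1/t)\<close>, extended by 0; they are closed under
  differentiation up to linear combinations.\<close>

definition flat :: "nat => real => real" where
 "flat n t = (if t > 0 then inverse t ^ n * exp (- inverse t) else 0)"

text \<open>The exponential beats every power; the quadratic bound is what makes the derivative at 0 vanish.\<close>

lemma flat_le: "0 <= flat n t \<and> flat n t <= fact (n + 2) * t\<^sup>2"
proof (cases "t > 0")
 case True
 define s where "s = inverse t"
 have s: "s > 0" "t = inverse s" using True by (auto simp: s_def)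
 have "(\<Sum>k\<in>{n+2}. s ^ k /\<^sub>R fact k) <= (\<Sum>k. s ^ k /\<^sub>R fact k)"
  using s by (intro sum_le_suminf summable_exp_generic) (auto intro!: mult_nonneg_nonneg)
 then have "s ^ (n + 2) <= fact (n + 2) * exp s"
  by (simp add: exp_def divide_le_eq inverse_eq_divide mult.commute del: fact_Suc power_Suc)
 then have "s ^ (n + 2) * (exp (- s) * (inverse s)\<^sup>2) <= fact (n + 2) * exp s * (exp (- s) * (inverse s)\<^sup>2)"
  by (rule mult_right_mono) simp
 moreover have "s ^ (n + 2) * (exp (- s) * (inverse s)\<^sup>2) = s ^ n * exp (- s)"
  using s by (simp add: field_simps power2_eq_square)
 moreover have "fact (n + 2) * exp s * (exp (- s) * (inverse s)\<^sup>2) = fact (n + 2) * (inverse s)\<^sup>2"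
  by (simp add: exp_minus)
 ultimately have "s ^ n * exp (- s) <= fact (n + 2) * (inverse s)\<^sup>2" by (simp only:)
 then show ?thesis using s(1) True unfolding flat_def s(2) by simp
qed (auto simp: flat_def)

lemma flat_deriv: "(flat n has_real_derivative flat (n + 2) t - real n * flat (n + 1) t) (at t)"
proof -
 consider "t > 0" | "t < 0" | "t = 0" by linarith
 then show ?thesis
 proof cases
  case 1
  have "((%t. inverse t ^ n * exp (- inverse t)) has_real_derivative
    real n * (- (inverse t * inverse t)) * inverse t ^ (n - 1) * exp (- inverse t)
    + inverse t ^ n * (exp (- inverse t) * (inverse t * inverse t))) (at t)"
   using 1 by (auto intro!: derivative_eq_intros)
  also have "real n * (- (inverse t * inverse t)) * inverse t ^ (n - 1) * exp (- inverse t)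
    + inverse t ^ n * (exp (- inverse t) * (inverse t * inverse t)) =
    flat (n + 2) t - real n * flat (n + 1) t"
   using 1 by (cases n) (simp_all add: flat_def algebra_simps)
  finally have "((%t. inverse t ^ n * exp (- inverse t)) has_real_derivative
    flat (n + 2) t - real n * flat (n + 1) t) (at t)" .
  then show ?thesis
   by (rule has_field_derivative_transform_within_open[of _ _ _ "{0<..}"]) (use 1 in \<open>auto simp: flat_def\<close>)
 next
  case 2
  have "((%t. 0) has_real_derivative flat (n + 2) t - real n * flat (n + 1) t) (at t)"
   using 2 by (auto simp: flat_def)
  then show ?thesis
   by (rule has_field_derivative_transform_within_open[of _ _ _ "{..<0}"]) (use 2 in \<open>auto simp: flat_def\<close>)
 next
  case 3
  have "((%h. flat n h / h) \<longlongrightarrow> 0) (at 0)"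
  proof (rule Lim_null_comparison[of _ "%h. fact (n + 2) * \<bar>h\<bar>"])
   have "\<bar>flat n h / h\<bar> <= fact (n + 2) * \<bar>h\<bar>" if "h \<noteq> 0" for h
   proof -
    have "flat n h / \<bar>h\<bar> <= fact (n + 2) * h\<^sup>2 / \<bar>h\<bar>"
     using flat_le[of n h] by (intro divide_right_mono) auto
    also have "h\<^sup>2 = \<bar>h\<bar> * \<bar>h\<bar>" by (simp add: power2_eq_square)
    also have "fact (n + 2) * (\<bar>h\<bar> * \<bar>h\<bar>) / \<bar>h\<bar> = fact (n + 2) * \<bar>h\<bar>"
     using that by (simp del: abs_mult_self_eq)
    finally show ?thesis using flat_le[of n h] by (simp only: abs_divide) simp
   qed
   then show "\<forall>\<^sub>F h in at 0. norm (flat n h / h) <= fact (n + 2) * \<bar>h\<bar>"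
    by (simp add: eventually_at_filter)
   show "((%h::real. fact (n + 2) * \<bar>h\<bar>) \<longlongrightarrow> 0) (at 0)"
    by (auto intro!: tendsto_eq_intros)
  qed
  then show ?thesis using 3 by (simp add: DERIV_def flat_def)
 qed
qed

lemma smooth_flat_affine: "smooth (%x::'a::euclidean_space. flat n (u \<bullet> x + b))"
proof (rule smooth_alg[of "{%x. flat n (u \<bullet> x + b) | n. True}"])
 let ?B = "{%x::'a. flat n (u \<bullet> x + b) | n. True}"
 have d: "((%x. flat n (u \<bullet> x + b)) has_derivative
  (%v. (flat (n + 2) (u \<bullet> x + b) - real n * flat (n + 1) (u \<bullet> x + b)) * (u \<bullet> v))) (at x)" for n x
 proof -
  have "((%x. u \<bullet> x + b) has_derivative (%v. u \<bullet> v)) (at x)"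
   by (auto intro!: derivative_eq_intros)
  from has_derivative_compose[OF this flat_deriv[unfolded has_field_derivative_def]] show ?thesis
   by (simp add: mult.commute)
 qed
 show "f differentiable (at x)" if "f \<in> ?B" for f x
  using d that by (auto simp: differentiable_def)
 have "(%x. (flat (n + 2) (u \<bullet> x + b) + (- real n) * flat (n + 1) (u \<bullet> x + b)) * (u \<bullet> v)) \<in> alg ?B" for n v
  by (intro alg.mult alg.add alg.const alg.base) auto
 then show "(%x. frechet_derivative f (at x) v) \<in> alg ?B" if "f \<in> ?B" for f v
  using frechet_derivative_at[OF d, symmetric] that by auto
qed (auto intro: alg.base)

text \<open>Smooth approximations from below of the indicator function of an open box.\<close>

definition bump :: "nat => 'a::euclidean_space => 'a => 'a => real" where
 "bump n a b x = (\<Prod>i\<in>Basis. flat 0 (real n * (x \<bullet> i - a \<bullet> i) - 1) * flat 0 (real n * (b \<bullet> i - x \<bullet> i) - 1))"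

lemma bump_test:
 fixes a b :: "'a::euclidean_space"
 assumes "box a b \<subseteq> U"
 shows "bump n a b \<in> test_functions U"
proof (rule test_functionsI[of _ "if n = 0 then {} else cbox (a + (1 / real n) *\<^sub>R One) (b - (1 / real n) *\<^sub>R One)"])
 let ?K = "if n = 0 then {} else cbox (a + (1 / real n) *\<^sub>R One) (b - (1 / real n) *\<^sub>R One)"
 have eq: "bump n a b = (%x. \<Prod>i\<in>Basis. flat 0 ((real n *\<^sub>R i) \<bullet> x + (- real n * (a \<bullet> i) - 1)) *
   flat 0 ((- real n *\<^sub>R i) \<bullet> x + (real n * (b \<bullet> i) - 1)))"
  by (auto simp: bump_def inner_commute algebra_simps)
 show "smooth (bump n a b)"
  unfolding eq by (intro smooth_prod smooth_mult smooth_flat_affine)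
 show "compact ?K" by simp
 have "?K \<subseteq> box a b"
  by (auto simp: mem_box inner_left_distrib inner_diff_left)
   (smt (verit) divide_pos_pos of_nat_0_less_iff)+
 then show "?K \<subseteq> U" using assms by blast
 show "bump n a b x = 0" if x: "x \<notin> ?K" for x
 proof -
  obtain i :: 'a where i: "i \<in> Basis" "real n * (x \<bullet> i - a \<bullet> i) - 1 <= 0 \<or> real n * (b \<bullet> i - x \<bullet> i) - 1 <= 0"
  proof (cases "n = 0")
   case True
   then show ?thesis using that[of "SOME i. i \<in> Basis"] by (simp add: some_in_eq)
  next
   case False
   then obtain i where "i \<in> Basis" "x \<bullet> i < a \<bullet> i + 1 / real n \<or> b \<bullet> i - 1 / real n < x \<bullet> i"
    using x by (auto simp: mem_box not_le inner_left_distrib inner_diff_left)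
   then show ?thesis using False that[of i] by (auto simp: field_simps)
  qed
  then have "flat 0 (real n * (x \<bullet> i - a \<bullet> i) - 1) = 0 \<or> flat 0 (real n * (b \<bullet> i - x \<bullet> i) - 1) = 0"
   by (auto simp: flat_def)
  then show ?thesis unfolding bump_def using i(1) by (auto intro!: prod_zero bexI[of _ i])
 qed
qed

lemma flat_0_01: "0 <= flat 0 t \<and> flat 0 t <= 1"
 by (simp add: flat_def)

lemma bump_01: "0 <= bump n a b x \<and> bump n a b x <= 1"
 unfolding bump_def using flat_0_01 by (intro conjI prod_nonneg prod_le_1) (auto intro: mult_le_one)

lemma flat_tendsto: "(%n. flat 0 (real n * s - 1)) \<longlonglongrightarrow> (if s > 0 then 1 else 0)"
proof (cases "s > 0")
 case True
 have lim: "filterlim (%n. real n * s - 1) at_top sequentially"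
  using filterlim_tendsto_add_at_top[OF tendsto_const[of "-1"]
    filterlim_tendsto_pos_mult_at_top[OF tendsto_const True filterlim_real_sequentially]]
  by (simp add: mult.commute)
 have "(%n. exp (- inverse (real n * s - 1))) \<longlonglongrightarrow> exp (- 0)"
  by (intro tendsto_intros tendsto_inverse_0_at_top lim)
 then have "(%n. exp (- inverse (real n * s - 1))) \<longlonglongrightarrow> 1" by simp
 moreover have "\<forall>\<^sub>F n in sequentially. exp (- inverse (real n * s - 1)) = flat 0 (real n * s - 1)"
  using lim[unfolded filterlim_at_top_dense, rule_format, of 0] by eventually_elim (simp add: flat_def)
 ultimately show ?thesis using True by (simp add: Lim_transform_eventually)
next
 case False
 then have "real n * s <= 0" for n by (simp add: mult_nonneg_nonpos)
 then have "flat 0 (real n * s - 1) = 0" for n unfolding flat_def by (smt (verit))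
 then show ?thesis using False by simp
qed

lemma bump_tendsto: "(%n. bump n a b x) \<longlonglongrightarrow> indicator (box a b) x"
proof -
 have "(%n. bump n a b x) \<longlonglongrightarrow> (\<Prod>i\<in>Basis. (if x \<bullet> i - a \<bullet> i > 0 then 1 else 0) * (if b \<bullet> i - x \<bullet> i > 0 then 1 else 0))"
  unfolding bump_def by (intro tendsto_intros flat_tendsto)
 also have "(\<Prod>i\<in>Basis. (if x \<bullet> i - a \<bullet> i > 0 then 1 else 0) * (if b \<bullet> i - x \<bullet> i > 0 then 1 else 0)) = (indicator (box a b) x :: real)"
 proof (cases "x \<in> box a b")
  case True
  then show ?thesis by (auto simp: mem_box)
 next
  case False
  then obtain i where i: "i \<in> Basis" "\<not> (a \<bullet> i < x \<bullet> i \<and> x \<bullet> i < b \<bullet> i)" by (auto simp: mem_box)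
  then show ?thesis using False by (auto intro!: prod_zero bexI[of _ i])
 qed
 finally show ?thesis .
qed

section \<open>Change of variables over an arbitrary finite index type\<close>

text \<open>The change of variables formula refers to a well-ordered index type. A copy of a finite type is
  given an arbitrary well-order, and the formula is transferred back along the bijection of the
  coordinates.\<close>

typedef 'a wo = "UNIV :: 'a set" morphisms unwo Wo ..

lemma bij_unwo: "bij unwo"
 by (metis (no_types, lifting) Wo_inverse UNIV_I bij_def injI surj_def unwo_inject)

instance wo :: (finite) finite
proof
 show "finite (UNIV :: 'a wo set)"
  using bij_unwo finite_imageD[of unwo "UNIV :: 'a wo set"] by (auto simp: bij_def)
qed

lemma ex_inj_nat: "\<exists>f :: 'a::finite => nat. inj f"
 using finite_imp_inj_to_nat_seg[of "UNIV :: 'a set"] by auto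

instantiation wo :: (finite) wellorder
begin
definition wo_index :: "'a wo => nat" where "wo_index = (SOME f. inj f)"
definition less_eq_wo :: "'a wo => 'a wo => bool" where "x <= y \<longleftrightarrow> wo_index x <= wo_index y"
definition less_wo :: "'a wo => 'a wo => bool" where "x < y \<longleftrightarrow> wo_index x < wo_index y"
instance
proof
 have inj: "inj (wo_index :: 'a wo => nat)"
  unfolding wo_index_def using someI_ex[OF ex_inj_nat] .
 fix x y z :: "'a wo" and P
 show "x < y \<longleftrightarrow> x <= y \<and> \<not> y <= x" "x <= x" "x <= y \<or> y <= x"
  by (auto simp: less_eq_wo_def less_wo_def)
 show "x <= y ==> y <= z ==> x <= z" by (auto simp: less_eq_wo_def)
 show "x <= y ==> y <= x ==> x = y" using inj by (auto simp: less_eq_wo_def dest: injD)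
 show "(!!x. (!!y. y < x ==> P y) ==> P x) ==> P (x :: 'a wo)"
  unfolding less_wo_def by (rule measure_induct[of wo_index P x]) blast
qed
end

definition to_wo :: "real^'m::finite => real^('m wo)" where "to_wo x = (\<chi> i. x $ unwo i)"
definition of_wo :: "real^('m wo) => real^'m::finite" where "of_wo x = (\<chi> i. x $ Wo i)"

lemma to_of_wo [simp]: "to_wo (of_wo x) = x" "of_wo (to_wo y) = y"
 by (auto simp: to_wo_def of_wo_def vec_eq_iff unwo_inverse Wo_inverse)

lemma linear_wo: "linear to_wo" "linear of_wo"
 by (auto simp: to_wo_def of_wo_def vec_eq_iff intro!: linearI)

lemma bounded_linear_wo: "bounded_linear to_wo" "bounded_linear of_wo"
 using linear_wo by (auto simp: linear_linear)

lemma det_reindex: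
 fixes A :: "real^'m::finite^'m"
 shows "det (\<chi> i j. A $ unwo i $ unwo j) = det A"
proof -
 let ?F = "map_permutation (UNIV :: 'm wo set) (unwo :: 'm wo => 'm)"
 have b: "bij_betw (unwo :: 'm wo => 'm) UNIV UNIV" using bij_unwo .
 have inj: "inj (unwo :: 'm wo => 'm)" using b by (rule bij_is_inj)
 have ap: "?F p (unwo i) = unwo (p i)" for p i
  using inj by (rule map_permutation_apply) simp
 have bij: "bij_betw ?F {p. p permutes UNIV} {p. p permutes UNIV}"
 proof (rule bij_betwI)
  show "?F \<in> {p. p permutes UNIV} \<rightarrow> {p. p permutes UNIV}"
   using map_permutation_permutes[OF b] by auto
  have b': "bij_betw (Wo :: 'm => 'm wo) UNIV UNIV"
   by (rule bij_betwI[of _ _ _ unwo]) (auto simp: Wo_inverse unwo_inverse)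
  show "map_permutation UNIV Wo \<in> {p. p permutes UNIV} \<rightarrow> {p. p permutes (UNIV :: 'm wo set)}"
   using map_permutation_permutes[OF b'] by auto
  have bij': "Wo (unwo i) = i" "unwo (Wo k) = k" for i and k :: 'm
   by (auto simp: Wo_inverse unwo_inverse)
  have ap': "map_permutation UNIV Wo q (Wo i) = Wo (q i)" for q and i :: 'm
   using bij_is_inj[OF b'] by (rule map_permutation_apply) simp
  show "map_permutation UNIV Wo (?F p) = p" for p
  proof
   fix i show "map_permutation UNIV Wo (?F p) i = p i"
    using ap'[of "?F p" "unwo i"] ap[of p i] by (simp add: bij')
  qed
  show "?F (map_permutation UNIV Wo q) = q" for q
  proof
   fix i show "?F (map_permutation UNIV Wo q) i = q i"
    using ap[of "map_permutation UNIV Wo q" "Wo i"] ap'[of q i] by (simp add: bij')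
  qed
 qed
 have "det A = (\<Sum>p | p permutes UNIV. of_int (sign p) * (\<Prod>i\<in>UNIV. A $ i $ p i))"
  by (simp add: det_def)
 also have "... = (\<Sum>p | p permutes (UNIV :: 'm wo set). of_int (sign (?F p)) * (\<Prod>i\<in>UNIV. A $ i $ ?F p i))"
  using sum.reindex_bij_betw[OF bij, symmetric] by simp
 also have "... = (\<Sum>p | p permutes (UNIV :: 'm wo set). of_int (sign p) * (\<Prod>i\<in>UNIV. A $ unwo i $ unwo (p i)))"
 proof (rule sum.cong[OF refl])
  fix p assume "p \<in> {p. p permutes (UNIV :: 'm wo set)}"
  then have "sign (?F p) = sign p"
   using inj by (intro sign_map_permutation) auto
  moreover have "(\<Prod>i\<in>UNIV. A $ i $ ?F p i) = (\<Prod>i\<in>UNIV. A $ unwo i $ unwo (p i))"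
   using prod.reindex_bij_betw[OF b, of "%i. A $ i $ ?F p i", symmetric] by (simp add: ap)
  ultimately show "of_int (sign (?F p)) * (\<Prod>i\<in>UNIV. A $ i $ ?F p i) =
   of_int (sign p) * (\<Prod>i\<in>UNIV. A $ unwo i $ unwo (p i))" by simp
 qed
 also have "... = det (\<chi> i j. A $ unwo i $ unwo j)"
  by (simp add: det_def)
 finally show ?thesis by simp
qed

lemma prod_Basis_cart: "(\<Prod>b\<in>Basis. (x :: real^'n) \<bullet> b) = (\<Prod>i\<in>UNIV. x $ i)"
proof -
 have "bij_betw (%i :: 'n. axis i (1::real)) UNIV Basis"
  by (auto simp: bij_betw_def inj_on_def axis_eq_axis Basis_vec_def)
 from prod.reindex_bij_betw[OF this, of "%b. x \<bullet> b"] show ?thesis by (simp add: inner_axis)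
qed

lemma lborel_wo: "distr lborel borel (of_wo :: real^('m wo) => real^'m::finite) = lborel"
proof (rule lborel_eqI[symmetric])
 have [measurable]: "(of_wo :: real^('m wo) => real^'m) \<in> borel_measurable borel"
  using linear_wo(2) by (intro borel_measurable_continuous_onI linear_continuous_on bounded_linear_wo)
 fix l u :: "real^'m" assume le: "!!b. b \<in> Basis ==> l \<bullet> b <= u \<bullet> b"
 have "of_wo -` box l u = box (to_wo l) (to_wo u)"
 proof -
  have "(\<forall>i. l $ i < x $ Wo i \<and> x $ Wo i < u $ i) \<longleftrightarrow>
     (\<forall>i. l $ unwo i < x $ i \<and> x $ i < u $ unwo i)" for x :: "real^('m wo)"
   by (metis Wo_inverse UNIV_I unwo_inverse)
  then show ?thesis by (auto simp: mem_box_cart of_wo_def to_wo_def)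
 qed
 moreover have le': "l $ i <= u $ i" for i
  using le[of "axis i 1"] by (auto simp: Basis_vec_def inner_axis)
 have "emeasure lborel (box (to_wo l) (to_wo u)) = ennreal (\<Prod>i\<in>UNIV. (u - l) $ unwo (i :: 'm wo))"
 proof -
  have "emeasure lborel (box (to_wo l) (to_wo u)) = ennreal (\<Prod>b\<in>Basis. (to_wo u - to_wo l) \<bullet> b)"
   by (rule emeasure_lborel_box) (auto simp: Basis_vec_def inner_axis to_wo_def le')
  then show ?thesis by (simp add: prod_Basis_cart to_wo_def)
 qed
 moreover have "(\<Prod>i\<in>UNIV. (u - l) $ unwo (i :: 'm wo)) = (\<Prod>i\<in>UNIV. (u - l) $ (i :: 'm))"
  using prod.reindex_bij_betw[OF bij_unwo, of "%i. (u - l) $ i"] .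
 moreover have "(\<Prod>i\<in>UNIV. (u - l) $ (i :: 'm)) = (\<Prod>b\<in>Basis. (u - l) \<bullet> b)"
  by (simp add: prod_Basis_cart)
 ultimately show "emeasure (distr lborel borel of_wo) (box l u) = ennreal (\<Prod>b\<in>Basis. (u - l) \<bullet> b)"
  by (simp add: emeasure_distr)
qed simp

lemma lebesgue_wo:
 shows measurable_of_wo: "(of_wo :: real^('m wo) => real^'m::finite) \<in> lebesgue \<rightarrow>\<^sub>M lebesgue"
  and distr_lebesgue_wo: "distr lebesgue lebesgue (of_wo :: real^('m wo) => real^'m) = lebesgue"
proof -
 have m: "(of_wo :: real^('m wo) => real^'m) \<in> lborel \<rightarrow>\<^sub>M lborel"
  using borel_measurable_continuous_onI[OF linear_continuous_on[OF bounded_linear_wo(2)]] by simp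
 have eq: "distr lebesgue lborel (of_wo :: real^('m wo) => real^'m) = lborel"
  using distr_completion[OF m] lborel_wo by (metis distr_cong sets_lborel)
 show "(of_wo :: real^('m wo) => real^'m) \<in> lebesgue \<rightarrow>\<^sub>M lebesgue"
  by (rule completion.measurable_completion2[OF measurable_completion[OF m]]) (simp add: eq)
 show "distr lebesgue lebesgue (of_wo :: real^('m wo) => real^'m) = lebesgue"
  using completion.completion_distr_eq[OF measurable_completion[OF m]] by (simp add: eq)
qed

text \<open>The formula holds for the conjugated map on the well-ordered copy; relabelling coordinates
  preserves Lebesgue measure and, by \<open>det_reindex\<close>, determinants.\<close>

lemma emeasure_differentiable_image:
 fixes g :: "real^'m::finite => real^'m"
 assumes A: "A \<in> sets lebesgue" "bounded A"
  and der: "!!y. (g has_derivative g' y) (at y)" and inj: "inj g"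
  and cont: "continuous_on UNIV (%y. det (matrix (g' y)))"
 shows "g ` A \<in> sets lebesgue"
  and "emeasure lebesgue (g ` A) = (\<integral>\<^sup>+y\<in>A. ennreal \<bar>det (matrix (g' y))\<bar> \<partial>lebesgue)"
proof -
 have gd: "g differentiable_on A"
  using der by (auto simp: differentiable_on_def intro: differentiable_at_withinI differentiableI)
 show gA: "g ` A \<in> sets lebesgue"
  by (rule differentiable_image_in_sets_lebesgue[OF A(1) _ gd]) simp
 let ?A = "of_wo -` A :: (real^('m wo)) set" and ?g = "%x. to_wo (g (of_wo x))"
 let ?g' = "%x v. to_wo (g' (of_wo x) (of_wo v))"
 let ?d = "%x. \<bar>det (matrix (g' x))\<bar>"
 have A': "?A \<in> sets lebesgue"
  using measurable_sets[OF measurable_of_wo A(1)] by simp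
 have det_eq: "det (matrix (?g' x)) = det (matrix (g' (of_wo x)))" for x
 proof -
  have "matrix (?g' x) = (\<chi> i j. matrix (g' (of_wo x)) $ unwo i $ unwo j)"
  proof -
   have ax: "of_wo (axis j 1) = axis (unwo j) (1::real)" for j :: "'m wo"
    by (auto simp: of_wo_def axis_def vec_eq_iff Wo_inverse unwo_inverse)
   show ?thesis unfolding matrix_def to_wo_def ax by (simp add: vec_eq_iff)
  qed
  then show ?thesis by (simp add: det_reindex)
 qed
 obtain c where c: "!!y. y \<in> A ==> ?d y <= c"
 proof -
  have "compact ((%y. det (matrix (g' y))) ` closure A)"
   using A(2) by (intro compact_continuous_image continuous_on_subset[OF cont]) auto
  then obtain c where "\<forall>z \<in> (%y. det (matrix (g' y))) ` closure A. norm z <= c"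
   using compact_imp_bounded bounded_iff by metis
  then have "?d y <= c" if "y \<in> A" for y using that closure_subset[of A] by auto
  then show ?thesis by (rule that)
 qed
 have dm[measurable]: "?d \<in> borel_measurable lebesgue"
  by (intro borel_measurable_abs measurable_completion) (simp add: borel_measurable_continuous_onI[OF cont])
 have fin: "emeasure lebesgue A < \<infinity>"
  using bounded_set_imp_lmeasurable[OF A(2,1)] unfolding fmeasurable_def by blast
 have int: "integrable lebesgue (%y. indicator A y *\<^sub>R ?d y)"
 proof (rule bint_bound[of _ "%y. indicator A y * c"])
  show "integrable lebesgue (%y. indicator A y * c)"
   using A(1) fin by (intro integrable_mult_left integrable_real_indicator) auto
  show "AE x in lebesgue. norm (indicator A x *\<^sub>R ?d x) <= norm (indicator A x * c)"
   using c by (auto simp: indicator_def intro!: AE_I2 order.trans[OF _ abs_ge_self])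
 qed (use A(1) in measurable)
 have int': "integrable lebesgue (%x. indicator ?A x *\<^sub>R \<bar>det (matrix (?g' x))\<bar>)"
 proof -
  have "integrable (distr lebesgue lebesgue of_wo) (%y. indicator A y *\<^sub>R ?d y)"
   using int by (simp add: distr_lebesgue_wo)
  from integrable_distr[OF measurable_of_wo this] show ?thesis
   by (simp add: det_eq indicator_def)
 qed
 let ?m = "LINT x:?A|lebesgue. \<bar>det (matrix (?g' x))\<bar>"
 have hi: "((%x. \<bar>det (matrix (?g' x))\<bar>) has_integral ?m) ?A"
  using int' by (intro has_integral_set_lebesgue) (simp add: set_integrable_def)
 have "?g ` ?A \<in> lmeasurable \<and> measure lebesgue (?g ` ?A) = ?m"
 proof (subst has_measure_differentiable_image[OF A'])
  show "(?g has_derivative ?g' x) (at x within ?A)" for x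
   using bounded_linear.has_derivative[OF bounded_linear_wo(1)
     has_derivative_compose[OF bounded_linear_imp_has_derivative[OF bounded_linear_wo(2)] der]]
   by (rule has_derivative_at_withinI)
  show "inj_on ?g ?A"
   by (rule inj_onI) (metis inj injD to_of_wo)
 qed (rule hi)
 moreover have "?g ` ?A = of_wo -` (g ` A)"
 proof (intro set_eqI iffI)
  fix x assume "x \<in> of_wo -` (g ` A)"
  then obtain a where a: "of_wo x = g a" "a \<in> A" by auto
  then have "x = ?g (to_wo a)" by (metis to_of_wo)
  with a(2) show "x \<in> ?g ` ?A" by (intro image_eqI[of _ _ "to_wo a"]) auto
 qed auto
 ultimately have "emeasure lebesgue (of_wo -` (g ` A) :: (real^('m wo)) set) = ennreal ?m"
  by (metis emeasure_eq_measure2)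
 moreover have "emeasure lebesgue (g ` A) = emeasure lebesgue (of_wo -` (g ` A) :: (real^('m wo)) set)"
  using emeasure_distr[OF measurable_of_wo gA] by (simp add: distr_lebesgue_wo)
 moreover have "?m = (LINT y:A|lebesgue. ?d y)"
 proof -
  have "(LINT y:A|distr lebesgue lebesgue of_wo. ?d y) = (LINT x|lebesgue. indicator A (of_wo x :: real^'m) *\<^sub>R ?d (of_wo x))"
   unfolding set_lebesgue_integral_def
   by (rule integral_distr[OF measurable_of_wo]) (use A(1) in measurable)
  then show ?thesis
   by (simp add: distr_lebesgue_wo set_lebesgue_integral_def det_eq indicator_def)
 qed
 moreover have "(\<integral>\<^sup>+y\<in>A. ennreal (?d y) \<partial>lebesgue) = ennreal (LINT y:A|lebesgue. ?d y)"
 proof -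
  have "(\<integral>\<^sup>+y\<in>A. ennreal (?d y) \<partial>lebesgue) = (\<integral>\<^sup>+y. ennreal (indicator A y *\<^sub>R ?d y) \<partial>lebesgue)"
   by (intro nn_integral_cong) (auto simp: indicator_def)
  also have "... = ennreal (LINT y:A|lebesgue. ?d y)"
   unfolding set_lebesgue_integral_def using int by (intro nn_integral_eq_integral) auto
  finally show ?thesis .
 qed
 ultimately show "emeasure lebesgue (g ` A) = (\<integral>\<^sup>+y\<in>A. ennreal (?d y) \<partial>lebesgue)" by simp
qed

lemma distr_lebesgue_on_diffeo:
 fixes \<Phi> \<Psi> :: "real^'m::finite => real^'m"
 assumes U: "open U" "bounded U"
  and inv: "!!x. \<Psi> (\<Phi> x) = x" "!!y. \<Phi> (\<Psi> y) = y" and \<Phi>U: "!!x. \<Phi> x \<in> U \<longleftrightarrow> x \<in> U"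
  and der: "!!y. (\<Psi> has_derivative \<Psi>' y) (at y)"
  and cont: "continuous_on UNIV (%y. det (matrix (\<Psi>' y)))"
 shows "\<Phi> \<in> Leb U \<rightarrow>\<^sub>M Leb U"
  and "distr (Leb U) (Leb U) \<Phi> =
    density (Leb U) (%y. ennreal \<bar>det (matrix (\<Psi>' y))\<bar>)"
proof -
 have [measurable, simp]: "U \<in> sets lebesgue" using U by auto
 have inj: "inj \<Psi>" by (metis inv(2) injI)
 have pre: "\<Phi> -` A \<inter> U = \<Psi> ` A" if "A \<subseteq> U" for A
  using that inv \<Phi>U by (auto simp: image_iff) (metis subsetD)+
 have sets: "A \<in> sets lebesgue \<and> A \<subseteq> U" if "A \<in> sets (Leb U)" for A
  using that by (auto simp: sets_restrict_space_iff)
 have im: "\<Psi> ` A \<in> sets lebesgue"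
   "emeasure lebesgue (\<Psi> ` A) = (\<integral>\<^sup>+y\<in>A. ennreal \<bar>det (matrix (\<Psi>' y))\<bar> \<partial>lebesgue)"
  if "A \<in> sets (Leb U)" for A
  using emeasure_differentiable_image[OF _ _ der inj cont, of A] sets[OF that] bounded_subset[OF U(2)] by auto
 show m: "\<Phi> \<in> Leb U \<rightarrow>\<^sub>M Leb U"
 proof (rule measurableI)
  show "\<Phi> -` A \<inter> space (Leb U) \<in> sets (Leb U)" if "A \<in> sets (Leb U)" for A
   using im(1)[OF that] pre[of A] sets[OF that] by (auto simp: sets_restrict_space_iff)
 qed (simp add: \<Phi>U)
 have dm: "(%y. ennreal \<bar>det (matrix (\<Psi>' y))\<bar>) \<in> borel_measurable (Leb U)"
 proof -
  have "(%y. det (matrix (\<Psi>' y))) \<in> borel_measurable lebesgue"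
   by (intro measurable_completion) (simp add: borel_measurable_continuous_onI[OF cont])
  then show ?thesis by (intro measurable_restrict_space1) measurable
 qed
 show "distr (Leb U) (Leb U) \<Phi> =
    density (Leb U) (%y. ennreal \<bar>det (matrix (\<Psi>' y))\<bar>)"
 proof (rule measure_eqI)
  fix A assume "A \<in> sets (distr (Leb U) (Leb U) \<Phi>)"
  then have A: "A \<in> sets (Leb U)" by simp
  have "emeasure (distr (Leb U) (Leb U) \<Phi>) A = emeasure (Leb U) (\<Psi> ` A)"
   using emeasure_distr[OF m A] pre[of A] sets[OF A] by simp
  also have "... = emeasure lebesgue (\<Psi> ` A)"
   using pre[of A] sets[OF A] by (intro emeasure_restrict_space) auto
  also have "... = (\<integral>\<^sup>+y\<in>A. ennreal \<bar>det (matrix (\<Psi>' y))\<bar> \<partial>lebesgue)" by (rule im(2)[OF A])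
  also have "... = (\<integral>\<^sup>+y\<in>A. ennreal \<bar>det (matrix (\<Psi>' y))\<bar> \<partial>Leb U)"
   using sets[OF A] by (subst nn_integral_restrict_space) (auto intro!: nn_integral_cong simp: indicator_def)
  also have "... = emeasure (density (Leb U) (%y. ennreal \<bar>det (matrix (\<Psi>' y))\<bar>)) A"
   using A by (simp add: emeasure_density[OF dm])
  finally show "emeasure (distr (Leb U) (Leb U) \<Phi>) A =
   emeasure (density (Leb U) (%y. ennreal \<bar>det (matrix (\<Psi>' y))\<bar>)) A" .
 qed simp
qed

section \<open>Vector measures as densities\<close>

lemma borel_subsets_restrict: "U \<in> sets borel ==> borel_subsets U = sets (restrict_space borel U)"
 by (auto simp: borel_subsets_def sets_restrict_space_iff)

lemma sigma_algebra_borel_subsets: "U \<in> sets borel ==> sigma_algebra U (borel_subsets U)"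
 using sets.sigma_algebra_axioms[of "restrict_space borel U"]
 by (simp add: borel_subsets_restrict space_restrict_space)

lemma space_borel_subsets:
 assumes "sets M = borel_subsets U" "U \<in> sets borel" shows "space M = U"
 using sets_eq_imp_space_eq[of M "restrict_space borel U"] assms
 by (simp add: borel_subsets_restrict space_restrict_space)

lemma measurable_borel_subsets:
 assumes "sets M = borel_subsets U" "U \<in> sets borel" "f \<in> borel_measurable borel"
 shows "f \<in> measurable M borel"
proof -
 have "f \<in> measurable (restrict_space borel U) borel" using assms(3) by (rule measurable_restrict_space1)
 moreover have "sets (restrict_space borel U) = sets M" using assms(1) borel_subsets_restrict[OF assms(2)] by simp
 ultimately show ?thesis using measurable_cong_sets by blast
qed

definition LB :: "'a::euclidean_space set => 'a measure" where "LB U = restrict_space lborel U"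

lemma sets_LB: "U \<in> sets borel ==> sets (LB U) = borel_subsets U"
 by (auto simp: LB_def borel_subsets_def sets_restrict_space_iff)

lemma emeasure_LB: "U \<in> sets borel ==> A \<in> borel_subsets U ==> emeasure (LB U) A = emeasure lborel A"
 unfolding LB_def by (rule emeasure_restrict_space) (auto simp: borel_subsets_def)

lemma finite_measure_LB:
 assumes "U \<in> sets borel" "bounded U" shows "finite_measure (LB U)"
proof (rule finite_measureI)
 have "U \<in> borel_subsets U" using assms by (simp add: borel_subsets_def)
 then show "emeasure (LB U) (space (LB U)) \<noteq> \<infinity>"
  using emeasure_bounded_finite[OF assms(2)] assms emeasure_LB[OF assms(1), of U]
  by (simp add: space_borel_subsets[OF sets_LB] less_top[symmetric])
qed

definition dens :: "'a::euclidean_space set => 'a measure => ('a => 'v::euclidean_space) => 'a set => 'v" where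
 "dens U M g A = (if A \<in> borel_subsets U then LINT x:A|M. g x else 0)"

lemma fvm_sums:
 "finite_vector_measure U \<mu> ==> range A \<subseteq> borel_subsets U ==> disjoint_family A ==>
  (%i. \<mu> (A i)) sums \<mu> (\<Union>i. A i)"
 unfolding finite_vector_measure_def by blast

lemma fvm_outside: "finite_vector_measure U \<mu> ==> A \<notin> borel_subsets U ==> \<mu> A = 0"
 unfolding finite_vector_measure_def by blast

lemma fvm_empty: "finite_vector_measure U \<mu> ==> \<mu> {} = 0"
 using fvm_sums[of U \<mu> "%i. {}"]
 by (auto simp: borel_subsets_def disjoint_family_on_def summable_const_iff dest!: sums_summable)

lemma fvm_Un:
 assumes "finite_vector_measure U \<mu>" "A \<in> borel_subsets U" "B \<in> borel_subsets U" "A \<inter> B = {}"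
 shows "\<mu> (A \<union> B) = \<mu> A + \<mu> B"
proof -
 have "(%i. \<mu> (binaryset A B i)) sums \<mu> (\<Union>i. binaryset A B i)"
 proof (rule fvm_sums[OF assms(1)])
  show "range (binaryset A B) \<subseteq> borel_subsets U"
   using assms by (auto simp: range_binaryset_eq borel_subsets_def)
  show "disjoint_family (binaryset A B)"
   using assms(4) by (auto simp: disjoint_family_on_def binaryset_def)
 qed
 then show ?thesis
  using binaryset_sums[of \<mu> A B, OF fvm_empty[OF assms(1)]] sums_unique2
  by (auto simp: UN_binaryset_eq)
qed

lemma fvm_bounded_linear:
 assumes "finite_vector_measure U \<mu>" "bounded_linear L"
 shows "finite_vector_measure U (%A. L (\<mu> A))"
 using assms bounded_linear.sums[OF assms(2)] linear_0[OF bounded_linear.linear[OF assms(2)]]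
 unfolding finite_vector_measure_def by auto

lemma fvm_add:
 "finite_vector_measure U \<mu> ==> finite_vector_measure U \<nu> ==> finite_vector_measure U (%A. \<mu> A + \<nu> A)"
 unfolding finite_vector_measure_def by (auto intro: sums_add)

lemma fvm_Pair:
 "finite_vector_measure U \<mu> ==> finite_vector_measure U \<nu> ==> finite_vector_measure U (%A. (\<mu> A, \<nu> A))"
 unfolding finite_vector_measure_def by (auto simp: sums_def sum_prod intro!: tendsto_Pair simp: zero_prod_def)

text \<open>The positive variation of a real-valued measure, as an extended number because its finiteness is
  a theorem.\<close>

definition posvar :: "'a::euclidean_space set => ('a set => real) => 'a set => ennreal" where
 "posvar U \<mu> E = (SUP A \<in> {A \<in> borel_subsets U. A \<subseteq> E}. ennreal (\<mu> A))"

lemma posvar_ge: "A \<in> borel_subsets U ==> A \<subseteq> E ==> ennreal (\<mu> A) <= posvar U \<mu> E"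
 unfolding posvar_def by (rule SUP_upper) auto

lemma posvar_mono: "E \<subseteq> F ==> posvar U \<mu> E <= posvar U \<mu> F"
 unfolding posvar_def by (rule SUP_subset_mono) auto

lemma posvar_add:
 assumes \<mu>: "finite_vector_measure U \<mu>" and disj: "E \<inter> F = {}"
 shows "posvar U \<mu> E + posvar U \<mu> F <= posvar U \<mu> (E \<union> F)"
proof -
 have ne: "{A \<in> borel_subsets U. A \<subseteq> E} \<noteq> {}" for E :: "'a set"
  by (auto simp: borel_subsets_def)
 have le: "ennreal (\<mu> A) + ennreal (\<mu> B) <= posvar U \<mu> (E \<union> F)"
  if "A \<in> borel_subsets U" "A \<subseteq> E" "B \<in> borel_subsets U" "B \<subseteq> F" for A B
 proof -
  consider "\<mu> A <= 0" | "\<mu> B <= 0" | "\<mu> A \<ge> 0" "\<mu> B \<ge> 0" by linarith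
  then show ?thesis
  proof cases
   case 1
   then show ?thesis using posvar_ge[of B U "E \<union> F" \<mu>] that by (auto simp: ennreal_neg)
  next
   case 2
   then show ?thesis using posvar_ge[of A U "E \<union> F" \<mu>] that by (auto simp: ennreal_neg)
  next
   case 3
   have AB: "A \<inter> B = {}" using that disj by blast
   have "ennreal (\<mu> A) + ennreal (\<mu> B) = ennreal (\<mu> (A \<union> B))"
    using 3 fvm_Un[OF \<mu> that(1,3) AB] by simp
   also have "... <= posvar U \<mu> (E \<union> F)"
    using that by (intro posvar_ge) (auto simp: borel_subsets_def)
   finally show ?thesis .
  qed
 qed
 have "posvar U \<mu> E + ennreal (\<mu> B) <= posvar U \<mu> (E \<union> F)" if "B \<in> borel_subsets U" "B \<subseteq> F" for B
  unfolding posvar_def[of U \<mu> E]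
  by (subst ennreal_SUP_add_left[OF ne, symmetric]) (use le that in \<open>auto intro!: SUP_least\<close>)
 then show ?thesis
  unfolding posvar_def[of U \<mu> F]
  by (subst ennreal_SUP_add_right[OF ne]) (auto intro!: SUP_least)
qed

lemma ennreal_plus_le: "ennreal (x + y) <= ennreal x + ennreal y"
 by (cases "x \<ge> 0"; cases "y \<ge> 0") (auto simp: ennreal_neg intro!: ennreal_leI)

lemma posvar_subadd:
 assumes \<mu>: "finite_vector_measure U \<mu>" and EF: "E \<in> borel_subsets U" "F \<in> borel_subsets U"
 shows "posvar U \<mu> (E \<union> F) <= posvar U \<mu> E + posvar U \<mu> F"
 unfolding posvar_def[of U \<mu> "E \<union> F"]
proof (rule SUP_least)
 fix A assume A: "A \<in> {A \<in> borel_subsets U. A \<subseteq> E \<union> F}"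
 have AE: "A \<inter> E \<in> borel_subsets U" "A - E \<in> borel_subsets U"
  using A EF by (auto simp: borel_subsets_def)
 have "(A \<inter> E) \<inter> (A - E) = {}" "(A \<inter> E) \<union> (A - E) = A" by auto
 then have "\<mu> A = \<mu> (A \<inter> E) + \<mu> (A - E)" using fvm_Un[OF \<mu> AE] by simp
 also have "ennreal ... <= ennreal (\<mu> (A \<inter> E)) + ennreal (\<mu> (A - E))" by (rule ennreal_plus_le)
 also have "... <= posvar U \<mu> E + posvar U \<mu> F"
  using A AE by (intro add_mono posvar_ge) auto
 finally show "ennreal (\<mu> A) <= posvar U \<mu> E + posvar U \<mu> F" .
qed

lemma sums_le_suminf_ennreal:
 fixes x :: "nat => real" assumes "x sums s" shows "ennreal s <= (\<Sum>i. ennreal (x i))"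
proof -
 have le: "ennreal (\<Sum>i<n. x i) <= (\<Sum>i. ennreal (x i))" for n
 proof -
  have "ennreal (\<Sum>i<n. x i) <= ennreal (\<Sum>i<n. max 0 (x i))" by (intro ennreal_leI sum_mono) auto
  also have "... = (\<Sum>i<n. ennreal (x i))"
   by (subst sum_ennreal[symmetric]) (auto intro!: sum.cong simp: max_def ennreal_neg simp del: sum_ennreal)
  also have "... <= (\<Sum>i. ennreal (x i))" by (intro sum_le_suminf) auto
  finally show ?thesis .
 qed
 have lim: "(%n. ennreal (\<Sum>i<n. x i)) \<longlonglongrightarrow> ennreal s"
  using assms by (intro tendsto_ennrealI) (simp add: sums_def)
 show ?thesis by (rule LIMSEQ_le_const2[OF lim], rule exI, rule allI, rule impI, rule le)
qed

lemma posvar_countably_additive: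
 assumes \<mu>: "finite_vector_measure U \<mu>" and U: "U \<in> sets borel"
 shows "countably_additive (borel_subsets U) (posvar U \<mu>)"
proof (rule countably_additiveI)
 fix A :: "nat => 'a set"
 assume A: "range A \<subseteq> borel_subsets U" "disjoint_family A"
 show "(\<Sum>i. posvar U \<mu> (A i)) = posvar U \<mu> (\<Union>i. A i)"
 proof (rule antisym)
  have "(\<Sum>i<n. posvar U \<mu> (A i)) <= posvar U \<mu> (\<Union>i<n. A i)" for n
  proof (induction n)
   case (Suc n)
   have disj: "(\<Union>i<n. A i) \<inter> A n = {}"
   proof -
    have "A i \<inter> A n = {}" if "i < n" for i
     using disjoint_family_onD[OF A(2), of i n] that by simp
    then show ?thesis by blast
   qed
   have "(\<Sum>i<Suc n. posvar U \<mu> (A i)) = (\<Sum>i<n. posvar U \<mu> (A i)) + posvar U \<mu> (A n)"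
    by simp
   also have "... <= posvar U \<mu> (\<Union>i<n. A i) + posvar U \<mu> (A n)"
    by (rule add_right_mono[OF Suc])
   also have "... <= posvar U \<mu> ((\<Union>i<n. A i) \<union> A n)" by (rule posvar_add[OF \<mu> disj])
   also have "(\<Union>i<n. A i) \<union> A n = (\<Union>i<Suc n. A i)" by (auto simp: lessThan_Suc)
   finally show ?case .
  qed simp
  then have "(\<Sum>i<n. posvar U \<mu> (A i)) <= posvar U \<mu> (\<Union>i. A i)" for n
   by (rule order_trans) (rule posvar_mono, blast)
  then show "(\<Sum>i. posvar U \<mu> (A i)) <= posvar U \<mu> (\<Union>i. A i)"
   by (rule suminf_le_const[OF summableI])
  show "posvar U \<mu> (\<Union>i. A i) <= (\<Sum>i. posvar U \<mu> (A i))"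
   unfolding posvar_def[of U \<mu> "\<Union>i. A i"]
  proof (rule SUP_least)
   fix B assume "B \<in> {B \<in> borel_subsets U. B \<subseteq> (\<Union>i. A i)}"
   then have B: "B \<in> borel_subsets U" "B = (\<Union>i. B \<inter> A i)" by auto
   have r: "range (%i. B \<inter> A i) \<subseteq> borel_subsets U" using B A(1) by (auto simp: borel_subsets_def)
   have "(%i. \<mu> (B \<inter> A i)) sums \<mu> (\<Union>i. B \<inter> A i)"
    by (rule fvm_sums[OF \<mu> r]) (use A(2) in \<open>auto simp: disjoint_family_on_def\<close>)
   then have "ennreal (\<mu> B) <= (\<Sum>i. ennreal (\<mu> (B \<inter> A i)))"
    using sums_le_suminf_ennreal B(2) by metis
   also have "... <= (\<Sum>i. posvar U \<mu> (A i))"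
    using r by (intro suminf_le summableI posvar_ge) auto
   finally show "ennreal (\<mu> B) <= (\<Sum>i. posvar U \<mu> (A i))" .
  qed
 qed
qed

text \<open>If the positive variation were infinite, bisecting a set of infinite variation
  would produce infinitely many disjoint sets of measure at least 1 in absolute value.\<close>

lemma posvar_finite:
 assumes \<mu>: "finite_vector_measure U \<mu>" and U: "U \<in> sets borel"
 shows "posvar U \<mu> U < \<infinity>"
proof (rule ccontr)
 assume "\<not> ?thesis"
 then have inf: "posvar U \<mu> U = \<infinity>" by (simp add: less_top[symmetric])
 let ?S = "{E \<in> borel_subsets U. posvar U \<mu> E = \<infinity>}"
 interpret sa: sigma_algebra U "borel_subsets U" by (rule sigma_algebra_borel_subsets[OF U])
 have step: "\<exists>F. F \<in> ?S \<and> F \<subseteq> E \<and> \<bar>\<mu> (E - F)\<bar> \<ge> 1" if E: "E \<in> ?S" for E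
 proof -
  have "ennreal (\<bar>\<mu> E\<bar> + 1) < posvar U \<mu> E" using E by simp
  then obtain B where B: "B \<in> borel_subsets U" "B \<subseteq> E" "ennreal (\<bar>\<mu> E\<bar> + 1) < ennreal (\<mu> B)"
   unfolding posvar_def less_SUP_iff by auto
  then have b: "\<bar>\<mu> E\<bar> + 1 < \<mu> B" by (subst (asm) ennreal_less_iff) auto
  have EB: "E - B \<in> borel_subsets U" using E B by auto
  have eq: "\<mu> E = \<mu> B + \<mu> (E - B)"
   using fvm_Un[OF \<mu> B(1) EB] B(2) by (simp add: Un_absorb1)
  have "posvar U \<mu> E <= posvar U \<mu> B + posvar U \<mu> (E - B)"
   using posvar_subadd[OF \<mu> B(1) EB] B(2) by (simp add: Un_absorb1)
  then have "posvar U \<mu> B = \<infinity> \<or> posvar U \<mu> (E - B) = \<infinity>"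
   using E by (simp add: ennreal_add_eq_top top_unique)
  then show ?thesis
  proof
   assume "posvar U \<mu> B = \<infinity>"
   then show ?thesis using B b eq by (intro exI[of _ B]) auto
  next
   assume "posvar U \<mu> (E - B) = \<infinity>"
   moreover have "E - (E - B) = B" using B by auto
   ultimately show ?thesis using EB b by (intro exI[of _ "E - B"]) auto
  qed
 qed
 have "\<exists>f. \<forall>E\<in>?S. f E \<in> ?S \<and> f E \<subseteq> E \<and> \<bar>\<mu> (E - f E)\<bar> \<ge> 1"
  by (rule bchoice) (intro ballI step)
 then obtain f where f: "!!E. E \<in> ?S ==> f E \<in> ?S \<and> f E \<subseteq> E \<and> \<bar>\<mu> (E - f E)\<bar> \<ge> 1" by (elim exE) (rule that, erule bspec)
 define E where "E n = (f ^^ n) U" for n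
 have ES: "E n \<in> ?S" for n
 proof (induction n)
  case 0
  show ?case using inf sa.top by (simp add: E_def)
 next
  case (Suc n)
  show ?case using f[OF Suc] by (simp add: E_def)
 qed
 have ESuc: "E (Suc n) = f (E n)" for n by (simp add: E_def)
 have dec: "E n \<subseteq> E m" if "m <= n" for m n
  using that
 proof (induction rule: dec_induct)
  case (step n)
  then show ?case using f[OF ES[of n]] unfolding ESuc by blast
 qed simp
 define D where "D n = E n - E (Suc n)" for n
 have D: "range D \<subseteq> borel_subsets U" using ES by (auto simp: D_def)
 have dis: "disjoint_family D"
 proof -
  have "D m \<inter> D n = {}" if "m < n" for m n
   using dec[of "Suc m" n] that by (auto simp: D_def)
  then show ?thesis
   unfolding disjoint_family_on_def by (metis Int_commute linorder_neqE_nat)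
 qed
 have "summable (%n. \<mu> (D n))" using fvm_sums[OF \<mu> D dis] by (rule sums_summable)
 then have "(%n. \<mu> (D n)) \<longlonglongrightarrow> 0" by (rule summable_LIMSEQ_zero)
 then have "\<forall>\<^sub>F n in sequentially. dist (\<mu> (D n)) 0 < 1" by (rule tendstoD) simp
 then obtain n where "\<bar>\<mu> (D n)\<bar> < 1" unfolding eventually_sequentially by auto
 then show False using f[OF ES[of n]] by (simp add: D_def ESuc)
qed

text \<open>The positive variation is a finite measure that dominates \<open>\<mu>\<close>, so
  \<open>\<mu>\<close> is its difference with the positive variation minus \<open>\<mu>\<close>.\<close>

lemma jordan_decomposition:
 fixes \<mu> :: "'a::euclidean_space set => real"
 assumes \<mu>: "finite_vector_measure U \<mu>" and U: "U \<in> sets borel"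
 obtains P Q where "finite_measure P" "finite_measure Q" "sets P = borel_subsets U" "sets Q = borel_subsets U"
  "!!A. A \<in> borel_subsets U ==> \<mu> A = measure P A - measure Q A"
proof -
 interpret sa: sigma_algebra U "borel_subsets U" by (rule sigma_algebra_borel_subsets[OF U])
 define P where "P = measure_of U (borel_subsets U) (posvar U \<mu>)"
 have sP: "sets P = borel_subsets U" "space P = U" by (simp_all add: P_def)
 have "posvar U \<mu> {} = 0"
  using fvm_empty[OF \<mu>] by (auto simp: posvar_def intro!: SUP_eq_const)
 then have eP: "emeasure P A = posvar U \<mu> A" if "A \<in> borel_subsets U" for A
  unfolding P_def using posvar_countably_additive[OF \<mu> U] that
  by (intro emeasure_measure_of_sigma sa.sigma_algebra_axioms) (auto simp: positive_def)
 have fP: "finite_measure P"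
  using posvar_finite[OF \<mu> U] eP[OF sa.top] by (intro finite_measureI) (simp add: sP)
 interpret P: finite_measure P by (rule fP)
 define q where "q A = measure P A - \<mu> A" for A
 have qpos: "q A \<ge> 0" if "A \<in> borel_subsets U" for A
 proof -
  have "ennreal (\<mu> A) <= ennreal (measure P A)"
   using posvar_ge[OF that order_refl, of \<mu>] eP[OF that] by (simp add: P.emeasure_eq_measure)
  then show ?thesis by (simp add: q_def ennreal_le_iff)
 qed
 define Q where "Q = measure_of U (borel_subsets U) (%A. ennreal (q A))"
 have sQ: "sets Q = borel_subsets U" "space Q = U" by (simp_all add: Q_def)
 have "countably_additive (borel_subsets U) (%A. ennreal (q A))"
 proof (rule countably_additiveI)
  fix A :: "nat => 'a set" assume A: "range A \<subseteq> borel_subsets U" "disjoint_family A"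
  have "(%i. q (A i)) sums q (\<Union>i. A i)"
   unfolding q_def using A by (intro sums_diff P.finite_measure_UNION fvm_sums[OF \<mu>]) (auto simp: sP)
  then show "(\<Sum>i. ennreal (q (A i))) = ennreal (q (\<Union>i. A i))"
   using A qpos by (intro suminf_ennreal_eq) auto
 qed
 then have eQ: "emeasure Q A = ennreal (q A)" if "A \<in> borel_subsets U" for A
  unfolding Q_def using that fvm_empty[OF \<mu>]
  by (intro emeasure_measure_of_sigma sa.sigma_algebra_axioms) (auto simp: positive_def q_def)
 have fQ: "finite_measure Q"
  using eQ[OF sa.top] by (intro finite_measureI) (simp add: sQ)
 show ?thesis
  by (rule that[OF fP fQ sP(1) sQ(1)]) (use eQ qpos in \<open>simp add: measure_def q_def\<close>)
qed

text \<open>The sum of finitely many measures dominates each of them; Radon-Nikodym gives the densities.\<close>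

lemma common_dominating_measure:
 fixes P :: "'k => 'a::euclidean_space measure"
 assumes K: "finite K" and P: "!!k. k \<in> K ==> finite_measure (P k)" "!!k. k \<in> K ==> sets (P k) = borel_subsets U"
  and U: "U \<in> sets borel"
 obtains M f where "finite_measure M" "sets M = borel_subsets U"
  "!!k. k \<in> K ==> integrable M (f k)" "!!k x. 0 <= (f k x :: real)"
  "!!k. k \<in> K ==> P k = density M (%x. ennreal (f k x))"
proof -
 interpret sa: sigma_algebra U "borel_subsets U" by (rule sigma_algebra_borel_subsets[OF U])
 define M where "M = measure_of U (borel_subsets U) (%A. \<Sum>k\<in>K. emeasure (P k) A)"
 have sM: "sets M = borel_subsets U" "space M = U" by (simp_all add: M_def)
 have ca: "countably_additive (borel_subsets U) (%A. \<Sum>k\<in>K. emeasure (P k) A)"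
 proof (rule countably_additiveI)
  fix A :: "nat => 'a set" assume A: "range A \<subseteq> borel_subsets U" "disjoint_family A"
  have "(\<Sum>i. \<Sum>k\<in>K. emeasure (P k) (A i)) = (\<Sum>k\<in>K. \<Sum>i. emeasure (P k) (A i))"
   by (rule suminf_sum) simp
  also have "... = (\<Sum>k\<in>K. emeasure (P k) (\<Union>i. A i))"
   using A P(2) by (intro sum.cong refl suminf_emeasure) auto
  finally show "(\<Sum>i. \<Sum>k\<in>K. emeasure (P k) (A i)) = (\<Sum>k\<in>K. emeasure (P k) (\<Union>i. A i))" .
 qed
 have eM: "emeasure M A = (\<Sum>k\<in>K. emeasure (P k) A)" if "A \<in> borel_subsets U" for A
  unfolding M_def using ca that
  by (intro emeasure_measure_of_sigma sa.sigma_algebra_axioms) (auto simp: positive_def)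
 have fM: "finite_measure M"
 proof (rule finite_measureI)
  have "emeasure (P k) U < top" if "k \<in> K" for k
   using finite_measure.emeasure_finite[OF P(1)[OF that], of U] by (simp add: less_top)
  note lt = this
  have "finite J ==> J \<subseteq> K ==> (\<Sum>k\<in>J. emeasure (P k) U) < top" for J
   by (induction J rule: finite_induct) (auto simp: lt)
  from this[OF K] have "(\<Sum>k\<in>K. emeasure (P k) U) < top" by simp
  then show "emeasure M (space M) \<noteq> \<infinity>" using eM[OF sa.top] by (simp add: sM)
 qed
 have ex: "\<exists>f. integrable M f \<and> (\<forall>x. 0 <= f x) \<and> P k = density M (%x. ennreal (f x))" if k: "k \<in> K" for k
 proof -
  have ac: "absolutely_continuous M (P k)"
   unfolding absolutely_continuous_def
  proof
   fix A assume "A \<in> null_sets M"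
   then have A: "A \<in> borel_subsets U" "emeasure M A = 0" by (auto simp: sM)
   then have "emeasure (P k) A = 0" using eM[OF A(1)] K k by simp
   then show "A \<in> null_sets (P k)" using A P(2)[OF k] by auto
  qed
  obtain h where h: "h \<in> borel_measurable M" "density M h = P k"
   using finite_measure.Radon_Nikodym_finite_measure[OF fM P(1)[OF k] _ ac] P(2)[OF k] sM by auto
  have "(\<integral>\<^sup>+x. h x \<partial>M) = emeasure (P k) (space M)"
   unfolding h(2)[symmetric] using h(1) by (subst emeasure_density) (auto intro!: nn_integral_cong)
  then have fin: "(\<integral>\<^sup>+x. h x \<partial>M) \<noteq> \<infinity>"
   using finite_measure.emeasure_finite[OF P(1)[OF k]] by simp
  have ae: "AE x in M. h x = ennreal (enn2real (h x))"
   using nn_integral_PInf_AE[OF h(1) fin] by (auto simp: less_top)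
  have "integrable M (%x. enn2real (h x))"
  proof (rule integrableI_bounded)
   have "(\<integral>\<^sup>+x. ennreal (norm (enn2real (h x))) \<partial>M) = (\<integral>\<^sup>+x. h x \<partial>M)"
    using ae by (intro nn_integral_cong_AE) auto
   then show "(\<integral>\<^sup>+x. ennreal (norm (enn2real (h x))) \<partial>M) < \<infinity>" using fin by (simp add: less_top)
  qed (use h(1) in measurable)
  moreover have "P k = density M (%x. ennreal (enn2real (h x)))"
   unfolding h(2)[symmetric]
   by (rule density_cong[OF h(1) _ ae]) (use h(1) in measurable)
  ultimately show ?thesis by (intro exI[of _ "%x. enn2real (h x)"]) auto
 qed
 have "\<forall>k. \<exists>f. (\<forall>x. 0 <= f x) \<and> (k \<in> K --> integrable M f \<and> P k = density M (%x. ennreal (f x)))"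
 proof
  fix k show "\<exists>f. (\<forall>x. 0 <= f x) \<and> (k \<in> K --> integrable M f \<and> P k = density M (%x. ennreal (f x)))"
   using ex[of k] by (cases "k \<in> K") (auto intro: exI[of _ "%_. 0"])
 qed
 then obtain f where "\<forall>k. (\<forall>x. 0 <= f k x) \<and> (k \<in> K --> integrable M (f k) \<and> P k = density M (%x. ennreal (f k x)))"
  by metis
 then show ?thesis using that[OF fM sM(1), of f] by blast
qed

lemma set_integrable_of_integrable:
 fixes f :: "'a => 'b::{banach, second_countable_topology}"
 shows "integrable M f ==> A \<in> sets M ==> set_integrable M A f"
 unfolding set_integrable_def by (rule integrable_mult_indicator)

lemma measure_density_real:
 assumes "integrable M f" "!!x. 0 <= f x" "A \<in> sets M"
 shows "measure (density M (%x. ennreal (f x))) A = (LINT x:A|M. f x)"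
proof -
 have "emeasure (density M (%x. ennreal (f x))) A = (\<integral>\<^sup>+x. ennreal (indicator A x *\<^sub>R f x) \<partial>M)"
  using assms by (subst emeasure_density) (auto intro!: nn_integral_cong simp: indicator_def)
 also have "... = ennreal (LINT x:A|M. f x)"
  unfolding set_lebesgue_integral_def using assms
  by (intro nn_integral_eq_integral integrable_mult_indicator) auto
 finally show ?thesis
  using assms by (simp add: measure_def set_lebesgue_integral_def)
qed

text \<open>This representation reduces all statements on vector measures to statements on densities. The
  extra measure \<open>L\<close>, in practice Lebesgue measure, becomes a density with respect
  to the same \<open>M\<close>, which turns the Lebesgue decomposition into a case distinction
  on the zero set of that density.\<close>

lemma fvm_density:
 fixes \<mu> :: "'a::euclidean_space set => 'v::euclidean_space"
 assumes \<mu>: "finite_vector_measure U \<mu>" and U: "U \<in> sets borel"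
  and L: "finite_measure L" "sets L = borel_subsets U"
 obtains M g a where "finite_measure M" "sets M = borel_subsets U" "integrable M g" "\<mu> = dens U M g"
  "integrable M a" "!!x. 0 <= (a x :: real)" "L = density M (%x. ennreal (a x))"
proof -
 have "\<forall>b. \<exists>P Q. finite_measure P \<and> finite_measure Q \<and> sets P = borel_subsets U \<and> sets Q = borel_subsets U \<and>
  (\<forall>A \<in> borel_subsets U. \<mu> A \<bullet> b = measure P A - measure Q A)"
 proof
  fix b
  have "finite_vector_measure U (%A. \<mu> A \<bullet> b)"
   by (rule fvm_bounded_linear[OF \<mu> bounded_linear_inner_left])
  from jordan_decomposition[OF this U] show "\<exists>P Q. finite_measure P \<and> finite_measure Q \<and> sets P = borel_subsets U \<and> sets Q = borel_subsets U \<and>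
  (\<forall>A \<in> borel_subsets U. \<mu> A \<bullet> b = measure P A - measure Q A)" by metis
 qed
 then obtain P Q where PQ: "!!b. finite_measure (P b)" "!!b. finite_measure (Q b)"
  "!!b. sets (P b) = borel_subsets U" "!!b. sets (Q b) = borel_subsets U"
  "!!b A. A \<in> borel_subsets U ==> \<mu> A \<bullet> b = measure (P b) A - measure (Q b) A" by metis
 \<comment> \<open>positive and negative parts of all coordinates, together with \<open>L\<close>, are dominated at once\<close>
 define R where "R k = (case k of None => L | Some (b, s) => if s then P b else Q b)" for k :: "('v \<times> bool) option"
 let ?K = "insert None (Some ` (Basis \<times> UNIV)) :: ('v \<times> bool) option set"
 obtain M f where M: "finite_measure M" "sets M = borel_subsets U"
  and f: "!!k. k \<in> ?K ==> integrable M (f k)" "!!k x. 0 <= (f k x :: real)"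
  "!!k. k \<in> ?K ==> R k = density M (%x. ennreal (f k x))"
  by (rule common_dominating_measure[of ?K R U])
   (use PQ L U in \<open>auto simp: R_def split: option.splits\<close>)
 define g where "g x = (\<Sum>b\<in>Basis. (f (Some (b, True)) x - f (Some (b, False)) x) *\<^sub>R b)" for x
 have g: "integrable M g" unfolding g_def
  by (intro bint_sum integrable_scaleR_left bint_diff f(1)) auto
 have "\<mu> = dens U M g"
 proof
  fix A
  show "\<mu> A = dens U M g A"
  proof (cases "A \<in> borel_subsets U")
   case True
   then have A: "A \<in> sets M" using M by simp
   have "\<mu> A \<bullet> b = (LINT x:A|M. g x) \<bullet> b" if b: "b \<in> Basis" for b
   proof -
    have "\<mu> A \<bullet> b = measure (R (Some (b, True))) A - measure (R (Some (b, False))) A"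
     using PQ(5)[OF True] by (simp add: R_def)
    also have "... = (LINT x:A|M. f (Some (b, True)) x) - (LINT x:A|M. f (Some (b, False)) x)"
     using b A by (simp add: f measure_density_real)
    also have "... = (LINT x:A|M. f (Some (b, True)) x - f (Some (b, False)) x)"
     using b by (intro set_integral_diff(2)[symmetric] set_integrable_of_integrable[OF _ A] f(1)) auto
    also have "... = (LINT x:A|M. g x \<bullet> b)"
     using b by (intro set_lebesgue_integral_cong) (use A in \<open>auto simp: g_def inner_sum_left inner_Basis if_distrib sum.delta cong: if_cong\<close>)
    also have "... = (LINT x|M. (indicator A x *\<^sub>R g x) \<bullet> b)"
     by (simp add: set_lebesgue_integral_def)
    also have "... = (LINT x:A|M. g x) \<bullet> b"
     unfolding set_lebesgue_integral_def using A g by (intro integral_inner_left) (auto intro: integrable_mult_indicator)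
    finally show ?thesis .
   qed
   then show ?thesis using True by (auto simp: dens_def intro: euclidean_eqI)
  qed (use fvm_outside[OF \<mu>] in \<open>simp add: dens_def\<close>)
 qed
 moreover have "L = density M (%x. ennreal (f None x))" using f(3)[of None] by (simp add: R_def)
 ultimately show ?thesis using that M g f by blast
qed

section \<open>Total variation and polar density\<close>

lemma fvm_dens:
 assumes M: "sets M = borel_subsets U" and U: "U \<in> sets borel" and g: "integrable M g"
 shows "finite_vector_measure U (dens U M g)"
 unfolding finite_vector_measure_def
proof (intro conjI allI impI)
 fix A :: "nat => 'a set" assume A: "range A \<subseteq> borel_subsets U \<and> disjoint_family A"
 have AM: "A i \<in> sets M" for i using A M by auto
 have UA: "(\<Union>i. A i) \<in> sets M" using AM by auto
 have "(%n. LINT x:(\<Union>i<n. A i)|M. g x) \<longlonglongrightarrow> (LINT x:(\<Union>n. \<Union>i<n. A i)|M. g x)"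
 proof (rule set_integral_cont_up)
  show "incseq (%n. \<Union>i<n. A i)" by (rule incseq_SucI) (force simp: less_Suc_eq)
  show "set_integrable M (\<Union>n. \<Union>i<n. A i) g"
   using AM by (intro set_integrable_of_integrable[OF g]) auto
 qed (use AM in auto)
 moreover have "(LINT x:(\<Union>i<n. A i)|M. g x) = (\<Sum>i<n. LINT x:A i|M. g x)" for n
  using A AM by (intro set_integral_finite_Union set_integrable_of_integrable[OF g])
   (auto simp: disjoint_family_on_def)
 moreover have "(\<Union>n. \<Union>i<n. A i) = (\<Union>i. A i)" by auto
 ultimately have "(%n. \<Sum>i<n. LINT x:A i|M. g x) \<longlonglongrightarrow> (LINT x:(\<Union>i. A i)|M. g x)" by simp
 moreover have "dens U M g (A i) = (LINT x:A i|M. g x)" for i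
  using AM[of i] M by (simp add: dens_def)
 moreover have "dens U M g (\<Union>i. A i) = (LINT x:(\<Union>i. A i)|M. g x)"
  using UA M by (simp add: dens_def)
 ultimately show "(%i. dens U M g (A i)) sums dens U M g (\<Union>i. A i)"
  by (simp add: sums_def)
qed (simp add: dens_def)

lemma emeasure_density_norm:
 fixes g :: "'a => 'b::{banach, second_countable_topology}"
 assumes "integrable M g" "A \<in> sets M"
 shows "emeasure (density M (%x. ennreal (norm (g x)))) A = ennreal (LINT x:A|M. norm (g x))"
proof -
 have "emeasure (density M (%x. ennreal (norm (g x)))) A = (\<integral>\<^sup>+x. ennreal (indicator A x *\<^sub>R norm (g x)) \<partial>M)"
  using assms by (subst emeasure_density) (auto intro!: nn_integral_cong simp: indicator_def)
 also have "... = ennreal (LINT x:A|M. norm (g x))"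
  unfolding set_lebesgue_integral_def using assms
  by (intro nn_integral_eq_integral integrable_mult_indicator integrable_norm) auto
 finally show ?thesis .
qed

lemma norm_dens_le:
 fixes g :: "'a => 'b::{banach, second_countable_topology}"
 assumes "integrable M g" "A \<in> sets M"
 shows "ennreal (norm (LINT x:A|M. g x)) <= emeasure (density M (%x. ennreal (norm (g x)))) A"
 unfolding emeasure_density_norm[OF assms]
proof (rule ennreal_leI)
 show "norm (LINT x:A|M. g x) <= (LINT x:A|M. norm (g x))"
  using set_integral_norm_bound[OF set_integrable_of_integrable[OF assms]] .
qed

text \<open>Preimages of small balls around a countable dense set.\<close>

lemma partition_small_oscillation:
 fixes g :: "'a => 'v::euclidean_space"
 assumes g: "g \<in> borel_measurable M" and E: "E \<in> sets M" and e: "e > 0"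
 shows "\<exists>(A :: nat => 'a set) q. range A \<subseteq> sets M \<and> disjoint_family A \<and> (\<Union>i. A i) = E \<and>
  (\<forall>i. \<forall>x\<in>A i. norm (g x - q i) <= e)"
proof -
 obtain D :: "'v set" where D: "countable D" "!!X. open X ==> X \<noteq> {} ==> \<exists>d\<in>D. d \<in> X"
  by (rule countable_dense_setE) blast
 have "D \<noteq> {}" using D(2)[of UNIV] by auto
 then have r: "range (from_nat_into D) = D" using D(1) by (rule range_from_nat_into)
 define B where "B n = g -` ball (from_nat_into D n) e \<inter> space M \<inter> E" for n
 have B: "range B \<subseteq> sets M" using g E by (auto simp: B_def intro!: sets.Int measurable_sets)
 have UB: "(\<Union>n. B n) = E"
 proof -
  have "x \<in> (\<Union>n. B n)" if x: "x \<in> E" for x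
  proof -
   obtain d where d: "d \<in> D" "d \<in> ball (g x) e" using D(2)[of "ball (g x) e"] e by auto
   then obtain n where "d = from_nat_into D n" using r by (metis imageE)
   then have "x \<in> B n" using d x sets.sets_into_space[OF E] by (auto simp: B_def dist_commute)
   then show ?thesis by blast
  qed
  then show ?thesis by (auto simp: B_def)
 qed
 show ?thesis
 proof (intro exI[of _ "disjointed B"] exI[of _ "from_nat_into D"] conjI allI ballI)
  show "range (disjointed B) \<subseteq> sets M" using sets.range_disjointed_sets[OF B] .
  show "disjoint_family (disjointed B)" by (rule disjoint_family_disjointed)
  show "(\<Union>i. disjointed B i) = E" by (simp add: UN_disjointed_eq UB)
  show "norm (g x - from_nat_into D i) <= e" if "x \<in> disjointed B i" for i x
   using subsetD[OF disjointed_subset that] by (auto simp: B_def dist_norm norm_minus_commute)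
 qed
qed

text \<open>On a partition on whose cells the density oscillates by at most \<open>d\<close>, the norm of
  the integral differs from the integral of the norm by at most \<open>2 d\<close> times the
  mass of the cell.\<close>

lemma total_variation_SUP:
 fixes g :: "'a::euclidean_space => 'v::euclidean_space"
 assumes M: "finite_measure M" "sets M = borel_subsets U" and g: "integrable M g" and E: "E \<in> borel_subsets U"
 shows "(SUP A \<in> {A::nat => 'a set. range A \<subseteq> borel_subsets U \<and> disjoint_family A \<and> (\<Union>i. A i) = E}.
    (\<Sum>i. ennreal (norm (dens U M g (A i))))) = emeasure (density M (%x. ennreal (norm (g x)))) E"
  (is "?S = emeasure ?N E")
proof (rule antisym)
 interpret finite_measure M by (rule M(1))
 have sN: "sets ?N = borel_subsets U" using M(2) by simp
 show "?S <= emeasure ?N E"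
 proof (rule SUP_least)
  fix A :: "nat => 'a set"
  assume "A \<in> {A. range A \<subseteq> borel_subsets U \<and> disjoint_family A \<and> (\<Union>i. A i) = E}"
  then have A: "range A \<subseteq> borel_subsets U" "disjoint_family A" "(\<Union>i. A i) = E" by auto
  have "(\<Sum>i. ennreal (norm (dens U M g (A i)))) <= (\<Sum>i. emeasure ?N (A i))"
  proof (intro suminf_le summableI)
   fix i have "A i \<in> sets M" using A(1) M(2) by auto
   then show "ennreal (norm (dens U M g (A i))) <= emeasure ?N (A i)"
    using norm_dens_le[OF g, of "A i"] M(2) by (simp add: dens_def)
  qed
  also have "... = emeasure ?N E"
   using suminf_emeasure[of A ?N] A sN by simp
  finally show "(\<Sum>i. ennreal (norm (dens U M g (A i)))) <= emeasure ?N E" .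
 qed
 show "emeasure ?N E <= ?S"
 proof (rule ennreal_le_epsilon)
  fix e :: real assume e: "e > 0"
  \<comment> \<open>the oscillation \<open>d\<close> costs at most \<open>2 d\<close> times the mass of \<open>E\<close> in total\<close>
  define d where "d = e / (2 * (measure M E + 1))"
  have d: "d > 0" using e by (simp add: d_def add_nonneg_pos)
  have EM: "E \<in> sets M" using E M(2) by simp
  obtain A :: "nat => 'a set" and q where Aq: "range A \<subseteq> sets M \<and> disjoint_family A \<and> (\<Union>i. A i) = E \<and>
    (\<forall>i. \<forall>x\<in>A i. norm (g x - q i) <= d)"
   using partition_small_oscillation[OF borel_measurable_integrable[OF g] EM d] by blast
  then have A: "range A \<subseteq> sets M" "disjoint_family A" "(\<Union>i. A i) = E" by auto
  have q: "norm (g x - q i) <= d" if "x \<in> A i" for i x using Aq that by blast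
  have le: "emeasure ?N (A i) <= ennreal (norm (dens U M g (A i))) + ennreal (2 * d) * emeasure M (A i)" for i
  proof -
   have Ai: "A i \<in> sets M" using A(1) by auto
   have si: "set_integrable M (A i) g" by (rule set_integrable_of_integrable[OF g Ai])
   have sc: "set_integrable M (A i) (%x. c)" for c :: 'v
    using Ai emeasure_finite[of "A i"] by (simp add: set_integrable_def less_top[symmetric])
   have sc': "set_integrable M (A i) (%x. c)" for c :: real
    using Ai emeasure_finite[of "A i"] by (simp add: set_integrable_def less_top[symmetric])
   have ci: "(LINT x:A i|M. c) = measure M (A i) *\<^sub>R c" for c :: 'v
   proof -
    have "integrable M (indicator (A i) :: 'a => real)"
     using Ai emeasure_finite[of "A i"] by (intro integrable_real_indicator) (auto simp: less_top[symmetric])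
    then have "(LINT x|M. indicator (A i) x *\<^sub>R c) = (LINT x|M. indicator (A i) x) *\<^sub>R c"
     by (rule integral_scaleR_left)
    also have "(LINT x|M. (indicator (A i) x :: real)) = measure M (A i)"
     by (simp only: Bochner_Integration.integral_indicator sets.Int_space_eq2[OF Ai])
    finally show ?thesis by (simp only: set_lebesgue_integral_def)
   qed
   have ci': "(LINT x:A i|M. c) = measure M (A i) * c" for c :: real
    using Ai by (simp add: set_lebesgue_integral_def)
   have sn: "set_integrable M (A i) (%x. norm (g x))"
    by (rule set_integrable_of_integrable[OF integrable_norm[OF g] Ai])
   have "(LINT x:A i|M. norm (g x)) <= (LINT x:A i|M. norm (q i) + d)"
   proof (rule set_integral_mono[OF sn sc'])
    show "norm (g x) <= norm (q i) + d" if "x \<in> A i" for x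
     using q[OF that] norm_triangle_ineq2[of "g x" "q i"] by linarith
   qed
   then have 1: "(LINT x:A i|M. norm (g x)) <= measure M (A i) * (norm (q i) + d)" by (simp add: ci')
   have "norm ((LINT x:A i|M. g x) - measure M (A i) *\<^sub>R q i) = norm (LINT x:A i|M. g x - q i)"
    by (simp add: set_integral_diff(2)[OF si sc] ci)
   also have "... <= (LINT x:A i|M. norm (g x - q i))"
    by (rule set_integral_norm_bound[OF set_integral_diff(1)[OF si sc]])
   also have "... <= (LINT x:A i|M. d)"
    by (rule set_integral_mono[OF set_integrable_norm[OF set_integral_diff(1)[OF si sc]] sc' q])
   finally have "norm (measure M (A i) *\<^sub>R q i) <= norm (LINT x:A i|M. g x) + measure M (A i) * d"
    unfolding ci' using norm_triangle_ineq3[of "LINT x:A i|M. g x" "measure M (A i) *\<^sub>R q i"] by linarith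
   then have "(LINT x:A i|M. norm (g x)) <= norm (LINT x:A i|M. g x) + 2 * d * measure M (A i)"
    using 1 by (simp add: algebra_simps)
   then have "ennreal (LINT x:A i|M. norm (g x)) <= ennreal (norm (LINT x:A i|M. g x) + 2 * d * measure M (A i))"
    by (rule ennreal_leI)
   also have "... = ennreal (norm (LINT x:A i|M. g x)) + ennreal (2 * d) * emeasure M (A i)"
    using d by (simp add: emeasure_eq_measure ennreal_mult)
   finally show ?thesis
    using Ai M(2) by (simp add: emeasure_density_norm[OF g Ai] dens_def)
  qed
  have "2 * d * measure M E = e * (measure M E / (measure M E + 1))"
  proof -
   have "2 * (e / (2 * x)) * y = e * (y / x)" for x y :: real by simp
   then show ?thesis unfolding d_def .
  qed
  also have "... <= e * 1"
   using e by (intro mult_left_mono) (auto simp: divide_le_eq add_nonneg_pos)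
  finally have "ennreal (2 * d * measure M E) <= ennreal e" by (intro ennreal_leI) simp
  then have small: "ennreal (2 * d) * emeasure M E <= ennreal e"
   using d by (simp add: ennreal_mult emeasure_eq_measure)
  have "emeasure ?N E = (\<Sum>i. emeasure ?N (A i))"
   using suminf_emeasure[of A ?N] A by simp
  also have "... <= (\<Sum>i. ennreal (norm (dens U M g (A i))) + ennreal (2 * d) * emeasure M (A i))"
   by (intro suminf_le summableI le)
  also have "... = (\<Sum>i. ennreal (norm (dens U M g (A i)))) + (\<Sum>i. ennreal (2 * d) * emeasure M (A i))"
   by (rule suminf_add[symmetric]) simp_all
  also have "(\<Sum>i. ennreal (2 * d) * emeasure M (A i)) = ennreal (2 * d) * emeasure M E"
   unfolding ennreal_suminf_cmult suminf_emeasure[OF A(1,2)] A(3) ..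
  also have "(\<Sum>i. ennreal (norm (dens U M g (A i)))) + ennreal (2 * d) * emeasure M E <= ?S + ennreal e"
  proof (rule add_mono[OF _ small])
   show "(\<Sum>i. ennreal (norm (dens U M g (A i)))) <= ?S"
    using A M(2) by (intro SUP_upper) auto
  qed
  finally show "emeasure ?N E <= ?S + ennreal e" .
 qed
qed

lemma total_variation_dens:
 fixes g :: "'a::euclidean_space => 'v::euclidean_space"
 assumes M: "finite_measure M" "sets M = borel_subsets U" and U: "U \<in> sets borel" and g: "integrable M g"
 shows "total_variation U (dens U M g) = density M (%x. ennreal (norm (g x)))"
proof -
 let ?N = "density M (%x. ennreal (norm (g x)))"
 interpret sa: sigma_algebra U "borel_subsets U" by (rule sigma_algebra_borel_subsets[OF U])
 have "total_variation U (dens U M g) = measure_of U (borel_subsets U) (emeasure ?N)"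
  unfolding total_variation_def
 proof (rule measure_of_eq[OF sa.space_closed])
  fix E assume "E \<in> sigma_sets U (borel_subsets U)"
  then have "E \<in> borel_subsets U" unfolding sa.sigma_sets_eq .
  then show "(SUP A \<in> {A::nat => 'a set. range A \<subseteq> borel_subsets U \<and> disjoint_family A \<and> (\<Union>i. A i) = E}.
    (\<Sum>i. ennreal (norm (dens U M g (A i))))) = emeasure ?N E"
   by (rule total_variation_SUP[OF M g])
 qed
 also have "... = ?N"
  using measure_of_of_measure[of ?N] unfolding sets_density space_density M(2) space_borel_subsets[OF M(2) U] .
 finally show ?thesis .
qed

text \<open>The polar density is determined by its integrals; comparing \<open>\<sigma> |g| M\<close> with
  \<open>g M\<close> on all sets identifies it almost everywhere.\<close>

lemma polar_density_dens:
 fixes g :: "'a::euclidean_space => 'v::euclidean_space"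
 assumes M: "finite_measure M" "sets M = borel_subsets U" and U: "U \<in> sets borel" and g: "integrable M g"
 shows "polar_density U (dens U M g) \<in> borel_measurable M"
  and "AE x in M. g x = norm (g x) *\<^sub>R polar_density U (dens U M g) x"
proof -
 interpret finite_measure M by (rule M(1))
 let ?\<mu> = "dens U M g" and ?N = "density M (%x. ennreal (norm (g x)))"
 note TV = total_variation_dens[OF M U g]
 let ?P = "%\<sigma>. integrable (total_variation U ?\<mu>) \<sigma> \<and>
  (\<forall>A\<in>borel_subsets U. ?\<mu> A = (LINT x:A|total_variation U ?\<mu>. \<sigma> x))"
 have gm[measurable]: "g \<in> borel_measurable M" using g by auto
 have iff: "integrable ?N \<sigma> \<longleftrightarrow> integrable M (%x. norm (g x) *\<^sub>R \<sigma> x)"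
  and eq: "A \<in> sets M ==> (LINT x:A|?N. \<sigma> x) = (LINT x:A|M. norm (g x) *\<^sub>R \<sigma> x)"
  if "\<sigma> \<in> borel_measurable M" for \<sigma> :: "'a => 'v" and A
 proof -
  show "integrable ?N \<sigma> \<longleftrightarrow> integrable M (%x. norm (g x) *\<^sub>R \<sigma> x)"
   using that by (intro integrable_density) auto
  assume A: "A \<in> sets M"
  show "(LINT x:A|?N. \<sigma> x) = (LINT x:A|M. norm (g x) *\<^sub>R \<sigma> x)"
   unfolding set_lebesgue_integral_def
   by (subst integral_density) (use that A in \<open>auto simp: mult.commute\<close>)
 qed
 have sgn: "norm (g x) *\<^sub>R sgn (g x) = g x" for x by (cases "g x = 0") (simp_all add: sgn_div_norm)
 have sm: "(%x. sgn (g x)) \<in> borel_measurable M"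
  unfolding sgn_div_norm by measurable
 have "?P (%x. sgn (g x))"
  unfolding TV using iff[OF sm] eq[OF sm] g M(2) by (simp add: sgn dens_def)
 then have P: "?P (polar_density U ?\<mu>)" unfolding polar_density_def by (rule someI[of ?P])
 then have "polar_density U ?\<mu> \<in> borel_measurable ?N" unfolding TV by auto
 then show m: "polar_density U ?\<mu> \<in> borel_measurable M" by simp
 have i: "integrable M (%x. norm (g x) *\<^sub>R polar_density U ?\<mu> x)" using P iff[OF m] unfolding TV by simp
 show "AE x in M. g x = norm (g x) *\<^sub>R polar_density U ?\<mu> x"
 proof (rule density_unique_banach[OF g i])
  fix A assume A: "A \<in> sets M"
  then have "?\<mu> A = (LINT x:A|M. norm (g x) *\<^sub>R polar_density U ?\<mu> x)"
   using P eq[OF m A] M(2) unfolding TV by auto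
  then show "(LINT x:A|M. g x) = (LINT x:A|M. norm (g x) *\<^sub>R polar_density U ?\<mu> x)"
   using A M(2) by (simp add: dens_def)
 qed
qed

lemma vm_integral_dens:
 fixes g :: "'a::euclidean_space => 'v::euclidean_space"
 assumes M: "finite_measure M" "sets M = borel_subsets U" and U: "U \<in> sets borel" and g: "integrable M g"
  and \<psi>: "\<psi> \<in> borel_measurable M"
 shows "vm_integral U (dens U M g) \<psi> = (LINT x|M. \<psi> x *\<^sub>R g x)"
proof -
 note p = polar_density_dens[OF M U g]
 let ?\<sigma> = "polar_density U (dens U M g)"
 have [measurable]: "g \<in> borel_measurable M" using g by auto
 have "vm_integral U (dens U M g) \<psi> = (LINT x|M. norm (g x) *\<^sub>R (\<psi> x *\<^sub>R ?\<sigma> x))"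
  unfolding vm_integral_def total_variation_dens[OF M U g]
  using p(1) \<psi> by (intro integral_density) auto
 also have "... = (LINT x|M. \<psi> x *\<^sub>R g x)"
 proof (rule integral_cong_AE)
  show "AE x in M. norm (g x) *\<^sub>R (\<psi> x *\<^sub>R ?\<sigma> x) = \<psi> x *\<^sub>R g x"
   using p(2) by eventually_elim (metis scaleR_left_commute)
 qed (use p(1) \<psi> in measurable)
 finally show ?thesis .
qed

text \<open>By positive homogeneity \<open>h (g) = |g| h (\<sigma>)\<close>: the integral of a
  one-homogeneous function of the polar density can be computed from any density.\<close>

lemma nn_integral_polar_density:
 fixes g :: "'a::euclidean_space => 'v::euclidean_space"
 assumes M: "finite_measure M" "sets M = borel_subsets U" and U: "U \<in> sets borel" and g: "integrable M g"
  and h: "h \<in> borel_measurable borel" "!!c \<xi>. 0 <= c ==> h (c *\<^sub>R \<xi>) = ennreal c * h \<xi>"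
 shows "(\<integral>\<^sup>+x\<in>U. h (polar_density U (dens U M g) x) \<partial>total_variation U (dens U M g)) = (\<integral>\<^sup>+x. h (g x) \<partial>M)"
proof -
 note p = polar_density_dens[OF M U g]
 let ?\<sigma> = "polar_density U (dens U M g)"
 have [measurable]: "g \<in> borel_measurable M" using g by auto
 have sp: "space M = U" by (rule space_borel_subsets[OF M(2) U])
 have hm[measurable]: "(%x. h (?\<sigma> x)) \<in> borel_measurable M" using p(1) h(1) by measurable
 have "(\<integral>\<^sup>+x\<in>U. h (?\<sigma> x) \<partial>total_variation U (dens U M g)) = (\<integral>\<^sup>+x. h (?\<sigma> x) \<partial>density M (%x. ennreal (norm (g x))))"
  unfolding total_variation_dens[OF M U g] by (rule nn_integral_cong) (simp add: sp)
 also have "... = (\<integral>\<^sup>+x. ennreal (norm (g x)) * h (?\<sigma> x) \<partial>M)"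
  by (rule nn_integral_density) measurable
 also have "... = (\<integral>\<^sup>+x. h (g x) \<partial>M)"
 proof (rule nn_integral_cong_AE)
  show "AE x in M. ennreal (norm (g x)) * h (?\<sigma> x) = h (g x)"
   using p(2) by eventually_elim (metis h(2) norm_ge_zero)
 qed
 finally show ?thesis .
qed

section \<open>Lebesgue decomposition and functions of measures\<close>

lemma space_LB: "U \<in> sets borel ==> space (LB U) = U"
 by (simp add: LB_def space_restrict_space)

text \<open>Lebesgue measurable integrands are replaced by Borel ones, because vector measures live on the
  Borel sets.\<close>

lemma lebesgue_on_borel_version:
 fixes f :: "'a::euclidean_space => 'v::euclidean_space"
 assumes U: "U \<in> sets borel" and f: "set_integrable lebesgue U f"
 obtains f' where "f' \<in> borel_measurable borel" "integrable (LB U) f'"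
  "AE x in lebesgue. x \<in> U --> f x = f' x" "AE x in Leb U. f x = f' x"
  "!!A. A \<in> borel_subsets U ==> (LINT x:A|lebesgue. f x) = (LINT x:A|LB U. f' x)"
proof -
 let ?F = "%x. indicator U x *\<^sub>R f x"
 have F: "integrable lebesgue ?F" using f by (simp add: set_integrable_def)
 have "\<exists>g. \<forall>b. g b \<in> borel_measurable lborel \<and> (AE x in lborel. ?F x \<bullet> b = g b x)"
 proof (rule choice, rule allI)
  fix b
  have "(%x. ?F x \<bullet> b) \<in> borel_measurable lebesgue"
   by (intro borel_measurable_inner borel_measurable_integrable[OF F] borel_measurable_const)
  from completion_ex_borel_measurable_real[OF this]
  show "\<exists>g. g \<in> borel_measurable lborel \<and> (AE x in lborel. ?F x \<bullet> b = g x)" by blast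
 qed
 then obtain g where g: "!!b. g b \<in> borel_measurable lborel" "!!b. AE x in lborel. ?F x \<bullet> b = g b x" by blast
 define f' where "f' x = (\<Sum>b\<in>Basis. g b x *\<^sub>R b)" for x
 have f'm: "f' \<in> borel_measurable borel"
  unfolding f'_def using g(1) by (intro borel_measurable_sum borel_measurable_scaleR) auto
 have ae: "AE x in lborel. ?F x = f' x"
 proof -
  have "AE x in lborel. \<forall>b\<in>Basis. ?F x \<bullet> b = g b x" using g(2) by (intro AE_finite_allI) auto
  then show ?thesis
  proof eventually_elim
   case (elim x)
   have "f' x = (\<Sum>b\<in>Basis. (?F x \<bullet> b) *\<^sub>R b)" unfolding f'_def using elim by (intro sum.cong) auto
   then show ?case unfolding euclidean_representation by simp
  qed
 qed
 have ae': "AE x in lebesgue. ?F x = f' x" using ae by (simp add: AE_completion)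
 have i': "integrable lborel f'"
 proof -
  have "f' \<in> borel_measurable lebesgue" using f'm by (intro measurable_completion) simp
  then have "integrable lebesgue f'"
   using Bochner_Integration.integrable_cong_AE[OF borel_measurable_integrable[OF F] _ ae'] F by simp
  then show ?thesis using integrable_completion[of f' lborel] f'm by simp
 qed
 have Ul: "U \<in> sets lborel" using U by simp
 have iL: "integrable (LB U) f'"
  unfolding LB_def using U i' by (subst integrable_restrict_space) (auto intro: integrable_mult_indicator)
 have ae2: "AE x in lebesgue. x \<in> U --> f x = f' x" using ae' by eventually_elim (auto simp: indicator_def)
 have ae3: "AE x in Leb U. f x = f' x"
  using ae2 U by (subst AE_restrict_space_iff) auto
 have "(LINT x:A|lebesgue. f x) = (LINT x:A|LB U. f' x)" if A: "A \<in> borel_subsets U" for A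
 proof -
  have Ab: "A \<in> sets borel" "A \<subseteq> U" using A by (auto simp: borel_subsets_def)
  have fi: "(%x. indicator A x *\<^sub>R f x) = (%x. indicator A x *\<^sub>R ?F x)"
   using Ab(2) by (auto simp: fun_eq_iff indicator_def of_bool_def)
  have mA: "(%x. indicator A x *\<^sub>R f' x) \<in> borel_measurable lborel"
   using f'm Ab(1) by (intro borel_measurable_scaleR borel_measurable_indicator) auto
  have "(LINT x:A|lebesgue. f x) = (LINT x|lebesgue. indicator A x *\<^sub>R f' x)"
   unfolding set_lebesgue_integral_def
  proof (rule integral_cong_AE)
   have "integrable lebesgue (%x. indicator A x *\<^sub>R ?F x)"
    by (rule integrable_mult_indicator[OF _ F]) (use Ab(1) in simp)
   then show "(%x. indicator A x *\<^sub>R f x) \<in> borel_measurable lebesgue" unfolding fi by auto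
   show "(%x. indicator A x *\<^sub>R f' x) \<in> borel_measurable lebesgue"
    by (rule measurable_completion[OF mA])
   show "AE x in lebesgue. indicator A x *\<^sub>R f x = indicator A x *\<^sub>R f' x"
    using ae2 by eventually_elim (use Ab(2) in \<open>auto simp: indicator_def\<close>)
  qed
  also have "... = (LINT x|lborel. indicator A x *\<^sub>R f' x)"
   by (rule integral_completion[OF mA])
  also have "... = (LINT x|lborel. indicator U x *\<^sub>R (indicator A x *\<^sub>R f' x))"
   using Ab(2) by (intro bint_cong) (auto simp: indicator_def)
  also have "... = (LINT x:A|LB U. f' x)"
   unfolding LB_def set_lebesgue_integral_def using U by (subst integral_restrict_space) auto
  finally show ?thesis .
 qed
 note eqs = this
 show ?thesis by (rule that[OF f'm iL ae2 ae3 eqs])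
qed

lemma lebesgue_times_eq_dens:
 fixes f :: "'a::euclidean_space => 'v::euclidean_space"
 assumes U: "U \<in> sets borel" and f: "set_integrable lebesgue U f"
 obtains f' where "f' \<in> borel_measurable borel" "integrable (LB U) f'" "lebesgue_times U f = dens U (LB U) f'"
  "AE x in lebesgue. x \<in> U --> f x = f' x" "AE x in Leb U. f x = f' x"
proof -
 obtain f' where f': "f' \<in> borel_measurable borel" "integrable (LB U) f'"
  "AE x in lebesgue. x \<in> U --> f x = f' x" "AE x in Leb U. f x = f' x"
  "!!A. A \<in> borel_subsets U ==> (LINT x:A|lebesgue. f x) = (LINT x:A|LB U. f' x)"
  by (rule lebesgue_on_borel_version[OF U f]) blast
 have "lebesgue_times U f = dens U (LB U) f'"
  using f'(5) by (auto simp: lebesgue_times_def dens_def)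
 from that[OF f'(1,2) this f'(3,4)] show ?thesis .
qed

lemma dens_LB_eq_lebesgue_times:
 fixes f :: "'a::euclidean_space => 'v::euclidean_space"
 assumes U: "U \<in> sets borel" and f: "integrable (LB U) f"
 shows "set_integrable lebesgue U f" "dens U (LB U) f = lebesgue_times U f"
proof -
 have i: "integrable lborel (%x. indicator U x *\<^sub>R f x)"
  using f U unfolding LB_def by (subst (asm) integrable_restrict_space) auto
 then show "set_integrable lebesgue U f"
  unfolding set_integrable_def by (subst integrable_completion) auto
 show "dens U (LB U) f = lebesgue_times U f"
 proof
  fix A
  show "dens U (LB U) f A = lebesgue_times U f A"
  proof (cases "A \<in> borel_subsets U")
   case True
   then have Ab: "A \<in> sets borel" "A \<subseteq> U" by (auto simp: borel_subsets_def)
   have eq: "(%x. indicator A x *\<^sub>R f x) = (%x. indicator A x *\<^sub>R (indicator U x *\<^sub>R f x))"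
    using Ab(2) by (auto simp: fun_eq_iff indicator_def of_bool_def)
   have "(%x. indicator A x *\<^sub>R f x) \<in> borel_measurable lborel"
    unfolding eq using i Ab(1) by (intro borel_measurable_scaleR borel_measurable_integrable[OF i]) auto
   then have "(LINT x:A|lebesgue. f x) = (LINT x|lborel. indicator A x *\<^sub>R f x)"
    unfolding set_lebesgue_integral_def by (rule integral_completion)
   also have "... = (LINT x|lborel. indicator U x *\<^sub>R (indicator A x *\<^sub>R f x))"
    using Ab(2) by (intro bint_cong) (auto simp: indicator_def)
   also have "... = (LINT x:A|LB U. f x)"
    unfolding LB_def set_lebesgue_integral_def using U by (subst integral_restrict_space) auto
   finally show ?thesis using True by (simp add: dens_def lebesgue_times_def)
  qed (simp add: dens_def lebesgue_times_def)
 qed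
qed

lemma fvm_lebesgue_times:
 fixes f :: "'a::euclidean_space => 'v::euclidean_space"
 assumes "U \<in> sets borel" "set_integrable lebesgue U f"
 shows "finite_vector_measure U (lebesgue_times U f)"
proof (rule lebesgue_times_eq_dens[OF assms])
 fix f' :: "'a => 'v"
 assume i: "integrable (LB U) f'" and eq: "lebesgue_times U f = dens U (LB U) f'"
 show ?thesis unfolding eq by (rule fvm_dens[OF sets_LB[OF assms(1)] assms(1) i])
qed

lemma lebesgue_decomposition_exists:
 fixes \<mu> :: "'a::euclidean_space set => 'v::euclidean_space"
 assumes U: "U \<in> sets borel" "bounded U" and \<mu>: "finite_vector_measure U \<mu>"
 obtains f \<Lambda> N g where "set_integrable lebesgue U f" "finite_measure \<Lambda>" "sets \<Lambda> = borel_subsets U"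
  "N \<in> borel_subsets U" "emeasure lborel N = 0" "emeasure \<Lambda> (U - N) = 0" "integrable \<Lambda> g"
  "\<mu> = (%A. lebesgue_times U f A + dens U \<Lambda> g A)"
proof -
 obtain S and h :: "'a => 'v" and a :: "'a => real" where S: "finite_measure S" "sets S = borel_subsets U" "integrable S h" "\<mu> = dens U S h"
  and a: "integrable S a" "!!x. 0 <= a x" "LB U = density S (%x. ennreal (a x))"
  by (rule fvm_density[OF \<mu> U(1) finite_measure_LB[OF U] sets_LB[OF U(1)]]) blast
 interpret S: finite_measure S by (rule S(1))
 have sp: "space S = U" by (rule space_borel_subsets[OF S(2) U(1)])
 have [measurable]: "a \<in> borel_measurable S" "h \<in> borel_measurable S" using a S by auto
 \<comment> \<open>Lebesgue measure is \<open>a S\<close>, so the singular part lives where \<open>a\<close> vanishes\<close>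
 define N where "N = {x\<in>space S. a x = 0}"
 have NS: "N \<in> sets S" unfolding N_def by measurable
 define \<Lambda> where "\<Lambda> = density S (indicator N)"
 define f where "f x = (inverse (a x)) *\<^sub>R h x" for x
 have sl: "sets \<Lambda> = borel_subsets U" by (simp add: \<Lambda>_def S(2))
 have f\<Lambda>: "finite_measure \<Lambda>"
 proof (rule finite_measureI)
  have "emeasure \<Lambda> (space \<Lambda>) = emeasure S (N \<inter> space S)"
   unfolding \<Lambda>_def using NS by (subst emeasure_restricted) auto
  then show "emeasure \<Lambda> (space \<Lambda>) \<noteq> \<infinity>" by simp
 qed
 have fm[measurable]: "f \<in> borel_measurable S" unfolding f_def by measurable
 have af: "a x *\<^sub>R f x = (if a x = 0 then 0 else h x)" for x by (simp add: f_def)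
 have fi: "integrable (LB U) f"
  unfolding a(3)
 proof (subst integrable_density)
  show "integrable S (%x. a x *\<^sub>R f x)"
   by (rule bint_bound[OF S(3)]) (auto simp: af)
 qed (use a(2) in auto)
 have gi: "integrable \<Lambda> h"
 proof -
  have "integrable (density S (%x. ennreal (indicator N x))) h"
   using NS by (subst integrable_density) (auto intro!: integrable_mult_indicator S(3))
  then show ?thesis by (simp add: \<Lambda>_def ennreal_indicator)
 qed
 have nN: "emeasure lborel N = 0"
 proof -
  have "emeasure (LB U) N = (\<integral>\<^sup>+x. ennreal (a x) * indicator N x \<partial>S)"
   unfolding a(3) using NS by (intro emeasure_density) auto
  also have "... = (\<integral>\<^sup>+x. 0 \<partial>S)" by (intro nn_integral_cong) (auto simp: N_def indicator_def)
  finally show ?thesis using emeasure_LB[OF U(1), of N] NS S(2) by simp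
 qed
 have cN: "emeasure \<Lambda> (U - N) = 0"
 proof -
  have "emeasure \<Lambda> (U - N) = emeasure S (N \<inter> (U - N))"
   unfolding \<Lambda>_def using NS sp by (intro emeasure_restricted) (auto simp: sp[symmetric])
  also have "N \<inter> (U - N) = {}" by auto
  finally show ?thesis by simp
 qed
 have eq: "\<mu> = (%A. dens U (LB U) f A + dens U \<Lambda> h A)"
 proof
  fix A
  show "\<mu> A = dens U (LB U) f A + dens U \<Lambda> h A"
  proof (cases "A \<in> borel_subsets U")
   case True
   then have A: "A \<in> sets S" using S(2) by simp
   have "(LINT x:A|LB U. f x) = (LINT x|S. a x *\<^sub>R (indicator A x *\<^sub>R f x))"
    unfolding a(3) set_lebesgue_integral_def using a(2) A by (intro integral_density) auto
   also have "... = (LINT x|S. indicator (A - N) x *\<^sub>R h x)"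
   proof (rule bint_cong)
    fix x assume "x \<in> space S"
    then show "a x *\<^sub>R indicator A x *\<^sub>R f x = indicator (A - N) x *\<^sub>R h x"
     by (auto simp: f_def N_def indicator_def)
   qed simp
   finally have 1: "(LINT x:A|LB U. f x) = (LINT x|S. indicator (A - N) x *\<^sub>R h x)" .
   have "(LINT x:A|density S (%x. ennreal (indicator N x)). h x) = (LINT x|S. indicator N x *\<^sub>R (indicator A x *\<^sub>R h x))"
    unfolding set_lebesgue_integral_def using A NS by (intro integral_density) auto
   also have "... = (LINT x|S. indicator (A \<inter> N) x *\<^sub>R h x)"
    by (rule bint_cong) (auto simp: indicator_def)
   finally have 2: "(LINT x:A|\<Lambda>. h x) = (LINT x|S. indicator (A \<inter> N) x *\<^sub>R h x)"
    by (simp add: \<Lambda>_def ennreal_indicator)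
   have "(LINT x:A|S. h x) = (LINT x|S. indicator (A - N) x *\<^sub>R h x + indicator (A \<inter> N) x *\<^sub>R h x)"
    unfolding set_lebesgue_integral_def by (rule bint_cong) (auto simp: indicator_def)
   also have "... = (LINT x|S. indicator (A - N) x *\<^sub>R h x) + (LINT x|S. indicator (A \<inter> N) x *\<^sub>R h x)"
    using A NS by (intro Bochner_Integration.integral_add integrable_mult_indicator S(3)) auto
   finally show ?thesis using True 1 2 S(4) by (simp add: dens_def)
  qed (use S(4) in \<open>simp add: dens_def\<close>)
 qed
 show ?thesis
  by (rule that[OF dens_LB_eq_lebesgue_times(1)[OF U(1) fi] f\<Lambda> sl _ nN cN gi])
   (use NS S(2) eq dens_LB_eq_lebesgue_times(2)[OF U(1) fi] in auto)
qed

lemma fvm_null_outside: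
 fixes \<nu> :: "'a::euclidean_space set => 'b::euclidean_space"
 assumes U: "U \<in> sets borel" "bounded U" and \<nu>: "finite_vector_measure U \<nu>"
  and N: "N \<in> borel_subsets U" "emeasure (total_variation U \<nu>) (U - N) = 0"
  and A: "A \<in> borel_subsets U" "A \<inter> N = {}"
 shows "\<nu> A = 0"
proof -
 obtain M and g :: "'a => 'b" and a :: "'a => real"
  where M: "finite_measure M" "sets M = borel_subsets U" "integrable M g" "\<nu> = dens U M g"
   "integrable M a" "!!x. 0 <= a x" "LB U = density M (%x. ennreal (a x))"
  by (rule fvm_density[OF \<nu> U(1) finite_measure_LB[OF U] sets_LB[OF U(1)]]) blast
 note TV = total_variation_dens[OF M(1,2) U(1) M(3)]
 have "ennreal (norm (LINT x:A|M. g x)) <= emeasure (total_variation U \<nu>) A"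
  using norm_dens_le[OF M(3), of A] A(1) M(2) unfolding M(4) TV by simp
 also have "... <= emeasure (total_variation U \<nu>) (U - N)"
  using A N(1) M(2) U unfolding M(4) TV by (intro emeasure_mono) (auto simp: borel_subsets_def)
 finally show ?thesis using N(2) A(1) unfolding M(4) by (simp add: dens_def)
qed

text \<open>Both singular parts agree with \<open>\<mu>\<close> on the union of the two Lebesgue-null
  carriers and vanish off it.\<close>

lemma lebesgue_decomposition_unique:
 fixes \<mu> :: "'a::euclidean_space set => 'v::euclidean_space"
 assumes U: "U \<in> sets borel" "bounded U"
  and 1: "is_lebesgue_decomposition U \<mu> f1 \<nu>1" and 2: "is_lebesgue_decomposition U \<mu> f2 \<nu>2"
 shows "\<nu>1 = \<nu>2" and "AE x in lebesgue. x \<in> U --> f1 x = f2 x"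
proof -
 have f: "set_integrable lebesgue U f1" "set_integrable lebesgue U f2"
  and \<nu>: "finite_vector_measure U \<nu>1" "finite_vector_measure U \<nu>2"
  and eq: "!!A. \<mu> A = lebesgue_times U f1 A + \<nu>1 A" "!!A. \<mu> A = lebesgue_times U f2 A + \<nu>2 A"
  using 1 2 unfolding is_lebesgue_decomposition_def by auto
 obtain N1 where N1: "N1 \<in> borel_subsets U" "emeasure lebesgue N1 = 0" "emeasure (total_variation U \<nu>1) (U - N1) = 0"
  using 1 unfolding is_lebesgue_decomposition_def by auto
 obtain N2 where N2: "N2 \<in> borel_subsets U" "emeasure lebesgue N2 = 0" "emeasure (total_variation U \<nu>2) (U - N2) = 0"
  using 2 unfolding is_lebesgue_decomposition_def by auto
 interpret sa: sigma_algebra U "borel_subsets U" by (rule sigma_algebra_borel_subsets[OF U(1)])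
 let ?N = "N1 \<union> N2"
 have N: "?N \<in> borel_subsets U" using N1 N2 by auto
 have "emeasure lebesgue ?N <= emeasure lebesgue N1 + emeasure lebesgue N2"
  using N1(1) N2(1) by (intro emeasure_subadditive) (auto simp: borel_subsets_def)
 then have N0: "emeasure lebesgue ?N = 0" using N1 N2 by simp
 have lt0: "lebesgue_times U f (A \<inter> ?N) = 0" for f :: "'a => 'v" and A
 proof (cases "A \<inter> ?N \<in> borel_subsets U")
  case True
  have "(LINT x:A \<inter> ?N|lebesgue. f x) = 0"
   unfolding set_lebesgue_integral_def
  proof (rule integral_eq_zero_AE)
   have "AE x in lebesgue. x \<notin> ?N"
    using N N0 by (intro AE_not_in) (auto simp: null_sets_def borel_subsets_def)
   then show "AE x in lebesgue. indicator (A \<inter> ?N) x *\<^sub>R f x = 0"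
    by eventually_elim auto
  qed
  then show ?thesis using True by (simp add: lebesgue_times_def)
 qed (simp add: lebesgue_times_def)
 have split: "\<nu>' A = \<mu> (A \<inter> ?N)" if \<nu>': "finite_vector_measure U \<nu>'" "N' \<in> borel_subsets U" "N' \<subseteq> ?N"
  "emeasure (total_variation U \<nu>') (U - N') = 0" "!!A. \<mu> A = lebesgue_times U f A + \<nu>' A" "A \<in> borel_subsets U" for \<nu>' N' f A
 proof -
  have "\<nu>' (A \<inter> ?N \<union> (A - ?N)) = \<nu>' (A \<inter> ?N) + \<nu>' (A - ?N)"
   using N that(6) by (intro fvm_Un[OF \<nu>'(1)]) auto
  moreover have "A \<inter> ?N \<union> (A - ?N) = A" by auto
  moreover have "\<nu>' (A - ?N) = 0"
   using N that(6) \<nu>'(3) by (intro fvm_null_outside[OF U \<nu>'(1,2,4)]) auto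
  ultimately have "\<nu>' A = \<nu>' (A \<inter> ?N)" by simp
  then show ?thesis using \<nu>'(5)[of "A \<inter> ?N"] lt0[of f A] by simp
 qed
 show \<nu>eq: "\<nu>1 = \<nu>2"
 proof
  fix A
  show "\<nu>1 A = \<nu>2 A"
  proof (cases "A \<in> borel_subsets U")
   case True
   show ?thesis
    using split[OF \<nu>(1) N1(1) _ N1(3) eq(1) True] split[OF \<nu>(2) N2(1) _ N2(3) eq(2) True] by simp
  qed (use fvm_outside[OF \<nu>(1)] fvm_outside[OF \<nu>(2)] in simp)
 qed
 obtain f1' where f1': "f1' \<in> borel_measurable borel" "integrable (LB U) f1'"
  "lebesgue_times U f1 = dens U (LB U) f1'"
  "AE x in lebesgue. x \<in> U --> f1 x = f1' x" "AE x in Leb U. f1 x = f1' x"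
  by (rule lebesgue_times_eq_dens[OF U(1) f(1)]) blast
 obtain f2' where f2': "f2' \<in> borel_measurable borel" "integrable (LB U) f2'"
  "lebesgue_times U f2 = dens U (LB U) f2'"
  "AE x in lebesgue. x \<in> U --> f2 x = f2' x" "AE x in Leb U. f2 x = f2' x"
  by (rule lebesgue_times_eq_dens[OF U(1) f(2)]) blast
 interpret L: finite_measure "LB U" by (rule finite_measure_LB[OF U])
 have "AE x in LB U. f1' x = f2' x"
 proof (rule L.density_unique_banach[OF f1'(2) f2'(2)])
  fix A assume "A \<in> sets (LB U)"
  then have A: "A \<in> borel_subsets U" by (simp add: sets_LB[OF U(1)])
  have "lebesgue_times U f1 A = lebesgue_times U f2 A" using eq[of A] \<nu>eq by simp
  then show "(LINT x:A|LB U. f1' x) = (LINT x:A|LB U. f2' x)"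
   unfolding f1'(3) f2'(3) using A by (simp add: dens_def)
 qed
 then have "AE x in lborel. x \<in> U --> f1' x = f2' x"
  unfolding LB_def using U(1) by (subst (asm) AE_restrict_space_iff) auto
 then have "AE x in lebesgue. x \<in> U --> f1' x = f2' x" by (rule AE_completion)
 then show "AE x in lebesgue. x \<in> U --> f1 x = f2 x"
  using f1'(4) f2'(4) by eventually_elim auto
qed

text \<open>The definition of \<open>\<rho>(\<mu>)\<close> chooses a decomposition and a polar density; by
  uniqueness and homogeneity its value can be read off from any decomposition, with the singular
  part given by any density.\<close>

lemma function_of_measure_eq:
 fixes F :: "'a::euclidean_space => 'v::euclidean_space"
 assumes U: "U \<in> sets borel" "bounded U"
  and F: "set_integrable lebesgue U F"
  and \<Lambda>: "finite_measure \<Lambda>" "sets \<Lambda> = borel_subsets U"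
  and N: "N \<in> borel_subsets U" "emeasure lborel N = 0" "emeasure \<Lambda> (U - N) = 0"
  and g: "integrable \<Lambda> g"
  and r: "recession \<rho> \<in> borel_measurable borel" "!!c \<xi>. 0 <= c ==> recession \<rho> (c *\<^sub>R \<xi>) = ennreal c * recession \<rho> \<xi>"
 shows "function_of_measure U \<rho> (%A. lebesgue_times U F A + dens U \<Lambda> g A) U =
  (\<integral>\<^sup>+x\<in>U. ennreal (\<rho> (F x)) \<partial>lebesgue) + (\<integral>\<^sup>+x. recession \<rho> (g x) \<partial>\<Lambda>)"
proof -
 let ?\<mu> = "%A. lebesgue_times U F A + dens U \<Lambda> g A"
 have NB: "N \<in> sets borel" using N(1) by (simp add: borel_subsets_def)
 have dec: "is_lebesgue_decomposition U ?\<mu> F (dens U \<Lambda> g)"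
  unfolding is_lebesgue_decomposition_def
 proof (intro conjI bexI[of _ N] allI F fvm_dens[OF \<Lambda>(2) U(1) g] N(1) refl)
  show "emeasure lebesgue N = 0" using N(2) NB by simp
  have "AE x in \<Lambda>. x \<notin> U - N"
   using N(3) \<Lambda>(2) N(1) U(1) by (intro AE_not_in) (auto simp: null_sets_def borel_subsets_def)
  then have ae: "AE x in \<Lambda>. ennreal (norm (g x)) * indicator (U - N) x = 0" by eventually_elim auto
  have "emeasure (total_variation U (dens U \<Lambda> g)) (U - N) =
    (\<integral>\<^sup>+x. ennreal (norm (g x)) * indicator (U - N) x \<partial>\<Lambda>)"
   unfolding total_variation_dens[OF \<Lambda> U(1) g]
   by (rule emeasure_density) (use g N(1) U(1) \<Lambda>(2) in \<open>auto simp: borel_subsets_def\<close>)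
  also have "... = (\<integral>\<^sup>+x. 0 \<partial>\<Lambda>)" by (rule nn_integral_cong_AE[OF ae])
  finally show "emeasure (total_variation U (dens U \<Lambda> g)) (U - N) = 0" by simp
 qed
 have sing: "singular_part U ?\<mu> = dens U \<Lambda> g"
  unfolding singular_part_def
 proof (rule the_equality)
  show "\<exists>f. is_lebesgue_decomposition U ?\<mu> f (dens U \<Lambda> g)" using dec by blast
  show "\<nu> = dens U \<Lambda> g" if "\<exists>f. is_lebesgue_decomposition U ?\<mu> f \<nu>" for \<nu>
   using that dec lebesgue_decomposition_unique(1)[OF U] by blast
 qed
 have "\<exists>\<nu>. is_lebesgue_decomposition U ?\<mu> (ac_density U ?\<mu>) \<nu>"
  unfolding ac_density_def by (rule someI[of "%f. \<exists>\<nu>. is_lebesgue_decomposition U ?\<mu> f \<nu>" F]) (use dec in blast)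
 then have ae: "AE x in lebesgue. x \<in> U --> ac_density U ?\<mu> x = F x"
  using lebesgue_decomposition_unique(2)[OF U _ dec] by blast
 have "(\<integral>\<^sup>+x\<in>U. ennreal (\<rho> (ac_density U ?\<mu> x)) \<partial>lebesgue) = (\<integral>\<^sup>+x\<in>U. ennreal (\<rho> (F x)) \<partial>lebesgue)"
  by (rule nn_integral_cong_AE) (use ae in \<open>eventually_elim, auto simp: indicator_def\<close>)
 moreover note nn_integral_polar_density[OF \<Lambda> U(1) g r]
 ultimately show ?thesis unfolding function_of_measure_def sing by (rule arg_cong2[of _ _ _ _ "(+)"])
qed

section \<open>Measures represented by distributions\<close>

lemma sigma_sets_boxes:
 assumes U: "open (U :: 'a::euclidean_space set)"
 shows "sigma_sets U {box a b | a b. box a b \<subseteq> U} = borel_subsets U"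
proof -
 let ?E = "{box a b | a b. box a b \<subseteq> U}"
 have Ub: "U \<in> sets borel" using U by simp
 interpret sa: sigma_algebra U "borel_subsets U" by (rule sigma_algebra_borel_subsets[OF Ub])
 show ?thesis
 proof
  show "sigma_sets U ?E \<subseteq> borel_subsets U"
   by (rule sa.sigma_sets_subset) (auto simp: borel_subsets_def)
  have op: "V \<in> sigma_sets U ?E" if V: "open V" "V \<subseteq> U" for V
  proof -
   obtain \<D> :: "'a set set" where D: "countable \<D>" "\<D> \<subseteq> Pow V" "!!X. X \<in> \<D> ==> \<exists>a b. X = box a b" "\<Union>\<D> = V"
    by (rule open_countable_Union_open_box[OF V(1)]) blast
   have "\<Union>\<D> \<in> sigma_sets U ?E"
   proof (rule sigma_sets_UNION[OF D(1)])
    fix X assume X: "X \<in> \<D>"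
    obtain a b where "X = box a b" using D(3)[OF X] by blast
    moreover have "X \<subseteq> U" using D(2) X V(2) by blast
    ultimately show "X \<in> sigma_sets U ?E" by (intro sigma_sets.Basic) blast
   qed
   then show ?thesis by (simp add: D(4))
  qed
  have "borel_subsets U = (\<inter>) U ` sigma_sets UNIV {S. open S}"
   unfolding borel_subsets_restrict[OF Ub] sets_restrict_space sets_borel ..
  also have "... = sigma_sets U ((\<inter>) U ` {S. open S})"
  proof (rule sigma_sets_Int[OF _ subset_UNIV])
   show "U \<in> sigma_sets UNIV {S. open S}" using U by (intro sigma_sets.Basic) simp
  qed
  also have "... \<subseteq> sigma_sets U ?E"
  proof (rule sigma_sets_mono)
   show "(\<inter>) U ` {S. open S} \<subseteq> sigma_sets U ?E"
   proof
    fix X assume "X \<in> (\<inter>) U ` {S. open S}"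
    then have "open X" "X \<subseteq> U" using U by auto
    then show "X \<in> sigma_sets U ?E" by (rule op)
   qed
  qed
  finally show "borel_subsets U \<subseteq> sigma_sets U ?E" .
 qed
qed

lemma test_borel_measurable: "\<psi> \<in> test_functions U ==> \<psi> \<in> borel_measurable borel"
 by (intro borel_measurable_continuous_onI smooth_continuous test_functionsD)

lemma bounded_test:
 assumes "\<psi> \<in> test_functions U" shows "\<exists>B. \<forall>x. norm (\<psi> x) <= B"
proof -
 have "bounded (\<psi> ` supp \<psi>)"
  using test_functionsD[OF assms] by (intro compact_imp_bounded compact_continuous_image smooth_continuous)
 then obtain B where B: "!!x. x \<in> supp \<psi> ==> norm (\<psi> x) <= B" unfolding bounded_iff by blast
 have "norm (\<psi> x) <= max B 0" for x using B[of x] not_supp[of x \<psi>] by (cases "x \<in> supp \<psi>") auto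
 then show ?thesis by blast
qed

text \<open>Bump functions converge to indicators of boxes, so \<open>h M\<close> vanishes on all boxes
  inside \<open>U\<close>. These are stable under intersection and generate the Borel sets of
  \<open>U\<close>, hence the measures with densities \<open>h\<^sup>+\<close> and
  \<open>h\<^sup>-\<close> coincide.\<close>

lemma fundamental_lemma:
 fixes h :: "'a::euclidean_space => real"
 assumes U: "open U" and M: "finite_measure M" "sets M = borel_subsets U" and h: "integrable M h"
  and test: "!!\<psi>. \<psi> \<in> test_functions U ==> (LINT x|M. \<psi> x * h x) = 0"
 shows "AE x in M. h x = 0"
proof -
 interpret finite_measure M by (rule M(1))
 have Ub: "U \<in> sets borel" using U by simp
 have sp: "space M = U" by (rule space_borel_subsets[OF M(2) Ub])
 let ?E = "{box a b | a b. box a b \<subseteq> U}"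
 let ?p = "%x. max 0 (h x)" and ?n = "%x. max 0 (- h x)"
 let ?P = "density M (%x. ennreal (?p x))" and ?N = "density M (%x. ennreal (?n x))"
 have [measurable]: "h \<in> borel_measurable M" using h by auto
 have pi: "integrable M ?p" "integrable M ?n" using h by (auto intro: integrable_max)
 have em: "emeasure (density M (%x. ennreal (f x))) A = ennreal (LINT x:A|M. f x)"
  if "integrable M f" "!!x. 0 <= f x" "A \<in> sets M" for f :: "'a => real" and A
  using emeasure_density_norm[of M f A] that by simp
 have box0: "(LINT x:box a b|M. h x) = 0" if ab: "box a b \<subseteq> U" for a b
 proof -
  have B: "box a b \<in> sets M" using ab M(2) by (simp add: borel_subsets_def)
  have lim: "(%n. LINT x|M. bump n a b x * h x) \<longlonglongrightarrow> (LINT x|M. indicator (box a b) x * h x)"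
  proof (rule integral_dominated_convergence[where w="%x. norm (h x)"])
   show "(%x. bump n a b x * h x) \<in> borel_measurable M" for n
    using measurable_borel_subsets[OF M(2) Ub test_borel_measurable[OF bump_test[OF ab]], of n] by measurable
   show "AE x in M. (%n. bump n a b x * h x) \<longlonglongrightarrow> indicator (box a b) x * h x"
    by (intro AE_I2 tendsto_mult bump_tendsto tendsto_const)
   show "AE x in M. norm (bump n a b x * h x) <= norm (h x)" for n
   proof (rule AE_I2)
    fix x show "norm (bump n a b x * h x) <= norm (h x)"
     using bump_01[of n a b x] by (simp add: abs_mult mult_left_le_one_le)
   qed
  qed (use h B in \<open>auto intro: integrable_norm\<close>)
  have "(LINT x|M. bump n a b x * h x) = 0" for n by (rule test[OF bump_test[OF ab]])
  then have "(LINT x|M. indicator (box a b) x * h x) = 0"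
   using LIMSEQ_unique[OF lim] by simp
  then show ?thesis by (simp add: set_lebesgue_integral_def)
 qed
 have eqE: "emeasure ?P X = emeasure ?N X" if X: "X \<in> ?E" for X
 proof -
  obtain a b where ab: "X = box a b" "box a b \<subseteq> U" using X by blast
  have XM: "X \<in> sets M" using ab M(2) by (simp add: borel_subsets_def)
  have "(LINT x:X|M. ?p x) - (LINT x:X|M. ?n x) = (LINT x:X|M. ?p x - ?n x)"
   by (rule set_integral_diff(2)[symmetric]) (use pi XM in \<open>auto intro: set_integrable_of_integrable\<close>)
  also have "... = (LINT x:X|M. h x)"
   unfolding set_lebesgue_integral_def by (rule bint_cong) auto
  finally have "(LINT x:X|M. ?p x) = (LINT x:X|M. ?n x)" using box0[OF ab(2)] ab(1) by simp
  then show ?thesis using em[OF pi(1) _ XM] em[OF pi(2) _ XM] by simp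
 qed
 obtain \<D> :: "'a set set" where D: "countable \<D>" "\<D> \<subseteq> Pow U" "!!X. X \<in> \<D> ==> \<exists>a b. X = box a b" "\<Union>\<D> = U"
  by (rule open_countable_Union_open_box[OF U]) blast
 define A where "A = from_nat_into (insert {} \<D>)"
 have rA: "range A = insert {} \<D>" unfolding A_def using D(1) by (intro range_from_nat_into) auto
 have "?P = ?N"
 proof (rule measure_eqI_generator_eq[where E="?E" and \<Omega>=U and A=A])
  show "Int_stable ?E"
  proof (rule Int_stableI)
   fix X Y assume "X \<in> ?E" "Y \<in> ?E"
   then obtain a b c d where XY: "X = box a b" "Y = box c d" "X \<subseteq> U" by blast
   then have "X \<inter> Y = box (\<Sum>i\<in>Basis. max (a \<bullet> i) (c \<bullet> i) *\<^sub>R i) (\<Sum>i\<in>Basis. min (b \<bullet> i) (d \<bullet> i) *\<^sub>R i)"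
    by (simp add: box_Int_box)
   moreover have "X \<inter> Y \<subseteq> U" using XY by blast
   ultimately show "X \<inter> Y \<in> ?E" by blast
  qed
  show "?E \<subseteq> Pow U" by blast
  show "sets ?P = sigma_sets U ?E" "sets ?N = sigma_sets U ?E"
   unfolding sigma_sets_boxes[OF U] using M(2) by simp_all
  show "range A \<subseteq> ?E"
  proof
   fix X assume "X \<in> range A"
   then have "X = {} \<or> X \<in> \<D>" using rA by blast
   then show "X \<in> ?E"
   proof
    assume "X = {}"
    then have "X = box 0 (0::'a) \<and> box 0 (0::'a) \<subseteq> U" by simp
    then show ?thesis by blast
   next
    assume "X \<in> \<D>"
    then show ?thesis using D(2,3) by blast
   qed
  qed
  show "(\<Union>i. A i) = U" using rA D(4) by simp
  show "emeasure ?P (A i) \<noteq> \<infinity>" for i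
  proof (cases "A i \<in> sets M")
   case True
   then show ?thesis using em[OF pi(1) _ True] by simp
  next
   case False
   then show ?thesis by (simp add: emeasure_notin_sets)
  qed
 qed (rule eqE)
 then have "AE x in M. ennreal (?p x) = ennreal (?n x)"
  by (subst (asm) density_unique_iff) auto
 then show ?thesis
  by eventually_elim (auto simp: max_def split: if_splits)
qed

lemma integrable_test_scaleR:
 fixes h :: "'a::euclidean_space => 'v::euclidean_space"
 assumes "integrable M h" "\<psi> \<in> borel_measurable M" "!!x. norm (\<psi> x) <= (B::real)"
 shows "integrable M (%x. \<psi> x *\<^sub>R h x)"
proof (rule bint_bound[of _ "%x. B *\<^sub>R norm (h x)"])
 show "integrable M (%x. B *\<^sub>R norm (h x))" using assms by (intro integrable_scaleR_right integrable_norm)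
 show "(%x. \<psi> x *\<^sub>R h x) \<in> borel_measurable M" using assms by (intro borel_measurable_scaleR) auto
 show "AE x in M. norm (\<psi> x *\<^sub>R h x) <= norm (B *\<^sub>R norm (h x))"
 proof (rule AE_I2)
  fix x
  have "norm (\<psi> x) * norm (h x) <= B * norm (h x)" using assms(3) by (intro mult_right_mono) auto
  also have "... <= norm (B *\<^sub>R norm (h x))" by simp
  finally show "norm (\<psi> x *\<^sub>R h x) <= norm (B *\<^sub>R norm (h x))" by simp
 qed
qed

lemma fundamental_lemma_vector:
 fixes h :: "'a::euclidean_space => 'v::euclidean_space"
 assumes U: "open U" and M: "finite_measure M" "sets M = borel_subsets U" and h: "integrable M h"
  and test: "!!\<psi>. \<psi> \<in> test_functions U ==> (LINT x|M. \<psi> x *\<^sub>R h x) = 0"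
 shows "AE x in M. h x = 0"
proof -
 have Ub: "U \<in> sets borel" using U by simp
 have "AE x in M. h x \<bullet> b = 0" for b
 proof (rule fundamental_lemma[OF U M integrable_inner_left[OF h]])
  fix \<psi> :: "'a => real" assume \<psi>: "\<psi> \<in> test_functions U"
  obtain B where B: "!!x. norm (\<psi> x) <= B" using bounded_test[OF \<psi>] by blast
  have m: "\<psi> \<in> borel_measurable M" by (rule measurable_borel_subsets[OF M(2) Ub test_borel_measurable[OF \<psi>]])
  have i: "integrable M (%x. \<psi> x *\<^sub>R h x)" by (rule integrable_test_scaleR[OF h m B])
  have "(LINT x|M. \<psi> x * (h x \<bullet> b)) = (LINT x|M. (\<psi> x *\<^sub>R h x) \<bullet> b)" by simp
  also have "... = (LINT x|M. \<psi> x *\<^sub>R h x) \<bullet> b" using i by (rule integral_inner_left)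
  finally show "(LINT x|M. \<psi> x * (h x \<bullet> b)) = 0" using test[OF \<psi>] by simp
 qed
 then have "AE x in M. \<forall>b\<in>Basis. h x \<bullet> b = 0" by (intro AE_finite_allI) auto
 then show ?thesis by eventually_elim (auto intro: euclidean_eqI)
qed

lemma dens_bounded_linear:
 assumes L: "bounded_linear L" and g: "integrable M g" and M: "sets M = borel_subsets U"
 shows "(%A. L (dens U M g A)) = dens U M (%x. L (g x))"
proof
 fix A
 have "L 0 = 0" using L by (simp add: linear_0 bounded_linear.linear)
 moreover have "L (LINT x:A|M. g x) = (LINT x:A|M. L (g x))" if "A \<in> borel_subsets U"
 proof -
  have "integrable M (%x. indicator A x *\<^sub>R g x)"
   using that M by (intro integrable_mult_indicator g) simp
  from integral_bounded_linear[OF L this] show ?thesis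
   using L by (simp add: set_lebesgue_integral_def linear_cmul bounded_linear.linear)
 qed
 ultimately show "L (dens U M g A) = dens U M (%x. L (g x)) A" by (simp add: dens_def)
qed

lemma fvm_common_density:
 fixes \<mu> :: "'a::euclidean_space set => 'v::euclidean_space" and \<nu> :: "'a set => 'w::euclidean_space"
 assumes U: "U \<in> sets borel" "bounded U" and \<mu>: "finite_vector_measure U \<mu>" and \<nu>: "finite_vector_measure U \<nu>"
 shows "\<exists>M g h. finite_measure M \<and> sets M = borel_subsets U \<and> integrable M g \<and> integrable M h \<and>
  \<mu> = dens U M g \<and> \<nu> = dens U M h"
proof (rule fvm_density[OF fvm_Pair[OF \<mu> \<nu>] U(1) finite_measure_LB[OF U] sets_LB[OF U(1)]])
 fix M and g :: "'a => 'v \<times> 'w"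
 assume M: "finite_measure M" "sets M = borel_subsets U" and g: "integrable M g"
  and eq: "(%A. (\<mu> A, \<nu> A)) = dens U M g"
 have "\<mu> = (%A. fst (dens U M g A))" "\<nu> = (%A. snd (dens U M g A))" unfolding eq[symmetric] by simp_all
 then have "\<mu> = dens U M (%x. fst (g x))" "\<nu> = dens U M (%x. snd (g x))"
  using dens_bounded_linear[OF bounded_linear_fst g M(2)] dens_bounded_linear[OF bounded_linear_snd g M(2)] by simp_all
 moreover have "integrable M (%x. fst (g x))" "integrable M (%x. snd (g x))"
  using integrable_bounded_linear[OF bounded_linear_fst g] integrable_bounded_linear[OF bounded_linear_snd g] by simp_all
 ultimately show ?thesis using M by blast
qed

lemma dens_add:
 assumes "integrable M g" "integrable M h" "sets M = borel_subsets U"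
 shows "(%A. dens U M g A + dens U M h A) = dens U M (%x. g x + h x)"
proof
 fix A show "dens U M g A + dens U M h A = dens U M (%x. g x + h x) A"
  using set_integral_add(2)[of M A g h] set_integrable_of_integrable[OF assms(1), of A]
   set_integrable_of_integrable[OF assms(2), of A] assms(3) by (simp add: dens_def)
qed

lemma vm_integral_add:
 fixes \<mu> \<nu> :: "'a::euclidean_space set => 'v::euclidean_space"
 assumes U: "U \<in> sets borel" "bounded U" and \<mu>: "finite_vector_measure U \<mu>" "finite_vector_measure U \<nu>"
  and \<psi>: "\<psi> \<in> borel_measurable borel" "!!x. norm (\<psi> x) <= B"
 shows "vm_integral U (%A. \<mu> A + \<nu> A) \<psi> = vm_integral U \<mu> \<psi> + vm_integral U \<nu> \<psi>"
proof -
 obtain M and g h :: "'a => 'v" where M: "finite_measure M" "sets M = borel_subsets U" and g: "integrable M g" "integrable M h"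
  and eq: "\<mu> = dens U M g" "\<nu> = dens U M h" using fvm_common_density[OF U \<mu>] by blast
 have m: "\<psi> \<in> borel_measurable M" by (rule measurable_borel_subsets[OF M(2) U(1) \<psi>(1)])
 have i: "integrable M (%x. g x + h x)" using g by simp
 show ?thesis
  unfolding eq dens_add[OF g M(2)] vm_integral_dens[OF M U(1) i m] vm_integral_dens[OF M U(1) g(1) m]
   vm_integral_dens[OF M U(1) g(2) m] scaleR_add_right
  by (intro Bochner_Integration.integral_add integrable_test_scaleR[OF g(1) m \<psi>(2)] integrable_test_scaleR[OF g(2) m \<psi>(2)])
qed

text \<open>Two representing measures are densities with respect to a common measure, and the fundamental
  lemma applies to the difference of the densities.\<close>

lemma represents_unique:
 fixes \<mu> :: "(real^'m) set => 'v::euclidean_space"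
 assumes U: "open U" "bounded U" and \<mu>: "represents U T \<mu>" and \<nu>: "represents U T \<nu>"
 shows "\<mu> = \<nu>"
proof -
 have Ub: "U \<in> sets borel" using U by simp
 obtain M and g h :: "real^'m => 'v" where M: "finite_measure M" "sets M = borel_subsets U" and g: "integrable M g" "integrable M h"
  and eq: "\<mu> = dens U M g" "\<nu> = dens U M h"
  using fvm_common_density[OF Ub U(2)] \<mu> \<nu> unfolding represents_def by blast
 have "AE x in M. g x - h x = 0"
 proof (rule fundamental_lemma_vector[OF U(1) M])
  show "integrable M (%x. g x - h x)" using g by simp
  fix \<psi> :: "real^'m => real" assume \<psi>: "\<psi> \<in> test_functions U"
  obtain B where B: "!!x. norm (\<psi> x) <= B" using bounded_test[OF \<psi>] by blast
  have m: "\<psi> \<in> borel_measurable M" by (rule measurable_borel_subsets[OF M(2) Ub test_borel_measurable[OF \<psi>]])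
  have "vm_integral U \<mu> \<psi> = vm_integral U \<nu> \<psi>" using \<mu> \<nu> \<psi> by (simp add: represents_def)
  then have "(LINT x|M. \<psi> x *\<^sub>R g x) = (LINT x|M. \<psi> x *\<^sub>R h x)"
   unfolding eq vm_integral_dens[OF M Ub g(1) m] vm_integral_dens[OF M Ub g(2) m] .
  then show "(LINT x|M. \<psi> x *\<^sub>R (g x - h x)) = 0"
   unfolding scaleR_diff_right
   by (subst bint_of_diff[OF integrable_test_scaleR[OF g(1) m B] integrable_test_scaleR[OF g(2) m B]]) simp
 qed
 then have ae: "AE x in M. g x = h x" by eventually_elim simp
 have "(LINT x:A|M. g x) = (LINT x:A|M. h x)" if "A \<in> borel_subsets U" for A
  unfolding set_lebesgue_integral_def
 proof (rule integral_cong_AE)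
  have A: "A \<in> sets M" using that M(2) by simp
  show "(%x. indicator A x *\<^sub>R g x) \<in> borel_measurable M" "(%x. indicator A x *\<^sub>R h x) \<in> borel_measurable M"
   using integrable_mult_indicator[OF A g(1)] integrable_mult_indicator[OF A g(2)] by auto
  show "AE x in M. indicator A x *\<^sub>R g x = indicator A x *\<^sub>R h x" using ae by eventually_elim simp
 qed
 then show ?thesis unfolding eq dens_def by (auto simp: fun_eq_iff)
qed

lemma representing_measure_eq:
 fixes \<mu> :: "(real^'m) set => 'v::euclidean_space"
 assumes "open U" "bounded U" "represents U T \<mu>"
 shows "representing_measure U T = \<mu>"
 unfolding representing_measure_def using assms represents_unique[OF assms(1,2)] by (intro the_equality) blast+

lemma set_integrable_lebesgue_on:
 fixes f :: "'a::euclidean_space => 'v::euclidean_space"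
 assumes "U \<in> sets borel"
 shows "set_integrable lebesgue U f \<longleftrightarrow> integrable (Leb U) f"
  and "(LINT x:U|lebesgue. f x) = (LINT x|Leb U. f x)"
 using assms by (simp_all add: set_integrable_def set_lebesgue_integral_def integrable_restrict_space integral_restrict_space)

lemma vm_integral_lebesgue_times:
 fixes f :: "'a::euclidean_space => 'v::euclidean_space"
 assumes U: "U \<in> sets borel" "bounded U" and f: "set_integrable lebesgue U f"
  and \<psi>: "\<psi> \<in> borel_measurable borel"
 shows "vm_integral U (lebesgue_times U f) \<psi> = (LINT x|Leb U. \<psi> x *\<^sub>R f x)"
proof (rule lebesgue_times_eq_dens[OF U(1) f])
 fix f' :: "'a => 'v"
 assume f': "f' \<in> borel_measurable borel" "integrable (LB U) f'" "lebesgue_times U f = dens U (LB U) f'"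
  and ae: "AE x in Leb U. f x = f' x"
 have sets: "U \<in> sets lborel" "U \<in> sets lebesgue" using U by auto
 have "vm_integral U (lebesgue_times U f) \<psi> = (LINT x|LB U. \<psi> x *\<^sub>R f' x)"
  unfolding f'(3) by (rule vm_integral_dens[OF finite_measure_LB[OF U] sets_LB[OF U(1)] U(1) f'(2)])
   (rule measurable_borel_subsets[OF sets_LB[OF U(1)] U(1) \<psi>])
 also have "... = (LINT x|lborel. indicator U x *\<^sub>R (\<psi> x *\<^sub>R f' x))"
  unfolding LB_def using sets by (intro integral_restrict_space) auto
 also have "... = (LINT x|lebesgue. indicator U x *\<^sub>R (\<psi> x *\<^sub>R f' x))"
  by (rule integral_completion[symmetric])
   (use sets f'(1) \<psi> in \<open>auto intro!: borel_measurable_scaleR borel_measurable_indicator\<close>)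
 also have "... = (LINT x|Leb U. \<psi> x *\<^sub>R f' x)"
  using sets by (intro integral_restrict_space[symmetric]) auto
 also have "... = (LINT x|Leb U. \<psi> x *\<^sub>R f x)"
 proof (rule integral_cong_AE)
  have m: "\<psi> \<in> borel_measurable (Leb U)" "f' \<in> borel_measurable (Leb U)"
   using \<psi> f'(1) by (auto intro!: measurable_restrict_space1 measurable_completion)
  then show "(%x. \<psi> x *\<^sub>R f' x) \<in> borel_measurable (Leb U)" by measurable
  have "f \<in> borel_measurable (Leb U)"
   using f set_integrable_lebesgue_on(1)[OF U(1), of f] by auto
  then show "(%x. \<psi> x *\<^sub>R f x) \<in> borel_measurable (Leb U)" using m by measurable
  show "AE x in Leb U. \<psi> x *\<^sub>R f' x = \<psi> x *\<^sub>R f x"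
   using ae by eventually_elim simp
 qed
 finally show ?thesis .
qed

text \<open>The data of a Lebesgue decomposition \<open>\<mu> = F \<L>\<^sup>m + g \<Lambda>\<close>.\<close>

definition decomp :: "(real^'m) set => (real^'m => 'v::euclidean_space) => (real^'m) measure => (real^'m) set => (real^'m => 'v) => bool" where
 "decomp U F \<Lambda> N g \<longleftrightarrow> integrable (Leb U) F \<and> finite_measure \<Lambda> \<and> sets \<Lambda> = borel_subsets U \<and>
  N \<in> borel_subsets U \<and> emeasure lborel N = 0 \<and> emeasure \<Lambda> (U - N) = 0 \<and> integrable \<Lambda> g"

definition dmeas :: "(real^'m) set => (real^'m => 'v::euclidean_space) => (real^'m) measure => (real^'m => 'v) => (real^'m) set => 'v" where
 "dmeas U F \<Lambda> g = (%A. lebesgue_times U F A + dens U \<Lambda> g A)"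

text \<open>Representation in the form in which it is verified and used: as an identity of integrals against
  test functions.\<close>

lemma represents_dmeas:
 assumes U: "open U" "bounded U" and d: "decomp U F \<Lambda> N g"
 shows "represents U T (dmeas U F \<Lambda> g) \<longleftrightarrow>
  (\<forall>\<psi>\<in>test_functions U. T \<psi> = (LINT x|Leb U. \<psi> x *\<^sub>R F x) + (LINT x|\<Lambda>. \<psi> x *\<^sub>R g x))"
proof -
 have Ub: "U \<in> sets borel" using U by simp
 have F: "set_integrable lebesgue U F" using d set_integrable_lebesgue_on(1)[OF Ub] by (auto simp: decomp_def)
 have \<Lambda>: "finite_measure \<Lambda>" "sets \<Lambda> = borel_subsets U" and g: "integrable \<Lambda> g" using d by (auto simp: decomp_def)
 note f1 = fvm_lebesgue_times[OF Ub F] and f2 = fvm_dens[OF \<Lambda>(2) Ub g]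
 have "vm_integral U (dmeas U F \<Lambda> g) \<psi> = (LINT x|Leb U. \<psi> x *\<^sub>R F x) + (LINT x|\<Lambda>. \<psi> x *\<^sub>R g x)"
  if \<psi>: "\<psi> \<in> test_functions U" for \<psi>
 proof -
  obtain B where B: "!!x. norm (\<psi> x) <= B" using bounded_test[OF \<psi>] by blast
  note m = test_borel_measurable[OF \<psi>]
  show ?thesis
   unfolding dmeas_def vm_integral_add[OF Ub U(2) f1 f2 m B] vm_integral_lebesgue_times[OF Ub U(2) F m]
    vm_integral_dens[OF \<Lambda> Ub g measurable_borel_subsets[OF \<Lambda>(2) Ub m]] ..
 qed
 moreover have "finite_vector_measure U (dmeas U F \<Lambda> g)" unfolding dmeas_def by (rule fvm_add[OF f1 f2])
 ultimately show ?thesis unfolding represents_def by auto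
qed

lemma fvm_decomp:
 fixes \<mu> :: "(real^'m) set => 'v::euclidean_space"
 assumes U: "open U" "bounded U" and \<mu>: "finite_vector_measure U \<mu>"
 shows "\<exists>F \<Lambda> N g. decomp U F \<Lambda> N g \<and> \<mu> = dmeas U F \<Lambda> g"
proof -
 have Ub: "U \<in> sets borel" using U by simp
 show ?thesis
 proof (rule lebesgue_decomposition_exists[OF Ub U(2) \<mu>])
  fix f \<Lambda> N and g :: "real^'m => 'v"
  assume "set_integrable lebesgue U f" "finite_measure \<Lambda>" "sets \<Lambda> = borel_subsets U"
   "N \<in> borel_subsets U" "emeasure lborel N = 0" "emeasure \<Lambda> (U - N) = 0" "integrable \<Lambda> g"
   "\<mu> = (%A. lebesgue_times U f A + dens U \<Lambda> g A)"
  then have "decomp U f \<Lambda> N g \<and> \<mu> = dmeas U f \<Lambda> g"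
   using set_integrable_lebesgue_on(1)[OF Ub, of f] by (simp add: decomp_def dmeas_def)
  then show ?thesis by blast
 qed
qed

lemma function_of_measure_dmeas:
 assumes U: "open U" "bounded U" and d: "decomp U F \<Lambda> N g"
  and r: "recession \<rho> \<in> borel_measurable borel" "!!c \<xi>. 0 <= c ==> recession \<rho> (c *\<^sub>R \<xi>) = ennreal c * recession \<rho> \<xi>"
 shows "function_of_measure U \<rho> (dmeas U F \<Lambda> g) U =
  (\<integral>\<^sup>+x. ennreal (\<rho> (F x)) \<partial>Leb U) + (\<integral>\<^sup>+x. recession \<rho> (g x) \<partial>\<Lambda>)"
proof -
 have Ub: "U \<in> sets borel" "U \<inter> space lebesgue \<in> sets lebesgue" using U by auto
 have F: "set_integrable lebesgue U F" using d set_integrable_lebesgue_on(1)[OF Ub(1)] by (auto simp: decomp_def)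
 show ?thesis
  unfolding dmeas_def nn_integral_restrict_space[OF Ub(2)]
  using d by (intro function_of_measure_eq[OF Ub(1) U(2) F _ _ _ _ _ _ r]) (auto simp: decomp_def)
qed

section \<open>Diffeomorphisms of the domain\<close>

lemma smooth_linear_functional:
 fixes L :: "'a::euclidean_space => real"
 assumes "bounded_linear L" shows "smooth L"
proof (rule smooth_alg[of "{L}"])
 have d: "(L has_derivative L) (at x)" for x by (rule bounded_linear_imp_has_derivative[OF assms])
 show "f differentiable (at x)" if "f \<in> {L}" for f x
  using d that by (auto simp: differentiable_def)
 show "(%x. frechet_derivative f (at x) v) \<in> alg {L}" if "f \<in> {L}" for f v
  using frechet_derivative_at[OF d] that by (auto intro: alg.const)
qed (auto intro: alg.base)

lemma smooth_det: "(!!i j. smooth (%x. A x $ i $ j)) ==> smooth (%x. det (A x :: real^'n^'n))"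
 unfolding det_def by (intro smooth_sum smooth_mult smooth_const smooth_prod)

lemma differentiable_det: "(det :: real^'n^'n => real) differentiable (at M)"
proof (rule smooth_differentiable)
 have "smooth (%M :: real^'n^'n. M $ i $ j)" for i j
  by (rule smooth_linear_functional)
   (intro bounded_linear_compose[OF bounded_linear_vec_nth bounded_linear_vec_nth])
 then show "smooth (det :: real^'n^'n => real)" by (rule smooth_det)
qed

lemma bounded_bilinear_mv: "bounded_bilinear (%(A :: real^'n^'m) x. A *v x)"
 unfolding bilinear_conv_bounded_bilinear[symmetric] bilinear_def
 by (auto intro!: linearI simp: matrix_vector_right_distrib matrix_vector_mult_add_rdistrib matrix_vector_mult_scaleR
   scaleR_matrix_vector_assoc)

lemma bounded_bilinear_mm: "bounded_bilinear (%(A :: real^'n^'m) (B :: real^'k^'n). A ** B)"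
 unfolding bilinear_conv_bounded_bilinear[symmetric] bilinear_def
 by (auto intro!: linearI simp: vec_eq_iff matrix_matrix_mult_def sum_distrib_left sum.distrib algebra_simps)

text \<open>The inverse by Cramer's rule, hence visibly a smooth function of the entries.\<close>

definition adjinv :: "real^'n^'n => real^'n^'n" where
 "adjinv A = (\<chi> i j. det (\<chi> k l. if l = i then axis j 1 $ k else A $ k $ l) / det A)"

lemma adjinv_inverse:
 assumes "det A \<noteq> 0" shows "A ** adjinv A = mat 1" "adjinv A ** A = mat 1"
proof -
 have "A *v column j (adjinv A) = axis j 1" for j
  using assms by (subst cramer) (auto simp: vec_eq_iff adjinv_def column_def)
 then have "(A ** adjinv A) $ i $ j = mat 1 $ i $ j" for i j
  by (auto simp: vec_eq_iff matrix_matrix_mult_def matrix_vector_mult_def column_def mat_def axis_def)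
 then show 1: "A ** adjinv A = mat 1" by (simp add: vec_eq_iff)
 then show "adjinv A ** A = mat 1" by (rule matrix_left_right_inverse1)
qed

lemma smooth_adjinv:
 assumes s: "!!i j. smooth (%x. A x $ i $ j)" and nz: "!!x. det (A x) \<noteq> 0"
 shows "smooth (%x. adjinv (A x) $ i $ j)"
proof -
 have "smooth (%x. det (\<chi> k l. if l = i then axis j 1 $ k else A x $ k $ l))"
 proof (rule smooth_det)
  fix p q
  show "smooth (%x. (\<chi> k l. if l = i then axis j 1 $ k else A x $ k $ l) $ p $ q)"
   by (cases "q = i") (simp_all add: s)
 qed
 moreover have "smooth (%x. inverse (det (A x)))" using smooth_inverse[OF smooth_det[OF s] nz] .
 ultimately show ?thesis unfolding adjinv_def divide_inverse by (simp add: smooth_mult)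
qed

lemma smooth_compose_forward:
 fixes \<Phi> :: "real^'m => real^'n"
 assumes d: "!!x. (\<Phi> has_derivative (%v. A x *v v)) (at x)"
  and A: "!!i j. smooth (%x. A x $ i $ j)" and f: "smooth f"
 shows "smooth (%x. f (\<Phi> x) :: real)"
  and "pd j (%x. f (\<Phi> x)) x = (\<Sum>i\<in>UNIV. pd i f (\<Phi> x) * A x $ i $ j)"
proof -
 let ?B = "{%y. f (\<Phi> y) | f. smooth f} \<union> {f. smooth f} :: (real^'m => real) set"
 have D: "((%x. f (\<Phi> x)) has_derivative (%v. \<Sum>i\<in>UNIV. pd i f (\<Phi> x) * (A x *v v) $ i)) (at x)"
  if "smooth f" for f :: "real^'n => real" and x
  using has_derivative_compose[OF d has_derivative_pd[OF smooth_differentiable[OF that]]] .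
 show "smooth (%x. f (\<Phi> x))"
 proof (rule smooth_alg[of ?B])
  show "f differentiable (at x)" if fB: "f \<in> ?B" for f x
  proof (cases "smooth f")
   case True
   then show ?thesis by (rule smooth_differentiable)
  next
   case False
   then obtain g where g: "smooth g" "f = (%y. g (\<Phi> y))" using fB by blast
   show ?thesis unfolding g(2) differentiable_def using D[OF g(1)] by blast
  qed
  show "(%x. frechet_derivative f (at x) v) \<in> alg ?B" if fB: "f \<in> ?B" for f v
  proof (cases "smooth f")
   case True
   then show ?thesis by (intro alg.base) (auto intro: smooth_frechet)
  next
   case False
   then obtain g where g: "smooth g" "f = (%y. g (\<Phi> y))" using fB by blast
   have eq: "(%x. frechet_derivative f (at x) v) =
     (%x. \<Sum>i\<in>UNIV. pd i g (\<Phi> x) * (\<Sum>j\<in>UNIV. A x $ i $ j * v $ j))"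
    unfolding g(2) using frechet_derivative_at[OF D[OF g(1)], symmetric]
    by (simp add: matrix_vector_mult_def)
   have 1: "(%y. pd i g (\<Phi> y)) \<in> alg ?B" for i
    by (rule alg.base, rule UnI1, rule CollectI, rule exI[of _ "pd i g"]) (simp add: g smooth_pd)
   have 2: "(%x. A x $ i $ j) \<in> alg ?B" for i j
    by (rule alg.base, rule UnI2) (simp add: A)
   show ?thesis unfolding eq by (intro alg_sum alg.mult alg.const 1 2)
  qed
  show "(%x. f (\<Phi> x)) \<in> alg ?B"
   by (rule alg.base, rule UnI1, rule CollectI, rule exI[of _ f]) (simp add: f)
 qed
 show "pd j (%x. f (\<Phi> x)) x = (\<Sum>i\<in>UNIV. pd i f (\<Phi> x) * A x $ i $ j)"
  using pd_eqI[OF D[OF f], of j x] by (simp add: matrix_vector_mult_def axis_def if_distrib sum.delta cong: if_cong)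
qed

text \<open>The derivative is carried as a matrix field \<open>A\<close>, because the transformation laws
  below involve its entries and their derivatives. The inverse \<open>\<Psi>\<close> is only
  required to be continuous; its smoothness follows.\<close>

definition diffeo :: "(real^'m) set => (real^'m => real^'m) => (real^'m => real^'m^'m) => (real^'m => real^'m) => bool" where
 "diffeo U \<Phi> A \<Psi> \<longleftrightarrow> (\<forall>x. \<Psi> (\<Phi> x) = x) \<and> (\<forall>y. \<Phi> (\<Psi> y) = y) \<and> (\<forall>x. \<Phi> x \<in> U \<longleftrightarrow> x \<in> U) \<and>
  (\<forall>x. (\<Phi> has_derivative (%v. A x *v v)) (at x)) \<and> (\<forall>i j. smooth (%x. A x $ i $ j)) \<and>
  (\<forall>x. det (A x) > 0) \<and> continuous_on UNIV \<Psi>"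

lemma diffeoD:
 assumes "diffeo U \<Phi> A \<Psi>"
 shows "\<Psi> (\<Phi> x) = x" "\<Phi> (\<Psi> y) = y" "\<Phi> x \<in> U \<longleftrightarrow> x \<in> U" "\<Psi> y \<in> U \<longleftrightarrow> y \<in> U"
  "(\<Phi> has_derivative (%v. A x *v v)) (at x)" "smooth (%x. A x $ i $ j)" "det (A x) > 0"
  "continuous_on UNIV \<Psi>" "continuous_on UNIV \<Phi>"
proof -
 show "\<Psi> (\<Phi> x) = x" "\<Phi> (\<Psi> y) = y" "\<Phi> x \<in> U \<longleftrightarrow> x \<in> U"
  "(\<Phi> has_derivative (%v. A x *v v)) (at x)" "smooth (%x. A x $ i $ j)" "det (A x) > 0" "continuous_on UNIV \<Psi>"
  using assms unfolding diffeo_def by blast+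
 show "\<Psi> y \<in> U \<longleftrightarrow> y \<in> U" using assms unfolding diffeo_def by metis
 have "(\<Phi> has_derivative (%v. A x *v v)) (at x)" for x using assms unfolding diffeo_def by blast
 then show "continuous_on UNIV \<Phi>"
  by (meson continuous_at_imp_continuous_on has_derivative_continuous)
qed

lemma diffeo_inverse_derivative:
 assumes d: "diffeo U \<Phi> A \<Psi>"
 shows "(\<Psi> has_derivative (%v. adjinv (A (\<Psi> y)) *v v)) (at y)"
proof (rule has_derivative_inverse_basic[where f = \<Phi> and T = UNIV])
 have nz: "det (A x) \<noteq> 0" for x using diffeoD(7)[OF d, of x] by simp
 show "(\<Phi> has_derivative (%v. A (\<Psi> y) *v v)) (at (\<Psi> y))" by (rule diffeoD(5)[OF d])
 show "bounded_linear ((*v) (adjinv (A (\<Psi> y))))" by (rule matrix_vector_mul_bounded_linear)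
 show "(*v) (adjinv (A (\<Psi> y))) \<circ> (*v) (A (\<Psi> y)) = id"
  by (auto simp: fun_eq_iff matrix_vector_mul_assoc adjinv_inverse[OF nz])
 show "continuous (at y) \<Psi>" using diffeoD(8)[OF d] by (simp add: continuous_on_eq_continuous_at)
qed (use diffeoD(2)[OF d] in auto)

lemma smooth_diffeo_inverse:
 assumes d: "diffeo U \<Phi> A \<Psi>" and f: "smooth f"
 shows "smooth (%y. f (\<Psi> y) :: real)"
proof (rule smooth_compose_self_similar[where F = "%i j x. adjinv (A x) $ i $ j"])
 have nz: "det (A x) \<noteq> 0" for x using diffeoD(7)[OF d, of x] by simp
 show "smooth (%x. adjinv (A x) $ i $ j)" for i j by (rule smooth_adjinv[OF diffeoD(6)[OF d] nz])
 show "(\<Psi> has_derivative (%v. \<chi> i. \<Sum>j\<in>UNIV. adjinv (A (\<Psi> y)) $ i $ j * v $ j)) (at y)" for y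
  using diffeo_inverse_derivative[OF d, of y] by (simp add: matrix_vector_mult_def)
qed (rule f)

lemma test_diffeo_inverse:
 assumes d: "diffeo U \<Phi> A \<Psi>" and f: "f \<in> test_functions U"
 shows "(%y. f (\<Psi> y) :: real) \<in> test_functions U"
proof (rule test_functionsI[of _ "\<Phi> ` supp f"])
 note t = test_functionsD[OF f]
 show "smooth (%y. f (\<Psi> y))" by (rule smooth_diffeo_inverse[OF d t(1)])
 show "compact (\<Phi> ` supp f)"
  by (rule compact_continuous_image[OF continuous_on_subset[OF diffeoD(9)[OF d] subset_UNIV] t(2)])
 show "\<Phi> ` supp f \<subseteq> U" using t(3) diffeoD(3)[OF d] by blast
 show "f (\<Psi> y) = 0" if "y \<notin> \<Phi> ` supp f" for y
  using that diffeoD(2)[OF d, of y] by (metis image_eqI not_supp)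
qed

lemma diffeo_measure:
 assumes U: "open U" "bounded U" and d: "diffeo U \<Phi> A \<Psi>"
 shows "\<Phi> \<in> Leb U \<rightarrow>\<^sub>M Leb U"
  and "distr (Leb U) (Leb U) \<Phi> = density (Leb U) (%y. ennreal (1 / det (A (\<Psi> y))))"
proof -
 have nz: "det (A x) \<noteq> 0" for x using diffeoD(7)[OF d, of x] by simp
 have det: "det (matrix (%v. adjinv (A (\<Psi> y)) *v v)) = 1 / det (A (\<Psi> y))" for y
 proof -
  have "det (A (\<Psi> y)) * det (adjinv (A (\<Psi> y))) = 1"
   using adjinv_inverse(1)[OF nz[of "\<Psi> y"]] by (simp flip: det_mul)
  then show ?thesis using nz[of "\<Psi> y"] by (simp add: field_simps)
 qed
 have cont: "continuous_on UNIV (%y. det (matrix (%v. adjinv (A (\<Psi> y)) *v v)))"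
  unfolding det
  by (intro continuous_intros smooth_continuous smooth_diffeo_inverse[OF d, where f="%x. det (A x)"]
    smooth_det diffeoD(6)[OF d]) (simp add: nz)
 note D = distr_lebesgue_on_diffeo[OF U diffeoD(1,2,3)[OF d] diffeo_inverse_derivative[OF d] cont]
 show "\<Phi> \<in> Leb U \<rightarrow>\<^sub>M Leb U" by (rule D(1))
 have "\<bar>1 / det (A (\<Psi> y))\<bar> = 1 / det (A (\<Psi> y))" for y using diffeoD(7)[OF d, of "\<Psi> y"] by simp
 then show "distr (Leb U) (Leb U) \<Phi> = density (Leb U) (%y. ennreal (1 / det (A (\<Psi> y))))"
  using D(2) unfolding det by simp
qed

lemma borel_lebesgue_on: "f \<in> borel_measurable borel ==> f \<in> borel_measurable (Leb U)"
 by (intro measurable_restrict_space1 measurable_completion) simp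

lemma continuous_lebesgue_on:
 fixes f :: "'a::euclidean_space => 'b::{second_countable_topology, topological_space}"
 shows "continuous_on UNIV f ==> f \<in> borel_measurable (Leb U)"
 by (intro borel_lebesgue_on borel_measurable_continuous_onI)

lemma diffeo_jac_continuous:
 assumes d: "diffeo U \<Phi> A \<Psi>" shows "continuous_on UNIV (%y. 1 / det (A (\<Psi> y)))" "continuous_on UNIV (%y. 1 / det (A y))"
proof -
 have nz: "det (A x) \<noteq> 0" for x using diffeoD(7)[OF d, of x] by simp
 show "continuous_on UNIV (%y. 1 / det (A (\<Psi> y)))" "continuous_on UNIV (%y. 1 / det (A y))"
  by (intro continuous_intros smooth_continuous smooth_diffeo_inverse[OF d, where f="%x. det (A x)"]
    smooth_det diffeoD(6)[OF d]; simp add: nz)+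
qed

lemma integral_diffeo:
 fixes u :: "real^'m => 'v::euclidean_space"
 assumes U: "open U" "bounded U" and d: "diffeo U \<Phi> A \<Psi>" and u: "u \<in> borel_measurable (Leb U)"
 shows "integrable (Leb U) (%x. u (\<Phi> x)) \<longleftrightarrow> integrable (Leb U) (%y. (1 / det (A (\<Psi> y))) *\<^sub>R u y)"
  and "(LINT x|Leb U. u (\<Phi> x)) = (LINT y|Leb U. (1 / det (A (\<Psi> y))) *\<^sub>R u y)"
  and "(%x. u (\<Phi> x)) \<in> borel_measurable (Leb U)"
proof -
 note D = diffeo_measure[OF U d]
 have j: "(%y. 1 / det (A (\<Psi> y))) \<in> borel_measurable (Leb U)"
  by (rule continuous_lebesgue_on[OF diffeo_jac_continuous(1)[OF d]])
 have p: "AE y in Leb U. 0 <= 1 / det (A (\<Psi> y))"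
  using diffeoD(7)[OF d] by (intro AE_I2) (simp add: less_imp_le)
 show "integrable (Leb U) (%x. u (\<Phi> x)) \<longleftrightarrow> integrable (Leb U) (%y. (1 / det (A (\<Psi> y))) *\<^sub>R u y)"
  using integrable_distr_eq[OF D(1) u] integrable_density[OF u j p] unfolding D(2) by simp
 show "(LINT x|Leb U. u (\<Phi> x)) = (LINT y|Leb U. (1 / det (A (\<Psi> y))) *\<^sub>R u y)"
  using integral_distr[OF D(1) u] integral_density[OF u j p] unfolding D(2) by simp
 show "(%x. u (\<Phi> x)) \<in> borel_measurable (Leb U)" using measurable_compose[OF D(1) u] .
qed

lemma nn_integral_diffeo:
 assumes U: "open U" "bounded U" and d: "diffeo U \<Phi> A \<Psi>" and u: "u \<in> borel_measurable (Leb U)"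
 shows "(\<integral>\<^sup>+x. u (\<Phi> x) \<partial>Leb U) = (\<integral>\<^sup>+y. ennreal (1 / det (A (\<Psi> y))) * u y \<partial>Leb U)"
proof -
 note D = diffeo_measure[OF U d]
 have j: "(%y. ennreal (1 / det (A (\<Psi> y)))) \<in> borel_measurable (Leb U)"
  using continuous_lebesgue_on[OF diffeo_jac_continuous(1)[OF d]] by measurable
 have "(\<integral>\<^sup>+x. u (\<Phi> x) \<partial>Leb U) = nn_integral (distr (Leb U) (Leb U) \<Phi>) u"
  by (rule nn_integral_distr[OF D(1), symmetric]) (simp add: u)
 also have "... = (\<integral>\<^sup>+y. ennreal (1 / det (A (\<Psi> y))) * u y \<partial>Leb U)"
  unfolding D(2) by (rule nn_integral_density[OF j u])
 finally show ?thesis .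
qed

lemma integrable_diffeo:
 fixes u :: "real^'m => 'v::euclidean_space"
 assumes U: "open U" "bounded U" and d: "diffeo U \<Phi> A \<Psi>" and u: "integrable (Leb U) u"
 shows "integrable (Leb U) (%x. u (\<Phi> x))"
proof -
 have um: "u \<in> borel_measurable (Leb U)" using u by auto
 have j: "(%y. 1 / det (A (\<Psi> y))) \<in> borel_measurable (Leb U)"
  by (rule continuous_lebesgue_on[OF diffeo_jac_continuous(1)[OF d]])
 have "compact ((%y. 1 / det (A (\<Psi> y))) ` closure U)"
  using U(2) by (intro compact_continuous_image continuous_on_subset[OF diffeo_jac_continuous(1)[OF d]]) auto
 then obtain B where B: "!!y. y \<in> closure U ==> norm (1 / det (A (\<Psi> y))) <= B"
  using compact_imp_bounded[of "(%y. 1 / det (A (\<Psi> y))) ` closure U"] unfolding bounded_iff by blast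
 have "integrable (Leb U) (%y. (1 / det (A (\<Psi> y))) *\<^sub>R u y)"
 proof (rule bint_bound[of _ "%y. B *\<^sub>R norm (u y)"])
  show "integrable (Leb U) (%y. B *\<^sub>R norm (u y))"
   by (intro integrable_scaleR_right integrable_norm u)
  show "(%y. (1 / det (A (\<Psi> y))) *\<^sub>R u y) \<in> borel_measurable (Leb U)" using j um by (rule borel_measurable_scaleR)
  show "AE y in Leb U. norm ((1 / det (A (\<Psi> y))) *\<^sub>R u y) <= norm (B *\<^sub>R norm (u y))"
  proof (rule AE_I2)
   fix y assume "y \<in> space (Leb U)"
   then have "y \<in> closure U" using closure_subset by auto
   then have "norm (1 / det (A (\<Psi> y))) * norm (u y) <= B * norm (u y)" by (intro mult_right_mono B) auto
   also have "... <= norm (B *\<^sub>R norm (u y))" by simp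
   finally show "norm ((1 / det (A (\<Psi> y))) *\<^sub>R u y) <= norm (B *\<^sub>R norm (u y))" by simp
  qed
 qed
 then show ?thesis using integral_diffeo(1)[OF U d um] by simp
qed

text \<open>The difference quotients have integral 0 by translation invariance and converge boundedly with
  uniformly bounded support.\<close>

lemma integral_pd_zero:
 fixes F :: "real^'m => real"
 assumes F: "F \<in> test_functions U"
 shows "(LINT x|lborel. pd j F x) = 0" and "integrable lborel F"
proof -
 note t = test_functionsD[OF F]
 let ?e = "axis j 1 :: real^'m"
 obtain R where R: "!!x. x \<in> supp F ==> norm x <= R" using t(2) compact_imp_bounded bounded_iff by metis
 obtain B where B: "!!x. norm (F x) <= B" using bounded_test[OF F] by blast
 obtain C where C: "!!x. norm (pd j F x) <= C" using bounded_test[OF test_pd[OF F]] by blast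
 have "0 <= C" using C[of 0] norm_ge_zero order_trans by blast
 have Fm: "F \<in> borel_measurable borel" by (rule test_borel_measurable[OF F])
 have fin: "integrable lborel (%x::real^'m. indicator (cball 0 r) x *\<^sub>R (c::real))" for r :: real and c
  using emeasure_bounded_finite[of "cball (0::real^'m) r"]
  by (intro integrable_scaleR_left integrable_real_indicator) auto
 show Fi: "integrable lborel F"
 proof (rule bint_bound[OF fin[of R B]])
  show "AE x in lborel. norm (F x) <= norm (indicator (cball 0 R) x *\<^sub>R B)"
  proof (rule AE_I2)
   fix x show "norm (F x) <= norm (indicator (cball 0 R) x *\<^sub>R B)"
    using B[of x] R[of x] not_supp[of x F] by (cases "x \<in> supp F") (auto simp: indicator_def)
  qed
 qed (use Fm in simp)
 have Fi': "integrable lborel (%x. F (c + x))" and Feq: "(LINT x|lborel. F (c + x)) = (LINT x|lborel. F x)" for c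
 proof -
  have m: "(+) c \<in> lborel \<rightarrow>\<^sub>M borel" by simp
  show "integrable lborel (%x. F (c + x))"
   using integrable_distr_eq[OF m Fm] Fi unfolding lborel_distr_plus by simp
  show "(LINT x|lborel. F (c + x)) = (LINT x|lborel. F x)"
   using integral_distr[OF m Fm] unfolding lborel_distr_plus by simp
 qed
 define h where "h n = 1 / real (Suc n)" for n
 have h: "0 < h n" "h n <= 1" for n by (auto simp: h_def)
 let ?q = "%n x. (F (h n *\<^sub>R ?e + x) - F x) / h n"
 have lim: "(%n. LINT x|lborel. ?q n x) \<longlonglongrightarrow> (LINT x|lborel. pd j F x)"
 proof (rule integral_dominated_convergence[where w="%x::real^'m. indicator (cball 0 (R + 1)) x *\<^sub>R C"])
  show "pd j F \<in> borel_measurable lborel" using test_borel_measurable[OF test_pd[OF F]] by simp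
  show "?q n \<in> borel_measurable lborel" for n using Fi'[of "h n *\<^sub>R ?e"] Fi by auto
  show "integrable lborel (%x::real^'m. indicator (cball 0 (R + 1)) x *\<^sub>R C)" by (rule fin)
  show "AE x in lborel. (%n. ?q n x) \<longlonglongrightarrow> pd j F x"
  proof (rule AE_I2)
   fix x
   have "((%s. F (x + s *\<^sub>R ?e)) has_real_derivative pd j F x) (at 0)"
   proof -
    have d1: "((%s::real. x + s *\<^sub>R ?e) has_derivative (%s. s *\<^sub>R ?e)) (at 0)"
     by (auto intro!: derivative_eq_intros)
    have d2: "(F has_derivative frechet_derivative F (at x)) (at (x + 0 *\<^sub>R ?e))"
     using smooth_has_derivative[OF t(1), of x] by simp
    have lin: "linear (frechet_derivative F (at x))"
     using smooth_has_derivative[OF t(1), of x] by (rule has_derivative_linear)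
    show ?thesis
     using has_derivative_compose[OF d1 d2]
     by (simp add: has_field_derivative_def pd_def linear_cmul[OF lin] mult.commute[of _ "frechet_derivative F (at x) ?e"])
   qed
   then have "((%s. (F (x + s *\<^sub>R ?e) - F x) / s) \<longlongrightarrow> pd j F x) (at 0)"
    by (simp add: DERIV_def)
   moreover have "filterlim h (at 0) sequentially"
   proof -
    have "h \<longlonglongrightarrow> 0" unfolding h_def[abs_def] by (rule LIMSEQ_Suc[OF lim_1_over_n])
    moreover have "h n \<noteq> 0" for n using h(1)[of n] by simp
    ultimately show ?thesis unfolding filterlim_at by simp
   qed
   ultimately have "(%n. (F (x + h n *\<^sub>R ?e) - F x) / h n) \<longlonglongrightarrow> pd j F x"
    by (rule filterlim_compose)
   then show "(%n. ?q n x) \<longlonglongrightarrow> pd j F x" by (simp add: add.commute)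
  qed
  show "AE x in lborel. norm (?q n x) <= indicator (cball 0 (R + 1)) x *\<^sub>R C" for n
  proof (rule AE_I2)
   fix x
   show "norm (?q n x) <= indicator (cball 0 (R + 1)) x *\<^sub>R C"
   proof (cases "x \<in> cball 0 (R + 1)")
    case True
    have "\<exists>z>0. z < h n \<and> F (x + h n *\<^sub>R ?e) - F (x + 0 *\<^sub>R ?e) = (h n - 0) * pd j F (x + z *\<^sub>R ?e)"
    proof (rule MVT2[OF h(1)])
     fix s
     have d1: "((%s::real. x + s *\<^sub>R ?e) has_derivative (%s. s *\<^sub>R ?e)) (at s)"
      by (auto intro!: derivative_eq_intros)
     note d2 = smooth_has_derivative[OF t(1), of "x + s *\<^sub>R ?e"]
     have lin: "linear (frechet_derivative F (at (x + s *\<^sub>R ?e)))" by (rule has_derivative_linear[OF d2])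
     show "((%s. F (x + s *\<^sub>R ?e)) has_real_derivative pd j F (x + s *\<^sub>R ?e)) (at s)"
      using has_derivative_compose[OF d1 d2]
      by (simp add: has_field_derivative_def pd_def linear_cmul[OF lin]
        mult.commute[of _ "frechet_derivative F (at (x + s *\<^sub>R ?e)) ?e"])
    qed
    then obtain z where "F (x + h n *\<^sub>R ?e) - F x = h n * pd j F (x + z *\<^sub>R ?e)" by auto
    then have "?q n x = pd j F (x + z *\<^sub>R ?e)" using h(1)[of n] by (simp add: add.commute)
    then show ?thesis using C True by simp
   next
    case False
    then have nx: "norm x > R + 1" by simp
    have "norm (h n *\<^sub>R ?e + x) \<ge> norm x - norm (h n *\<^sub>R ?e)"
     using norm_triangle_ineq4[of "h n *\<^sub>R ?e + x" "h n *\<^sub>R ?e"] by simp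
    then have "norm (h n *\<^sub>R ?e + x) > R" using nx h[of n] by simp
    then have "F (h n *\<^sub>R ?e + x) = 0" "F x = 0"
     using R[of x] R[of "h n *\<^sub>R ?e + x"] nx not_supp[of _ F] by fastforce+
    then show ?thesis using \<open>0 <= C\<close> by (simp add: indicator_def)
   qed
  qed
 qed
 have "(LINT x|lborel. ?q n x) = 0" for n
  using Fi Fi' by (simp add: Feq)
 then have "(%n. LINT x|lborel. ?q n x) \<longlonglongrightarrow> 0" by (simp only: tendsto_const)
 then show "(LINT x|lborel. pd j F x) = 0" by (rule LIMSEQ_unique[OF lim])
qed

lemma test_lebesgue_on_eq:
 fixes G :: "real^'m => real"
 assumes "open U" and G: "G \<in> borel_measurable borel" "!!x. x \<notin> U ==> G x = 0"
 shows "(LINT x|Leb U. G x) = (LINT x|lborel. G x)"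
  and "integrable (Leb U) G \<longleftrightarrow> integrable lborel G"
proof -
 have s: "U \<inter> space lebesgue \<in> sets lebesgue" using assms by auto
 have e: "(%x. indicator U x *\<^sub>R G x) = G" using G(2) by (auto simp: indicator_def fun_eq_iff)
 show "(LINT x|Leb U. G x) = (LINT x|lborel. G x)"
  unfolding integral_restrict_space[OF s] e using G(1) by (intro integral_completion) simp
 show "integrable (Leb U) G \<longleftrightarrow> integrable lborel G"
  unfolding integrable_restrict_space[OF s] e using G(1) by (intro integrable_completion) simp
qed

lemma test_0_outside: "f \<in> test_functions U ==> x \<notin> U ==> f x = 0"
 using test_functionsD(3)[of f U] not_supp[of x f] by blast

lemma integrable_test: "open U ==> (f :: real^'m => real) \<in> test_functions U ==> integrable (Leb U) f"
 using test_lebesgue_on_eq(2)[of U f] test_borel_measurable[of f U] test_0_outside[of f U] integral_pd_zero(2)[of f U]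
 by blast

lemma integration_by_parts:
 fixes f g :: "real^'m => real"
 assumes U: "open U" and f: "f \<in> test_functions U" and g: "smooth g"
 shows "(LINT x|Leb U. pd j f x * g x) = - (LINT x|Leb U. f x * pd j g x)"
proof -
 have fg: "(%x. f x * g x) \<in> test_functions U" by (rule test_mult[OF f g])
 have i: "integrable (Leb U) (%x. pd j f x * g x)" "integrable (Leb U) (%x. f x * pd j g x)"
  by (intro integrable_test[OF U] test_mult test_pd f g smooth_pd)+
 have "(LINT x|Leb U. pd j f x * g x) + (LINT x|Leb U. f x * pd j g x) =
   (LINT x|Leb U. pd j f x * g x + f x * pd j g x)"
  by (rule Bochner_Integration.integral_add[symmetric, OF i])
 also have "... = (LINT x|Leb U. pd j (%x. f x * g x) x)"
  using test_functionsD(1)[OF f] g by (simp add: pd_mult smooth_differentiable)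
 also have "... = (LINT x|lborel. pd j (%x. f x * g x) x)"
  by (rule test_lebesgue_on_eq(1)[OF U test_borel_measurable[OF test_pd[OF fg]] test_0_outside[OF test_pd[OF fg]]])
 also have "... = 0" by (rule integral_pd_zero(1)[OF fg])
 finally show ?thesis by simp
qed

lemma fundamental_lemma_continuous:
 fixes D :: "real^'m => real"
 assumes U: "open U" "bounded U" and D: "continuous_on UNIV D" "!!x. x \<notin> U ==> D x = 0"
  and test: "!!\<eta>. \<eta> \<in> test_functions U ==> (LINT x|Leb U. \<eta> x * D x) = 0"
 shows "D x = 0"
proof -
 have Ub: "U \<in> sets borel" using U by simp
 have Dm: "D \<in> borel_measurable borel" by (rule borel_measurable_continuous_onI[OF D(1)])
 have sl: "U \<inter> space lborel \<in> sets lborel" using U by simp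
 have "compact (D ` closure U)"
  using U(2) by (intro compact_continuous_image continuous_on_subset[OF D(1)]) auto
 then obtain B where B: "!!y. y \<in> closure U ==> norm (D y) <= B"
  using compact_imp_bounded[of "D ` closure U"] unfolding bounded_iff by blast
 interpret L: finite_measure "LB U" by (rule finite_measure_LB[OF Ub U(2)])
 have DL: "D \<in> borel_measurable (LB U)" by (rule measurable_borel_subsets[OF sets_LB[OF Ub] Ub Dm])
 have Di: "integrable (LB U) D"
  by (rule L.integrable_const_bound[of _ B])
   (use DL B closure_subset[of U] in \<open>auto simp: space_LB[OF Ub] intro!: AE_I2\<close>)
 have "AE x in LB U. D x = 0"
 proof (rule fundamental_lemma[OF U(1) finite_measure_LB[OF Ub U(2)] sets_LB[OF Ub] Di])
  fix \<psi> :: "real^'m => real" assume \<psi>: "\<psi> \<in> test_functions U"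
  have m: "(%x. \<psi> x * D x) \<in> borel_measurable borel" using Dm test_borel_measurable[OF \<psi>] by simp
  have "(LINT x|LB U. \<psi> x * D x) = (LINT x|lborel. indicator U x *\<^sub>R (\<psi> x * D x))"
   unfolding LB_def by (rule integral_restrict_space[OF sl])
  also have "... = (LINT x|lborel. \<psi> x * D x)"
   by (rule bint_cong) (use D(2) in \<open>auto simp: indicator_def\<close>)
  also have "... = (LINT x|Leb U. \<psi> x * D x)"
   using D(2) by (intro test_lebesgue_on_eq(1)[OF U(1) m, symmetric]) auto
  finally show "(LINT x|LB U. \<psi> x * D x) = 0" using test[OF \<psi>] by simp
 qed
 then have ae: "AE x in lborel. x \<in> U --> D x = 0"
  unfolding LB_def by (subst (asm) AE_restrict_space_iff[OF sl])
 have "open (U \<inter> D -` (- {0}))"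
  by (intro open_Int U(1) open_vimage D(1)) auto
 moreover have "negligible (U \<inter> D -` (- {0}))"
 proof -
  have "AE x in lebesgue. x \<notin> U \<inter> D -` (- {0})" using AE_completion[OF ae] by eventually_elim auto
  then show ?thesis
   unfolding negligible_iff_null_sets by (simp add: AE_iff_null_sets completion.AE_iff_null_sets \<open>open (U \<inter> D -` (- {0}))\<close>)
 qed
 ultimately have "U \<inter> D -` (- {0}) = {}" using open_not_negligible by blast
 then show ?thesis using D(2)[of x] by auto
qed

section \<open>Transformation of distributional derivatives\<close>

lemma matrix_entries_sum:
 "(\<Sum>k\<in>UNIV. \<Sum>l\<in>UNIV. A $ k $ i * F $ k $ l * A $ l $ j) = (transpose A ** F ** A) $ i $ (j :: 'm::finite)"
 for A F :: "real^'m^'m"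
proof -
 have "(transpose A ** F ** A) $ i $ j = (\<Sum>l\<in>UNIV. (\<Sum>k\<in>UNIV. A $ k $ i * F $ k $ l) * A $ l $ j)"
  by (simp add: matrix_matrix_mult_def transpose_def)
 also have "... = (\<Sum>k\<in>UNIV. \<Sum>l\<in>UNIV. A $ k $ i * F $ k $ l * A $ l $ j)"
  unfolding sum_distrib_right by (rule sum.swap)
 finally show ?thesis by simp
qed

lemma smooth_div_det:
 assumes d: "diffeo U \<Phi> A \<Psi>" and f: "smooth f"
 shows "smooth (%x. f x / det (A x))"
proof -
 have nz: "det (A x) \<noteq> 0" for x using diffeoD(7)[OF d, of x] by simp
 have "smooth (%x. f x * inverse (det (A x)))"
  by (rule smooth_mult[OF f smooth_inverse[OF smooth_det[OF diffeoD(6)[OF d]] nz]])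
 then show ?thesis by (simp add: divide_inverse)
qed

text \<open>The test functions on the image side that arise from transporting \<open>\<psi> \<partial>\<^sub>j\<close>.\<close>

definition transported :: "(real^'m => real^'m^'m) => (real^'m => real^'m) => (real^'m => real) => 'm => 'm => real^'m => real" where
 "transported A \<Psi> \<psi> k j y = \<psi> (\<Psi> y) * A (\<Psi> y) $ k $ j / det (A (\<Psi> y))"

lemma test_transported:
 assumes d: "diffeo U \<Phi> A \<Psi>" and \<psi>: "\<psi> \<in> test_functions U"
 shows "transported A \<Psi> \<psi> k j \<in> test_functions U"
proof -
 have "(%x. \<psi> x * (A x $ k $ j / det (A x))) \<in> test_functions U"
  by (rule test_mult[OF \<psi> smooth_div_det[OF d diffeoD(6)[OF d]]])
 from test_diffeo_inverse[OF d this] show ?thesis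
  by (simp add: transported_def[abs_def])
qed

text \<open>The cofactor matrix is divergence free. Instead of differentiating cofactors, the identity is
  tested: after a change of variables and integration by parts, both sides integrate against
  \<open>\<eta>\<close> to the integral of \<open>\<partial>\<^sub>j\<psi> (\<eta> \<circ>
  \<Phi>)\<close>.\<close>

lemma piola:
 fixes U :: "(real^'m) set"
 assumes U: "open U" "bounded U" and d: "diffeo U \<Phi> A \<Psi>" and \<psi>: "\<psi> \<in> test_functions U"
 shows "pd j \<psi> (\<Psi> y) / det (A (\<Psi> y)) = (\<Sum>k\<in>UNIV. pd k (transported A \<Psi> \<psi> k j) y)"
proof -
 let ?Q = "%k. transported A \<Psi> \<psi> k j"
 have Qt: "?Q k \<in> test_functions U" for k by (rule test_transported[OF d \<psi>])
 have Lt: "(%y. pd j \<psi> (\<Psi> y) / det (A (\<Psi> y))) \<in> test_functions U"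
  using test_diffeo_inverse[OF d, of "%x. pd j \<psi> x * (1 / det (A x))"]
   test_mult[OF test_pd[OF \<psi>] smooth_div_det[OF d smooth_const[of 1]]] by simp
 let ?D = "%y. pd j \<psi> (\<Psi> y) / det (A (\<Psi> y)) - (\<Sum>k\<in>UNIV. pd k (?Q k) y)"
 have ints: "integrable (Leb U) (%y. \<eta> y * f y)" if "f \<in> test_functions U" "smooth \<eta>" for f \<eta> :: "real^'m => real"
  using integrable_test[OF U(1) test_mult[OF that]] by (simp add: mult.commute)
 have "?D y = 0"
 proof (rule fundamental_lemma_continuous[OF U])
  show "continuous_on UNIV ?D"
   by (intro continuous_on_diff continuous_on_sum smooth_continuous[OF test_functionsD(1)[OF Lt]]
     smooth_continuous[OF test_functionsD(1)[OF test_pd[OF Qt]]])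
  show "?D x = 0" if "x \<notin> U" for x
   using test_0_outside[OF Lt that] test_0_outside[OF test_pd[OF Qt] that] by simp
  fix \<eta> :: "real^'m => real" assume \<eta>: "\<eta> \<in> test_functions U"
  have \<eta>s: "smooth \<eta>" by (rule test_functionsD(1)[OF \<eta>])
  have \<eta>\<Phi>: "smooth (%x. \<eta> (\<Phi> x))" "!!j x. pd j (%x. \<eta> (\<Phi> x)) x = (\<Sum>i\<in>UNIV. pd i \<eta> (\<Phi> x) * A x $ i $ j)"
   using smooth_compose_forward[OF diffeoD(5)[OF d] diffeoD(6)[OF d] \<eta>s] by auto
  have cm: "(%y. \<eta> y * pd j \<psi> (\<Psi> y)) \<in> borel_measurable (Leb U)"
   by (intro continuous_lebesgue_on continuous_on_mult smooth_continuous[OF \<eta>s]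
     smooth_continuous[OF smooth_diffeo_inverse[OF d smooth_pd[OF test_functionsD(1)[OF \<psi>]]]])
  have "(LINT y|Leb U. \<eta> y * (pd j \<psi> (\<Psi> y) / det (A (\<Psi> y)))) = (LINT x|Leb U. \<eta> (\<Phi> x) * pd j \<psi> (\<Psi> (\<Phi> x)))"
   using integral_diffeo(2)[OF U d cm] by (simp add: mult.assoc)
  also have "... = (LINT x|Leb U. pd j \<psi> x * \<eta> (\<Phi> x))"
   by (simp add: diffeoD(1)[OF d] mult.commute)
  also have "... = - (LINT x|Leb U. \<psi> x * pd j (%x. \<eta> (\<Phi> x)) x)"
   by (rule integration_by_parts[OF U(1) \<psi> \<eta>\<Phi>(1)])
  also have "... = - (LINT x|Leb U. (\<Sum>k\<in>UNIV. pd k \<eta> (\<Phi> x) * (\<psi> (\<Psi> (\<Phi> x)) * A (\<Psi> (\<Phi> x)) $ k $ j)))"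
   unfolding \<eta>\<Phi>(2) diffeoD(1)[OF d] sum_distrib_left by (simp add: mult_ac)
  also have "... = - (LINT y|Leb U. (1 / det (A (\<Psi> y))) *\<^sub>R (\<Sum>k\<in>UNIV. pd k \<eta> y * (\<psi> (\<Psi> y) * A (\<Psi> y) $ k $ j)))"
  proof -
   have "(%y. \<Sum>k\<in>UNIV. pd k \<eta> y * (\<psi> (\<Psi> y) * A (\<Psi> y) $ k $ j)) \<in> borel_measurable (Leb U)"
    by (intro continuous_lebesgue_on continuous_on_sum continuous_on_mult smooth_continuous smooth_pd[OF \<eta>s]
      smooth_diffeo_inverse[OF d test_functionsD(1)[OF \<psi>]] smooth_diffeo_inverse[OF d diffeoD(6)[OF d]])
   from integral_diffeo(2)[OF U d this] show ?thesis by simp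
  qed
  also have "... = - (LINT y|Leb U. (\<Sum>k\<in>UNIV. pd k \<eta> y * ?Q k y))"
   by (simp add: transported_def sum_divide_distrib sum_distrib_left)
  also have "... = - (\<Sum>k\<in>UNIV. LINT y|Leb U. pd k \<eta> y * ?Q k y)"
   by (subst bint_of_sum) (auto intro: ints[OF Qt smooth_pd[OF \<eta>s]])
  also have "... = (\<Sum>k\<in>UNIV. LINT y|Leb U. \<eta> y * pd k (?Q k) y)"
   unfolding integration_by_parts[OF U(1) \<eta> test_functionsD(1)[OF Qt]] sum_negf by simp
  also have "... = (LINT y|Leb U. (\<Sum>k\<in>UNIV. \<eta> y * pd k (?Q k) y))"
   by (subst bint_of_sum) (auto intro: ints[OF test_pd[OF Qt] \<eta>s])
  finally have eq: "(LINT y|Leb U. \<eta> y * (pd j \<psi> (\<Psi> y) / det (A (\<Psi> y)))) =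
    (LINT y|Leb U. (\<Sum>k\<in>UNIV. \<eta> y * pd k (?Q k) y))" .
  have "(LINT y|Leb U. \<eta> y * ?D y) = (LINT y|Leb U. \<eta> y * (pd j \<psi> (\<Psi> y) / det (A (\<Psi> y))) - (\<Sum>k\<in>UNIV. \<eta> y * pd k (?Q k) y))"
   by (simp add: right_diff_distrib sum_distrib_left)
  also have "... = 0"
   by (subst bint_of_diff[OF ints[OF Lt \<eta>s] bint_sum[OF ints[OF test_pd[OF Qt] \<eta>s]]])
    (simp only: eq diff_self)
  finally show "(LINT y|Leb U. \<eta> y * ?D y) = 0" .
 qed
 then show ?thesis by simp
qed

lemma integrable_mult_test:
 fixes u :: "real^'m => real"
 assumes u: "integrable (Leb U) u" and \<psi>: "\<psi> \<in> test_functions U"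
 shows "integrable (Leb U) (%x. u x * \<psi> x)"
proof -
 obtain B where B: "!!x. norm (\<psi> x) <= B" using bounded_test[OF \<psi>] by blast
 have "integrable (Leb U) (%x. \<psi> x *\<^sub>R u x)"
  by (rule integrable_test_scaleR[OF u borel_lebesgue_on[OF test_borel_measurable[OF \<psi>]] B])
 then show ?thesis by (simp add: mult.commute)
qed

lemma distr_D_eq:
 assumes "open U"
 shows "distr_D U u \<psi> $ i $ j = - (LINT x|Leb U. u x $ i * pd j \<psi> x)"
 using set_integrable_lebesgue_on(2)[of U "%x. u x $ i * pd j \<psi> x"] assms by (simp add: distr_D_def pd_def)

lemma integrable_component: "integrable M z ==> integrable M (%x. z x $ i :: real)"
 using integrable_bounded_linear[OF bounded_linear_vec_nth] .

text \<open>The chain rule in distributional form. It holds for merely integrable \<open>z\<close> because,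
  by Piola's identity, the transported test functions absorb the Jacobian.\<close>

lemma distr_D_compose:
 fixes z :: "real^'m => real^'k"
 assumes U: "open U" "bounded U" and d: "diffeo U \<Phi> A \<Psi>" and \<psi>: "\<psi> \<in> test_functions U"
  and z: "integrable (Leb U) z"
 shows "distr_D U (%x. z (\<Phi> x)) \<psi> $ i $ j = (\<Sum>k\<in>UNIV. distr_D U z (transported A \<Psi> \<psi> k j) $ i $ k)"
proof -
 let ?Q = "%k. transported A \<Psi> \<psi> k j"
 have Qt: "?Q k \<in> test_functions U" for k by (rule test_transported[OF d \<psi>])
 have zi: "integrable (Leb U) (%x. z x $ i)" by (rule integrable_component[OF z])
 have m: "(%y. z y $ i * pd j \<psi> (\<Psi> y)) \<in> borel_measurable (Leb U)"
  by (intro borel_measurable_times borel_measurable_integrable[OF zi] continuous_lebesgue_on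
    smooth_continuous[OF smooth_diffeo_inverse[OF d smooth_pd[OF test_functionsD(1)[OF \<psi>]]]])
 have "(LINT x|Leb U. z (\<Phi> x) $ i * pd j \<psi> x) = (LINT y|Leb U. z y $ i * (pd j \<psi> (\<Psi> y) / det (A (\<Psi> y))))"
  using integral_diffeo(2)[OF U d m] by (simp add: diffeoD(1)[OF d] mult.commute)
 also have "... = (LINT y|Leb U. (\<Sum>k\<in>UNIV. z y $ i * pd k (?Q k) y))"
  unfolding piola[OF U d \<psi>] sum_distrib_left ..
 also have "... = (\<Sum>k\<in>UNIV. LINT y|Leb U. z y $ i * pd k (?Q k) y)"
  by (rule bint_of_sum) (rule integrable_mult_test[OF zi test_pd[OF Qt]])
 finally show ?thesis unfolding distr_D_eq[OF U(1)] by (simp add: sum_negf)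
qed

definition pullback_z :: "(real^'m => real^'m^'m) => (real^'m => real^'m) => (real^'m => real^'m) => real^'m => real^'m" where
 "pullback_z A \<Phi> z x = transpose (A x) *v z (\<Phi> x)"

text \<open>The factor \<open>A^T\<close> is moved to the test function by the product rule, which leaves
  the undifferentiated field times the second derivatives of \<open>\<Phi>\<close>.\<close>

lemma distr_D_pullback:
 assumes U: "open U" "bounded U" and d: "diffeo U \<Phi> A \<Psi>" and \<psi>: "\<psi> \<in> test_functions U"
  and z: "integrable (Leb U) z"
 shows "distr_D U (pullback_z A \<Phi> z) \<psi> $ i $ j =
  (\<Sum>k\<in>UNIV. \<Sum>l\<in>UNIV. distr_D U z (transported A \<Psi> (%x. \<psi> x * A x $ k $ i) l j) $ k $ l) +
  (LINT x|Leb U. \<psi> x * (\<Sum>k\<in>UNIV. z (\<Phi> x) $ k * pd j (%x. A x $ k $ i) x))"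
proof -
 have z\<Phi>: "integrable (Leb U) (%x. z (\<Phi> x))" by (rule integrable_diffeo[OF U d z])
 have zk: "integrable (Leb U) (%x. z (\<Phi> x) $ k)" for k by (rule integrable_component[OF z\<Phi>])
 have As: "smooth (%x. A x $ k $ i)" for k by (rule diffeoD(6)[OF d])
 have \<psi>A: "(%x. \<psi> x * A x $ k $ i) \<in> test_functions U" for k by (rule test_mult[OF \<psi> As])
 have i1: "integrable (Leb U) (%x. z (\<Phi> x) $ k * pd j (%x. \<psi> x * A x $ k $ i) x)" for k
  by (rule integrable_mult_test[OF zk test_pd[OF \<psi>A]])
 have i2: "integrable (Leb U) (%x. z (\<Phi> x) $ k * (\<psi> x * pd j (%x. A x $ k $ i) x))" for k
  by (rule integrable_mult_test[OF zk test_mult[OF \<psi> smooth_pd[OF As]]])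
 have prod: "A x $ k $ i * pd j \<psi> x = pd j (%x. \<psi> x * A x $ k $ i) x - \<psi> x * pd j (%x. A x $ k $ i) x" for k x
  using pd_mult[OF smooth_differentiable[OF test_functionsD(1)[OF \<psi>]] smooth_differentiable[OF As]]
  by (simp add: mult.commute)
 have "(LINT x|Leb U. pullback_z A \<Phi> z x $ i * pd j \<psi> x) =
   (LINT x|Leb U. (\<Sum>k\<in>UNIV. z (\<Phi> x) $ k * pd j (%x. \<psi> x * A x $ k $ i) x) -
    (\<Sum>k\<in>UNIV. z (\<Phi> x) $ k * (\<psi> x * pd j (%x. A x $ k $ i) x)))"
 proof (rule bint_cong[OF refl])
  fix x
  have "pullback_z A \<Phi> z x $ i * pd j \<psi> x = (\<Sum>k\<in>UNIV. z (\<Phi> x) $ k * (A x $ k $ i * pd j \<psi> x))"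
   by (simp add: pullback_z_def matrix_vector_mult_def transpose_def sum_distrib_left sum_distrib_right mult_ac)
  also have "... = (\<Sum>k\<in>UNIV. z (\<Phi> x) $ k * pd j (%x. \<psi> x * A x $ k $ i) x) -
    (\<Sum>k\<in>UNIV. z (\<Phi> x) $ k * (\<psi> x * pd j (%x. A x $ k $ i) x))"
   unfolding prod right_diff_distrib sum_subtractf ..
  finally show "pullback_z A \<Phi> z x $ i * pd j \<psi> x = (\<Sum>k\<in>UNIV. z (\<Phi> x) $ k * pd j (%x. \<psi> x * A x $ k $ i) x) -
    (\<Sum>k\<in>UNIV. z (\<Phi> x) $ k * (\<psi> x * pd j (%x. A x $ k $ i) x))" .
 qed
 also have "... = (LINT x|Leb U. (\<Sum>k\<in>UNIV. z (\<Phi> x) $ k * pd j (%x. \<psi> x * A x $ k $ i) x)) -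
   (LINT x|Leb U. (\<Sum>k\<in>UNIV. z (\<Phi> x) $ k * (\<psi> x * pd j (%x. A x $ k $ i) x)))"
  by (rule bint_of_diff) (intro bint_sum i1 i2)+
 also have "(LINT x|Leb U. (\<Sum>k\<in>UNIV. z (\<Phi> x) $ k * pd j (%x. \<psi> x * A x $ k $ i) x)) =
   (\<Sum>k\<in>UNIV. LINT x|Leb U. z (\<Phi> x) $ k * pd j (%x. \<psi> x * A x $ k $ i) x)"
  by (rule bint_of_sum) (rule i1)
 also have "... = - (\<Sum>k\<in>UNIV. distr_D U (%x. z (\<Phi> x)) (%x. \<psi> x * A x $ k $ i) $ k $ j)"
  unfolding distr_D_eq[OF U(1)] by (simp add: sum_negf)
 finally show ?thesis
  unfolding distr_D_eq[OF U(1), of "pullback_z A \<Phi> z"] distr_D_compose[OF U d \<psi>A z]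
  by (simp add: sum_distrib_left mult_ac)
qed

definition sym_part :: "real^'m^'m => real^'m^'m" where "sym_part M = (1/2) *\<^sub>R (M + transpose M)"

text \<open>The matrix \<open>\<Sum>\<^sub>k v\<^sub>k D\<^sup>2\<Phi>\<^sub>k\<close> when \<open>A =
  D\<Phi>\<close>.\<close>

definition second_order :: "(real^'m => real^'m^'m) => real^'m => real^'m => real^'m^'m" where
 "second_order A x v = (\<chi> i j. \<Sum>k\<in>UNIV. v $ k * pd j (%x. A x $ k $ i) x)"

text \<open>The cases of the full and of the symmetric gradient are treated simultaneously; the flag selects
  the symmetric one.\<close>

definition symop :: "bool => real^'m^'m => real^'m^'m" where "symop s M = (if s then sym_part M else M)"

definition distr_op :: "bool => (real^'m) set => (real^'m => real^'m) => (real^'m => real) => real^'m^'m" where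
 "distr_op s = (if s then distr_E else distr_D)"

lemma distr_op_symop: "distr_op s U z \<psi> = symop s (distr_D U z \<psi>)"
 by (simp add: distr_op_def symop_def distr_E_def sym_part_def)

lemma bounded_linear_symop: "bounded_linear (symop s :: real^'m^'m => _)"
proof -
 have "linear (symop s :: real^'m^'m => _)"
  by (auto intro!: linearI simp: symop_def sym_part_def vec_eq_iff transpose_def algebra_simps)
 then show ?thesis by (simp add: linear_linear)
qed

text \<open>The congruence \<open>M \<mapsto> A^T M A\<close> commutes with transposition, so both operators
  obey the same law with the lower order term symmetrised accordingly. This is why
  \<open>z\<close> has to be varied as a covector field.\<close>

lemma distr_op_pullback:
 assumes U: "open U" "bounded U" and d: "diffeo U \<Phi> A \<Psi>" and \<psi>: "\<psi> \<in> test_functions U"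
  and z: "integrable (Leb U) z"
 shows "distr_op s U (pullback_z A \<Phi> z) \<psi> $ i $ j =
  (\<Sum>k\<in>UNIV. \<Sum>l\<in>UNIV. distr_op s U z (transported A \<Psi> (%x. \<psi> x * A x $ k $ i) l j) $ k $ l) +
  (LINT x|Leb U. \<psi> x * symop s (second_order A x (z (\<Phi> x))) $ i $ j)"
proof (cases s)
 case False
 then show ?thesis using distr_D_pullback[OF U d \<psi> z, of i j]
  by (simp add: distr_op_def symop_def second_order_def)
next
 case True
 let ?P = "%i j k l. transported A \<Psi> (%x. \<psi> x * A x $ k $ i) l j"
 let ?h = "%i j x. \<Sum>k\<in>UNIV. z (\<Phi> x) $ k * pd j (%x. A x $ k $ i) x"
 have P: "?P j i k l = ?P i j l k" for k l by (auto simp: transported_def fun_eq_iff mult_ac)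
 have z\<Phi>: "integrable (Leb U) (%x. z (\<Phi> x))" by (rule integrable_diffeo[OF U d z])
 have hi: "integrable (Leb U) (%x. \<psi> x * ?h i j x)" for i j
 proof -
  have "integrable (Leb U) (%x. \<Sum>k\<in>UNIV. z (\<Phi> x) $ k * (\<psi> x * pd j (%x. A x $ k $ i) x))"
   by (intro bint_sum integrable_mult_test integrable_component[OF z\<Phi>]
     test_mult[OF \<psi> smooth_pd[OF diffeoD(6)[OF d]]])
  then show ?thesis by (simp add: sum_distrib_left mult_ac)
 qed
 have "(\<Sum>k\<in>UNIV. \<Sum>l\<in>UNIV. distr_D U z (?P j i k l) $ k $ l) = (\<Sum>k\<in>UNIV. \<Sum>l\<in>UNIV. distr_D U z (?P i j l k) $ k $ l)"
  unfolding P ..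
 also have "... = (\<Sum>k\<in>UNIV. \<Sum>l\<in>UNIV. distr_D U z (?P i j k l) $ l $ k)"
  by (rule sum.swap)
 finally have swap: "(\<Sum>k\<in>UNIV. \<Sum>l\<in>UNIV. distr_D U z (?P j i k l) $ k $ l) = (\<Sum>k\<in>UNIV. \<Sum>l\<in>UNIV. distr_D U z (?P i j k l) $ l $ k)" .
 have "distr_E U (pullback_z A \<Phi> z) \<psi> $ i $ j =
   (1/2) * (distr_D U (pullback_z A \<Phi> z) \<psi> $ i $ j + distr_D U (pullback_z A \<Phi> z) \<psi> $ j $ i)"
  by (simp add: distr_E_def transpose_def)
 also have "... = (1/2) * ((\<Sum>k\<in>UNIV. \<Sum>l\<in>UNIV. distr_D U z (?P i j k l) $ k $ l) + (\<Sum>k\<in>UNIV. \<Sum>l\<in>UNIV. distr_D U z (?P i j k l) $ l $ k))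
   + (1/2) * ((LINT x|Leb U. \<psi> x * ?h i j x) + (LINT x|Leb U. \<psi> x * ?h j i x))"
  unfolding distr_D_pullback[OF U d \<psi> z] swap by (simp add: algebra_simps)
 also have "(1/2) * ((\<Sum>k\<in>UNIV. \<Sum>l\<in>UNIV. distr_D U z (?P i j k l) $ k $ l) + (\<Sum>k\<in>UNIV. \<Sum>l\<in>UNIV. distr_D U z (?P i j k l) $ l $ k))
   = (\<Sum>k\<in>UNIV. \<Sum>l\<in>UNIV. distr_E U z (?P i j k l) $ k $ l)"
  by (simp add: distr_E_def transpose_def sum.distrib[symmetric] sum_distrib_left)
 also have "(1/2) * ((LINT x|Leb U. \<psi> x * ?h i j x) + (LINT x|Leb U. \<psi> x * ?h j i x)) =
   (LINT x|Leb U. (1/2) * (\<psi> x * ?h i j x + \<psi> x * ?h j i x))"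
  using hi by simp
 also have "... = (LINT x|Leb U. \<psi> x * symop s (second_order A x (z (\<Phi> x))) $ i $ j)"
  by (rule bint_cong) (auto simp: True symop_def sym_part_def second_order_def transpose_def algebra_simps)
 finally show ?thesis by (simp add: True distr_op_def)
qed

section \<open>Transport of measures\<close>

lemma borel_measurable_op:
 fixes opr :: "real^'m => 'v::euclidean_space => 'w::euclidean_space"
 assumes c: "continuous_on UNIV (%(x, M). opr x M)"
  and f: "f \<in> measurable N borel" and u: "u \<in> measurable N borel"
 shows "(%x. opr (f x) (u x)) \<in> borel_measurable N"
proof -
 have m: "(%(x, M). opr x M) \<in> borel_measurable (borel \<Otimes>\<^sub>M borel)"
  using borel_measurable_continuous_onI[OF c] by (simp add: borel_prod)
 have "(%x. (f x, u x)) \<in> N \<rightarrow>\<^sub>M borel \<Otimes>\<^sub>M borel" using f u by measurable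
 from measurable_compose[OF this m] show ?thesis by simp
qed

definition push :: "(real^'m) set => (real^'m) measure => (real^'m => real^'m) => (real^'m) measure" where
 "push U \<Lambda> \<Psi> = distr \<Lambda> (restrict_space borel U) \<Psi>"

lemma measurable_diffeo_inverse:
 assumes U: "open U" and d: "diffeo U \<Phi> A \<Psi>" and \<Lambda>: "sets \<Lambda> = borel_subsets U"
 shows "\<Psi> \<in> \<Lambda> \<rightarrow>\<^sub>M restrict_space borel U"
proof -
 have Ub: "U \<in> sets borel" using U by simp
 have "\<Psi> \<in> borel_measurable \<Lambda>"
  by (rule measurable_borel_subsets[OF \<Lambda> Ub borel_measurable_continuous_onI[OF diffeoD(8)[OF d]]])
 then show ?thesis
  using diffeoD(4)[OF d] space_borel_subsets[OF \<Lambda> Ub] by (intro measurable_restrict_space2) auto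
qed

text \<open>A diffeomorphism maps Lebesgue-null sets to Lebesgue-null sets, so a decomposition stays a
  decomposition. The factor \<open>1 / det A\<close> appears only on the singular part: on the
  absolutely continuous part it cancels against the change of Lebesgue measure.\<close>

lemma decomp_transport:
 fixes opr :: "real^'m => 'v::euclidean_space => 'w::euclidean_space"
 assumes U: "open U" "bounded U" and d: "diffeo U \<Phi> A \<Psi>" and dec: "decomp U F \<Lambda> N g"
  and cont: "continuous_on UNIV (%(x, M). opr x M)"
  and bd: "\<forall>x\<in>U. \<forall>M. norm (opr x M) <= c * norm M"
  and h: "integrable (Leb U) h"
 shows "decomp U (%x. opr x (F (\<Phi> x)) + h x) (push U \<Lambda> \<Psi>) (\<Phi> -` N \<inter> U) (%x. (1 / det (A x)) *\<^sub>R opr x (g (\<Phi> x)))"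
  and "(%y. (1 / det (A (\<Psi> y))) *\<^sub>R opr (\<Psi> y) (g y)) \<in> borel_measurable \<Lambda>"
  and "integrable \<Lambda> (%y. (1 / det (A (\<Psi> y))) *\<^sub>R opr (\<Psi> y) (g y))"
  and "(%x. (1 / det (A x)) *\<^sub>R opr x (g (\<Phi> x))) \<in> borel_measurable (push U \<Lambda> \<Psi>)"
  and "integrable (Leb U) (%x. opr x (F (\<Phi> x)))"
proof -
 have Ub: "U \<in> sets borel" using U by simp
 have F: "integrable (Leb U) F" and \<Lambda>: "finite_measure \<Lambda>" "sets \<Lambda> = borel_subsets U"
  and N: "N \<in> borel_subsets U" "emeasure lborel N = 0" "emeasure \<Lambda> (U - N) = 0" and g: "integrable \<Lambda> g"
  using dec unfolding decomp_def by auto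
 have sp\<Lambda>: "space \<Lambda> = U" by (rule space_borel_subsets[OF \<Lambda>(2) Ub])
 note \<Psi>m = measurable_diffeo_inverse[OF U(1) d \<Lambda>(2)]
 have gm: "g \<in> borel_measurable \<Lambda>" using g by auto
 have \<Phi>m: "\<Phi> \<in> restrict_space borel U \<rightarrow>\<^sub>M \<Lambda>"
 proof -
  have "\<Phi> \<in> restrict_space borel U \<rightarrow>\<^sub>M borel"
   by (intro measurable_restrict_space1 borel_measurable_continuous_onI diffeoD(9)[OF d])
  then have "\<Phi> \<in> restrict_space borel U \<rightarrow>\<^sub>M restrict_space borel U"
   using diffeoD(3)[OF d] by (intro measurable_restrict_space2) (auto simp: space_restrict_space)
  then show ?thesis
   using \<Lambda>(2) borel_subsets_restrict[OF Ub] measurable_cong_sets by blast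
 qed
 show int1: "integrable (Leb U) (%x. opr x (F (\<Phi> x)))"
 proof (rule bint_bound[of _ "%x. c *\<^sub>R norm (F (\<Phi> x))"])
  note F\<Phi> = integrable_diffeo[OF U d F]
  show "integrable (Leb U) (%x. c *\<^sub>R norm (F (\<Phi> x)))"
   by (intro integrable_scaleR_right integrable_norm F\<Phi>)
  show "(%x. opr x (F (\<Phi> x))) \<in> borel_measurable (Leb U)"
   by (rule borel_measurable_op[OF cont borel_lebesgue_on borel_measurable_integrable[OF F\<Phi>]]) simp
  show "AE x in Leb U. norm (opr x (F (\<Phi> x))) <= norm (c *\<^sub>R norm (F (\<Phi> x)))"
  proof (rule AE_I2)
   fix x assume "x \<in> space (Leb U)"
   then have "norm (opr x (F (\<Phi> x))) <= c * norm (F (\<Phi> x))" using bd by simp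
   also have "... <= norm (c *\<^sub>R norm (F (\<Phi> x)))" by simp
   finally show "norm (opr x (F (\<Phi> x))) <= norm (c *\<^sub>R norm (F (\<Phi> x)))" .
  qed
 qed
 have jm: "(%y. 1 / det (A (\<Psi> y))) \<in> borel_measurable \<Lambda>"
  by (rule measurable_borel_subsets[OF \<Lambda>(2) Ub borel_measurable_continuous_onI[OF diffeo_jac_continuous(1)[OF d]]])
 have \<Psi>b: "\<Psi> \<in> borel_measurable \<Lambda>"
  by (rule measurable_borel_subsets[OF \<Lambda>(2) Ub borel_measurable_continuous_onI[OF diffeoD(8)[OF d]]])
 show m2: "(%y. (1 / det (A (\<Psi> y))) *\<^sub>R opr (\<Psi> y) (g y)) \<in> borel_measurable \<Lambda>"
  by (intro borel_measurable_scaleR jm borel_measurable_op[OF cont \<Psi>b gm])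
 have "compact ((%y. 1 / det (A (\<Psi> y))) ` closure U)"
  using U(2) by (intro compact_continuous_image continuous_on_subset[OF diffeo_jac_continuous(1)[OF d]]) auto
 then obtain B where B: "!!y. y \<in> closure U ==> norm (1 / det (A (\<Psi> y))) <= B"
  using compact_imp_bounded[of "(%y. 1 / det (A (\<Psi> y))) ` closure U"] unfolding bounded_iff by blast
 show i2: "integrable \<Lambda> (%y. (1 / det (A (\<Psi> y))) *\<^sub>R opr (\<Psi> y) (g y))"
 proof (rule bint_bound[OF _ m2, of "%y. (\<bar>B\<bar> * \<bar>c\<bar>) *\<^sub>R norm (g y)"])
  show "integrable \<Lambda> (%y. (\<bar>B\<bar> * \<bar>c\<bar>) *\<^sub>R norm (g y))" by (intro integrable_scaleR_right integrable_norm g)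
  show "AE y in \<Lambda>. norm ((1 / det (A (\<Psi> y))) *\<^sub>R opr (\<Psi> y) (g y)) <= norm ((\<bar>B\<bar> * \<bar>c\<bar>) *\<^sub>R norm (g y))"
  proof (rule AE_I2)
   fix y assume y: "y \<in> space \<Lambda>"
   have "norm (1 / det (A (\<Psi> y))) <= \<bar>B\<bar>" using B[of y] y closure_subset[of U] by (auto simp: sp\<Lambda>)
   moreover have "norm (opr (\<Psi> y) (g y)) <= \<bar>c\<bar> * norm (g y)"
   proof -
    have "norm (opr (\<Psi> y) (g y)) <= c * norm (g y)" using y diffeoD(4)[OF d] bd by (simp add: sp\<Lambda>)
    also have "... <= \<bar>c\<bar> * norm (g y)" by (intro mult_right_mono) auto
    finally show ?thesis .
   qed
   ultimately have "norm (1 / det (A (\<Psi> y))) * norm (opr (\<Psi> y) (g y)) <= \<bar>B\<bar> * (\<bar>c\<bar> * norm (g y))"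
    by (intro mult_mono) auto
   then show "norm ((1 / det (A (\<Psi> y))) *\<^sub>R opr (\<Psi> y) (g y)) <= norm ((\<bar>B\<bar> * \<bar>c\<bar>) *\<^sub>R norm (g y))"
    by (simp add: abs_mult mult.assoc)
  qed
 qed
 have sP: "sets (push U \<Lambda> \<Psi>) = borel_subsets U" by (simp add: push_def borel_subsets_restrict[OF Ub])
 show m3: "(%x. (1 / det (A x)) *\<^sub>R opr x (g (\<Phi> x))) \<in> borel_measurable (push U \<Lambda> \<Psi>)"
 proof -
  have "(%x. (1 / det (A x)) *\<^sub>R opr x (g (\<Phi> x))) \<in> borel_measurable (restrict_space borel U)"
  proof (intro borel_measurable_scaleR borel_measurable_op[OF cont])
   show "(%x. 1 / det (A x)) \<in> borel_measurable (restrict_space borel U)"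
    by (intro measurable_restrict_space1 borel_measurable_continuous_onI diffeo_jac_continuous(2)[OF d])
   show "(%x. x) \<in> borel_measurable (restrict_space borel U)" by (intro measurable_restrict_space1) simp
   show "(%x. g (\<Phi> x)) \<in> borel_measurable (restrict_space borel U)" by (rule measurable_compose[OF \<Phi>m gm])
  qed
  then show ?thesis by (simp add: push_def)
 qed
 have i3: "integrable (push U \<Lambda> \<Psi>) (%x. (1 / det (A x)) *\<^sub>R opr x (g (\<Phi> x)))"
 proof -
  have mm: "(%x. (1 / det (A x)) *\<^sub>R opr x (g (\<Phi> x))) \<in> borel_measurable (restrict_space borel U)"
   using m3 by (simp add: push_def)
  show ?thesis unfolding push_def integrable_distr_eq[OF \<Psi>m mm] using i2 by (simp add: diffeoD(2)[OF d])
 qed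
 have pre: "\<Psi> -` (\<Phi> -` X \<inter> U) \<inter> U = X" if "X \<subseteq> U" for X
  using that diffeoD(2,4)[OF d] by auto
 have sub: "N \<subseteq> U" using N(1) by (simp add: borel_subsets_def)
 have N': "\<Phi> -` N \<inter> U \<in> borel_subsets U"
  using measurable_sets[OF \<Phi>m, of N] N(1) \<Lambda>(2) by (simp add: borel_subsets_restrict[OF Ub] space_restrict_space)
 have N'1: "emeasure lborel (\<Phi> -` N \<inter> U) = 0"
 proof -
  note D = diffeo_measure[OF U d]
  have NL: "N \<in> sets (Leb U)" using N(1) U by (auto simp: borel_subsets_def sets_restrict_space_iff)
  have "emeasure lborel (\<Phi> -` N \<inter> U) = emeasure (Leb U) (\<Phi> -` N \<inter> U)"
   using N' U by (subst emeasure_restrict_space) (auto simp: borel_subsets_def)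
  also have "... = emeasure (distr (Leb U) (Leb U) \<Phi>) N"
   using emeasure_distr[OF D(1) NL] by simp
  also have "... = (\<integral>\<^sup>+y. ennreal (1 / det (A (\<Psi> y))) * indicator N y \<partial>Leb U)"
   unfolding D(2) using continuous_lebesgue_on[OF diffeo_jac_continuous(1)[OF d]] NL by (intro emeasure_density) auto
  also have "... = (\<integral>\<^sup>+y. 0 \<partial>Leb U)"
  proof (rule nn_integral_cong_AE)
   have "emeasure (Leb U) N = 0"
    using N sub U by (subst emeasure_restrict_space) (auto simp: borel_subsets_def)
   then have "AE y in Leb U. y \<notin> N" using NL by (intro AE_not_in) auto
   then show "AE y in Leb U. ennreal (1 / det (A (\<Psi> y))) * indicator N y = 0" by eventually_elim auto
  qed
  finally show ?thesis by simp
 qed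
 have N'2: "emeasure (push U \<Lambda> \<Psi>) (U - \<Phi> -` N \<inter> U) = 0"
 proof -
  have eq: "U - \<Phi> -` N \<inter> U = \<Phi> -` (U - N) \<inter> U" using diffeoD(3)[OF d] by auto
  have "\<Phi> -` (U - N) \<inter> U \<in> sets (restrict_space borel U)"
   using measurable_sets[OF \<Phi>m, of "U - N"] N(1) \<Lambda>(2) Ub by (auto simp: borel_subsets_def space_restrict_space)
  then show ?thesis
   using emeasure_distr[OF \<Psi>m] pre[of "U - N"] N(3) unfolding push_def eq by (simp add: sp\<Lambda>)
 qed
 have fm: "finite_measure (push U \<Lambda> \<Psi>)"
  unfolding push_def by (rule finite_measure.finite_measure_distr[OF \<Lambda>(1) \<Psi>m])
 show "decomp U (%x. opr x (F (\<Phi> x)) + h x) (push U \<Lambda> \<Psi>) (\<Phi> -` N \<inter> U) (%x. (1 / det (A x)) *\<^sub>R opr x (g (\<Phi> x)))"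
  unfolding decomp_def using fm sP N' N'1 N'2 i3 bint_add[OF int1 h] by blast
qed

text \<open>An operator that acts pointwise and linearly on the values can be moved to the test function,
  entry by entry; \<open>opr\<close> covers right multiplication by \<open>A\<close> as well as
  congruence by \<open>A\<close>.\<close>

lemma represents_transport:
 fixes opr :: "real^'m => 'v::euclidean_space => 'w::euclidean_space"
 assumes U: "open U" "bounded U" and d: "diffeo U \<Phi> A \<Psi>" and dec: "decomp U F \<Lambda> N g"
  and cont: "continuous_on UNIV (%(x, M). opr x M)"
  and bd: "\<forall>x\<in>U. \<forall>M. norm (opr x M) <= c * norm M"
  and lin: "!!x. linear (opr x)"
  and h: "integrable (Leb U) h"
  and T: "represents U T (dmeas U F \<Lambda> g)"
  and \<zeta>: "!!\<psi> b a. \<psi> \<in> test_functions U ==> b \<in> Basis ==> a \<in> Basis ==>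
   (%y. \<psi> (\<Psi> y) * (opr (\<Psi> y) a \<bullet> b) / det (A (\<Psi> y))) \<in> test_functions U"
  and T': "!!\<psi> b. \<psi> \<in> test_functions U ==> b \<in> Basis ==> T' \<psi> \<bullet> b =
   (\<Sum>a\<in>Basis. T (%y. \<psi> (\<Psi> y) * (opr (\<Psi> y) a \<bullet> b) / det (A (\<Psi> y))) \<bullet> a) + (LINT x|Leb U. \<psi> x * (h x \<bullet> b))"
 shows "represents U T' (dmeas U (%x. opr x (F (\<Phi> x)) + h x) (push U \<Lambda> \<Psi>) (%x. (1 / det (A x)) *\<^sub>R opr x (g (\<Phi> x))))"
proof -
 have Ub: "U \<in> sets borel" using U by simp
 have F: "integrable (Leb U) F" and \<Lambda>: "finite_measure \<Lambda>" "sets \<Lambda> = borel_subsets U" and g: "integrable \<Lambda> g"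
  using dec unfolding decomp_def by auto
 note dt = decomp_transport[OF U d dec cont bd h]
 note \<Psi>m = measurable_diffeo_inverse[OF U(1) d \<Lambda>(2)]
 have expand: "(\<Sum>a\<in>Basis. (s * (opr x a \<bullet> b) / t) * (M \<bullet> a)) = s * (opr x M \<bullet> b) / t" for s t x M b
 proof -
  have "opr x M = opr x (\<Sum>a\<in>Basis. (M \<bullet> a) *\<^sub>R a)" by (simp add: euclidean_representation)
  also have "... = (\<Sum>a\<in>Basis. (M \<bullet> a) *\<^sub>R opr x a)"
   using lin[of x] by (simp add: linear_sum linear_cmul)
  finally show ?thesis by (simp add: inner_sum_left sum_distrib_left sum_divide_distrib mult_ac)
 qed
 have "T' \<psi> = (LINT x|Leb U. \<psi> x *\<^sub>R (opr x (F (\<Phi> x)) + h x)) +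
   (LINT x|push U \<Lambda> \<Psi>. \<psi> x *\<^sub>R (1 / det (A x)) *\<^sub>R opr x (g (\<Phi> x)))" (is "_ = ?R1 + ?R2")
  if \<psi>: "\<psi> \<in> test_functions U" for \<psi>
 proof (rule euclidean_eqI)
  fix b :: 'w assume b: "b \<in> Basis"
  obtain B where B: "!!x. norm (\<psi> x) <= B" using bounded_test[OF \<psi>] by blast
  have \<psi>L: "\<psi> \<in> borel_measurable (Leb U)" by (rule borel_lebesgue_on[OF test_borel_measurable[OF \<psi>]])
  have \<psi>P: "\<psi> \<in> borel_measurable (push U \<Lambda> \<Psi>)"
   using measurable_restrict_space1[OF test_borel_measurable[OF \<psi>], of U] by (simp add: push_def)
  let ?\<zeta> = "%a y. \<psi> (\<Psi> y) * (opr (\<Psi> y) a \<bullet> b) / det (A (\<Psi> y))"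
  have zt: "?\<zeta> a \<in> test_functions U" if "a \<in> Basis" for a by (rule \<zeta>[OF \<psi> b that])
  have Ta: "T (?\<zeta> a) \<bullet> a = (LINT y|Leb U. ?\<zeta> a y * (F y \<bullet> a)) + (LINT y|\<Lambda>. ?\<zeta> a y * (g y \<bullet> a))"
   and ia: "integrable (Leb U) (%y. ?\<zeta> a y * (F y \<bullet> a))" "integrable \<Lambda> (%y. ?\<zeta> a y * (g y \<bullet> a))"
   if a: "a \<in> Basis" for a
  proof -
   obtain C where C: "!!x. norm (?\<zeta> a x) <= C" using bounded_test[OF zt[OF a]] by blast
   have i1: "integrable (Leb U) (%y. ?\<zeta> a y *\<^sub>R F y)"
    by (rule integrable_test_scaleR[OF F borel_lebesgue_on[OF test_borel_measurable[OF zt[OF a]]] C])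
   have i2: "integrable \<Lambda> (%y. ?\<zeta> a y *\<^sub>R g y)"
    by (rule integrable_test_scaleR[OF g measurable_borel_subsets[OF \<Lambda>(2) Ub test_borel_measurable[OF zt[OF a]]] C])
   show "integrable (Leb U) (%y. ?\<zeta> a y * (F y \<bullet> a))" "integrable \<Lambda> (%y. ?\<zeta> a y * (g y \<bullet> a))"
    using integrable_inner_left[OF i1, of a] integrable_inner_left[OF i2, of a] by simp_all
   have "T (?\<zeta> a) = (LINT y|Leb U. ?\<zeta> a y *\<^sub>R F y) + (LINT y|\<Lambda>. ?\<zeta> a y *\<^sub>R g y)"
    using T zt[OF a] unfolding represents_dmeas[OF U dec] by blast
   then show "T (?\<zeta> a) \<bullet> a = (LINT y|Leb U. ?\<zeta> a y * (F y \<bullet> a)) + (LINT y|\<Lambda>. ?\<zeta> a y * (g y \<bullet> a))"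
    using integral_inner_left[OF i1, of a] integral_inner_left[OF i2, of a] by (simp add: inner_add_left)
  qed
  have "(\<Sum>a\<in>Basis. T (?\<zeta> a) \<bullet> a) = (LINT y|Leb U. (\<Sum>a\<in>Basis. ?\<zeta> a y * (F y \<bullet> a))) + (LINT y|\<Lambda>. (\<Sum>a\<in>Basis. ?\<zeta> a y * (g y \<bullet> a)))"
   using ia by (simp add: Ta sum.distrib bint_of_sum)
  also have "(LINT y|Leb U. (\<Sum>a\<in>Basis. ?\<zeta> a y * (F y \<bullet> a))) = (LINT y|Leb U. (1 / det (A (\<Psi> y))) *\<^sub>R (\<psi> (\<Psi> y) * (opr (\<Psi> y) (F y) \<bullet> b)))"
   unfolding expand by simp
  also have "... = (LINT x|Leb U. \<psi> (\<Psi> (\<Phi> x)) * (opr (\<Psi> (\<Phi> x)) (F (\<Phi> x)) \<bullet> b))"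
  proof (rule integral_diffeo(2)[OF U d, symmetric])
   have 1: "(%y. \<psi> (\<Psi> y)) \<in> borel_measurable (Leb U)"
    by (intro continuous_lebesgue_on smooth_continuous smooth_diffeo_inverse[OF d test_functionsD(1)[OF \<psi>]])
   have 2: "(%y. opr (\<Psi> y) (F y)) \<in> borel_measurable (Leb U)"
    by (rule borel_measurable_op[OF cont continuous_lebesgue_on[OF diffeoD(8)[OF d]] borel_measurable_integrable[OF F]])
   show "(%y. \<psi> (\<Psi> y) * (opr (\<Psi> y) (F y) \<bullet> b)) \<in> borel_measurable (Leb U)"
    using 1 2 by measurable
  qed
  also have "... = (LINT x|Leb U. \<psi> x * (opr x (F (\<Phi> x)) \<bullet> b))" by (simp add: diffeoD(1)[OF d])
  finally have S: "(\<Sum>a\<in>Basis. T (?\<zeta> a) \<bullet> a) = (LINT x|Leb U. \<psi> x * (opr x (F (\<Phi> x)) \<bullet> b)) +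
    (LINT y|\<Lambda>. \<psi> (\<Psi> y) * (opr (\<Psi> y) (g y) \<bullet> b) / det (A (\<Psi> y)))"
   unfolding expand .
  note i1 = integrable_test_scaleR[OF dt(5) \<psi>L B] and i2 = integrable_test_scaleR[OF h \<psi>L B]
  have R1: "?R1 \<bullet> b = (LINT x|Leb U. \<psi> x * (opr x (F (\<Phi> x)) \<bullet> b)) + (LINT x|Leb U. \<psi> x * (h x \<bullet> b))"
   using integral_inner_left[OF i1, of b] integral_inner_left[OF i2, of b] i1 i2
   by (simp add: scaleR_add_right inner_add_left)
  have "integrable (push U \<Lambda> \<Psi>) (%x. (1 / det (A x)) *\<^sub>R opr x (g (\<Phi> x)))" using dt(1) unfolding decomp_def by blast
  note i3 = integrable_test_scaleR[OF this \<psi>P B]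
  have "?R2 \<bullet> b = (LINT x|push U \<Lambda> \<Psi>. \<psi> x * (opr x (g (\<Phi> x)) \<bullet> b) / det (A x))"
   using integral_inner_left[OF i3, of b] by simp
  also have "... = (LINT y|\<Lambda>. \<psi> (\<Psi> y) * (opr (\<Psi> y) (g (\<Phi> (\<Psi> y))) \<bullet> b) / det (A (\<Psi> y)))"
   unfolding push_def
  proof (rule integral_distr[OF \<Psi>m])
   have "(%x. (\<psi> x *\<^sub>R (1 / det (A x)) *\<^sub>R opr x (g (\<Phi> x))) \<bullet> b) \<in> borel_measurable (push U \<Lambda> \<Psi>)"
    using borel_measurable_integrable[OF i3] by measurable
   then show "(%x. \<psi> x * (opr x (g (\<Phi> x)) \<bullet> b) / det (A x)) \<in> borel_measurable (restrict_space borel U)"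
    by (simp add: push_def)
  qed
  finally have R2: "?R2 \<bullet> b = (LINT y|\<Lambda>. \<psi> (\<Psi> y) * (opr (\<Psi> y) (g y) \<bullet> b) / det (A (\<Psi> y)))"
   by (simp only: diffeoD(2)[OF d])
  show "T' \<psi> \<bullet> b = (?R1 + ?R2) \<bullet> b"
   unfolding T'[OF \<psi> b] S inner_add_left R1 R2 by simp
 qed
 then show ?thesis unfolding represents_dmeas[OF U dt(1)] by blast
qed

text \<open>All dependence on the diffeomorphism now sits in smooth factors, while the measures \<open>Leb
  U\<close> and \<open>\<Lambda>\<close> of integration are fixed.\<close>

lemma function_of_measure_transport:
 fixes opr :: "real^'m => 'v::euclidean_space => 'w::euclidean_space"
 assumes U: "open U" "bounded U" and d: "diffeo U \<Phi> A \<Psi>" and dec: "decomp U F \<Lambda> N g"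
  and cont: "continuous_on UNIV (%(x, M). opr x M)"
  and bd: "\<forall>x\<in>U. \<forall>M. norm (opr x M) <= c * norm M"
  and h: "integrable (Leb U) h" and hm: "(%y. h (\<Psi> y)) \<in> borel_measurable (Leb U)"
  and \<rho>: "continuous_on UNIV \<rho>" "!!\<xi>. 0 <= \<rho> \<xi>"
  and r: "recession \<rho> \<in> borel_measurable borel" "!!c \<xi>. 0 <= c ==> recession \<rho> (c *\<^sub>R \<xi>) = ennreal c * recession \<rho> \<xi>"
 shows "function_of_measure U \<rho> (dmeas U (%x. opr x (F (\<Phi> x)) + h x) (push U \<Lambda> \<Psi>) (%x. (1 / det (A x)) *\<^sub>R opr x (g (\<Phi> x)))) U =
  (\<integral>\<^sup>+y. ennreal (1 / det (A (\<Psi> y))) * ennreal (\<rho> (opr (\<Psi> y) (F y) + h (\<Psi> y))) \<partial>Leb U) +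
  (\<integral>\<^sup>+y. ennreal (1 / det (A (\<Psi> y))) * recession \<rho> (opr (\<Psi> y) (g y)) \<partial>\<Lambda>)"
proof -
 have F: "integrable (Leb U) F" and \<Lambda>: "finite_measure \<Lambda>" "sets \<Lambda> = borel_subsets U"
  using dec unfolding decomp_def by auto
 note dt = decomp_transport[OF U d dec cont bd h]
 note \<Psi>m = measurable_diffeo_inverse[OF U(1) d \<Lambda>(2)]
 let ?u = "%y. ennreal (\<rho> (opr (\<Psi> y) (F y) + h (\<Psi> y)))"
 have um: "?u \<in> borel_measurable (Leb U)"
 proof -
  have 2: "(%y. opr (\<Psi> y) (F y)) \<in> borel_measurable (Leb U)"
   by (rule borel_measurable_op[OF cont continuous_lebesgue_on[OF diffeoD(8)[OF d]] borel_measurable_integrable[OF F]])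
  have "\<rho> \<in> borel_measurable borel" by (rule borel_measurable_continuous_onI[OF \<rho>(1)])
  then show ?thesis using 2 hm by measurable
 qed
 have 1: "(\<integral>\<^sup>+x. ennreal (\<rho> (opr x (F (\<Phi> x)) + h x)) \<partial>Leb U) =
   (\<integral>\<^sup>+y. ennreal (1 / det (A (\<Psi> y))) * ?u y \<partial>Leb U)"
  using nn_integral_diffeo[OF U d um] by (simp add: diffeoD(1)[OF d])
 have "(%x. recession \<rho> ((1 / det (A x)) *\<^sub>R opr x (g (\<Phi> x)))) \<in> borel_measurable (distr \<Lambda> (restrict_space borel U) \<Psi>)"
  using measurable_compose[OF dt(4) r(1)] by (simp add: push_def)
 then have "(\<integral>\<^sup>+x. recession \<rho> ((1 / det (A x)) *\<^sub>R opr x (g (\<Phi> x))) \<partial>push U \<Lambda> \<Psi>) =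
   (\<integral>\<^sup>+y. recession \<rho> ((1 / det (A (\<Psi> y))) *\<^sub>R opr (\<Psi> y) (g (\<Phi> (\<Psi> y)))) \<partial>\<Lambda>)"
  unfolding push_def by (rule nn_integral_distr[OF \<Psi>m])
 also have "... = (\<integral>\<^sup>+y. ennreal (1 / det (A (\<Psi> y))) * recession \<rho> (opr (\<Psi> y) (g y)) \<partial>\<Lambda>)"
  using diffeoD(7)[OF d] by (simp add: diffeoD(2)[OF d] r(2) less_imp_le)
 finally have 2: "(\<integral>\<^sup>+x. recession \<rho> ((1 / det (A x)) *\<^sub>R opr x (g (\<Phi> x))) \<partial>push U \<Lambda> \<Psi>) =
   (\<integral>\<^sup>+y. ennreal (1 / det (A (\<Psi> y))) * recession \<rho> (opr (\<Psi> y) (g y)) \<partial>\<Lambda>)" .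
 have "function_of_measure U \<rho> (dmeas U (%x. opr x (F (\<Phi> x)) + h x) (push U \<Lambda> \<Psi>) (%x. (1 / det (A x)) *\<^sub>R opr x (g (\<Phi> x)))) U =
   (\<integral>\<^sup>+x. ennreal (\<rho> (opr x (F (\<Phi> x)) + h x)) \<partial>Leb U) +
   (\<integral>\<^sup>+x. recession \<rho> ((1 / det (A x)) *\<^sub>R opr x (g (\<Phi> x))) \<partial>push U \<Lambda> \<Psi>)"
  by (rule function_of_measure_dmeas[OF U dt(1)]) (use r in auto)
 then show ?thesis unfolding 1 2 .
qed

section \<open>Recession functions\<close>

text \<open>The difference quotient \<open>(\<rho> (t \<xi>) - \<rho> 0) / t\<close> is monotone in
  \<open>t\<close> by convexity, so the limit exists in the extended numbers.\<close>

lemma recession_tendsto: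
 fixes \<rho> :: "'v::real_vector => real"
 assumes conv: "convex_on UNIV \<rho>" and nn: "!!\<xi>. 0 <= \<rho> \<xi>"
 shows "((%t::real. ennreal (\<rho> (t *\<^sub>R \<xi>) / t)) \<longlongrightarrow> recession \<rho> \<xi>) at_top"
proof -
 define q where "q t = (\<rho> (t *\<^sub>R \<xi>) - \<rho> 0) / t" for t
 have mono: "q s <= q t" if "0 < s" "s <= t" for s t
 proof -
  have t: "t > 0" using that by simp
  have "\<rho> ((1 - s / t) *\<^sub>R 0 + (s / t) *\<^sub>R (t *\<^sub>R \<xi>)) <= (1 - s / t) * \<rho> 0 + (s / t) * \<rho> (t *\<^sub>R \<xi>)"
   using that by (intro convex_onD[OF conv]) auto
  then have "\<rho> (s *\<^sub>R \<xi>) - \<rho> 0 <= (s / t) * (\<rho> (t *\<^sub>R \<xi>) - \<rho> 0)"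
   using t by (simp add: algebra_simps)
  then have "(\<rho> (s *\<^sub>R \<xi>) - \<rho> 0) / s <= ((s / t) * (\<rho> (t *\<^sub>R \<xi>) - \<rho> 0)) / s"
   using that by (intro divide_right_mono) auto
  then show ?thesis using that by (simp add: q_def)
 qed
 define S where "S = (SUP t\<in>{0<..}. ennreal (q t))"
 have limq: "((%t. ennreal (q t)) \<longlongrightarrow> S) at_top"
 proof (rule increasing_tendsto)
  show "\<forall>\<^sub>F t in at_top. ennreal (q t) <= S"
   using eventually_gt_at_top[of "0::real"] by eventually_elim (auto simp: S_def intro: SUP_upper)
  fix y assume "y < S"
  then obtain s where s: "s > 0" "y < ennreal (q s)" unfolding S_def less_SUP_iff by auto
  show "\<forall>\<^sub>F t in at_top. y < ennreal (q t)"
   using eventually_ge_at_top[of s]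
  proof eventually_elim
   case (elim t)
   have "ennreal (q s) <= ennreal (q t)" by (rule ennreal_leI[OF mono[OF s(1) elim]])
   then show ?case using s(2) by (rule less_le_trans[rotated])
  qed
 qed
 have lim0: "((%t. ennreal (\<rho> 0 / t)) \<longlongrightarrow> 0) at_top"
 proof -
  have "((%t::real. \<rho> 0 / t) \<longlongrightarrow> 0) at_top"
   by (intro tendsto_divide_0[OF tendsto_const] filterlim_at_top_imp_at_infinity filterlim_ident)
  then show ?thesis using tendsto_ennrealI by fastforce
 qed
 have "((%t::real. ennreal (\<rho> (t *\<^sub>R \<xi>) / t)) \<longlongrightarrow> S) at_top"
 proof (rule tendsto_sandwich)
  show "((%t. ennreal (q t)) \<longlongrightarrow> S) at_top" by (rule limq)
  show "((%t. ennreal (q t) + ennreal (\<rho> 0 / t)) \<longlongrightarrow> S) at_top"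
   using tendsto_add[OF limq lim0] by simp
  show "\<forall>\<^sub>F t in at_top. ennreal (q t) <= ennreal (\<rho> (t *\<^sub>R \<xi>) / t)"
   using eventually_gt_at_top[of "0::real"]
   by eventually_elim (auto simp: q_def nn intro!: ennreal_leI divide_right_mono)
  show "\<forall>\<^sub>F t in at_top. ennreal (\<rho> (t *\<^sub>R \<xi>) / t) <= ennreal (q t) + ennreal (\<rho> 0 / t)"
   using eventually_gt_at_top[of "0::real"]
  proof eventually_elim
   case (elim t)
   have "\<rho> (t *\<^sub>R \<xi>) / t = q t + \<rho> 0 / t" by (simp add: q_def diff_divide_distrib)
   then show ?case using ennreal_plus_le[of "q t" "\<rho> 0 / t"] by simp
  qed
 qed
 then show ?thesis unfolding recession_def using tendsto_Lim[OF trivial_limit_at_top_linorder] by metis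
qed

lemma recession_unique:
 fixes \<rho> :: "'v::real_vector => real"
 assumes "convex_on UNIV \<rho>" "!!\<xi>. 0 <= \<rho> \<xi>"
  and "((%t::real. ennreal (\<rho> (t *\<^sub>R \<xi>) / t)) \<longlongrightarrow> L) at_top"
 shows "recession \<rho> \<xi> = L"
 using tendsto_unique[OF trivial_limit_at_top_linorder recession_tendsto[OF assms(1,2)] assms(3)] .

lemma recession_scale:
 fixes \<rho> :: "'v::real_vector => real"
 assumes conv: "convex_on UNIV \<rho>" and nn: "!!\<xi>. 0 <= \<rho> \<xi>" and c: "0 <= c"
 shows "recession \<rho> (c *\<^sub>R \<xi>) = ennreal c * recession \<rho> \<xi>"
proof (cases "c = 0")
 case True
 have "((%t::real. \<rho> 0 / t) \<longlongrightarrow> 0) at_top"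
  by (intro tendsto_divide_0[OF tendsto_const] filterlim_at_top_imp_at_infinity filterlim_ident)
 then have "((%t. ennreal (\<rho> 0 / t)) \<longlongrightarrow> 0) at_top" using tendsto_ennrealI by fastforce
 then have "recession \<rho> 0 = 0" by (intro recession_unique[OF conv nn]) simp
 then show ?thesis using True by simp
next
 case False
 then have c: "c > 0" using c by simp
 have fl: "filterlim (%t::real. t * c) at_top at_top"
  using c by (intro filterlim_at_top_mult_tendsto_pos[OF tendsto_const c filterlim_ident])
 have "((%t. ennreal c * ennreal (\<rho> ((t * c) *\<^sub>R \<xi>) / (t * c))) \<longlongrightarrow> ennreal c * recession \<rho> \<xi>) at_top"
  by (intro ennreal_tendsto_cmult filterlim_compose[OF recession_tendsto[OF conv nn] fl]) simp
 moreover have "\<forall>\<^sub>F t in at_top. ennreal c * ennreal (\<rho> ((t * c) *\<^sub>R \<xi>) / (t * c)) = ennreal (\<rho> (t *\<^sub>R (c *\<^sub>R \<xi>)) / t)"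
  using eventually_gt_at_top[of "0::real"]
 proof eventually_elim
  case (elim t)
  then show ?case using c nn by (subst ennreal_mult[symmetric]) auto
 qed
 ultimately have "((%t. ennreal (\<rho> (t *\<^sub>R (c *\<^sub>R \<xi>)) / t)) \<longlongrightarrow> ennreal c * recession \<rho> \<xi>) at_top"
  by (rule Lim_transform_eventually)
 then show ?thesis by (rule recession_unique[OF conv nn])
qed

lemma recession_0: "convex_on UNIV \<rho> ==> (!!\<xi>. 0 <= \<rho> \<xi>) ==> recession \<rho> 0 = 0"
 using recession_scale[of \<rho> 0 0] by simp

lemma recession_measurable:
 fixes \<rho> :: "'v::euclidean_space => real"
 assumes conv: "convex_on UNIV \<rho>" and nn: "!!\<xi>. 0 <= \<rho> \<xi>"
 shows "recession \<rho> \<in> borel_measurable borel"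
proof (rule borel_measurable_LIMSEQ_order)
 have c: "continuous_on UNIV \<rho>" using convex_on_continuous[OF open_UNIV conv] .
 show "(%\<xi>. ennreal (\<rho> (real n *\<^sub>R \<xi>) / real n)) \<in> borel_measurable borel" for n
  by (intro measurable_compose[OF _ measurable_ennreal] borel_measurable_continuous_onI)
   (cases "n = 0"; auto intro!: continuous_intros continuous_on_compose2[OF c])
 show "(%n. ennreal (\<rho> (real n *\<^sub>R \<xi>) / real n)) \<longlonglongrightarrow> recession \<rho> \<xi>" for \<xi>
  by (rule filterlim_compose[OF recession_tendsto[OF conv nn] filterlim_real_sequentially])
qed

lemma recession_linear_growth:
 fixes \<rho> :: "'v::real_normed_vector => real"
 assumes conv: "convex_on UNIV \<rho>" and nn: "!!\<xi>. 0 <= \<rho> \<xi>" and gr: "!!\<xi>. \<rho> \<xi> <= C * (1 + norm \<xi>)"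
 shows "recession \<rho> \<xi> = ennreal (enn2real (recession \<rho> \<xi>))" "enn2real (recession \<rho> \<xi>) <= C * norm \<xi>"
  "convex_on UNIV (%\<xi>. enn2real (recession \<rho> \<xi>))"
proof -
 have C: "0 <= C" using gr[of 0] nn[of 0] by simp
 have lc: "((%t::real. C / t + C * norm \<xi>) \<longlongrightarrow> C * norm \<xi>) at_top" for \<xi> :: 'v
 proof -
  have "((%t::real. C / t) \<longlongrightarrow> 0) at_top"
   by (intro tendsto_divide_0[OF tendsto_const] filterlim_at_top_imp_at_infinity filterlim_ident)
  from tendsto_add[OF this tendsto_const] show ?thesis by simp
 qed
 have le: "recession \<rho> \<xi> <= ennreal (C * norm \<xi>)" for \<xi>
 proof (rule tendsto_le[OF trivial_limit_at_top_linorder tendsto_ennrealI[OF lc] recession_tendsto[OF conv nn]])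
  show "\<forall>\<^sub>F t in at_top. ennreal (\<rho> (t *\<^sub>R \<xi>) / t) <= ennreal (C / t + C * norm \<xi>)"
   using eventually_gt_at_top[of "0::real"]
  proof eventually_elim
   case (elim t)
   have "\<rho> (t *\<^sub>R \<xi>) / t <= C * (1 + norm (t *\<^sub>R \<xi>)) / t" using elim by (intro divide_right_mono gr) auto
   also have "... = C / t + C * norm \<xi>" using elim by (simp add: field_simps)
   finally show ?case by (rule ennreal_leI)
  qed
 qed
 have fin: "recession \<rho> \<xi> \<noteq> \<infinity>" for \<xi> using le[of \<xi>] by (auto simp: top_unique)
 then show eq: "recession \<rho> \<xi> = ennreal (enn2real (recession \<rho> \<xi>))" for \<xi> by (simp add: less_top)
 show "enn2real (recession \<rho> \<xi>) <= C * norm \<xi>"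
  using enn2real_mono[OF le[of \<xi>]] C by simp
 have lim: "((%t::real. \<rho> (t *\<^sub>R \<xi>) / t) \<longlongrightarrow> enn2real (recession \<rho> \<xi>)) at_top" for \<xi>
 proof -
  have "((%t::real. enn2real (ennreal (\<rho> (t *\<^sub>R \<xi>) / t))) \<longlongrightarrow> enn2real (recession \<rho> \<xi>)) at_top"
   by (rule tendsto_enn2real[OF _ enn2real_nonneg]) (use recession_tendsto[OF conv nn, of \<xi>] eq[of \<xi>] in simp)
  moreover have "\<forall>\<^sub>F t in at_top. enn2real (ennreal (\<rho> (t *\<^sub>R \<xi>) / t)) = \<rho> (t *\<^sub>R \<xi>) / t"
   using eventually_gt_at_top[of "0::real"] by eventually_elim (simp add: nn)
  ultimately show ?thesis by (rule Lim_transform_eventually)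
 qed
 show "convex_on UNIV (%\<xi>. enn2real (recession \<rho> \<xi>))"
 proof (rule convex_onI)
  fix s :: real and x y :: 'v assume s: "0 < s" "s < 1"
  show "enn2real (recession \<rho> ((1 - s) *\<^sub>R x + s *\<^sub>R y)) <= (1 - s) * enn2real (recession \<rho> x) + s * enn2real (recession \<rho> y)"
  proof (rule tendsto_le[OF trivial_limit_at_top_linorder tendsto_add[OF tendsto_mult_left[OF lim] tendsto_mult_left[OF lim]] lim])
   show "\<forall>\<^sub>F t in at_top. \<rho> (t *\<^sub>R ((1 - s) *\<^sub>R x + s *\<^sub>R y)) / t <= (1 - s) * (\<rho> (t *\<^sub>R x) / t) + s * (\<rho> (t *\<^sub>R y) / t)"
    using eventually_gt_at_top[of "0::real"]
   proof eventually_elim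
    case (elim t)
    have "t *\<^sub>R ((1 - s) *\<^sub>R x + s *\<^sub>R y) = (1 - s) *\<^sub>R (t *\<^sub>R x) + s *\<^sub>R (t *\<^sub>R y)"
     by (simp add: scaleR_add_right mult.commute)
    then have "\<rho> (t *\<^sub>R ((1 - s) *\<^sub>R x + s *\<^sub>R y)) <= (1 - s) * \<rho> (t *\<^sub>R x) + s * \<rho> (t *\<^sub>R y)"
     using convex_onD[OF conv, of s "t *\<^sub>R x" "t *\<^sub>R y"] s by simp
    then have "\<rho> (t *\<^sub>R ((1 - s) *\<^sub>R x + s *\<^sub>R y)) / t <= ((1 - s) * \<rho> (t *\<^sub>R x) + s * \<rho> (t *\<^sub>R y)) / t"
     using elim by (intro divide_right_mono) auto
    then show ?case by (simp add: add_divide_distrib)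
   qed
  qed
 qed simp
qed

lemma recession_superlinear:
 fixes \<rho> :: "'v::real_normed_vector => real"
 assumes conv: "convex_on UNIV \<rho>" and nn: "!!\<xi>. 0 <= \<rho> \<xi>"
  and p: "p > 1" and C: "C > 0" and gr: "!!\<xi>. C * (norm \<xi> powr p - 1) <= \<rho> \<xi>" and \<xi>: "\<xi> \<noteq> 0"
 shows "recession \<rho> \<xi> = \<infinity>"
proof (rule recession_unique[OF conv nn])
 have n: "norm \<xi> > 0" using \<xi> by simp
 have "filterlim (%t::real. t powr (p - 1)) at_top at_top"
  using p by real_asymp
 then have "filterlim (%t::real. C * norm \<xi> powr p * t powr (p - 1)) at_top at_top"
  using C n by (intro filterlim_tendsto_pos_mult_at_top[OF tendsto_const]) auto
 then have f: "filterlim (%t::real. C * norm \<xi> powr p * t powr (p - 1) + (- C)) at_top at_top"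
  by (subst add.commute) (rule filterlim_tendsto_add_at_top[OF tendsto_const])
 have "filterlim (%t::real. \<rho> (t *\<^sub>R \<xi>) / t) at_top at_top"
 proof (rule filterlim_at_top_mono[OF f])
  show "\<forall>\<^sub>F t in at_top. C * norm \<xi> powr p * t powr (p - 1) + (- C) <= \<rho> (t *\<^sub>R \<xi>) / t"
   using eventually_ge_at_top[of "1::real"]
  proof eventually_elim
   case (elim t)
   have e: "norm (t *\<^sub>R \<xi>) powr p = t * (norm \<xi> powr p * t powr (p - 1))"
    using elim n by (simp add: powr_mult powr_diff)
   have "C * norm \<xi> powr p * t powr (p - 1) + (- C) <= C * norm \<xi> powr p * t powr (p - 1) - C / t"
    using elim C by (simp add: divide_le_eq)
   also have "... = C * (norm (t *\<^sub>R \<xi>) powr p - 1) / t" unfolding e using elim by (simp add: field_simps)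
   also have "... <= \<rho> (t *\<^sub>R \<xi>) / t" using elim by (intro divide_right_mono gr) auto
   finally show ?case .
  qed
 qed
 then show "((%t::real. ennreal (\<rho> (t *\<^sub>R \<xi>) / t)) \<longlongrightarrow> \<infinity>) at_top"
  by (simp add: ennreal_tendsto_top_eq_at_top)
qed

section \<open>Differentiation under the integral sign\<close>

text \<open>This bounds the increment by \<open>|t|\<close> times values of \<open>\<rho>\<close> itself;
  with the growth condition it provides the integrable majorant for differentiation under the
  integral sign.\<close>

lemma convex_increment_bound:
 fixes \<rho> :: "'v::real_vector => real"
 assumes conv: "convex_on UNIV \<rho>" and nn: "!!\<xi>. 0 <= \<rho> \<xi>" and t: "abs t <= 1"
 shows "\<bar>\<rho> (a + t *\<^sub>R v) - \<rho> a\<bar> <= abs t * (\<rho> (a + v) + \<rho> (a - v))"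
proof -
 have pos: "\<bar>\<rho> (a + s *\<^sub>R v) - \<rho> a\<bar> <= s * (\<rho> (a + v) + \<rho> (a - v))" if s: "0 <= s" "s <= 1" for s v
 proof -
  have "\<rho> ((1 - s) *\<^sub>R a + s *\<^sub>R (a + v)) <= (1 - s) * \<rho> a + s * \<rho> (a + v)"
   using s by (intro convex_onD[OF conv]) auto
  moreover have "(1 - s) *\<^sub>R a + s *\<^sub>R (a + v) = a + s *\<^sub>R v" by (simp add: algebra_simps)
  ultimately have "\<rho> (a + s *\<^sub>R v) - \<rho> a <= s * (\<rho> (a + v) - \<rho> a)" by (simp add: algebra_simps)
  also have "... <= s * (\<rho> (a + v) + \<rho> (a - v))"
   using s nn[of a] nn[of "a - v"] by (intro mult_left_mono) auto
  finally have 1: "\<rho> (a + s *\<^sub>R v) - \<rho> a <= s * (\<rho> (a + v) + \<rho> (a - v))" .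
  \<comment> \<open>\<open>a\<close> divides the segment from \<open>a + s v\<close> to \<open>a - v\<close> in this ratio\<close>
  define u where "u = s / (1 + s)"
  have u: "0 <= u" "u <= 1" using s by (auto simp: u_def)
  have "\<rho> ((1 - u) *\<^sub>R (a + s *\<^sub>R v) + u *\<^sub>R (a - v)) <= (1 - u) * \<rho> (a + s *\<^sub>R v) + u * \<rho> (a - v)"
   using u by (intro convex_onD[OF conv]) auto
  moreover have "(1 - u) *\<^sub>R (a + s *\<^sub>R v) + u *\<^sub>R (a - v) = a + ((1 - u) * s - u) *\<^sub>R v" by (simp add: algebra_simps)
  moreover have "(1 - u) * s - u = 0" using s by (simp add: u_def field_simps)
  ultimately have "\<rho> a <= (1 - u) * \<rho> (a + s *\<^sub>R v) + u * \<rho> (a - v)" by simp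
  then have "(1 + s) * \<rho> a <= (1 + s) * ((1 - u) * \<rho> (a + s *\<^sub>R v) + u * \<rho> (a - v))"
   using s by (intro mult_left_mono) auto
  also have "... = ((1 + s) * (1 - u)) * \<rho> (a + s *\<^sub>R v) + ((1 + s) * u) * \<rho> (a - v)" by (simp add: algebra_simps)
  also have "(1 + s) * (1 - u) = 1" using s by (simp add: u_def field_simps)
  also have "(1 + s) * u = s" using s by (simp add: u_def)
  finally have "\<rho> a - \<rho> (a + s *\<^sub>R v) <= s * (\<rho> (a - v) - \<rho> a)" by (simp add: algebra_simps)
  also have "... <= s * (\<rho> (a + v) + \<rho> (a - v))"
   using s nn[of a] nn[of "a + v"] by (intro mult_left_mono) auto
  finally show ?thesis using 1 by simp
 qed
 show ?thesis
 proof (cases "t \<ge> 0")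
  case True
  then show ?thesis using pos[of t v] t by simp
 next
  case False
  then show ?thesis using pos[of "- t" "- v"] t by (simp add: add.commute)
 qed
qed

text \<open>Only directional differentiability is available. Since \<open>\<rho>\<close> is locally
  Lipschitz, moving the direction from \<open>v\<close> to \<open>V t\<close> changes the value
  by \<open>o(t)\<close>.\<close>

lemma directional_derivative_curve:
 fixes \<rho> :: "'v::euclidean_space => real"
 assumes conv: "convex_on UNIV \<rho>" and nn: "!!\<xi>. 0 <= \<rho> \<xi>"
  and D: "((%t. \<rho> (a + t *\<^sub>R v)) has_real_derivative D) (at 0)" and V: "(V \<longlongrightarrow> v) (at 0)"
 shows "((%t. (\<rho> (a + t *\<^sub>R V t) - \<rho> a) / t) \<longlongrightarrow> D) (at 0)"
proof -
 have c: "continuous_on UNIV \<rho>" using convex_on_continuous[OF open_UNIV conv] .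
 have "compact (\<rho> ` cball a 2)" by (intro compact_continuous_image continuous_on_subset[OF c]) auto
 then obtain B where B: "!!x. x \<in> cball a 2 ==> norm (\<rho> x) <= B"
  using compact_imp_bounded[of "\<rho> ` cball a 2"] unfolding bounded_iff by blast
 \<comment> \<open>a convex function that is bounded on a ball is Lipschitz on a smaller one\<close>
 have lip: "\<bar>\<rho> (x + w) - \<rho> x\<bar> <= norm w * (2 * B)" if x: "x \<in> cball a 1" and w: "norm w <= 1" for x w
 proof (cases "w = 0")
  case False
  let ?u = "(1 / norm w) *\<^sub>R w"
  have nu: "norm ?u = 1" using False by simp
  have "\<bar>\<rho> (x + norm w *\<^sub>R ?u) - \<rho> x\<bar> <= \<bar>norm w\<bar> * (\<rho> (x + ?u) + \<rho> (x - ?u))"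
   by (rule convex_increment_bound[OF conv nn]) (use w in simp)
  also have "... <= \<bar>norm w\<bar> * (B + B)"
  proof (intro mult_left_mono add_mono)
   have "dist a (x + ?u) <= 2" "dist a (x - ?u) <= 2"
    using x nu dist_triangle[of a "x + ?u" x] dist_triangle[of a "x - ?u" x] by (auto simp: dist_norm)
   then show "\<rho> (x + ?u) <= B" "\<rho> (x - ?u) <= B" using B[of "x + ?u"] B[of "x - ?u"] by auto
  qed simp
  finally show ?thesis using False by simp
 qed simp
 have l1: "((%t. (\<rho> (a + t *\<^sub>R v) - \<rho> a) / t) \<longlongrightarrow> D) (at 0)"
  using D by (simp add: DERIV_def)
 have l2: "((%t. (\<rho> (a + t *\<^sub>R V t) - \<rho> (a + t *\<^sub>R v)) / t) \<longlongrightarrow> 0) (at 0)"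
 proof (rule Lim_null_comparison[of _ "%t. norm (V t - v) * (2 * B)"])
  have e1: "\<forall>\<^sub>F t in at 0. norm (t *\<^sub>R v) < 1"
   by (rule order_tendstoD(2)[of _ 0]) (auto intro!: tendsto_eq_intros)
  have e2: "\<forall>\<^sub>F t in at 0. norm (V t - v) < 1"
   by (rule order_tendstoD(2)[of _ 0]) (use V in \<open>auto intro!: tendsto_norm_zero simp: LIM_zero_iff\<close>)
  have e3: "\<forall>\<^sub>F t::real in at 0. abs t < 1"
   by (rule order_tendstoD(2)[of _ 0]) (auto intro!: tendsto_eq_intros)
  have e4: "\<forall>\<^sub>F t::real in at 0. t \<noteq> 0" by (simp add: eventually_at_filter)
  show "\<forall>\<^sub>F t in at 0. norm ((\<rho> (a + t *\<^sub>R V t) - \<rho> (a + t *\<^sub>R v)) / t) <= norm (V t - v) * (2 * B)"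
   using e1 e2 e3 e4
  proof eventually_elim
   case (elim t)
   have "\<bar>\<rho> ((a + t *\<^sub>R v) + t *\<^sub>R (V t - v)) - \<rho> (a + t *\<^sub>R v)\<bar> <= norm (t *\<^sub>R (V t - v)) * (2 * B)"
   proof (rule lip)
    show "a + t *\<^sub>R v \<in> cball a 1" using elim(1) by (simp add: dist_norm)
    have "abs t * norm (V t - v) <= 1 * 1" using elim by (intro mult_mono) auto
    then show "norm (t *\<^sub>R (V t - v)) <= 1" by simp
   qed
   then have "\<bar>\<rho> (a + t *\<^sub>R V t) - \<rho> (a + t *\<^sub>R v)\<bar> <= abs t * (norm (V t - v) * (2 * B))"
    by (simp add: add.assoc flip: scaleR_add_right)
   then show ?case using elim(4) by (simp add: abs_divide divide_le_eq mult.commute)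
  qed
  have "((%t. norm (V t - v)) \<longlongrightarrow> 0) (at 0)" using V by (intro tendsto_norm_zero) (simp add: LIM_zero_iff)
  from tendsto_mult[OF this tendsto_const] show "((%t. norm (V t - v) * (2 * B)) \<longlongrightarrow> 0) (at 0)" by simp
 qed
 have "((%t. (\<rho> (a + t *\<^sub>R v) - \<rho> a) / t + (\<rho> (a + t *\<^sub>R V t) - \<rho> (a + t *\<^sub>R v)) / t) \<longlongrightarrow> D) (at 0)"
  using tendsto_add[OF l1 l2] by simp
 then show ?thesis by (simp add: diff_divide_distrib)
qed

lemma integral_differentiable_at_0:
 fixes f :: "real => 'a => real"
 assumes int0: "integrable M (f 0)" and w: "integrable M w" and t0: "t0 > 0"
  and meas: "!!t. abs t < t0 ==> f t \<in> borel_measurable M"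
  and bnd: "!!t. abs t < t0 ==> AE x in M. \<bar>f t x - f 0 x\<bar> <= abs t * w x"
  and lim: "AE x in M. \<exists>d. ((%t. (f t x - f 0 x) / t) \<longlongrightarrow> d) (at 0)"
 shows "abs t < t0 ==> integrable M (f t)" and "(%t. LINT x|M. f t x) differentiable (at 0)"
proof -
 show int: "integrable M (f t)" if t: "abs t < t0" for t
 proof -
  have "integrable M (%x. f t x - f 0 x)"
  proof (rule bint_bound[of _ "%x. abs t * w x"])
   show "integrable M (%x. abs t * w x)" using w by simp
   show "(%x. f t x - f 0 x) \<in> borel_measurable M" using meas[OF t] int0 by auto
   show "AE x in M. norm (f t x - f 0 x) <= norm (abs t * w x)" using bnd[OF t] by eventually_elim auto
  qed
  from bint_add[OF this int0] show ?thesis by simp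
 qed
 define d where "d x = (if \<exists>d. ((%t. (f t x - f 0 x) / t) \<longlongrightarrow> d) (at 0) then (SOME d. ((%t. (f t x - f 0 x) / t) \<longlongrightarrow> d) (at 0)) else 0)" for x
 have d: "AE x in M. ((%t. (f t x - f 0 x) / t) \<longlongrightarrow> d x) (at 0)"
  using lim by eventually_elim (auto simp: d_def intro: someI_ex)
 \<comment> \<open>measurability of the limit is obtained along a sequence, where limits of measurable functions are measurable\<close>
 define s where "s n = t0 / real (n + 2)" for n
 have s: "0 < s n" "s n < t0" for n using t0 by (auto simp: s_def divide_less_eq intro!: add_pos_nonneg)
 have slim: "filterlim s (at 0) sequentially"
 proof -
  have "(%n. t0 * (1 / real (n + 2))) \<longlonglongrightarrow> t0 * 0"
   by (intro tendsto_mult tendsto_const LIMSEQ_ignore_initial_segment lim_1_over_n)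
  then have "s \<longlonglongrightarrow> 0" by (simp add: s_def[abs_def])
  moreover have "s n \<noteq> 0" for n using s(1)[of n] by simp
  ultimately show ?thesis unfolding filterlim_at by simp
 qed
 define e where "e x = lim (%n. (f (s n) x - f 0 x) / s n)" for x
 have em: "e \<in> borel_measurable M"
  unfolding e_def
 proof (rule borel_measurable_lim_metric)
  show "(%x. (f (s n) x - f 0 x) / s n) \<in> borel_measurable M" for n
   using meas[of "s n"] s[of n] int0 by auto
 qed
 have e: "AE x in M. ((%t. (f t x - f 0 x) / t) \<longlongrightarrow> e x) (at 0)"
  using d
 proof eventually_elim
  case (elim x)
  have "e x = d x" unfolding e_def using filterlim_compose[OF elim slim] by (rule limI)
  then show ?case using elim by simp
 qed
 have "((%t. LINT x|M. (f t x - f 0 x) / t) \<longlongrightarrow> (LINT x|M. e x)) (at 0)"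
 proof (rule tendsto_at_iff_sequentially[THEN iffD2, rule_format])
  fix X :: "nat => real" assume X0: "!!i. X i \<in> UNIV - {0}" and X: "X \<longlonglongrightarrow> 0"
  have Xf: "filterlim X (at 0) sequentially" unfolding filterlim_at using X X0 by simp
  have ev: "\<forall>\<^sub>F n in sequentially. \<bar>X n\<bar> < t0"
   using tendstoD[OF X t0] by (simp add: dist_real_def)
  then obtain n0 where n0: "!!n. n \<ge> n0 ==> \<bar>X n\<bar> < t0" unfolding eventually_sequentially by blast
  have "(%n. LINT x|M. (f (X (n + n0)) x - f 0 x) / X (n + n0)) \<longlonglongrightarrow> (LINT x|M. e x)"
  proof (rule integral_dominated_convergence[OF em _ w])
   show "(%x. (f (X (n + n0)) x - f 0 x) / X (n + n0)) \<in> borel_measurable M" for n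
    using meas[of "X (n + n0)"] n0[of "n + n0"] int0 by auto
   show "AE x in M. (%n. (f (X (n + n0)) x - f 0 x) / X (n + n0)) \<longlonglongrightarrow> e x"
    using e
   proof eventually_elim
    case (elim x)
    show ?case by (rule LIMSEQ_ignore_initial_segment[OF filterlim_compose[OF elim Xf]])
   qed
   show "AE x in M. norm ((f (X (n + n0)) x - f 0 x) / X (n + n0)) <= w x" for n
    using bnd[OF n0[of "n + n0", simplified]]
   proof eventually_elim
    case (elim x)
    then show ?case using X0 by (auto simp: abs_divide divide_le_eq mult.commute)
   qed
  qed
  then show "((%t. LINT x|M. (f t x - f 0 x) / t) \<circ> X) \<longlonglongrightarrow> (LINT x|M. e x)"
   unfolding o_def by (rule LIMSEQ_offset)
 qed
 moreover have "\<forall>\<^sub>F t in at 0. (LINT x|M. (f t x - f 0 x) / t) = ((LINT x|M. f t x) - (LINT x|M. f 0 x)) / t"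
 proof -
  have "\<forall>\<^sub>F t::real in at 0. abs t < t0"
   by (rule order_tendstoD(2)[of _ 0]) (use t0 in \<open>auto intro!: tendsto_eq_intros\<close>)
  then show ?thesis
  proof eventually_elim
   case (elim t)
   show ?case using int[OF elim] int0 by simp
  qed
 qed
 ultimately have "((%t. ((LINT x|M. f t x) - (LINT x|M. f 0 x)) / t) \<longlongrightarrow> (LINT x|M. e x)) (at 0)"
  by (rule Lim_transform_eventually)
 then have "((%t. LINT x|M. f t x) has_real_derivative (LINT x|M. e x)) (at 0)"
  by (simp add: DERIV_def)
 then show "(%t. LINT x|M. f t x) differentiable (at 0)"
  unfolding real_differentiable_def by blast
qed

lemma powr_add_le: "p \<ge> 1 ==> 0 <= a ==> 0 <= b ==> (a + b) powr p <= 2 powr p * (a powr p + b powr p)"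
 for a b p :: real
proof -
 assume p: "p \<ge> 1" "0 <= a" "0 <= b"
 have "(a + b) powr p <= (2 * max a b) powr p" using p by (intro powr_mono2) auto
 also have "... = 2 powr p * max a b powr p" using p by (simp add: powr_mult)
 also have "... <= 2 powr p * (a powr p + b powr p)" by (intro mult_left_mono) (auto simp: max_def)
 finally show ?thesis .
qed

text \<open>The product of a factor \<open>J\<close> with \<open>J - 1 = O(t)\<close> and of \<open>\<rho>
  (f + t V)\<close> is differentiated under the integral sign; the growth bound at \<open>|f| +
  G\<close> is the majorant.\<close>

lemma energy_differentiable:
 fixes \<rho> :: "'v::euclidean_space => real" and f :: "'a => 'v" and V :: "real => 'a => 'v"
 assumes M: "finite_measure M"
  and conv: "convex_on UNIV \<rho>" and nn: "!!\<xi>. 0 <= \<rho> \<xi>"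
  and p: "p \<ge> 1" and gr: "!!\<xi>. \<rho> \<xi> <= C * (norm \<xi> powr p + 1)"
  and f: "f \<in> borel_measurable M" and fp: "integrable M (%x. norm (f x) powr p)"
  and G: "G \<in> borel_measurable M" "!!x. 0 <= G x" "integrable M (%x. G x powr p)"
  and t0: "0 < t0" "t0 <= 1"
  and Vm: "!!t. abs t < t0 ==> V t \<in> borel_measurable M"
  and VG: "!!t x. abs t < t0 ==> x \<in> space M ==> norm (V t x) <= G x"
  and Vl: "!!x. x \<in> space M ==> ((%t. V t x) \<longlongrightarrow> V 0 x) (at 0)"
  and dif: "AE x in M. (%t. \<rho> (f x + t *\<^sub>R V 0 x)) differentiable (at 0)"
  and Jm: "!!t. abs t < t0 ==> J t \<in> borel_measurable M"
  and J0: "!!t x. abs t < t0 ==> x \<in> space M ==> 0 <= J t x"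
  and J1: "!!t x. abs t < t0 ==> x \<in> space M ==> \<bar>J t x - 1\<bar> <= abs t * c"
  and Jd: "!!x. x \<in> space M ==> \<exists>d. ((%t. (J t x - 1) / t) \<longlongrightarrow> d) (at 0)"
 shows "abs t < t0 ==> (\<integral>\<^sup>+x. ennreal (J t x) * ennreal (\<rho> (f x + t *\<^sub>R V t x)) \<partial>M) < \<infinity>"
  and "(%t. enn2real (\<integral>\<^sup>+x. ennreal (J t x) * ennreal (\<rho> (f x + t *\<^sub>R V t x)) \<partial>M)) differentiable (at 0)"
proof -
 interpret finite_measure M by (rule M)
 have cont: "continuous_on UNIV \<rho>" using convex_on_continuous[OF open_UNIV conv] .
 have \<rho>m: "\<rho> \<in> borel_measurable borel" by (rule borel_measurable_continuous_onI[OF cont])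
 have C0: "0 <= C" using gr[of 0] nn[of 0] by simp
 let ?F = "%t x. J t x * \<rho> (f x + t *\<^sub>R V t x)"
 define W where "W x = C * (2 powr p * (norm (f x) powr p + G x powr p) + 1)" for x
 have Wi: "integrable M W" unfolding W_def using fp G(3) by auto
 have bound: "\<rho> (f x + v) <= W x" if "norm v <= G x" for x v
 proof -
  have "norm (f x + v) powr p <= (norm (f x) + G x) powr p"
   using that norm_triangle_ineq[of "f x" v] p by (intro powr_mono2) auto
  also have "... <= 2 powr p * (norm (f x) powr p + G x powr p)" using p G(2) by (intro powr_add_le) auto
  finally have "C * (norm (f x + v) powr p + 1) <= W x" unfolding W_def using C0 by (intro mult_left_mono) auto
  then show ?thesis using gr[of "f x + v"] by linarith
 qed
 have W0: "0 <= W x" for x unfolding W_def using C0 by (intro mult_nonneg_nonneg add_nonneg_nonneg) auto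
 have sp0: "J 0 x = 1" if "x \<in> space M" for x using J1[of 0 x] t0 that by simp
 have Fm: "?F t \<in> borel_measurable M" if "abs t < t0" for t
  using Jm[OF that] Vm[OF that] f \<rho>m by measurable
 have incr: "\<bar>\<rho> (f x + t *\<^sub>R V t x) - \<rho> (f x)\<bar> <= abs t * (2 * W x)" if "abs t < t0" "x \<in> space M" for t x
 proof -
  have "\<bar>\<rho> (f x + t *\<^sub>R V t x) - \<rho> (f x)\<bar> <= abs t * (\<rho> (f x + V t x) + \<rho> (f x - V t x))"
   using that t0 by (intro convex_increment_bound[OF conv nn]) auto
  also have "... <= abs t * (W x + W x)"
   using bound[of "V t x" x] bound[of "- V t x" x] VG[OF that] by (intro mult_left_mono add_mono) auto
  finally show ?thesis by simp
 qed
 have \<rho>0: "\<rho> (f x) <= W x" for x using bound[of 0 x] G(2) by simp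
 have c0: "0 <= c" if "x \<in> space M" for x
 proof -
  have "0 <= \<bar>t0 / 2\<bar> * c" using J1[of "t0 / 2" x] that t0 abs_ge_zero[of "J (t0 / 2) x - 1"] by linarith
  then show ?thesis using t0 by (simp add: zero_le_mult_iff)
 qed
 have lipF: "\<bar>?F t x - ?F 0 x\<bar> <= abs t * ((c + 2 * (1 + c)) * W x)" if t: "abs t < t0" and x: "x \<in> space M" for t x
 proof -
  have eq: "?F t x - ?F 0 x = (J t x - 1) * \<rho> (f x) + J t x * (\<rho> (f x + t *\<^sub>R V t x) - \<rho> (f x))"
   using sp0[OF x] by (simp add: algebra_simps)
  have "abs t * c <= 1 * c" using t t0 c0[OF x] by (intro mult_right_mono) auto
  then have "J t x <= 1 + c" using J1[OF t x] by linarith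
  then have a: "\<bar>J t x * (\<rho> (f x + t *\<^sub>R V t x) - \<rho> (f x))\<bar> <= (1 + c) * (abs t * (2 * W x))"
   unfolding abs_mult using incr[OF t x] J0[OF t x] c0[OF x] by (intro mult_mono) auto
  have b: "\<bar>(J t x - 1) * \<rho> (f x)\<bar> <= (abs t * c) * W x"
   unfolding abs_mult using J1[OF t x] \<rho>0[of x] nn[of "f x"] c0[OF x] by (intro mult_mono) auto
  have "\<bar>?F t x - ?F 0 x\<bar> <= (abs t * c) * W x + (1 + c) * (abs t * (2 * W x))"
   unfolding eq using a b by linarith
  then show ?thesis by (simp add: algebra_simps)
 qed
 have F0: "integrable M (?F 0)"
 proof (rule bint_bound[OF Wi])
  show "?F 0 \<in> borel_measurable M" by (rule Fm) (use t0 in simp)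
  show "AE x in M. norm (?F 0 x) <= norm (W x)"
   by (rule AE_I2) (use sp0 \<rho>0 nn W0 in auto)
 qed
 have lim: "AE x in M. \<exists>d. ((%t. (?F t x - ?F 0 x) / t) \<longlongrightarrow> d) (at 0)"
  using dif AE_space
 proof eventually_elim
  case (elim x)
  then obtain D where D: "((%t. \<rho> (f x + t *\<^sub>R V 0 x)) has_real_derivative D) (at 0)"
   using real_differentiableE by blast
  obtain d where d: "((%t. (J t x - 1) / t) \<longlongrightarrow> d) (at 0)" using Jd[OF elim(2)] by blast
  have q: "((%t. (\<rho> (f x + t *\<^sub>R V t x) - \<rho> (f x)) / t) \<longlongrightarrow> D) (at 0)"
   by (rule directional_derivative_curve[OF conv nn D Vl[OF elim(2)]])
  have J: "((%t. J t x) \<longlongrightarrow> 1) (at 0)"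
  proof -
   have "((%t. (J t x - 1) / t * t + 1) \<longlongrightarrow> d * 0 + 1) (at 0)" by (intro tendsto_intros d)
   moreover have "\<forall>\<^sub>F t in at 0. (J t x - 1) / t * t + 1 = J t x" by (simp add: eventually_at_filter)
   ultimately show ?thesis using Lim_transform_eventually by fastforce
  qed
  have "((%t. (J t x - 1) / t * \<rho> (f x) + J t x * ((\<rho> (f x + t *\<^sub>R V t x) - \<rho> (f x)) / t)) \<longlongrightarrow> d * \<rho> (f x) + 1 * D) (at 0)"
   by (intro tendsto_intros d q J)
  moreover have "(J t x - 1) / t * \<rho> (f x) + J t x * ((\<rho> (f x + t *\<^sub>R V t x) - \<rho> (f x)) / t) = (?F t x - ?F 0 x) / t" for t
   using sp0[OF elim(2)] by (simp add: diff_divide_distrib algebra_simps)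
  ultimately show ?case by auto
 qed
 have wi: "integrable M (%x. (c + 2 * (1 + c)) * W x)" using Wi by simp
 have bnd: "AE x in M. \<bar>?F t x - ?F 0 x\<bar> <= abs t * ((c + 2 * (1 + c)) * W x)" if "abs t < t0" for t
  by (rule AE_I2) (rule lipF[OF that])
 have R1: "integrable M (?F t)" if "abs t < t0" for t
  by (rule integral_differentiable_at_0(1)[of M ?F, OF F0 wi t0(1) _ _ lim that]) (fact Fm, fact bnd)
 have R2: "(%t. LINT x|M. ?F t x) differentiable (at 0)"
  by (rule integral_differentiable_at_0(2)[of M ?F, OF F0 wi t0(1) _ _ lim]) (fact Fm, fact bnd)
 have nneq: "(\<integral>\<^sup>+x. ennreal (J t x) * ennreal (\<rho> (f x + t *\<^sub>R V t x)) \<partial>M) = ennreal (LINT x|M. ?F t x)" if t: "abs t < t0" for t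
 proof -
  have "(\<integral>\<^sup>+x. ennreal (J t x) * ennreal (\<rho> (f x + t *\<^sub>R V t x)) \<partial>M) = (\<integral>\<^sup>+x. ennreal (?F t x) \<partial>M)"
   using J0[OF t] nn by (intro nn_integral_cong) (simp add: ennreal_mult)
  also have "... = ennreal (LINT x|M. ?F t x)"
   by (rule nn_integral_eq_integral[OF R1[OF t]]) (use J0[OF t] nn in \<open>auto intro!: AE_I2\<close>)
  finally show ?thesis .
 qed
 show "abs t < t0 ==> (\<integral>\<^sup>+x. ennreal (J t x) * ennreal (\<rho> (f x + t *\<^sub>R V t x)) \<partial>M) < \<infinity>"
  using nneq by simp
 have eq: "enn2real (\<integral>\<^sup>+x. ennreal (J t x) * ennreal (\<rho> (f x + t *\<^sub>R V t x)) \<partial>M) = (LINT x|M. ?F t x)" if t: "abs t < t0" for t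
  unfolding nneq[OF t] by (rule enn2real_ennreal, rule integral_nonneg_AE, rule AE_I2) (use J0[OF t] nn in auto)
 obtain D where D: "((%t. LINT x|M. ?F t x) has_real_derivative D) (at 0)" using R2 real_differentiableE by blast
 have "((%t. enn2real (\<integral>\<^sup>+x. ennreal (J t x) * ennreal (\<rho> (f x + t *\<^sub>R V t x)) \<partial>M)) has_real_derivative D) (at 0)"
  by (rule has_field_derivative_transform_within_open[OF D, of "{-t0<..<t0}"]) (use t0 eq in auto)
 then show "(%t. enn2real (\<integral>\<^sup>+x. ennreal (J t x) * ennreal (\<rho> (f x + t *\<^sub>R V t x)) \<partial>M)) differentiable (at 0)"
  unfolding real_differentiable_def by blast
qed

section \<open>Diffeomorphisms close to the identity\<close>

lemma jacobian_test_function: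
 fixes \<phi> :: "real^'m => real^'m"
 assumes \<phi>: "\<phi> \<in> test_functions U"
 shows "(\<phi> has_derivative (%v. jacobian \<phi> (at x) *v v)) (at x)"
  and "smooth (%x. jacobian \<phi> (at x) $ i $ j)"
  and "continuous_on UNIV (%x. jacobian \<phi> (at x))"
  and "\<exists>b. \<forall>x. norm (jacobian \<phi> (at x)) <= b"
  and "x \<notin> supp \<phi> ==> jacobian \<phi> (at x) = 0"
proof -
 note t = test_functionsD[OF \<phi>]
 show "(\<phi> has_derivative (%v. jacobian \<phi> (at x) *v v)) (at x)"
  using smooth_differentiable[OF t(1)] jacobian_works by blast
 have e: "jacobian \<phi> (at x) $ i $ j = frechet_derivative \<phi> (at x) (axis j 1) $ i" for x i j
  by (simp add: jacobian_def matrix_def)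
 show s: "smooth (%x. jacobian \<phi> (at x) $ i $ j)" for i j
  unfolding e by (intro smooth_component smooth_frechet t)
 have "continuous_on UNIV (%x. \<chi> i j. jacobian \<phi> (at x) $ i $ j)"
  by (intro continuous_on_vec_lambda smooth_continuous s)
 then show c: "continuous_on UNIV (%x. jacobian \<phi> (at x))" by simp
 show z: "jacobian \<phi> (at x) = 0" if "x \<notin> supp \<phi>" for x
  using frechet_eq_0_outside[OF t(1) that] by (simp add: vec_eq_iff e)
 have "bounded ((%x. jacobian \<phi> (at x)) ` supp \<phi>)"
  by (intro compact_imp_bounded compact_continuous_image continuous_on_subset[OF c] t) simp
 then obtain b where b: "!!x. x \<in> supp \<phi> ==> norm (jacobian \<phi> (at x)) <= b" unfolding bounded_iff by blast
 have "norm (jacobian \<phi> (at x)) <= max b 0" for x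
  using b[of x] z[of x] by (cases "x \<in> supp \<phi>") auto
 then show "\<exists>b. \<forall>x. norm (jacobian \<phi> (at x)) <= b" by blast
qed

lemma norm_transpose: "norm (transpose M) = norm (M :: real^'n^'m)"
proof -
 have "(norm (transpose M))\<^sup>2 = (norm M)\<^sup>2"
  by (simp only: power2_norm_eq_inner inner_vec_def transpose_def vec_lambda_beta inner_real_def) (rule sum.swap)
 then show ?thesis by simp
qed

lemma norm_matrix_vector_le: "norm ((A :: real^'n^'m) *v x) <= norm A * norm x"
proof -
 have "norm (A *v x) = L2_set (%i. \<bar>(A *v x) $ i\<bar>) UNIV" by (simp add: norm_vec_def)
 also have "... <= L2_set (%i. norm (A $ i) * norm x) UNIV"
 proof (rule L2_set_mono)
  fix i
  have "(A *v x) $ i = A $ i \<bullet> x" by (simp add: matrix_vector_mul_component)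
  then show "\<bar>(A *v x) $ i\<bar> <= norm (A $ i) * norm x" using Cauchy_Schwarz_ineq2[of "A $ i" x] by simp
 qed simp
 also have "... = norm A * norm x" by (simp add: norm_vec_def[of A] L2_set_left_distrib)
 finally show ?thesis .
qed

text \<open>The derivative of \<open>1 / det\<close> at the identity gives a linear bound near it, and a
  derivative along curves \<open>t \<mapsto> I + t X t\<close> of which only the limit of
  \<open>X\<close> at 0 is known.\<close>

lemma inverse_det_near_identity:
 obtains \<delta> c where "\<delta> > 0" "c \<ge> 0"
  "!!H :: real^'m^'m. norm H <= \<delta> ==> det (mat 1 + H) > 0 \<and> \<bar>1 / det (mat 1 + H) - 1\<bar> <= c * norm H"
  "!!(X :: real => real^'m^'m) B. (X \<longlongrightarrow> B) (at 0) ==>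
   \<exists>d. ((%t. (1 / det (mat 1 + t *\<^sub>R X t) - 1) / t) \<longlongrightarrow> d) (at 0)"
proof -
 let ?k = "%M :: real^'m^'m. 1 / det M"
 obtain D where D: "((det :: real^'m^'m => real) has_derivative D) (at (mat 1))"
  using differentiable_det[of "mat 1"] unfolding differentiable_def by blast
 have "(?k has_derivative (%h. - (inverse (det (mat 1 :: real^'m^'m)) * D h * inverse (det (mat 1 :: real^'m^'m))))) (at (mat 1))"
  using Deriv.has_derivative_inverse[OF _ D] by (simp add: det_I inverse_eq_divide)
 then obtain L where L: "(?k has_derivative L) (at (mat 1))" by blast
 have bl: "bounded_linear L" using L by (rule has_derivative_bounded_linear)
 obtain K where K: "!!x. norm (L x) <= norm x * K" "K > 0" using bounded_linear.pos_bounded[OF bl] by blast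
 have small: "\<exists>\<delta>>0. \<forall>H. norm H < \<delta> --> \<bar>?k (mat 1 + H) - 1 - L H\<bar> <= e * norm H" if "e > 0" for e
 proof -
  obtain \<delta> where "\<delta> > 0" and \<delta>: "!!y. norm (y - mat 1) < \<delta> ==> norm (?k y - ?k (mat 1) - L (y - mat 1)) <= e * norm (y - mat 1)"
   using L[unfolded has_derivative_at_alt] \<open>e > 0\<close> by blast
  have "\<bar>?k (mat 1 + H) - 1 - L H\<bar> <= e * norm H" if "norm H < \<delta>" for H
   using \<delta>[of "mat 1 + H"] that by (simp add: det_I)
  then show ?thesis using \<open>\<delta> > 0\<close> by blast
 qed
 obtain \<delta>1 where \<delta>1: "\<delta>1 > 0" "!!H. norm H < \<delta>1 ==> \<bar>?k (mat 1 + H) - 1 - L H\<bar> <= 1 * norm H" using small[of 1] by auto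
 have "isCont (det :: real^'m^'m => real) (mat 1)" using D has_derivative_continuous by blast
 from this[unfolded continuous_at, THEN tendstoD, of 1]
 have "\<forall>\<^sub>F y :: real^'m^'m in at (mat 1). dist (det y) (det (mat 1 :: real^'m^'m)) < 1" by simp
 then obtain \<delta>2 where \<delta>2: "\<delta>2 > 0" and \<delta>2': "!!y :: real^'m^'m. y \<noteq> mat 1 ==> dist y (mat 1) < \<delta>2 ==> dist (det y) (det (mat 1 :: real^'m^'m)) < 1"
  unfolding eventually_at by auto
 define \<delta> where "\<delta> = min \<delta>1 \<delta>2 / 2"
 show thesis
 proof (rule that[of \<delta> "K + 1"])
  show "\<delta> > 0" "K + 1 \<ge> 0" using \<delta>1 \<delta>2 K by (auto simp: \<delta>_def)
  fix H :: "real^'m^'m" assume H: "norm H <= \<delta>"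
  have "norm H < \<delta>1" "norm H < \<delta>2" using H \<delta>1(1) \<delta>2 by (auto simp: \<delta>_def)
  have "det (mat 1 + H) > 0" using \<delta>2'[of "mat 1 + H"] \<open>norm H < \<delta>2\<close> by (cases "H = 0") (simp_all add: dist_norm dist_real_def det_I)
  moreover have "\<bar>?k (mat 1 + H) - 1\<bar> <= (K + 1) * norm H"
   using \<delta>1(2)[OF \<open>norm H < \<delta>1\<close>] K(1)[of H] by (simp add: algebra_simps)
  ultimately show "det (mat 1 + H) > 0 \<and> \<bar>1 / det (mat 1 + H) - 1\<bar> <= (K + 1) * norm H" by blast
 next
  fix X :: "real => real^'m^'m" and B assume X: "(X \<longlongrightarrow> B) (at 0)"
  have lim: "((%t. (?k (mat 1 + t *\<^sub>R X t) - 1) / t - L (X t)) \<longlongrightarrow> 0) (at 0)"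
  proof (rule tendstoI)
   fix e :: real assume e: "e > 0"
   define e' where "e' = e / (norm B + 2)"
   have e': "e' > 0" using e by (simp add: e'_def add_nonneg_pos)
   obtain \<delta>' where \<delta>': "\<delta>' > 0" "!!H. norm H < \<delta>' ==> \<bar>?k (mat 1 + H) - 1 - L H\<bar> <= e' * norm H" using small[OF e'] by auto
   have "((%t. norm (t *\<^sub>R X t)) \<longlongrightarrow> norm (0 *\<^sub>R B)) (at 0)" by (intro tendsto_intros X)
   then have ev1: "\<forall>\<^sub>F t in at 0. norm (t *\<^sub>R X t) < \<delta>'" using \<delta>'(1) by (intro order_tendstoD(2)[of _ "norm (0 *\<^sub>R B)"]) auto
   have ev2: "\<forall>\<^sub>F t in at 0. norm (X t) < norm B + 1"
    by (rule order_tendstoD(2)[OF tendsto_norm[OF X]]) simp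
   have ev3: "\<forall>\<^sub>F t::real in at 0. t \<noteq> 0" by (simp add: eventually_at_filter)
   show "\<forall>\<^sub>F t in at 0. dist ((?k (mat 1 + t *\<^sub>R X t) - 1) / t - L (X t)) 0 < e"
    using ev1 ev2 ev3
   proof eventually_elim
    case (elim t)
    have Ls: "L (t *\<^sub>R X t) = t * L (X t)" using bl by (simp add: linear_simps)
    have "\<bar>(?k (mat 1 + t *\<^sub>R X t) - 1) / t - L (X t)\<bar> * abs t = \<bar>?k (mat 1 + t *\<^sub>R X t) - 1 - t * L (X t)\<bar>"
     using elim(3) by (simp add: abs_mult[symmetric] field_simps)
    also have "... <= e' * (abs t * norm (X t))" using \<delta>'(2)[OF elim(1)] by (simp add: Ls)
    finally have "\<bar>(?k (mat 1 + t *\<^sub>R X t) - 1) / t - L (X t)\<bar> * abs t <= (e' * norm (X t)) * abs t" by (simp add: mult_ac)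
    then have "\<bar>(?k (mat 1 + t *\<^sub>R X t) - 1) / t - L (X t)\<bar> <= e' * norm (X t)"
     using elim(3) by simp
    also have "... < e' * (norm B + 2)" using elim(2) e' by (intro mult_strict_left_mono) auto
    also have "... = e" by (smt (verit) e'_def norm_ge_zero nonzero_mult_div_cancel_right times_divide_eq_left)
    finally show ?case by simp
   qed
  qed
  have "((%t. L (X t)) \<longlongrightarrow> L B) (at 0)" by (rule bounded_linear.tendsto[OF bl X])
  from tendsto_add[OF lim this]
  have "((%t. (?k (mat 1 + t *\<^sub>R X t) - 1) / t) \<longlongrightarrow> 0 + L B) (at 0)" by simp
  then show "\<exists>d. ((%t. (1 / det (mat 1 + t *\<^sub>R X t) - 1) / t) \<longlongrightarrow> d) (at 0)" by blast
 qed
qed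

text \<open>Preimages are fixed points of the contraction \<open>x \<mapsto> y - t \<phi> x\<close>, and the
  distance is at most halved by the perturbed identity.\<close>

lemma small_perturbation_bij:
 fixes \<phi> :: "'a::{complete_space, real_normed_vector} => 'a"
 assumes lip: "!!x y. norm (t *\<^sub>R \<phi> x - t *\<^sub>R \<phi> y) <= (1 / 2) * norm (x - y)"
 shows "bij (%x. x + t *\<^sub>R \<phi> x)" "continuous_on UNIV (inv (%x. x + t *\<^sub>R \<phi> x))"
proof -
 let ?\<Phi> = "%x. x + t *\<^sub>R \<phi> x"
 have low: "norm (x - y) <= 2 * norm (?\<Phi> x - ?\<Phi> y)" for x y
 proof -
  have "norm (x - y) = norm ((?\<Phi> x - ?\<Phi> y) - (t *\<^sub>R \<phi> x - t *\<^sub>R \<phi> y))" by (simp add: algebra_simps)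
  also have "... <= norm (?\<Phi> x - ?\<Phi> y) + (1 / 2) * norm (x - y)"
   using norm_triangle_ineq4[of "?\<Phi> x - ?\<Phi> y" "t *\<^sub>R \<phi> x - t *\<^sub>R \<phi> y"] lip[of x y] by linarith
  finally show ?thesis by linarith
 qed
 have inj: "inj ?\<Phi>"
 proof (rule injI)
  fix x y assume "?\<Phi> x = ?\<Phi> y"
  then show "x = y" using low[of x y] by simp
 qed
 have "\<exists>x. y = ?\<Phi> x" for y
 proof -
  have "\<exists>!x. (%x. y - t *\<^sub>R \<phi> x) x = x"
   by (rule banach_fix_type[of "1 / 2"]) (use lip in \<open>auto simp: dist_norm norm_minus_commute\<close>)
  then obtain x where "y - t *\<^sub>R \<phi> x = x" by blast
  then have "y = ?\<Phi> x" by (simp add: algebra_simps)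
  then show ?thesis by blast
 qed
 then have surj: "surj ?\<Phi>" unfolding surj_def by blast
 show "bij ?\<Phi>" using inj surj by (rule bijI)
 have s: "?\<Phi> (inv ?\<Phi> y) = y" for y using surj by (rule surj_f_inv_f)
 show "continuous_on UNIV (inv ?\<Phi>)"
 proof (rule continuous_onI)
  fix x e :: 'a and \<epsilon> :: real assume "\<epsilon> > 0"
  have "dist (inv ?\<Phi> x') (inv ?\<Phi> x) <= \<epsilon>" if "dist x' x < \<epsilon> / 2" for x'
   using low[of "inv ?\<Phi> x'" "inv ?\<Phi> x"] that unfolding s by (simp add: dist_norm)
  then show "\<exists>d>0. \<forall>x'\<in>UNIV. dist x' x < d --> dist (inv ?\<Phi> x') (inv ?\<Phi> x) <= \<epsilon>"
   using \<open>\<epsilon> > 0\<close> by (intro exI[of _ "\<epsilon> / 2"]) auto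
 qed
qed

text \<open>For small \<open>t\<close> the contraction argument applies uniformly. The set \<open>U\<close>
  is invariant because the perturbation is the identity off \<open>U\<close> and bijective.\<close>

lemma inner_variation_diffeo:
 fixes U :: "(real^'m) set" and \<phi> :: "real^'m => real^'m"
 assumes \<phi>: "\<phi> \<in> test_functions U"
 defines "B \<equiv> %x. jacobian \<phi> (at x)" and "\<Psi> \<equiv> %t. inv (%x. x + t *\<^sub>R \<phi> x)"
 obtains t0 c where "0 < t0" "t0 <= 1"
  "!!t. abs t < t0 ==> diffeo U (%x. x + t *\<^sub>R \<phi> x) (%x. mat 1 + t *\<^sub>R B x) (\<Psi> t)"
  "!!t x. abs t < t0 ==> \<bar>1 / det (mat 1 + t *\<^sub>R B x) - 1\<bar> <= abs t * c"
  "!!y. ((%t. \<Psi> t y) \<longlongrightarrow> y) (at 0)"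
  "!!y. \<exists>d. ((%t. (1 / det (mat 1 + t *\<^sub>R B (\<Psi> t y)) - 1) / t) \<longlongrightarrow> d) (at 0)"
proof -
 note J = jacobian_test_function[OF \<phi>]
 obtain b where b: "!!x. norm (B x) <= b" using J(4) unfolding B_def by blast
 have b0: "b \<ge> 0" using norm_ge_zero[of "B 0"] b[of 0] by linarith
 obtain m where m: "!!x. norm (\<phi> x) <= m" using bounded_test[OF \<phi>] by blast
 obtain \<delta> c where \<delta>: "\<delta> > 0" "c \<ge> 0"
  and det1: "!!H :: real^'m^'m. norm H <= \<delta> ==> det (mat 1 + H) > 0 \<and> \<bar>1 / det (mat 1 + H) - 1\<bar> <= c * norm H"
  and det2: "!!(X :: real => real^'m^'m) B. (X \<longlongrightarrow> B) (at 0) ==>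
   \<exists>d. ((%t. (1 / det (mat 1 + t *\<^sub>R X t) - 1) / t) \<longlongrightarrow> d) (at 0)"
  by (rule inverse_det_near_identity) blast
 define t0 where "t0 = min 1 (min \<delta> (1 / 2) / (b + 1))"
 have t0: "0 < t0" "t0 <= 1" using \<delta>(1) b0 by (auto simp: t0_def)
 have tb: "abs t * b <= min \<delta> (1 / 2)" if "abs t < t0" for t
 proof -
  have "abs t * b <= (min \<delta> (1 / 2) / (b + 1)) * (b + 1)"
   using that b0 \<delta>(1) by (intro mult_mono) (auto simp: t0_def)
  then show ?thesis using b0 by simp
 qed
 have lip: "norm (\<phi> x - \<phi> y) <= b * norm (x - y)" for x y
 proof (rule differentiable_bound[of UNIV \<phi> "%x v. B x *v v"])
  show "(\<phi> has_derivative (%v. B x *v v)) (at x within UNIV)" for x using J(1) by (simp add: B_def)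
  show "onorm (%v. B x *v v) <= b" for x
  proof (rule onorm_le)
   fix v
   show "norm (B x *v v) <= b * norm v"
    using norm_matrix_vector_le[of "B x" v] mult_right_mono[OF b[of x] norm_ge_zero[of v]] by linarith
  qed
 qed auto
 have lipt: "norm (t *\<^sub>R \<phi> x - t *\<^sub>R \<phi> y) <= (1 / 2) * norm (x - y)" if "abs t < t0" for t x y
 proof -
  have "norm (t *\<^sub>R \<phi> x - t *\<^sub>R \<phi> y) = abs t * norm (\<phi> x - \<phi> y)"
   by (metis norm_scaleR scaleR_diff_right)
  also have "... <= abs t * (b * norm (x - y))" by (intro mult_left_mono lip) auto
  also have "... = (abs t * b) * norm (x - y)" by simp
  also have "... <= (1 / 2) * norm (x - y)" using tb[OF that] by (intro mult_right_mono) auto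
  finally show ?thesis .
 qed
 have bij: "bij (%x. x + t *\<^sub>R \<phi> x)" and cont: "continuous_on UNIV (\<Psi> t)" if "abs t < t0" for t
  using small_perturbation_bij[of t \<phi>, OF lipt[OF that]] unfolding \<Psi>_def by blast+
 have nB: "norm (t *\<^sub>R B x) <= abs t * b" for t x using b[of x] by (simp add: mult_left_mono)
 have "diffeo U (%x. x + t *\<^sub>R \<phi> x) (%x. mat 1 + t *\<^sub>R B x) (\<Psi> t)" if t: "abs t < t0" for t
 proof -
  have 1: "\<Psi> t (x + t *\<^sub>R \<phi> x) = x" for x
   unfolding \<Psi>_def using inv_f_f[OF bij_is_inj[OF bij[OF t]], of x] by simp
  have 2: "\<Psi> t y + t *\<^sub>R \<phi> (\<Psi> t y) = y" for y
   unfolding \<Psi>_def using surj_f_inv_f[OF bij_is_surj[OF bij[OF t]], of y] by simp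
  have out: "\<phi> x = 0" if "x \<notin> U" for x using test_functionsD(3)[OF \<phi>] not_supp[of x \<phi>] that by blast
  have 3: "x + t *\<^sub>R \<phi> x \<in> U \<longleftrightarrow> x \<in> U" for x
  proof
   assume a: "x + t *\<^sub>R \<phi> x \<in> U"
   show "x \<in> U"
   proof (rule ccontr)
    assume "x \<notin> U"
    then show False using out[of x] a by simp
   qed
  next
   assume x: "x \<in> U"
   show "x + t *\<^sub>R \<phi> x \<in> U"
   proof (rule ccontr)
    assume n: "x + t *\<^sub>R \<phi> x \<notin> U"
    have "\<Psi> t ((x + t *\<^sub>R \<phi> x) + t *\<^sub>R \<phi> (x + t *\<^sub>R \<phi> x)) = x + t *\<^sub>R \<phi> x" by (rule 1)
    then have "x + t *\<^sub>R \<phi> x = x" using out[OF n] 1[of x] by simp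
    then show False using n x by metis
   qed
  qed
  have 4: "((%x. x + t *\<^sub>R \<phi> x) has_derivative (%v. (mat 1 + t *\<^sub>R B x) *v v)) (at x)" for x
  proof -
   have "((%x. x + t *\<^sub>R \<phi> x) has_derivative (%v. v + t *\<^sub>R (B x *v v))) (at x)"
    using J(1)[of x] by (intro derivative_intros) (simp add: B_def)
   then show ?thesis by (simp add: matrix_vector_mult_add_rdistrib scaleR_matrix_vector_assoc)
  qed
  have 5: "smooth (%x. (mat 1 + t *\<^sub>R B x) $ i $ j)" for i j
   using J(2)[of i j] by (auto simp: B_def intro!: smooth_add smooth_mult)
  have 6: "det (mat 1 + t *\<^sub>R B x) > 0" for x
   using det1[of "t *\<^sub>R B x"] nB[of t x] tb[OF t] by simp
  show ?thesis unfolding diffeo_def using 1 2 3 4 5 6 cont[OF t] by blast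
 qed
 note d = this
 show thesis
 proof (rule that[of t0 "c * b", OF t0 d])
  fix t and x :: "real^'m" assume t: "abs t < t0"
  have "\<bar>1 / det (mat 1 + t *\<^sub>R B x) - 1\<bar> <= c * norm (t *\<^sub>R B x)"
   using det1[of "t *\<^sub>R B x"] nB[of t x] tb[OF t] by simp
  also have "... <= c * (abs t * b)" using \<delta>(2) nB by (rule mult_left_mono[rotated])
  finally show "\<bar>1 / det (mat 1 + t *\<^sub>R B x) - 1\<bar> <= abs t * (c * b)" by (simp add: mult_ac)
 next
  fix y :: "real^'m"
  have ev: "\<forall>\<^sub>F t::real in at 0. abs t < t0"
   by (rule order_tendstoD(2)[of _ 0]) (use t0 in \<open>auto intro!: tendsto_eq_intros\<close>)
  have "((%t. \<Psi> t y - y) \<longlongrightarrow> 0) (at 0)"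
  proof (rule Lim_null_comparison)
   show "\<forall>\<^sub>F t in at 0. norm (\<Psi> t y - y) <= abs t * m"
    using ev
   proof eventually_elim
    case (elim t)
    have "\<Psi> t y + t *\<^sub>R \<phi> (\<Psi> t y) = y" using diffeoD(2)[OF d[OF elim]] .
    then have "\<Psi> t y - y = - (t *\<^sub>R \<phi> (\<Psi> t y))" by (simp add: algebra_simps)
    then show ?case using m[of "\<Psi> t y"] by (simp add: mult_left_mono)
   qed
   have "((%t. abs t * m) \<longlongrightarrow> \<bar>0\<bar> * m) (at 0)" by (intro tendsto_intros)
   then show "((%t. abs t * m) \<longlongrightarrow> 0) (at 0)" by simp
  qed
  then show l: "((%t. \<Psi> t y) \<longlongrightarrow> y) (at 0)" by (simp add: LIM_zero_iff)
  have "isCont B y" using J(3) continuous_on_eq_continuous_at[OF open_UNIV] unfolding B_def by blast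
  then have "((%t. B (\<Psi> t y)) \<longlongrightarrow> B y) (at 0)" using l by (rule isCont_tendsto_compose)
  then show "\<exists>d. ((%t. (1 / det (mat 1 + t *\<^sub>R B (\<Psi> t y)) - 1) / t) \<longlongrightarrow> d) (at 0)" by (rule det2)
 qed
qed

section \<open>Higher integrability of fields with integrable symmetric gradient\<close>

definition lp :: "'a measure => real => ('a => real) => bool" where
 "lp M p u \<longleftrightarrow> u \<in> borel_measurable M \<and> integrable M (%x. \<bar>u x\<bar> powr p)"

lemma lp_mono:
 assumes v: "lp M p v" and u: "u \<in> borel_measurable M" and le: "AE x in M. \<bar>u x\<bar> <= \<bar>v x\<bar>" and p: "p \<ge> 1"
 shows "lp M p u"
proof -
 have "integrable M (%x. \<bar>u x\<bar> powr p)"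
 proof (rule bint_bound[of _ "%x. \<bar>v x\<bar> powr p"])
  show "integrable M (%x. \<bar>v x\<bar> powr p)" using v by (simp add: lp_def)
  show "(%x. \<bar>u x\<bar> powr p) \<in> borel_measurable M" using u by measurable
  show "AE x in M. norm (\<bar>u x\<bar> powr p) <= norm (\<bar>v x\<bar> powr p)"
   using le by eventually_elim (use p in \<open>auto intro!: powr_mono2\<close>)
 qed
 then show ?thesis using u by (simp add: lp_def)
qed

lemma lp_add:
 assumes u: "lp M p u" and v: "lp M p v" and p: "p \<ge> 1"
 shows "lp M p (%x. u x + v x)"
proof -
 have m: "u \<in> borel_measurable M" "v \<in> borel_measurable M"
  and i: "integrable M (%x. \<bar>u x\<bar> powr p)" "integrable M (%x. \<bar>v x\<bar> powr p)" using u v by (auto simp: lp_def)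
 have "integrable M (%x. \<bar>u x + v x\<bar> powr p)"
 proof (rule bint_bound[of _ "%x. 2 powr p * (\<bar>u x\<bar> powr p + \<bar>v x\<bar> powr p)"])
  show "integrable M (%x. 2 powr p * (\<bar>u x\<bar> powr p + \<bar>v x\<bar> powr p))" using i by auto
  show "(%x. \<bar>u x + v x\<bar> powr p) \<in> borel_measurable M" using m by measurable
  have "\<bar>u x + v x\<bar> powr p <= 2 powr p * (\<bar>u x\<bar> powr p + \<bar>v x\<bar> powr p)" for x
  proof -
   have "\<bar>u x + v x\<bar> powr p <= (\<bar>u x\<bar> + \<bar>v x\<bar>) powr p" using p by (intro powr_mono2) auto
   also have "... <= 2 powr p * (\<bar>u x\<bar> powr p + \<bar>v x\<bar> powr p)" using p by (intro powr_add_le) auto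
   finally show ?thesis .
  qed
  then show "AE x in M. norm (\<bar>u x + v x\<bar> powr p) <= norm (2 powr p * (\<bar>u x\<bar> powr p + \<bar>v x\<bar> powr p))"
   by (intro AE_I2) (simp add: abs_of_nonneg)
 qed
 then show ?thesis using m by (simp add: lp_def)
qed

lemma lp_cmult: "lp M p u ==> lp M p (%x. c * u x)"
 by (auto simp: lp_def abs_mult powr_mult)

lemma lp_abs: "lp M p u ==> lp M p (%x. \<bar>u x\<bar>)"
 by (auto simp: lp_def)

lemma lp_const: "finite_measure M ==> lp M p (%x. c)"
 by (simp add: lp_def finite_measure.integrable_const)

lemma lp_sum:
 assumes "finite I" "!!i. i \<in> I ==> lp M p (u i)" "p \<ge> 1"
 shows "lp M p (%x. \<Sum>i\<in>I. u i x)"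
 using assms
proof (induction I rule: finite_induct)
 case empty then show ?case by (simp add: lp_def)
next
 case (insert i I)
 then show ?case using lp_add[of M p "u i" "%x. \<Sum>i\<in>I. u i x"] by simp
qed

lemma abs_powr_convex:
 assumes p: "p \<ge> 1" shows "convex_on UNIV (%x::real. \<bar>x\<bar> powr p)"
proof (rule convex_onI)
 fix t x y :: real assume t: "0 < t" "t < 1"
 have small: "(s * a) powr p <= s * a powr p" if "0 < s" "s < 1" "0 <= a" for s a
 proof -
  have "s powr p <= s powr 1" using that p by (intro powr_mono') auto
  then have "s powr p * a powr p <= s * a powr p" using that by (intro mult_right_mono) auto
  then show ?thesis using that by (simp add: powr_mult)
 qed
 have "\<bar>(1 - t) * x + t * y\<bar> <= (1 - t) * \<bar>x\<bar> + t * \<bar>y\<bar>"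
  using abs_triangle_ineq[of "(1 - t) * x" "t * y"] t by (simp add: abs_mult)
 then have "\<bar>(1 - t) * x + t * y\<bar> powr p <= ((1 - t) * \<bar>x\<bar> + t * \<bar>y\<bar>) powr p"
  using p by (intro powr_mono2) auto
 also have "... <= (1 - t) * \<bar>x\<bar> powr p + t * \<bar>y\<bar> powr p"
 proof (cases "x = 0 \<or> y = 0")
  case True
  then show ?thesis using small[of "1 - t" "\<bar>x\<bar>"] small[of t "\<bar>y\<bar>"] t p by auto
 next
  case False
  then show ?thesis using convex_onD[OF powr_convex[OF p], of t "\<bar>x\<bar>" "\<bar>y\<bar>"] t by simp
 qed
 finally show "\<bar>(1 - t) *\<^sub>R x + t *\<^sub>R y\<bar> powr p <= (1 - t) * \<bar>x\<bar> powr p + t * \<bar>y\<bar> powr p" by simp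
qed simp

lemma lborel_translate:
 fixes v :: "'a::euclidean_space"
 shows "u \<in> borel_measurable borel ==> (\<integral>\<^sup>+x. u (x + v) \<partial>lborel) = (\<integral>\<^sup>+x. u x \<partial>lborel)"
  and "w \<in> borel_measurable borel ==> (LINT x|lborel. w (x + v)) = (LINT x|lborel. w x :: real)"
proof -
 assume u: "u \<in> borel_measurable borel"
 have "(\<integral>\<^sup>+x. u x \<partial>distr lborel borel ((+) v)) = (\<integral>\<^sup>+x. u (v + x) \<partial>lborel)"
  by (rule nn_integral_distr) (use u in simp_all)
 then show "(\<integral>\<^sup>+x. u (x + v) \<partial>lborel) = (\<integral>\<^sup>+x. u x \<partial>lborel)"
  unfolding lborel_distr_plus by (simp add: add.commute)
next
 assume w: "w \<in> borel_measurable borel"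
 have "(LINT x|distr lborel borel ((+) v). w x) = (LINT x|lborel. w (v + x))"
  by (rule integral_distr) (use w in simp_all)
 then show "(LINT x|lborel. w (x + v)) = (LINT x|lborel. w x)"
  unfolding lborel_distr_plus by (simp add: add.commute)
qed

text \<open>Averages \<open>x \<mapsto> E (k u (x + D))\<close> over random displacements \<open>D\<close>.
  Fubini and translation invariance bound them by the corresponding norm of \<open>u\<close>.\<close>

lemma average_integrable:
 fixes u :: "'a::euclidean_space => real"
 assumes P: "prob_space P" and D[measurable]: "D \<in> borel_measurable P" and k[measurable]: "k \<in> borel_measurable P"
  and kc: "!!w. w \<in> space P ==> \<bar>k w\<bar> <= c"
  and um[measurable]: "u \<in> borel_measurable borel" and ui: "integrable lborel u"
 shows "integrable (lborel \<Otimes>\<^sub>M P) (%(x, w). k w * u (x + D w))"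
proof -
 interpret P: prob_space P by (rule P)
 interpret Q: pair_sigma_finite lborel P by unfold_locales
 have m: "(%(x, w). k w * u (x + D w)) \<in> borel_measurable (lborel \<Otimes>\<^sub>M P)" by measurable
 show ?thesis
 proof (rule integrableI_bounded[OF m])
  have "(\<integral>\<^sup>+y. ennreal (norm (case y of (x, w) => k w * u (x + D w))) \<partial>(lborel \<Otimes>\<^sub>M P)) =
    (\<integral>\<^sup>+w. \<integral>\<^sup>+x. ennreal (norm (k w * u (x + D w))) \<partial>lborel \<partial>P)"
   using Q.nn_integral_snd[of "%y. ennreal (norm (case y of (x, w) => k w * u (x + D w)))"] m by simp
  also have "... <= (\<integral>\<^sup>+w. ennreal c * (\<integral>\<^sup>+x. ennreal (norm (u x)) \<partial>lborel) \<partial>P)"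
  proof (rule nn_integral_mono)
   fix w assume w: "w \<in> space P"
   have c0: "0 <= c" using kc[OF w] by linarith
   have "(\<integral>\<^sup>+x. ennreal (norm (k w * u (x + D w))) \<partial>lborel) <= (\<integral>\<^sup>+x. ennreal c * ennreal (norm (u (x + D w))) \<partial>lborel)"
   proof (rule nn_integral_mono)
    fix x
    have "norm (k w * u (x + D w)) <= c * norm (u (x + D w))"
     unfolding norm_mult using kc[OF w] by (intro mult_right_mono) auto
    then show "ennreal (norm (k w * u (x + D w))) <= ennreal c * ennreal (norm (u (x + D w)))"
     using c0 by (simp add: ennreal_mult[symmetric] ennreal_leI)
   qed
   also have "... = ennreal c * (\<integral>\<^sup>+x. ennreal (norm (u (x + D w))) \<partial>lborel)" by (rule nn_integral_cmult) measurable
   also have "... = ennreal c * (\<integral>\<^sup>+x. ennreal (norm (u x)) \<partial>lborel)"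
    using lborel_translate(1)[of "%x. ennreal (norm (u x))" "D w"] by simp
   finally show "(\<integral>\<^sup>+x. ennreal (norm (k w * u (x + D w))) \<partial>lborel) <= ennreal c * (\<integral>\<^sup>+x. ennreal (norm (u x)) \<partial>lborel)" .
  qed
  also have "... = ennreal c * (\<integral>\<^sup>+x. ennreal (norm (u x)) \<partial>lborel)" by (simp add: P.emeasure_space_1)
  also have "... < \<infinity>" using ui by (simp add: integrable_iff_bounded ennreal_mult_less_top)
  finally show "(\<integral>\<^sup>+y. ennreal (norm (case y of (x, w) => k w * u (x + D w))) \<partial>(lborel \<Otimes>\<^sub>M P)) < \<infinity>" .
 qed
qed

text \<open>The average is moved to the test function, which is translated in the opposite direction.\<close>

lemma average_duality:
 fixes u :: "'a::euclidean_space => real"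
 assumes P: "prob_space P" and D[measurable]: "D \<in> borel_measurable P" and k[measurable]: "k \<in> borel_measurable P"
  and kc: "!!w. w \<in> space P ==> \<bar>k w\<bar> <= c"
  and um[measurable]: "u \<in> borel_measurable borel" and ui: "integrable lborel u"
  and \<eta>[measurable]: "\<eta> \<in> borel_measurable borel" and e: "!!x. \<bar>\<eta> x\<bar> <= e"
 shows "integrable lborel (%x. LINT w|P. k w * u (x + D w))"
  and "integrable lborel (%x. \<eta> x * (LINT w|P. k w * u (x + D w)))"
  and "integrable P (%w. k w * (LINT y|lborel. \<eta> (y - D w) * u y))"
  and "(LINT x|lborel. \<eta> x * (LINT w|P. k w * u (x + D w))) = (LINT w|P. k w * (LINT y|lborel. \<eta> (y - D w) * u y))"
proof -
 interpret P: prob_space P by (rule P)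
 interpret Q: pair_sigma_finite lborel P by unfold_locales
 note a = average_integrable[OF P D k kc um ui]
 show i1: "integrable lborel (%x. LINT w|P. k w * u (x + D w))"
  using Q.integrable_fst'[OF a] by simp
 have "e \<ge> 0" using e[of undefined] by linarith
 have i: "integrable (lborel \<Otimes>\<^sub>M P) (%(x, w). \<eta> x * (k w * u (x + D w)))"
 proof (rule bint_bound[of _ "%y. e * (case y of (x, w) => k w * u (x + D w))"])
  show "integrable (lborel \<Otimes>\<^sub>M P) (%y. e * (case y of (x, w) => k w * u (x + D w)))"
   using a by (rule integrable_mult_right)
  show "(%(x, w). \<eta> x * (k w * u (x + D w))) \<in> borel_measurable (lborel \<Otimes>\<^sub>M P)" by measurable
  show "AE y in lborel \<Otimes>\<^sub>M P. norm (case y of (x, w) => \<eta> x * (k w * u (x + D w))) <= norm (e * (case y of (x, w) => k w * u (x + D w)))"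
  proof (rule AE_I2)
   fix y :: "'a \<times> 'b"
   have "\<bar>\<eta> (fst y)\<bar> * \<bar>k (snd y) * u (fst y + D (snd y))\<bar> <= \<bar>e\<bar> * \<bar>k (snd y) * u (fst y + D (snd y))\<bar>"
    using e[of "fst y"] by (intro mult_right_mono) auto
   then show "norm (case y of (x, w) => \<eta> x * (k w * u (x + D w))) <= norm (e * (case y of (x, w) => k w * u (x + D w)))"
    by (simp add: case_prod_beta abs_mult)
  qed
 qed
 show "integrable lborel (%x. \<eta> x * (LINT w|P. k w * u (x + D w)))"
  using Q.integrable_fst'[OF i] by simp
 have tr: "(LINT x|lborel. \<eta> x * (k w * u (x + D w))) = k w * (LINT y|lborel. \<eta> (y - D w) * u y)" for w
 proof -
  have "(LINT x|lborel. \<eta> x * (k w * u (x + D w))) = (LINT x|lborel. k w * (\<eta> ((x + D w) - D w) * u (x + D w)))"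
   by (simp add: mult_ac)
  also have "... = (LINT y|lborel. k w * (\<eta> (y - D w) * u y))"
   by (rule lborel_translate(2)) measurable
  finally show ?thesis by simp
 qed
 have sw: "integrable (P \<Otimes>\<^sub>M lborel) (%(w, x). \<eta> x * (k w * u (x + D w)))"
  using Q.integrable_product_swap[OF i] by (simp add: case_prod_beta)
 interpret Q': pair_sigma_finite P lborel by unfold_locales
 show "integrable P (%w. k w * (LINT y|lborel. \<eta> (y - D w) * u y))"
  using Q'.integrable_fst'[OF sw] by (simp add: tr)
 have "(LINT w|P. LINT x|lborel. \<eta> x * (k w * u (x + D w))) = (LINT x|lborel. LINT w|P. \<eta> x * (k w * u (x + D w)))"
  by (rule Q.Fubini_integral[OF i])
 then show "(LINT x|lborel. \<eta> x * (LINT w|P. k w * u (x + D w))) = (LINT w|P. k w * (LINT y|lborel. \<eta> (y - D w) * u y))"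
  by (simp add: tr)
qed

text \<open>Jensen's inequality bounds the \<open>p\<close>-th power of the average by the average of the
  \<open>p\<close>-th powers.\<close>

lemma average_lp:
 fixes u :: "'a::euclidean_space => real"
 assumes P: "prob_space P" and D[measurable]: "D \<in> borel_measurable P" and k[measurable]: "k \<in> borel_measurable P"
  and kc: "!!w. w \<in> space P ==> \<bar>k w\<bar> <= c"
  and um[measurable]: "u \<in> borel_measurable borel" and ui: "integrable lborel u"
  and p: "p \<ge> 1" and up: "integrable lborel (%x. \<bar>u x\<bar> powr p)"
 shows "lp lborel p (%x. LINT w|P. k w * u (x + D w))"
proof -
 interpret P: prob_space P by (rule P)
 interpret Q: pair_sigma_finite lborel P by unfold_locales
 have c0: "0 <= c"
 proof -
  obtain w where "w \<in> space P" using P.not_empty by blast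
  then show ?thesis using kc[of w] by linarith
 qed
 have one: "\<bar>1 :: real\<bar> <= 1" by simp
 have i0: "integrable (lborel \<Otimes>\<^sub>M P) (%(x, w). k w * u (x + D w))"
  by (rule average_integrable[OF P D k kc um ui])
 note i1 = average_integrable[OF P D borel_measurable_const, of 1 1 u, simplified, OF ui]
 have upm: "(%x. \<bar>u x\<bar> powr p) \<in> borel_measurable borel" by measurable
 note i2 = average_integrable[OF P D borel_measurable_const, of 1 1 "%x. \<bar>u x\<bar> powr p", simplified, OF up]
 have m: "(%x. LINT w|P. k w * u (x + D w)) \<in> borel_measurable lborel"
  using Q.integrable_fst'[OF i0] by auto
 have bd: "AE x in lborel. \<bar>LINT w|P. k w * u (x + D w)\<bar> powr p <= c powr p * (LINT w|P. \<bar>u (x + D w)\<bar> powr p)"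
  using Q.AE_integrable_fst'[OF i0] Q.AE_integrable_fst'[OF i1] Q.AE_integrable_fst'[OF i2]
 proof eventually_elim
  case (elim x)
  have 1: "integrable P (%w. u (x + D w))" "integrable P (%w. \<bar>u (x + D w)\<bar> powr p)" using elim(2,3) by auto
  have "\<bar>LINT w|P. k w * u (x + D w)\<bar> <= (LINT w|P. \<bar>k w * u (x + D w)\<bar>)"
   using integral_norm_bound[of P "%w. k w * u (x + D w)"] by simp
  also have "... <= (LINT w|P. c * \<bar>u (x + D w)\<bar>)"
  proof (rule integral_mono)
   show "integrable P (%w. \<bar>k w * u (x + D w)\<bar>)" using elim(1) by simp
   show "integrable P (%w. c * \<bar>u (x + D w)\<bar>)" using 1 by simp
   fix w assume "w \<in> space P"
   then show "\<bar>k w * u (x + D w)\<bar> <= c * \<bar>u (x + D w)\<bar>" using kc by (simp add: abs_mult mult_right_mono)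
  qed
  finally have "\<bar>LINT w|P. k w * u (x + D w)\<bar> powr p <= (c * (LINT w|P. \<bar>u (x + D w)\<bar>)) powr p"
   using p by (intro powr_mono2) auto
  also have "... = c powr p * \<bar>LINT w|P. \<bar>u (x + D w)\<bar>\<bar> powr p" using c0 by (simp add: powr_mult)
  also have "\<bar>LINT w|P. \<bar>u (x + D w)\<bar>\<bar> powr p <= (LINT w|P. \<bar>\<bar>u (x + D w)\<bar>\<bar> powr p)"
   by (rule P.jensens_inequality[where I = UNIV and q = "%s. \<bar>s\<bar> powr p"]) (use 1 abs_powr_convex[OF p] in auto)
  finally show ?case by (simp add: mult_left_mono)
 qed
 have "integrable lborel (%x. \<bar>LINT w|P. k w * u (x + D w)\<bar> powr p)"
 proof (rule bint_bound[of lborel "%x. c powr p * (LINT w|P. \<bar>u (x + D w)\<bar> powr p)"])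
  show "integrable lborel (%x. c powr p * (LINT w|P. \<bar>u (x + D w)\<bar> powr p))"
   using Q.integrable_fst'[OF i2] by simp
  show "(%x. \<bar>LINT w|P. k w * u (x + D w)\<bar> powr p) \<in> borel_measurable lborel" using m by measurable
  show "AE x in lborel. norm (\<bar>LINT w|P. k w * u (x + D w)\<bar> powr p) <= norm (c powr p * (LINT w|P. \<bar>u (x + D w)\<bar> powr p))"
   using bd
  proof eventually_elim
   case (elim x)
   show ?case using order_trans[OF elim abs_ge_self] by simp
  qed
 qed
 then show ?thesis using m by (simp add: lp_def)
qed


lemma test_translate:
 fixes \<eta> :: "real^'m => real"
 assumes \<eta>: "\<eta> \<in> test_functions V" and sub: "!!x. x \<in> V ==> x + v \<in> U"
 shows "(%y. \<eta> (y - v)) \<in> test_functions U" "pd j (%y. \<eta> (y - v)) y = pd j \<eta> (y - v)"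
proof -
 note t = test_functionsD[OF \<eta>]
 have d: "((%y. y - v) has_derivative (%u. mat 1 *v u)) (at x)" for x :: "real^'m"
  by (auto intro!: derivative_eq_intros)
 have A: "smooth (%x::real^'m. (mat 1 :: real^'m^'m) $ i $ j)" for i j by simp
 note c = smooth_compose_forward[OF d A t(1)]
 show "pd j (%y. \<eta> (y - v)) y = pd j \<eta> (y - v)"
  using c(2)[of j y] by (simp add: mat_def if_distrib cong: if_cong)
 show "(%y. \<eta> (y - v)) \<in> test_functions U"
 proof (rule test_functionsI[of _ "(%x. v + x) ` supp \<eta>"])
  show "smooth (%y. \<eta> (y - v))" by (rule c(1))
  show "compact ((%x. v + x) ` supp \<eta>)" using t(2) by (rule compact_translation)
  show "(%x. v + x) ` supp \<eta> \<subseteq> U" using t(3) sub by (auto simp: add.commute)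
  fix x assume x: "x \<notin> (%x. v + x) ` supp \<eta>"
  have "x - v \<notin> supp \<eta>"
  proof
   assume "x - v \<in> supp \<eta>"
   then have "v + (x - v) \<in> (%x. v + x) ` supp \<eta>" by (rule imageI)
   then show False using x by simp
  qed
  then show "\<eta> (x - v) = 0" by (rule not_supp)
 qed
qed

definition unit_time :: "real measure" where "unit_time = restrict_space lborel {0..1}"

lemma unit_time:
 shows "prob_space unit_time" "space unit_time = {0..1}" "(%t. t) \<in> borel_measurable unit_time"
  "(LINT t|unit_time. u t) = (LINT t|lborel. u t * indicator {0..1} t :: real)"
proof -
 show "prob_space unit_time"
  by (rule prob_spaceI) (simp add: unit_time_def space_restrict_space emeasure_restrict_space)
 show "space unit_time = {0..1}" by (simp add: unit_time_def space_restrict_space)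
 show "(%t. t) \<in> borel_measurable unit_time" unfolding unit_time_def by (rule measurable_restrict_space1) simp
 show "(LINT t|unit_time. u t) = (LINT t|lborel. u t * indicator {0..1} t)"
  by (simp add: unit_time_def integral_restrict_space mult.commute)
qed

text \<open>With \<open>a = z \<bullet> h\<close> and \<open>q = h \<bullet> f h\<close>, this is the weak
  form of \<open>a (x + h) - a x = \<integral> q (x + t h) dt\<close>. The fundamental theorem
  of calculus is applied to the translated test function, since \<open>z\<close> has no
  pointwise derivative.\<close>

lemma weak_increment:
 fixes a q :: "real^'m => real" and h :: "real^'m"
 assumes \<eta>: "\<eta> \<in> test_functions V" and sub: "!!x t. x \<in> V ==> 0 <= t ==> t <= 1 ==> x + t *\<^sub>R h \<in> U"
  and am: "a \<in> borel_measurable borel" and ai: "integrable lborel a"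
  and weak: "!!\<psi>. \<psi> \<in> test_functions U ==>
   (LINT y|lborel. a y * (\<Sum>j\<in>UNIV. pd j \<psi> y * h $ j)) = - (LINT y|lborel. \<psi> y * q y)"
 shows "(LINT y|lborel. (\<eta> (y - h) - \<eta> y) * a y) = (LINT t|unit_time. LINT y|lborel. \<eta> (y - t *\<^sub>R h) * q y)"
proof -
 note t = test_functionsD[OF \<eta>]
 define G where "G y = - (\<Sum>j\<in>UNIV. pd j \<eta> y * h $ j)" for y
 have Gc: "continuous_on UNIV G" unfolding G_def
  by (intro continuous_intros smooth_continuous smooth_pd t)
 obtain g where g: "!!y. \<bar>G y\<bar> <= g"
 proof -
  have "\<exists>B. \<forall>x. norm (pd j \<eta> x) <= B" for j by (rule bounded_test[OF test_pd[OF \<eta>]])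
  then obtain B where B: "!!j x. \<bar>pd j \<eta> x\<bar> <= B j" unfolding real_norm_def by metis
  have "\<bar>G y\<bar> <= (\<Sum>j\<in>UNIV. B j * \<bar>h $ j\<bar>)" for y
  proof -
   have "\<bar>G y\<bar> <= (\<Sum>j\<in>UNIV. \<bar>pd j \<eta> y * h $ j\<bar>)" unfolding G_def abs_minus_cancel by (rule sum_abs)
   also have "... <= (\<Sum>j\<in>UNIV. B j * \<bar>h $ j\<bar>)" unfolding abs_mult by (intro sum_mono mult_right_mono B) auto
   finally show ?thesis .
  qed
  then show ?thesis by (rule that)
 qed
 have der: "((%s. \<eta> (y - s *\<^sub>R h)) has_real_derivative G (y - s *\<^sub>R h)) (at s)" for y s
 proof -
  have "((%s. \<eta> (y - s *\<^sub>R h)) has_derivative (%r. frechet_derivative \<eta> (at (y - s *\<^sub>R h)) (- (r *\<^sub>R h)))) (at s)"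
   by (rule has_derivative_compose[OF _ smooth_has_derivative[OF t(1)]]) (auto intro!: derivative_eq_intros)
  moreover have "frechet_derivative \<eta> (at (y - s *\<^sub>R h)) (- (r *\<^sub>R h)) = G (y - s *\<^sub>R h) * r" for r
   using frechet_pd[OF smooth_differentiable[OF t(1)], of "y - s *\<^sub>R h" "- (r *\<^sub>R h)"]
   by (simp add: G_def sum_distrib_left sum_distrib_right sum_negf mult_ac)
  ultimately show ?thesis unfolding has_field_derivative_def by simp
 qed
 have FTC: "\<eta> (y - h) - \<eta> y = (LINT s|unit_time. G (y - s *\<^sub>R h))" for y
 proof -
  have "(LINT s|lborel. G (y - s *\<^sub>R h) * indicator {0..1} s) = \<eta> (y - 1 *\<^sub>R h) - \<eta> (y - 0 *\<^sub>R h)"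
  proof (rule integral_FTC_Icc_real)
   fix s :: real
   show "((%s. \<eta> (y - s *\<^sub>R h)) has_real_derivative G (y - s *\<^sub>R h)) (at s)" by (rule der)
   have "isCont G (y - s *\<^sub>R h)" using Gc continuous_on_eq_continuous_at[OF open_UNIV] by blast
   then show "isCont (%s. G (y - s *\<^sub>R h)) s"
    by (rule isCont_o2[rotated]) (auto intro!: continuous_intros)
  qed simp
  then show ?thesis by (simp add: unit_time(4))
 qed
 interpret T: prob_space unit_time by (rule unit_time(1))
 interpret Q: pair_sigma_finite lborel unit_time by unfold_locales
 note [measurable] = unit_time(3) borel_measurable_continuous_onI[OF Gc] am
 have i0: "integrable (lborel \<Otimes>\<^sub>M unit_time) (%(y, s). g * a (y + (%_. 0) s))"
  by (rule average_integrable[OF unit_time(1), of _ _ "\<bar>g\<bar>"]) (use ai am in auto)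
 have i: "integrable (lborel \<Otimes>\<^sub>M unit_time) (%(y, s). G (y - s *\<^sub>R h) * a y)"
 proof (rule bint_bound[OF i0])
  show "(%(y, s). G (y - s *\<^sub>R h) * a y) \<in> borel_measurable (lborel \<Otimes>\<^sub>M unit_time)" by measurable
  show "AE x in lborel \<Otimes>\<^sub>M unit_time. norm (case x of (y, s) => G (y - s *\<^sub>R h) * a y) <= norm (case x of (y, s) => g * a (y + (%_. 0) s))"
  proof (rule AE_I2)
   fix x :: "(real^'m) \<times> real"
   have "\<bar>G (fst x - snd x *\<^sub>R h)\<bar> * \<bar>a (fst x)\<bar> <= \<bar>g\<bar> * \<bar>a (fst x)\<bar>"
    using g[of "fst x - snd x *\<^sub>R h"] by (intro mult_right_mono) auto
   then show "norm (case x of (y, s) => G (y - s *\<^sub>R h) * a y) <= norm (case x of (y, s) => g * a (y + (%_. 0) s))"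
    by (simp add: case_prod_beta abs_mult)
  qed
 qed
 have "(LINT y|lborel. (\<eta> (y - h) - \<eta> y) * a y) = (LINT y|lborel. LINT s|unit_time. G (y - s *\<^sub>R h) * a y)"
  by (simp add: FTC)
 also have "... = (LINT s|unit_time. LINT y|lborel. G (y - s *\<^sub>R h) * a y)"
  by (rule Q.Fubini_integral[OF i, symmetric])
 also have "... = (LINT t|unit_time. LINT y|lborel. \<eta> (y - t *\<^sub>R h) * q y)"
 proof (rule bint_cong[OF refl])
  fix s assume "s \<in> space unit_time"
  then have s: "0 <= s" "s <= 1" by (auto simp: unit_time(2))
  have tt: "!!x. x \<in> V ==> x + s *\<^sub>R h \<in> U" using sub s by blast
  note tr = test_translate[OF \<eta> tt]
  have "(LINT y|lborel. G (y - s *\<^sub>R h) * a y) = - (LINT y|lborel. a y * (\<Sum>j\<in>UNIV. pd j (%y. \<eta> (y - s *\<^sub>R h)) y * h $ j))"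
   by (simp add: tr(2)[simplified] G_def mult.commute)
  also have "... = (LINT y|lborel. \<eta> (y - s *\<^sub>R h) * q y)" using weak[OF tr(1)] by simp
  finally show "(LINT y|lborel. G (y - s *\<^sub>R h) * a y) = (LINT y|lborel. \<eta> (y - s *\<^sub>R h) * q y)" .
 qed
 finally show ?thesis .
qed


text \<open>Uniform distribution on a ball. Its space is the ball itself, so that bounds on displacements
  hold everywhere and not just almost everywhere.\<close>

definition disp :: "real => (real^'m) measure" where
 "disp \<rho> = uniform_measure (restrict_space lborel (cball 0 \<rho>)) (cball 0 \<rho>)"

lemma disp:
 assumes \<rho>: "\<rho> > 0"
 shows "prob_space (disp \<rho> :: (real^'m) measure)" "space (disp \<rho>) = (cball 0 \<rho> :: (real^'m) set)"
  "(%k. k) \<in> borel_measurable (disp \<rho> :: (real^'m) measure)"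
  "\<exists>C::real. 0 <= C \<and> (\<forall>u\<in>borel_measurable borel. (\<integral>\<^sup>+k. u k \<partial>(disp \<rho> :: (real^'m) measure)) <= ennreal C * (\<integral>\<^sup>+k. u k \<partial>lborel))"
proof -
 let ?B = "cball 0 \<rho> :: (real^'m) set" and ?M = "restrict_space lborel (cball 0 \<rho>) :: (real^'m) measure"
 have e: "emeasure ?M ?B = emeasure lborel ?B" by (rule emeasure_restrict_space) auto
 have v: "measure lborel ?B > 0" using content_cball_pos[OF \<rho>, of "0 :: real^'m"] .
 have fin: "emeasure lborel ?B < \<infinity>" using emeasure_lborel_cball_finite[of "0 :: real^'m" \<rho>] by simp
 then have ev: "emeasure lborel ?B = ennreal (measure lborel ?B)" by (simp add: emeasure_eq_ennreal_measure)
 show "prob_space (disp \<rho> :: (real^'m) measure)" unfolding disp_def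
  by (rule prob_space_uniform_measure) (use v in \<open>simp_all add: e ev\<close>)
 show "space (disp \<rho>) = ?B" by (simp add: disp_def uniform_measure_def space_restrict_space)
 show "(%k. k) \<in> borel_measurable (disp \<rho> :: (real^'m) measure)"
  unfolding disp_def by (simp add: uniform_measure_def measurable_restrict_space1)
 have "(\<integral>\<^sup>+k. u k \<partial>disp \<rho>) <= ennreal (1 / measure lborel ?B) * (\<integral>\<^sup>+k. u k \<partial>lborel)"
  if u: "u \<in> borel_measurable borel" for u :: "real^'m => ennreal"
 proof -
  have um: "u \<in> borel_measurable ?M" using u by (simp add: measurable_restrict_space1)
  have B: "?B \<in> sets ?M" by (simp add: sets_restrict_space_iff)
  have "(\<integral>\<^sup>+k. u k \<partial>disp \<rho>) = (\<integral>\<^sup>+k. u k * indicator ?B k \<partial>?M) / emeasure ?M ?B"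
   unfolding disp_def by (rule nn_integral_uniform_measure[OF um B])
  also have "(\<integral>\<^sup>+k. u k * indicator ?B k \<partial>?M) = (\<integral>\<^sup>+k. u k * indicator ?B k * indicator ?B k \<partial>lborel)"
   by (rule nn_integral_restrict_space) simp
  also have "... / emeasure ?M ?B <= (\<integral>\<^sup>+k. u k \<partial>lborel) / emeasure ?M ?B"
   by (intro divide_right_mono_ennreal nn_integral_mono) (simp split: split_indicator)
  also have "... = ennreal (1 / measure lborel ?B) * (\<integral>\<^sup>+k. u k \<partial>lborel)"
   unfolding e ev divide_ennreal_def using v by (simp add: inverse_ennreal mult.commute divide_inverse)
  finally show ?thesis .
 qed
 then show "\<exists>C::real. 0 <= C \<and> (\<forall>u\<in>borel_measurable borel. (\<integral>\<^sup>+k. u k \<partial>(disp \<rho> :: (real^'m) measure)) <= ennreal C * (\<integral>\<^sup>+k. u k \<partial>lborel))"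
  using v by (intro exI[of _ "1 / measure lborel ?B"]) auto
qed

text \<open>The density of the displacement is bounded, so the average of an integrable function is a
  bounded function.\<close>

lemma disp_average_bounded:
 fixes u :: "real^'m => real"
 assumes \<rho>: "\<rho> > 0" and kc: "!!k. k \<in> cball 0 \<rho> ==> \<bar>\<kappa> k\<bar> <= b"
  and um[measurable]: "u \<in> borel_measurable borel" and ui: "integrable lborel u"
 shows "\<exists>B. \<forall>x. \<bar>LINT k|disp \<rho>. \<kappa> k * u (x + (c + k))\<bar> <= B"
proof -
 obtain C where C: "0 <= C" "!!u. u \<in> borel_measurable borel ==> (\<integral>\<^sup>+k. u k \<partial>(disp \<rho> :: (real^'m) measure)) <= ennreal C * (\<integral>\<^sup>+k. u k \<partial>lborel)"
  using disp(4)[OF \<rho>, where 'm = 'm] by blast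
 have b0: "0 <= b" using kc[of 0] \<rho> by (smt (verit) abs_ge_zero centre_in_cball)
 define I where "I = ennreal b * (ennreal C * (\<integral>\<^sup>+x. ennreal \<bar>u x\<bar> \<partial>lborel))"
 have I: "I < \<infinity>" using ui by (simp add: I_def integrable_iff_bounded ennreal_mult_less_top)
 have "\<bar>LINT k|disp \<rho>. \<kappa> k * u (x + (c + k))\<bar> <= enn2real I" for x
 proof (cases "integrable (disp \<rho>) (%k. \<kappa> k * u (x + (c + k)))")
  case True
  have "ennreal (norm (LINT k|disp \<rho>. \<kappa> k * u (x + (c + k)))) <= (\<integral>\<^sup>+k. ennreal (norm (\<kappa> k * u (x + (c + k)))) \<partial>disp \<rho>)"
   by (rule integral_norm_bound_ennreal[OF True])
  also have "... <= (\<integral>\<^sup>+k. ennreal (b * \<bar>u (x + (c + k))\<bar>) \<partial>disp \<rho>)"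
  proof (rule nn_integral_mono)
   fix k :: "real^'m" assume "k \<in> space (disp \<rho>)"
   then have "\<bar>\<kappa> k\<bar> <= b" using kc by (simp add: disp(2)[OF \<rho>])
   then show "ennreal (norm (\<kappa> k * u (x + (c + k)))) <= ennreal (b * \<bar>u (x + (c + k))\<bar>)"
    by (intro ennreal_leI) (simp add: abs_mult mult_right_mono)
  qed
  also have "... <= ennreal C * (\<integral>\<^sup>+k. ennreal (b * \<bar>u (x + (c + k))\<bar>) \<partial>lborel)" by (rule C(2)) measurable
  also have "(\<integral>\<^sup>+k. ennreal (b * \<bar>u (x + (c + k))\<bar>) \<partial>lborel) = (\<integral>\<^sup>+k. ennreal b * ennreal \<bar>u (k + (x + c))\<bar> \<partial>lborel)"
   using b0 by (simp add: ennreal_mult ac_simps)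
  also have "... = ennreal b * (\<integral>\<^sup>+k. ennreal \<bar>u (k + (x + c))\<bar> \<partial>lborel)" by (rule nn_integral_cmult) measurable
  also have "(\<integral>\<^sup>+k. ennreal \<bar>u (k + (x + c))\<bar> \<partial>lborel) = (\<integral>\<^sup>+k. ennreal \<bar>u k\<bar> \<partial>lborel)"
   by (rule lborel_translate(1)) measurable
  finally have "ennreal \<bar>LINT k|disp \<rho>. \<kappa> k * u (x + (c + k))\<bar> <= I" by (simp add: I_def mult_ac)
  from enn2real_mono[OF this] I show ?thesis by simp
 qed (simp add: not_integrable_integral_eq)
 then show ?thesis by blast
qed

lemma integrable_lborel_mult:
 assumes "integrable lborel u" "\<eta> \<in> borel_measurable borel" "!!x. \<bar>\<eta> x\<bar> <= e"
 shows "integrable lborel (%y. \<eta> y * u y :: real)"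
 using integrable_test_scaleR[of lborel u \<eta> e] assms by simp

text \<open>The symmetric gradient controls \<open>z (x + h) \<bullet> h - z x \<bullet> h\<close> for every
  \<open>h\<close>. Averaged over \<open>h = c + k\<close>, the unshifted term becomes \<open>z
  x\<close> times the mean displacement, while \<open>z (x + h)\<close> becomes harmless. The
  identity is tested with \<open>\<eta>\<close>, so that only Fubini for integrals is needed.\<close>

lemma korn_identity:
 fixes z :: "real^'m => real^'m" and f :: "real^'m => real^'m^'m"
 assumes r: "r > 0" and \<rho>: "\<rho> > 0" and sub: "ball x0 (r + (norm c + \<rho>)) \<subseteq> U"
  and zm: "!!a. (%y. z y $ a) \<in> borel_measurable borel" and zi: "!!a. integrable lborel (%y. z y $ a)"
  and fm: "!!a b. (%y. f y $ a $ b) \<in> borel_measurable borel" and fi: "!!a b. integrable lborel (%y. f y $ a $ b)"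
  and weak: "!!\<psi> h. \<psi> \<in> test_functions U ==>
   (LINT y|lborel. (z y \<bullet> h) * (\<Sum>j\<in>UNIV. pd j \<psi> y * h $ j)) = - (LINT y|lborel. \<psi> y * (h \<bullet> (f y *v h)))"
 defines "P \<equiv> (disp \<rho> :: (real^'m) measure) \<Otimes>\<^sub>M unit_time"
 shows "AE x in LB (ball x0 r). (\<Sum>a\<in>UNIV. (LINT k|disp \<rho>. (c + k) $ a) * z x $ a) =
   (\<Sum>a\<in>UNIV. LINT k|disp \<rho>. (c + k) $ a * z (x + (c + k)) $ a) -
   (\<Sum>a\<in>UNIV. \<Sum>b\<in>UNIV. LINT w|P. ((c + fst w) $ a * (c + fst w) $ b) * f (x + snd w *\<^sub>R (c + fst w)) $ a $ b)"
proof -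
 let ?U = "ball x0 r" and ?\<nu> = "disp \<rho> :: (real^'m) measure" and ?l = "norm c + \<rho>"
 note dp = disp[OF \<rho>, where 'm = 'm]
 interpret N: prob_space ?\<nu> by (rule dp(1))
 interpret T: prob_space unit_time by (rule unit_time(1))
 interpret NT: pair_prob_space ?\<nu> unit_time by unfold_locales
 have P: "prob_space P" unfolding P_def by unfold_locales
 note [measurable] = dp(3) unit_time(3) zm fm
 have l: "norm (c + k) <= ?l" if "k \<in> cball 0 \<rho>" for k
  using norm_triangle_ineq[of c k] that by (simp add: dist_norm)
 have la: "\<bar>(c + k) $ a\<bar> <= ?l" if "k \<in> cball 0 \<rho>" for k a
  using component_le_norm_cart[of "c + k" a] l[OF that] by linarith
 have D1: "(%k. c + k) \<in> borel_measurable ?\<nu>" by measurable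
 have ka: "(%k. (c + k) $ a) \<in> borel_measurable ?\<nu>" for a
  by (rule measurable_compose[OF D1 borel_measurable_continuous_onI[of "%v. v $ a"]]) (intro continuous_intros)
 have kab: "\<bar>(c + k) $ a\<bar> <= ?l" if "k \<in> space ?\<nu>" for k a using that la by (simp add: dp(2))
 have fstP: "fst \<in> measurable P ?\<nu>" unfolding P_def by simp
 have D2: "(%w. snd w *\<^sub>R (c + fst w)) \<in> borel_measurable P" unfolding P_def by measurable
 have kP: "(%w. (c + fst w) $ a * (c + fst w) $ b) \<in> borel_measurable P" for a b
  by (intro borel_measurable_times measurable_compose[OF fstP ka])
 have kPb: "\<bar>(c + fst w) $ a * (c + fst w) $ b\<bar> <= ?l * ?l" if "w \<in> space P" for w a b
  unfolding abs_mult using that \<rho>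
  by (intro mult_mono la) (auto simp: P_def space_pair_measure dp(2))
 define Z where "Z a x = (LINT k|disp \<rho>. (c + k) $ a * z (x + (c + k)) $ a)" for a x
 define F where "F a b x = (LINT w|P. ((c + fst w) $ a * (c + fst w) $ b) * f (x + snd w *\<^sub>R (c + fst w)) $ a $ b)" for a b x
 define m where "m a = (LINT k|?\<nu>. (c + k) $ a)" for a
 define W where "W x = (\<Sum>a\<in>UNIV. m a * z x $ a) - ((\<Sum>a\<in>UNIV. Z a x) - (\<Sum>a\<in>UNIV. \<Sum>b\<in>UNIV. F a b x))" for x
 have Zi: "integrable lborel (Z a)" for a
  unfolding Z_def by (rule average_duality(1)[OF dp(1) D1 ka kab zm zi, where \<eta> = "%_. 0" and e = 0]) auto
 have Fi: "integrable lborel (F a b)" for a b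
  unfolding F_def by (rule average_duality(1)[OF P D2 kP kPb fm fi, where \<eta> = "%_. 0" and e = 0]) auto
 have Wi: "integrable lborel W" unfolding W_def
  by (intro bint_diff bint_sum integrable_mult_right zi Zi Fi)
 have test: "(LINT x|LB ?U. \<eta> x * W x) = 0" if \<eta>: "\<eta> \<in> test_functions ?U" for \<eta> :: "real^'m => real"
 proof -
  obtain e where e: "!!x. \<bar>\<eta> x\<bar> <= e" using bounded_test[OF \<eta>] unfolding real_norm_def by blast
  have \<eta>m[measurable]: "\<eta> \<in> borel_measurable borel" by (rule test_borel_measurable[OF \<eta>])
  note Zd = average_duality[OF dp(1) D1 ka kab zm zi \<eta>m e]
  note Fd = average_duality[OF P D2 kP kPb fm fi \<eta>m e]
  have \<eta>v: "integrable lborel (%y. \<eta> (y - v) * u y)" if "integrable lborel u" for u v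
   by (rule integrable_lborel_mult[OF that, of "%y. \<eta> (y - v)" e]) (use e in simp_all)
  define Iz where "Iz a = (LINT y|lborel. \<eta> y * z y $ a)" for a
  define Kz where "Kz a v = (LINT y|lborel. \<eta> (y - v) * z y $ a)" for a v
  define Kf where "Kf a b v = (LINT y|lborel. \<eta> (y - v) * f y $ a $ b)" for a b v
  have per_k: "(\<Sum>a\<in>UNIV. (c + k) $ a * Kz a (c + k)) - (\<Sum>a\<in>UNIV. (c + k) $ a * Iz a) =
    (LINT t|unit_time. (\<Sum>a\<in>UNIV. \<Sum>b\<in>UNIV. ((c + k) $ a * (c + k) $ b) * Kf a b (t *\<^sub>R (c + k))))"
   if k: "k \<in> space ?\<nu>" for k
  proof -
   define h where "h = c + k"
   have hl: "norm h <= ?l" using l k by (simp add: h_def dp(2))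
   have seg: "x + t *\<^sub>R h \<in> U" if "x \<in> ?U" "0 <= t" "t <= 1" for x t
   proof -
    have "norm (t *\<^sub>R h) <= ?l" using that hl mult_mono[of t 1 "norm h" ?l] by simp
    then have "dist x0 (x + t *\<^sub>R h) < r + ?l"
     using that(1) norm_triangle_ineq4[of "x0 - x" "t *\<^sub>R h"] by (simp add: dist_norm algebra_simps)
    then show ?thesis using sub by auto
   qed
   have inn: "z y \<bullet> h = (\<Sum>a\<in>UNIV. h $ a * z y $ a)" for y by (simp add: inner_vec_def mult.commute)
   have quad: "h \<bullet> (f y *v h) = (\<Sum>a\<in>UNIV. \<Sum>b\<in>UNIV. h $ a * h $ b * f y $ a $ b)" for y
    by (simp add: inner_vec_def matrix_vector_mult_def sum_distrib_left mult_ac)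
   have zhm: "(%y. z y \<bullet> h) \<in> borel_measurable borel" unfolding inn by measurable
   have zhi: "integrable lborel (%y. z y \<bullet> h)" unfolding inn
    by (intro bint_sum integrable_mult_right zi)
   have "(LINT y|lborel. (\<eta> (y - h) - \<eta> y) * (z y \<bullet> h)) = (LINT t|unit_time. LINT y|lborel. \<eta> (y - t *\<^sub>R h) * (h \<bullet> (f y *v h)))"
    by (rule weak_increment[OF \<eta> seg zhm zhi weak])
   moreover have "(LINT y|lborel. (\<eta> (y - h) - \<eta> y) * (z y \<bullet> h)) = (\<Sum>a\<in>UNIV. h $ a * Kz a h) - (\<Sum>a\<in>UNIV. h $ a * Iz a)"
   proof -
    have i: "integrable lborel (%y. h $ a * (\<eta> (y - h) * z y $ a))" "integrable lborel (%y. h $ a * (\<eta> y * z y $ a))" for a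
     using \<eta>v[OF zi, of h a] \<eta>v[OF zi, of 0 a] by auto
    have "(\<eta> (y - h) - \<eta> y) * (z y \<bullet> h) = (\<Sum>a\<in>UNIV. h $ a * (\<eta> (y - h) * z y $ a)) - (\<Sum>a\<in>UNIV. h $ a * (\<eta> y * z y $ a))" for y
     unfolding inn sum_subtractf[symmetric] sum_distrib_left by (rule sum.cong) (auto simp: algebra_simps)
    then show ?thesis using i
     by (simp add: bint_of_diff bint_of_sum Kz_def Iz_def)
   qed
   moreover have "(LINT y|lborel. \<eta> (y - t *\<^sub>R h) * (h \<bullet> (f y *v h))) =
     (\<Sum>a\<in>UNIV. \<Sum>b\<in>UNIV. (h $ a * h $ b) * Kf a b (t *\<^sub>R h))" for t
   proof -
    have i: "integrable lborel (%y. h $ a * h $ b * (\<eta> (y - t *\<^sub>R h) * f y $ a $ b))" for a b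
     using \<eta>v[OF fi, of "t *\<^sub>R h" a b] by auto
    have "\<eta> (y - t *\<^sub>R h) * (h \<bullet> (f y *v h)) = (\<Sum>a\<in>UNIV. \<Sum>b\<in>UNIV. h $ a * h $ b * (\<eta> (y - t *\<^sub>R h) * f y $ a $ b))" for y
     unfolding quad by (simp add: sum_distrib_left mult_ac)
    then show ?thesis using i
     by (simp add: bint_of_sum bint_sum Kf_def)
   qed
   ultimately show ?thesis by (simp add: h_def)
  qed
  have ki: "integrable ?\<nu> (%k. (c + k) $ a)" for a
   by (rule N.integrable_const_bound[of _ ?l]) (use kab ka in \<open>auto intro!: AE_I2\<close>)
  have i1: "integrable ?\<nu> (%k. (c + k) $ a * Kz a (c + k))" for a unfolding Kz_def by (rule Zd(3))
  have i2: "integrable P (%w. ((c + fst w) $ a * (c + fst w) $ b) * Kf a b (snd w *\<^sub>R (c + fst w)))" for a b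
   unfolding Kf_def by (rule Fd(3))
  have L: "(LINT k|?\<nu>. (\<Sum>a\<in>UNIV. (c + k) $ a * Kz a (c + k)) - (\<Sum>a\<in>UNIV. (c + k) $ a * Iz a)) =
    (\<Sum>a\<in>UNIV. LINT x|lborel. \<eta> x * Z a x) - (\<Sum>a\<in>UNIV. m a * Iz a)"
  proof -
   have "(LINT k|?\<nu>. (c + k) $ a * Kz a (c + k)) = (LINT x|lborel. \<eta> x * Z a x)" for a
    unfolding Kz_def Z_def by (rule Zd(4)[symmetric])
   moreover have "(LINT k|?\<nu>. (c + k) $ a * Iz a) = m a * Iz a" for a by (simp add: m_def)
   ultimately show ?thesis using i1 ki
    by (simp only: bint_of_diff bint_of_sum bint_sum integrable_mult_left)
  qed
  have R: "(LINT k|?\<nu>. LINT t|unit_time. (\<Sum>a\<in>UNIV. \<Sum>b\<in>UNIV. ((c + k) $ a * (c + k) $ b) * Kf a b (t *\<^sub>R (c + k)))) =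
    (\<Sum>a\<in>UNIV. \<Sum>b\<in>UNIV. LINT x|lborel. \<eta> x * F a b x)"
  proof -
   let ?g = "%w. \<Sum>a\<in>UNIV. \<Sum>b\<in>UNIV. ((c + fst w) $ a * (c + fst w) $ b) * Kf a b (snd w *\<^sub>R (c + fst w))"
   have gi: "integrable (?\<nu> \<Otimes>\<^sub>M unit_time) ?g" using i2 unfolding P_def
    by (intro bint_sum)
   have "(LINT k|?\<nu>. LINT t|unit_time. ?g (k, t)) = (LINT w|P. ?g w)"
    unfolding P_def by (rule NT.integral_fst'[OF gi])
   also have "... = (\<Sum>a\<in>UNIV. \<Sum>b\<in>UNIV. LINT w|P. ((c + fst w) $ a * (c + fst w) $ b) * Kf a b (snd w *\<^sub>R (c + fst w)))"
    using i2 by (simp only: bint_of_sum bint_sum)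
   also have "... = (\<Sum>a\<in>UNIV. \<Sum>b\<in>UNIV. LINT x|lborel. \<eta> x * F a b x)"
    unfolding Kf_def F_def by (simp only: Fd(4))
   finally show ?thesis by simp
  qed
  have main: "(\<Sum>a\<in>UNIV. LINT x|lborel. \<eta> x * Z a x) - (\<Sum>a\<in>UNIV. m a * Iz a) = (\<Sum>a\<in>UNIV. \<Sum>b\<in>UNIV. LINT x|lborel. \<eta> x * F a b x)"
   unfolding L[symmetric] R[symmetric] by (rule bint_cong[OF refl per_k])
  have iz: "integrable lborel (%x. m a * (\<eta> x * z x $ a))" for a using \<eta>v[OF zi, of 0 a] by auto
  have iZ: "integrable lborel (%x. \<eta> x * Z a x)" for a using \<eta>v[OF Zi, of 0 a] by auto
  have iF: "integrable lborel (%x. \<eta> x * F a b x)" for a b using \<eta>v[OF Fi, of 0 a b] by auto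
  have "(LINT x|LB ?U. \<eta> x * W x) = (LINT x|lborel. indicator ?U x *\<^sub>R (\<eta> x * W x))"
   unfolding LB_def by (rule integral_restrict_space) simp
  also have "... = (LINT x|lborel. \<eta> x * W x)"
   by (rule bint_cong[OF refl]) (use test_0_outside[OF \<eta>] in \<open>auto split: split_indicator\<close>)
  also have "... = (LINT x|lborel. (\<Sum>a\<in>UNIV. m a * (\<eta> x * z x $ a)) - ((\<Sum>a\<in>UNIV. \<eta> x * Z a x) - (\<Sum>a\<in>UNIV. \<Sum>b\<in>UNIV. \<eta> x * F a b x)))"
   by (rule bint_cong[OF refl]) (simp add: W_def right_diff_distrib sum_distrib_left mult_ac)
  also have "... = (\<Sum>a\<in>UNIV. LINT x|lborel. m a * (\<eta> x * z x $ a)) - ((\<Sum>a\<in>UNIV. LINT x|lborel. \<eta> x * Z a x) - (\<Sum>a\<in>UNIV. \<Sum>b\<in>UNIV. LINT x|lborel. \<eta> x * F a b x))"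
   using iz iZ iF by (simp only: bint_of_diff bint_of_sum bint_sum bint_diff)
  also have "... = 0" using main by (simp add: Iz_def)
  finally show ?thesis .
 qed
 have Wl: "integrable (LB ?U) W" unfolding LB_def
  using integrable_mult_indicator[OF _ Wi, of ?U] by (simp add: integrable_restrict_space)
 have "AE x in LB ?U. W x = 0"
  by (rule fundamental_lemma[OF open_ball finite_measure_LB sets_LB Wl test]) auto
 then show ?thesis
 proof eventually_elim
  case (elim x)
  then show ?case unfolding W_def Z_def F_def m_def by linarith
 qed
qed


lemma lp_restrict:
 assumes "V \<in> sets borel" "lp lborel p u" shows "lp (LB V) p u"
 using integrable_mult_indicator[of V lborel "%x. \<bar>u x\<bar> powr p"] assms
 by (auto simp: lp_def LB_def integrable_restrict_space measurable_restrict_space1)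

text \<open>Displacements around \<open>0\<close> and around \<open>s e\<^sub>i\<close> have means that
  differ by \<open>s e\<^sub>i\<close>; the difference of the two identities expresses \<open>s
  z\<^sub>i\<close> by a bounded function and by averages of \<open>f\<close>, to which Jensen
  applies.\<close>

lemma korn_local:
 fixes z :: "real^'m => real^'m" and f :: "real^'m => real^'m^'m"
 assumes R: "s > 0" and sub: "ball x0 (3 * s) \<subseteq> U" and p: "p \<ge> 1"
  and zm: "!!a. (%y. z y $ a) \<in> borel_measurable borel" and zi: "!!a. integrable lborel (%y. z y $ a)"
  and fm: "!!a b. (%y. f y $ a $ b) \<in> borel_measurable borel" and fi: "!!a b. integrable lborel (%y. f y $ a $ b)"
  and fp: "!!a b. integrable lborel (%y. \<bar>f y $ a $ b\<bar> powr p)"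
  and weak: "!!\<psi> h. \<psi> \<in> test_functions U ==>
   (LINT y|lborel. (z y \<bullet> h) * (\<Sum>j\<in>UNIV. pd j \<psi> y * h $ j)) = - (LINT y|lborel. \<psi> y * (h \<bullet> (f y *v h)))"
 shows "lp (LB (ball x0 s)) p (%x. z x $ i)"
proof -
 let ?U = "ball x0 s" and ?\<nu> = "disp s :: (real^'m) measure"
 note dp = disp[OF R, where 'm = 'm]
 interpret N: prob_space ?\<nu> by (rule dp(1))
 interpret T: prob_space unit_time by (rule unit_time(1))
 interpret NT: pair_prob_space ?\<nu> unit_time by unfold_locales
 define P where "P = ?\<nu> \<Otimes>\<^sub>M unit_time"
 have P: "prob_space P" unfolding P_def by unfold_locales
 note [measurable] = dp(3) unit_time(3)
 define W where "W c x = (\<Sum>a\<in>UNIV. LINT k|disp s. (c + k) $ a * z (x + (c + k)) $ a) -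
   (\<Sum>a\<in>UNIV. \<Sum>b\<in>UNIV. LINT w|P. ((c + fst w) $ a * (c + fst w) $ b) * f (x + snd w *\<^sub>R (c + fst w)) $ a $ b)" for c x
 have key: "lp (LB ?U) p (W c) \<and> (AE x in LB ?U. (\<Sum>a\<in>UNIV. (LINT k|?\<nu>. (c + k) $ a) * z x $ a) = W c x)" if c: "norm c <= s" for c
 proof
  let ?l = "norm c + s"
  have la: "\<bar>(c + k) $ a\<bar> <= ?l" if "k \<in> cball 0 s" for k a
   using component_le_norm_cart[of "c + k" a] norm_triangle_ineq[of c k] that by (simp add: dist_norm)
  have D1: "(%k. c + k) \<in> borel_measurable ?\<nu>" by measurable
  have ka: "(%k. (c + k) $ a) \<in> borel_measurable ?\<nu>" for a
   by (rule measurable_compose[OF D1 borel_measurable_continuous_onI[of "%v. v $ a"]]) (intro continuous_intros)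
  have kab: "\<bar>(c + k) $ a\<bar> <= ?l" if "k \<in> space ?\<nu>" for k a using that la by (simp add: dp(2))
  have fstP: "fst \<in> measurable P ?\<nu>" unfolding P_def by simp
  have D2: "(%w. snd w *\<^sub>R (c + fst w)) \<in> borel_measurable P" unfolding P_def by measurable
  have kP: "(%w. (c + fst w) $ a * (c + fst w) $ b) \<in> borel_measurable P" for a b
   by (intro borel_measurable_times measurable_compose[OF fstP ka])
  have kPb: "\<bar>(c + fst w) $ a * (c + fst w) $ b\<bar> <= ?l * ?l" if "w \<in> space P" for w a b
   unfolding abs_mult using that R
   by (intro mult_mono la) (auto simp: P_def space_pair_measure dp(2))
  have sub': "ball x0 (s + (norm c + s)) \<subseteq> U"
   by (rule subset_trans[OF subset_ball sub]) (use c in linarith)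
  show "AE x in LB ?U. (\<Sum>a\<in>UNIV. (LINT k|?\<nu>. (c + k) $ a) * z x $ a) = W c x"
   unfolding W_def P_def by (rule korn_identity[OF R R sub' zm zi fm fi weak])
  have fin: "finite_measure (LB ?U)" by (rule finite_measure_LB) auto
  have Z: "lp (LB ?U) p (%x. LINT k|disp s. (c + k) $ a * z (x + (c + k)) $ a)" for a
  proof -
   obtain B where B: "!!x. \<bar>LINT k|disp s. (c + k) $ a * z (x + (c + k)) $ a\<bar> <= B"
    using disp_average_bounded[OF R, of "%k. (c + k) $ a" ?l "%y. z y $ a" c, OF la zm zi] by blast
   have "integrable lborel (%x. LINT k|disp s. (c + k) $ a * z (x + (c + k)) $ a)"
    by (rule average_duality(1)[OF dp(1) D1 ka kab zm zi, where \<eta> = "%_. 0" and e = 0]) auto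
   then have m: "(%x. LINT k|disp s. (c + k) $ a * z (x + (c + k)) $ a) \<in> borel_measurable borel" by auto
   show ?thesis
   proof (rule lp_mono[OF lp_const[OF fin] _ _ p])
    show "(%x. LINT k|disp s. (c + k) $ a * z (x + (c + k)) $ a) \<in> borel_measurable (LB ?U)"
     using m by (simp add: LB_def measurable_restrict_space1)
    show "AE x in LB ?U. \<bar>LINT k|disp s. (c + k) $ a * z (x + (c + k)) $ a\<bar> <= \<bar>\<bar>B\<bar>\<bar>"
     by (rule AE_I2) (use B in \<open>simp add: order_trans[OF _ abs_ge_self]\<close>)
   qed
  qed
  have F: "lp (LB ?U) p (%x. LINT w|P. ((c + fst w) $ a * (c + fst w) $ b) * f (x + snd w *\<^sub>R (c + fst w)) $ a $ b)" for a b
   by (rule lp_restrict[OF _ average_lp[OF P D2 kP kPb fm fi p fp]]) simp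
  have "lp (LB ?U) p (%x. (\<Sum>a\<in>UNIV. LINT k|disp s. (c + k) $ a * z (x + (c + k)) $ a) + (-1) *
   (\<Sum>a\<in>UNIV. \<Sum>b\<in>UNIV. LINT w|P. ((c + fst w) $ a * (c + fst w) $ b) * f (x + snd w *\<^sub>R (c + fst w)) $ a $ b))"
   by (intro lp_add[OF _ _ p] lp_cmult lp_sum[OF _ _ p] Z F) simp_all
  then show "lp (LB ?U) p (W c)" by (simp add: W_def[abs_def])
 qed
 have comp: "integrable ?\<nu> (%k. k $ a)" for a
 proof (rule N.integrable_const_bound[of _ s])
  show "AE k in ?\<nu>. norm (k $ a) <= s"
   by (rule AE_I2) (use component_le_norm_cart in \<open>auto simp: dp(2) dist_norm intro: order_trans\<close>)
  show "(%k. k $ a) \<in> borel_measurable ?\<nu>"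
   by (rule measurable_compose[OF dp(3) borel_measurable_continuous_onI[of "%v. v $ a"]]) (intro continuous_intros)
 qed
 have mean: "(LINT k|?\<nu>. (c + k) $ a) = c $ a + (LINT k|?\<nu>. k $ a)" for c a
  using comp[of a] by (simp add: N.prob_space)
 \<comment> \<open>the unknown mean of the random part cancels between the centres \<open>e\<close> and \<open>0\<close>\<close>
 define e where "e = s *\<^sub>R (axis i 1 :: real^'m)"
 have ne: "norm e <= s" using R by (simp add: e_def)
 have n0: "norm (0 :: real^'m) <= s" using R by simp
 have "lp (LB ?U) p (%x. (1 / s) * (W e x + (-1) * W 0 x))"
  by (intro lp_cmult lp_add[OF _ _ p] conjunct1[OF key] ne n0)
 then show ?thesis
 proof (rule lp_mono[OF _ _ _ p])
  show "(%x. z x $ i) \<in> borel_measurable (LB ?U)" using zm[of i] by (simp add: LB_def measurable_restrict_space1)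
  show "AE x in LB ?U. \<bar>z x $ i\<bar> <= \<bar>(1 / s) * (W e x + (-1) * W 0 x)\<bar>"
   using conjunct2[OF key[OF ne]] conjunct2[OF key[OF n0]]
  proof eventually_elim
   case (elim x)
   have "W e x - W 0 x = (\<Sum>a\<in>UNIV. e $ a * z x $ a)"
    unfolding elim[symmetric] mean by (simp add: sum_subtractf[symmetric] algebra_simps)
   also have "... = (\<Sum>a\<in>UNIV. if a = i then s * z x $ a else 0)"
    by (rule sum.cong) (auto simp: e_def axis_def)
   also have "... = s * z x $ i" by simp
   finally show ?case using R by simp
  qed
 qed
qed

lemma korn_compact:
 fixes z :: "real^'m => real^'m" and f :: "real^'m => real^'m^'m"
 assumes U: "open U" and K: "compact K" "K \<subseteq> U" and p: "p \<ge> 1"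
  and zm: "!!a. (%y. z y $ a) \<in> borel_measurable borel" and zi: "!!a. integrable lborel (%y. z y $ a)"
  and fm: "!!a b. (%y. f y $ a $ b) \<in> borel_measurable borel" and fi: "!!a b. integrable lborel (%y. f y $ a $ b)"
  and fp: "!!a b. integrable lborel (%y. \<bar>f y $ a $ b\<bar> powr p)"
  and weak: "!!\<psi> h. \<psi> \<in> test_functions U ==>
   (LINT y|lborel. (z y \<bullet> h) * (\<Sum>j\<in>UNIV. pd j \<psi> y * h $ j)) = - (LINT y|lborel. \<psi> y * (h \<bullet> (f y *v h)))"
 shows "integrable lborel (%x. indicator K x * \<bar>z x $ i\<bar> powr p)"
proof -
 have ex: "\<exists>s. s > 0 \<and> ball x (3 * s) \<subseteq> U" if x: "x \<in> K" for x
 proof -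
  have "x \<in> U" using K(2) x by (rule subsetD)
  from openE[OF U this] obtain e where e: "e > 0" "ball x e \<subseteq> U" .
  then show ?thesis by (intro exI[of _ "e / 3"]) simp
 qed
 have "\<exists>s. \<forall>x\<in>K. s x > 0 \<and> ball x (3 * s x) \<subseteq> U"
  by (rule bchoice) (rule ballI, rule ex)
 then obtain s where s': "\<forall>x\<in>K. s x > 0 \<and> ball x (3 * s x) \<subseteq> U" ..
 have s: "s x > 0" "ball x (3 * s x) \<subseteq> U" if "x \<in> K" for x using s' that by simp_all
 have "K \<subseteq> (\<Union>x\<in>K. ball x (s x))"
 proof
  fix x assume "x \<in> K"
  then show "x \<in> (\<Union>x\<in>K. ball x (s x))" using s(1) by (intro UN_I[of x]) simp_all
 qed
 from compactE_image[OF K(1) open_ball this] obtain X where X: "X \<subseteq> K" "finite X" "K \<subseteq> (\<Union>x\<in>X. ball x (s x))" .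
 have li: "integrable lborel (%y. indicator (ball x (s x)) y * \<bar>z y $ i\<bar> powr p)" if "x \<in> X" for x
 proof -
  have x: "x \<in> K" using that X(1) by blast
  have "lp (LB (ball x (s x))) p (%y. z y $ i)"
   by (rule korn_local[OF s(1)[OF x] s(2)[OF x] p zm zi fm fi fp weak])
  then show ?thesis by (simp add: lp_def LB_def integrable_restrict_space)
 qed
 show ?thesis
 proof (rule bint_bound[of _ "%y. \<Sum>x\<in>X. indicator (ball x (s x)) y * \<bar>z y $ i\<bar> powr p"])
  show "integrable lborel (%y. \<Sum>x\<in>X. indicator (ball x (s x)) y * \<bar>z y $ i\<bar> powr p)"
   by (rule bint_sum[OF li])
  have "K \<in> sets borel" using K(1) by (simp add: borel_compact)
  then show "(%y. indicator K y * \<bar>z y $ i\<bar> powr p) \<in> borel_measurable lborel" using zm[of i] by measurable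
  show "AE y in lborel. norm (indicator K y * \<bar>z y $ i\<bar> powr p) <= norm (\<Sum>x\<in>X. indicator (ball x (s x)) y * \<bar>z y $ i\<bar> powr p)"
  proof (rule AE_I2)
   fix y
   have nn: "0 <= indicator (ball x (s x)) y * \<bar>z y $ i\<bar> powr p" for x by simp
   have "indicator K y * \<bar>z y $ i\<bar> powr p <= (\<Sum>x\<in>X. indicator (ball x (s x)) y * \<bar>z y $ i\<bar> powr p)"
   proof (cases "y \<in> K")
    case True
    then obtain x where x: "x \<in> X" "y \<in> ball x (s x)" using X(3) by blast
    then have "indicator K y * \<bar>z y $ i\<bar> powr p = indicator (ball x (s x)) y * \<bar>z y $ i\<bar> powr p" using True by simp
    also have "... <= (\<Sum>x\<in>X. indicator (ball x (s x)) y * \<bar>z y $ i\<bar> powr p)"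
     by (rule member_le_sum[OF x(1) nn X(2)])
    finally show ?thesis .
   next
    case False
    then show ?thesis by (simp add: sum_nonneg)
   qed
   then show "norm (indicator K y * \<bar>z y $ i\<bar> powr p) <= norm (\<Sum>x\<in>X. indicator (ball x (s x)) y * \<bar>z y $ i\<bar> powr p)"
    by (simp add: sum_nonneg)
  qed
 qed
qed

text \<open>An elementary substitute for the local Korn inequality: no estimate of the full gradient is
  obtained, only the integrability of \<open>z\<close> itself, which suffices to dominate the
  lower order term. Passing to Borel versions that vanish off \<open>U\<close> makes all
  translates meaningful.\<close>

lemma korn_higher_integrability:
 fixes U :: "(real^'m) set" and z :: "real^'m => real^'m" and f :: "real^'m => real^'m^'m"
 assumes U: "open U" "bounded U" and K: "compact K" "K \<subseteq> U" and p: "p \<ge> 1"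
  and z: "integrable (Leb U) z" and f: "integrable (Leb U) f"
  and fp: "integrable (Leb U) (%x. norm (f x) powr p)"
  and E: "!!\<psi>. \<psi> \<in> test_functions U ==> distr_E U z \<psi> = (LINT x|Leb U. \<psi> x *\<^sub>R f x)"
 shows "integrable (Leb U) (%x. indicator K x * norm (z x) powr p)"
proof -
 have Ub: "U \<in> sets borel" using U by simp
 have sz: "set_integrable lebesgue U z" and sf: "set_integrable lebesgue U f"
  using z f set_integrable_lebesgue_on(1)[OF Ub] by blast+
 obtain z1 where z1: "z1 \<in> borel_measurable borel" "AE x in Leb U. z x = z1 x"
  by (rule lebesgue_on_borel_version[OF Ub sz]) blast
 obtain f1 where f1: "f1 \<in> borel_measurable borel" "AE x in Leb U. f x = f1 x"
  by (rule lebesgue_on_borel_version[OF Ub sf]) blast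
 define z' where "z' x = indicat_real U x *\<^sub>R z1 x" for x
 define f' where "f' x = indicat_real U x *\<^sub>R f1 x" for x
 have sp: "AE x in Leb U. x \<in> U" using AE_space[of "Leb U"] by simp
 have zz: "AE x in Leb U. z x = z' x" using z1(2) sp by eventually_elim (simp add: z'_def)
 have ff: "AE x in Leb U. f x = f' x" using f1(2) sp by eventually_elim (simp add: f'_def)
 have z'm: "z' \<in> borel_measurable borel" unfolding z'_def using z1(1) Ub by measurable
 have f'm: "f' \<in> borel_measurable borel" unfolding f'_def using f1(1) Ub by measurable
 have vn: "(%x. x $ a) \<in> borel_measurable borel" for a :: 'm
  by (rule borel_measurable_continuous_onI) (intro continuous_intros)
 have vn2: "(%x. x $ a $ b) \<in> borel_measurable borel" for a b :: 'm
  by (rule borel_measurable_continuous_onI) (intro continuous_intros)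
 have zam: "(%y. z' y $ a) \<in> borel_measurable borel" for a by (rule measurable_compose[OF z'm vn])
 have fam: "(%y. f' y $ a $ b) \<in> borel_measurable borel" for a b by (rule measurable_compose[OF f'm vn2])
 have z'0: "z' x = 0" and f'0: "f' x = 0" if "x \<notin> U" for x using that by (auto simp: z'_def f'_def)
 have zO: "integrable (Leb U) z'"
  using Bochner_Integration.integrable_cong_AE_imp[OF z borel_lebesgue_on[OF z'm]] zz by (simp add: eq_commute)
 have fO: "integrable (Leb U) f'"
  using Bochner_Integration.integrable_cong_AE_imp[OF f borel_lebesgue_on[OF f'm]] ff by (simp add: eq_commute)
 have zi: "integrable lborel (%y. z' y $ a)" for a
  using test_lebesgue_on_eq(2)[OF U(1) zam, of a] integrable_component[OF zO, of a] z'0 by simp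
 have fi: "integrable lborel (%y. f' y $ a $ b)" for a b
 proof -
  have "integrable (Leb U) (%y. f' y $ a $ b)"
   by (rule integrable_component) (rule integrable_bounded_linear[OF bounded_linear_vec_nth fO])
  then show ?thesis using test_lebesgue_on_eq(2)[OF U(1) fam, of a b] f'0 by simp
 qed
 have fpi: "integrable lborel (%y. \<bar>f' y $ a $ b\<bar> powr p)" for a b
 proof -
  have m: "(%y. \<bar>f' y $ a $ b\<bar> powr p) \<in> borel_measurable borel" using fam[of a b] by measurable
  have "integrable (Leb U) (%y. \<bar>f' y $ a $ b\<bar> powr p)"
  proof (rule bint_bound[OF fp borel_lebesgue_on[OF m]])
   show "AE x in Leb U. norm (\<bar>f' x $ a $ b\<bar> powr p) <= norm (norm (f x) powr p)"
    using ff
   proof eventually_elim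
    case (elim x)
    have "\<bar>f' x $ a $ b\<bar> <= norm (f x)" unfolding elim
     using component_le_norm_cart[of "f' x $ a" b] Finite_Cartesian_Product.norm_nth_le[of "f' x" a] by linarith
    then show ?case using p by (simp add: powr_mono2)
   qed
  qed
  then show ?thesis using test_lebesgue_on_eq(2)[OF U(1) m] f'0 by simp
 qed
 have weak: "(LINT y|lborel. (z' y \<bullet> h) * (\<Sum>j\<in>UNIV. pd j \<psi> y * h $ j)) = - (LINT y|lborel. \<psi> y * (h \<bullet> (f' y *v h)))"
  if \<psi>: "\<psi> \<in> test_functions U" for \<psi> and h :: "real^'m"
 proof -
  note t = test_pd[OF \<psi>]
  define I where "I a j = (LINT y|lborel. z' y $ a * pd j \<psi> y)" for a j
  define Q where "Q a b = (LINT y|lborel. \<psi> y * f' y $ a $ b)" for a b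
  have bt: "integrable lborel (%y. \<eta> y * u y)" if \<eta>: "\<eta> \<in> test_functions U" and "integrable lborel u" for \<eta> u :: "real^'m => real"
  proof -
   obtain B where B: "!!x. \<bar>\<eta> x\<bar> <= B" using bounded_test[OF \<eta>] unfolding real_norm_def by blast
   show ?thesis by (rule integrable_lborel_mult[OF that(2) test_borel_measurable[OF \<eta>] B])
  qed
  have D: "distr_D U z \<psi> $ a $ j = - I a j" for a j
  proof -
   have m: "(%y. z' y $ a * pd j \<psi> y) \<in> borel_measurable borel"
    using zam[of a] test_borel_measurable[OF t, of j] by measurable
   have "(LINT x|Leb U. z x $ a * pd j \<psi> x) = (LINT x|Leb U. z' x $ a * pd j \<psi> x)"
   proof (rule integral_cong_AE)
    show "(%x. z x $ a * pd j \<psi> x) \<in> borel_measurable (Leb U)"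
     using measurable_compose[OF borel_measurable_integrable[OF z] vn, of a] borel_lebesgue_on[OF test_borel_measurable[OF t, of j]] by measurable
    show "(%x. z' x $ a * pd j \<psi> x) \<in> borel_measurable (Leb U)" by (rule borel_lebesgue_on[OF m])
    show "AE x in Leb U. z x $ a * pd j \<psi> x = z' x $ a * pd j \<psi> x" using zz by eventually_elim simp
   qed
   then show ?thesis unfolding distr_D_eq[OF U(1)] I_def
    using test_lebesgue_on_eq(1)[OF U(1) m] z'0 by simp
  qed
  have Ef: "distr_E U z \<psi> $ a $ b = Q a b" for a b
  proof -
   obtain B where B: "!!x. norm (\<psi> x) <= B" using bounded_test[OF \<psi>] by blast
   have \<psi>m: "\<psi> \<in> borel_measurable (Leb U)" by (rule borel_lebesgue_on[OF test_borel_measurable[OF \<psi>]])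
   have i: "integrable (Leb U) (%x. \<psi> x *\<^sub>R f x)" by (rule integrable_test_scaleR[OF f \<psi>m B])
   have bl: "bounded_linear (%M::real^'m^'m. M $ a $ b)"
    using bounded_linear_compose[OF bounded_linear_vec_nth bounded_linear_vec_nth] .
   have m: "(%y. \<psi> y * f' y $ a $ b) \<in> borel_measurable borel"
    using fam[of a b] test_borel_measurable[OF \<psi>] by measurable
   have "distr_E U z \<psi> $ a $ b = (LINT x|Leb U. (\<psi> x *\<^sub>R f x) $ a $ b)"
    unfolding E[OF \<psi>] by (rule integral_bounded_linear[OF bl i, symmetric])
   also have "... = (LINT x|Leb U. \<psi> x * f' x $ a $ b)"
   proof (rule integral_cong_AE)
    show "(%x. (\<psi> x *\<^sub>R f x) $ a $ b) \<in> borel_measurable (Leb U)"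
     by (rule measurable_compose[OF borel_measurable_integrable[OF i] vn2])
    show "(%x. \<psi> x * f' x $ a $ b) \<in> borel_measurable (Leb U)" by (rule borel_lebesgue_on[OF m])
    show "AE x in Leb U. (\<psi> x *\<^sub>R f x) $ a $ b = \<psi> x * f' x $ a $ b" using ff by eventually_elim simp
   qed
   also have "... = Q a b" unfolding Q_def using test_lebesgue_on_eq(1)[OF U(1) m] f'0 by simp
   finally show ?thesis .
  qed
  have EI: "distr_E U z \<psi> $ a $ b = - (1 / 2) * (I a b + I b a)" for a b
   by (simp add: distr_E_def transpose_def D field_simps)
  have L: "(LINT y|lborel. (z' y \<bullet> h) * (\<Sum>j\<in>UNIV. pd j \<psi> y * h $ j)) = (\<Sum>a\<in>UNIV. \<Sum>j\<in>UNIV. h $ a * h $ j * I a j)"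
  proof -
   have i: "integrable lborel (%y. h $ a * h $ j * (z' y $ a * pd j \<psi> y))" for a j
    using bt[OF t zi, of j a] by (simp add: mult.commute)
   have "(z' y \<bullet> h) * (\<Sum>j\<in>UNIV. pd j \<psi> y * h $ j) = (\<Sum>a\<in>UNIV. \<Sum>j\<in>UNIV. h $ a * h $ j * (z' y $ a * pd j \<psi> y))" for y
    by (simp add: inner_vec_def sum_product mult_ac)
   then show ?thesis using i
    by (simp add: bint_of_sum bint_sum I_def)
  qed
  have R: "(LINT y|lborel. \<psi> y * (h \<bullet> (f' y *v h))) = (\<Sum>a\<in>UNIV. \<Sum>b\<in>UNIV. h $ a * h $ b * Q a b)"
  proof -
   have i: "integrable lborel (%y. h $ a * h $ b * (\<psi> y * f' y $ a $ b))" for a b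
    using bt[OF \<psi> fi, of a b] by simp
   have "\<psi> y * (h \<bullet> (f' y *v h)) = (\<Sum>a\<in>UNIV. \<Sum>b\<in>UNIV. h $ a * h $ b * (\<psi> y * f' y $ a $ b))" for y
    by (simp add: inner_vec_def matrix_vector_mult_def sum_distrib_left mult_ac)
   then show ?thesis using i
    by (simp add: bint_of_sum bint_sum Q_def)
  qed
  have sw: "(\<Sum>a\<in>UNIV. \<Sum>b\<in>UNIV. h $ a * h $ b * I b a) = (\<Sum>a\<in>UNIV. \<Sum>b\<in>UNIV. h $ a * h $ b * I a b)"
   by (subst sum.swap) (simp add: mult_ac)
  have "(\<Sum>a\<in>UNIV. \<Sum>b\<in>UNIV. h $ a * h $ b * Q a b) =
    - (1 / 2) * ((\<Sum>a\<in>UNIV. \<Sum>b\<in>UNIV. h $ a * h $ b * I a b) + (\<Sum>a\<in>UNIV. \<Sum>b\<in>UNIV. h $ a * h $ b * I b a))"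
   unfolding sum.distrib[symmetric] sum_distrib_left Ef[symmetric] EI
   by (intro sum.cong refl) (simp add: algebra_simps)
  then show ?thesis unfolding L R sw by simp
 qed
 have Kb: "K \<in> sets borel" using K(1) by (simp add: borel_compact)
 have comp: "lp (Leb U) p (%x. indicator K x * z' x $ i)" for i
 proof -
  have m: "(%x. indicator K x * z' x $ i) \<in> borel_measurable borel" using zam[of i] Kb by measurable
  have m2: "(%x. indicator K x * \<bar>z' x $ i\<bar> powr p) \<in> borel_measurable borel" using zam[of i] Kb by measurable
  have "integrable lborel (%x. indicator K x * \<bar>z' x $ i\<bar> powr p)"
   by (rule korn_compact[OF U(1) K p zam zi fam fi fpi weak])
  then have "integrable (Leb U) (%x. indicator K x * \<bar>z' x $ i\<bar> powr p)"
   using test_lebesgue_on_eq(2)[OF U(1) m2] z'0 by simp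
  moreover have "\<bar>indicator K x * z' x $ i\<bar> powr p = indicator K x * \<bar>z' x $ i\<bar> powr p" for x
   by (simp split: split_indicator)
  ultimately show ?thesis using borel_lebesgue_on[OF m] by (simp add: lp_def)
 qed
 have "lp (Leb U) p (%x. \<Sum>i\<in>UNIV. \<bar>indicator K x * z' x $ i\<bar>)"
  by (rule lp_sum[OF _ lp_abs[OF comp] p]) simp
 then have "lp (Leb U) p (%x. indicator K x * norm (z x))"
 proof (rule lp_mono[OF _ _ _ p])
  show "(%x. indicator K x * norm (z x)) \<in> borel_measurable (Leb U)"
   using borel_measurable_integrable[OF z] borel_lebesgue_on[of "indicat_real K" U] Kb by simp
  show "AE x in Leb U. \<bar>indicator K x * norm (z x)\<bar> <= \<bar>\<Sum>i\<in>UNIV. \<bar>indicator K x * z' x $ i\<bar>\<bar>"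
   using zz
  proof eventually_elim
   case (elim x)
   show ?case using norm_le_l1_cart[of "z' x"]
    by (simp add: elim sum_nonneg split: split_indicator)
  qed
 qed
 moreover have "\<bar>indicator K x * norm (z x)\<bar> powr p = indicator K x * norm (z x) powr p" for x
  by (simp split: split_indicator)
 ultimately show ?thesis by (simp add: lp_def)
qed

section \<open>Transformation of the derivative measures\<close>

lemma sum_Basis_matrix:
 "(\<Sum>a\<in>(Basis :: (real^'m^'k) set). G a) = (\<Sum>k\<in>UNIV. \<Sum>l\<in>UNIV. G (axis k (axis l 1)))"
proof -
 let ?e = "%(k, l). axis k (axis l 1) :: real^'m^'k"
 have B: "(Basis :: (real^'m^'k) set) = ?e ` UNIV" by (auto simp: Basis_vec_def)
 have inj: "inj ?e" by (auto simp: inj_def axis_eq_axis)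
 have "(\<Sum>a\<in>(Basis :: (real^'m^'k) set). G a) = (\<Sum>x\<in>UNIV. G (?e x))" unfolding B using inj by (subst sum.reindex) (auto simp: inj_on_def inj_def)
 also have "... = (\<Sum>x\<in>UNIV \<times> UNIV. G (?e x))" by simp
 also have "... = (\<Sum>k\<in>UNIV. \<Sum>l\<in>UNIV. G (axis k (axis l 1)))" by (simp only: sum.cartesian_product split_def fst_conv snd_conv)
 finally show ?thesis .
qed

lemma inner_axis_matrix: "(M :: real^'m^'k) \<bullet> axis i (axis j 1) = M $ i $ j"
 by (simp add: inner_axis)

lemma Basis_matrixE:
 assumes "b \<in> (Basis :: (real^'m^'k) set)" obtains i j where "b = axis i (axis j 1)"
 using assms by (auto simp: Basis_vec_def)

lemma axis_mm: "((axis k (axis l 1) :: real^'m^'k) ** A) $ i $ j = (if i = k then A $ l $ j else 0)"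
 for A :: "real^'n^'m"
 by (simp add: matrix_matrix_mult_def axis_def if_distrib[of "%u. u * _"] if_distribR cong: if_cong)

lemma bounded_mm:
 obtains c where "c \<ge> 0" "!!(M :: real^'m^'k) (A :: real^'n^'m). norm (M ** A) <= c * norm A * norm M"
proof -
 obtain K where K: "!!(M :: real^'m^'k) (A :: real^'n^'m). norm (M ** A) <= norm M * norm A * K" "0 < K"
  using bounded_bilinear.pos_bounded[OF bounded_bilinear_mm] by blast
 show thesis
 proof (rule that[of K])
  show "K \<ge> 0" using K(2) by simp
  fix M :: "real^'m^'k" and A :: "real^'n^'m"
  show "norm (M ** A) <= K * norm A * norm M" using K(1)[of M A] by (simp add: mult_ac)
 qed
qed

text \<open>The matrix identity \<open>D(u \<circ> \<Phi>) = (Du \<circ> \<Phi>) A\<close> for measures.\<close>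

lemma composition_transport:
 fixes u :: "real^'m => real^'k" and U :: "(real^'m) set"
 assumes U: "open U" "bounded U" and d: "diffeo U \<Phi> A \<Psi>" and Ab: "!!x. norm (A x) <= b" and Ac: "continuous_on UNIV A"
  and dec: "decomp U f \<Lambda> N g" and u: "integrable (Leb U) u"
  and rep: "represents U (distr_D U u) (dmeas U f \<Lambda> g)"
 shows "represents U (distr_D U (%x. u (\<Phi> x)))
  (dmeas U (%x. f (\<Phi> x) ** A x + 0) (push U \<Lambda> \<Psi>) (%x. (1 / det (A x)) *\<^sub>R (g (\<Phi> x) ** A x)))"
  and "continuous_on UNIV (%(x, M :: real^'m^'k). M ** A x)"
  and "\<exists>c. \<forall>x\<in>U. \<forall>M :: real^'m^'k. norm (M ** A x) <= c * norm M"
proof -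
 show cont: "continuous_on UNIV (%(x, M :: real^'m^'k). M ** A x)"
  unfolding case_prod_beta
  by (intro bounded_bilinear.continuous_on[OF bounded_bilinear_mm] continuous_intros continuous_on_compose2[OF Ac]) auto
 obtain c where c: "c \<ge> 0" "!!(M :: real^'m^'k) (A :: real^'m^'m). norm (M ** A) <= c * norm A * norm M"
  by (rule bounded_mm) blast
 have bd: "\<forall>x\<in>U. \<forall>M :: real^'m^'k. norm (M ** A x) <= (c * b) * norm M"
 proof (intro ballI allI)
  fix x and M :: "real^'m^'k"
  have "c * norm (A x) * norm M <= c * b * norm M" using c(1) Ab by (intro mult_right_mono mult_left_mono) auto
  then show "norm (M ** A x) <= (c * b) * norm M" using c(2)[of M "A x"] by linarith
 qed
 then show "\<exists>c. \<forall>x\<in>U. \<forall>M :: real^'m^'k. norm (M ** A x) <= c * norm M" by blast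
 have lin: "linear (%M :: real^'m^'k. M ** A x)" for x
  using bounded_bilinear.bounded_linear_left[OF bounded_bilinear_mm] by (rule bounded_linear.linear)
 have tr: "\<psi> (\<Psi> y) * (((axis k (axis l 1) :: real^'m^'k) ** A (\<Psi> y)) \<bullet> axis i (axis j 1)) / det (A (\<Psi> y)) =
   (if i = k then transported A \<Psi> \<psi> l j y else 0)" for \<psi> y k l i j
  by (simp add: inner_axis_matrix axis_mm transported_def)
 have zero_test: "(%y. 0 :: real) \<in> test_functions U"
  by (rule test_functionsI[of _ "{}"]) auto
 show "represents U (distr_D U (%x. u (\<Phi> x)))
  (dmeas U (%x. f (\<Phi> x) ** A x + 0) (push U \<Lambda> \<Psi>) (%x. (1 / det (A x)) *\<^sub>R (g (\<Phi> x) ** A x)))"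
 proof (rule represents_transport[where opr = "%x M. M ** A x" and h = "%x. 0", OF U d dec cont bd lin _ rep])
  show "integrable (Leb U) (%x. 0 :: real^'m^'k)" by simp
 next
  fix \<psi> :: "real^'m => real" and a b :: "real^'m^'k" assume \<psi>: "\<psi> \<in> test_functions U" and "b \<in> Basis" "a \<in> Basis"
  then obtain i j k l where b: "b = axis i (axis j 1)" and a: "a = axis k (axis l 1)" by (metis Basis_matrixE)
  show "(%y. \<psi> (\<Psi> y) * ((a ** A (\<Psi> y)) \<bullet> b) / det (A (\<Psi> y))) \<in> test_functions U"
   unfolding a b tr using test_transported[OF d \<psi>, of l j] zero_test by (cases "i = k") simp_all
 next
  fix \<psi> :: "real^'m => real" and b :: "real^'m^'k" assume \<psi>: "\<psi> \<in> test_functions U" and "b \<in> Basis"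
  then obtain i j where b: "b = axis i (axis j 1)" by (metis Basis_matrixE)
  have z0: "distr_D U u (%y. 0) $ i $ l = 0" for i l
   by (simp add: distr_D_eq[OF U(1)] pd_def)
  have "(\<Sum>a\<in>Basis. distr_D U u (%y. \<psi> (\<Psi> y) * ((a ** A (\<Psi> y)) \<bullet> b) / det (A (\<Psi> y))) \<bullet> a) =
    (\<Sum>k\<in>UNIV. \<Sum>l\<in>UNIV. distr_D U u (%y. if i = k then transported A \<Psi> \<psi> l j y else 0) $ k $ l)"
   unfolding sum_Basis_matrix b tr unfolding inner_axis_matrix ..
  also have "... = (\<Sum>k\<in>UNIV. if k = i then (\<Sum>l\<in>UNIV. distr_D U u (transported A \<Psi> \<psi> l j) $ i $ l) else 0)"
   by (rule sum.cong) (auto simp: z0)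
  also have "... = distr_D U (%x. u (\<Phi> x)) \<psi> \<bullet> b"
   unfolding b inner_axis_matrix distr_D_compose[OF U d \<psi> u] by simp
  finally show "distr_D U (%x. u (\<Phi> x)) \<psi> \<bullet> b =
    (\<Sum>a\<in>Basis. distr_D U u (%y. \<psi> (\<Psi> y) * ((a ** A (\<Psi> y)) \<bullet> b) / det (A (\<Psi> y))) \<bullet> a) +
    (LINT x|Leb U. \<psi> x * (0 \<bullet> b))" by simp
 qed
qed

text \<open>The identity \<open>D (A^T (z \<circ> \<Phi>)) = A^T (Dz \<circ> \<Phi>) A + \<Sum>\<^sub>k
  (z\<^sub>k \<circ> \<Phi>) D\<^sup>2\<Phi>\<^sub>k\<close> for measures, and its symmetric
  part.\<close>

lemma pullback_transport:
 fixes z :: "real^'m => real^'m" and U :: "(real^'m) set"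
 assumes U: "open U" "bounded U" and d: "diffeo U \<Phi> A \<Psi>" and Ab: "!!x. norm (A x) <= b" and Ac: "continuous_on UNIV A"
  and dec: "decomp U f \<Lambda> N g" and z: "integrable (Leb U) z"
  and h: "integrable (Leb U) (%x. symop s (second_order A x (z (\<Phi> x))))"
  and rep: "represents U (distr_op s U z) (dmeas U f \<Lambda> g)"
 shows "represents U (distr_op s U (pullback_z A \<Phi> z))
  (dmeas U (%x. transpose (A x) ** f (\<Phi> x) ** A x + symop s (second_order A x (z (\<Phi> x)))) (push U \<Lambda> \<Psi>)
   (%x. (1 / det (A x)) *\<^sub>R (transpose (A x) ** g (\<Phi> x) ** A x)))"
  and "continuous_on UNIV (%(x, M :: real^'m^'m). transpose (A x) ** M ** A x)"
  and "\<exists>c. \<forall>x\<in>U. \<forall>M :: real^'m^'m. norm (transpose (A x) ** M ** A x) <= c * norm M"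
proof -
 have tc: "continuous_on UNIV (%x. transpose (A x))"
  unfolding transpose_def by (intro continuous_on_vec_lambda continuous_intros Ac)
 show cont: "continuous_on UNIV (%(x, M :: real^'m^'m). transpose (A x) ** M ** A x)"
  unfolding case_prod_beta
  by (intro bounded_bilinear.continuous_on[OF bounded_bilinear_mm] continuous_intros continuous_on_compose2[OF Ac] continuous_on_compose2[OF tc]) auto
 note nt = norm_transpose
 obtain c where c: "c \<ge> 0" "!!(M :: real^'m^'m) (A :: real^'m^'m). norm (M ** A) <= c * norm A * norm M"
  by (rule bounded_mm) blast
 have b0: "0 <= b" using Ab[of 0] norm_ge_zero[of "A 0"] by linarith
 have bd: "\<forall>x\<in>U. \<forall>M :: real^'m^'m. norm (transpose (A x) ** M ** A x) <= (c * b * (c * b)) * norm M"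
 proof (intro ballI allI)
  fix x and M :: "real^'m^'m"
  have "norm (transpose (A x) ** M) <= c * norm M * norm (A x)" using c(2)[of "transpose (A x)" M] by (simp add: nt)
  also have "... <= c * norm M * b" using c(1) Ab by (intro mult_left_mono) auto
  finally have 1: "norm (transpose (A x) ** M) <= c * norm M * b" .
  have "norm (transpose (A x) ** M ** A x) <= c * norm (A x) * norm (transpose (A x) ** M)" by (rule c(2))
  also have "... <= c * b * (c * norm M * b)" using c(1) Ab 1 b0 by (intro mult_mono mult_nonneg_nonneg) auto
  finally show "norm (transpose (A x) ** M ** A x) <= (c * b * (c * b)) * norm M" by (simp add: mult_ac)
 qed
 then show "\<exists>c. \<forall>x\<in>U. \<forall>M :: real^'m^'m. norm (transpose (A x) ** M ** A x) <= c * norm M" by blast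
 have lin: "linear (%M :: real^'m^'m. transpose (A x) ** M ** A x)" for x
  by (rule linear_compose[unfolded o_def, of "%M. transpose (A x) ** M" "%M. M ** A x"])
   (rule bounded_linear.linear, rule bounded_bilinear.bounded_linear_right[OF bounded_bilinear_mm],
   rule bounded_linear.linear, rule bounded_bilinear.bounded_linear_left[OF bounded_bilinear_mm])
 have entry: "(transpose M ** axis k (axis l 1) ** M) $ i $ j = M $ k $ i * M $ l $ j" for M :: "real^'m^'m" and k l i j
 proof -
  have "(\<Sum>r\<in>UNIV. \<Sum>q\<in>UNIV. M $ r $ i * axis k (axis l 1) $ r $ q * M $ q $ j) =
    (\<Sum>r\<in>UNIV. if r = k then (\<Sum>q\<in>UNIV. if q = l then M $ k $ i * M $ l $ j else 0) else 0)"
  proof (rule sum.cong)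
   fix r :: 'm
   have "(\<Sum>q\<in>UNIV. M $ k $ i * (axis l 1 :: real^'m) $ q * M $ q $ j) = (\<Sum>q\<in>UNIV. if q = l then M $ k $ i * M $ l $ j else 0)"
    by (rule sum.cong) (auto simp: axis_def)
   then show "(\<Sum>q\<in>UNIV. M $ r $ i * axis k (axis l 1) $ r $ q * M $ q $ j) =
     (if r = k then (\<Sum>q\<in>UNIV. if q = l then M $ k $ i * M $ l $ j else 0) else 0)"
    by (cases "r = k") (simp_all add: axis_def[of k])
  qed simp
  then show ?thesis unfolding matrix_entries_sum by simp
 qed
 have tr: "\<psi> (\<Psi> y) * ((transpose (A (\<Psi> y)) ** axis k (axis l 1) ** A (\<Psi> y)) \<bullet> axis i (axis j 1)) / det (A (\<Psi> y)) =
   transported A \<Psi> (%x. \<psi> x * A x $ k $ i) l j y" for \<psi> y k l i j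
  by (simp add: inner_axis_matrix entry transported_def mult_ac)
 show "represents U (distr_op s U (pullback_z A \<Phi> z))
  (dmeas U (%x. transpose (A x) ** f (\<Phi> x) ** A x + symop s (second_order A x (z (\<Phi> x)))) (push U \<Lambda> \<Psi>)
   (%x. (1 / det (A x)) *\<^sub>R (transpose (A x) ** g (\<Phi> x) ** A x)))"
 proof (rule represents_transport[where opr = "%x M. transpose (A x) ** M ** A x", OF U d dec cont bd lin h rep])
  fix \<psi> :: "real^'m => real" and a b :: "real^'m^'m" assume \<psi>: "\<psi> \<in> test_functions U" and "b \<in> Basis" "a \<in> Basis"
  then obtain i j k l where b: "b = axis i (axis j 1)" and a: "a = axis k (axis l 1)" by (metis Basis_matrixE)
  show "(%y. \<psi> (\<Psi> y) * ((transpose (A (\<Psi> y)) ** a ** A (\<Psi> y)) \<bullet> b) / det (A (\<Psi> y))) \<in> test_functions U"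
   unfolding a b tr by (rule test_transported[OF d test_mult[OF \<psi> diffeoD(6)[OF d]]])
 next
  fix \<psi> :: "real^'m => real" and b :: "real^'m^'m" assume \<psi>: "\<psi> \<in> test_functions U" and "b \<in> Basis"
  then obtain i j where b: "b = axis i (axis j 1)" by (metis Basis_matrixE)
  show "distr_op s U (pullback_z A \<Phi> z) \<psi> \<bullet> b =
    (\<Sum>a\<in>Basis. distr_op s U z (%y. \<psi> (\<Psi> y) * ((transpose (A (\<Psi> y)) ** a ** A (\<Psi> y)) \<bullet> b) / det (A (\<Psi> y))) \<bullet> a) +
    (LINT x|Leb U. \<psi> x * (symop s (second_order A x (z (\<Phi> x))) \<bullet> b))"
   unfolding sum_Basis_matrix b tr unfolding inner_axis_matrix by (rule distr_op_pullback[OF U d \<psi> z])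
 qed
qed

section \<open>Differentiability of the two energies\<close>

lemma differentiable_near_0:
 fixes f g :: "real => real"
 assumes "f differentiable (at 0)" "t0 > 0" "!!t. abs t < t0 ==> f t = g t"
 shows "g differentiable (at 0)"
proof -
 obtain D where D: "(f has_real_derivative D) (at 0)" using assms(1) real_differentiableE by blast
 have "(g has_real_derivative D) (at 0)"
  by (rule has_field_derivative_transform_within_open[OF D, of "{-t0<..<t0}"]) (use assms(2,3) in auto)
 then show ?thesis unfolding real_differentiable_def by blast
qed

text \<open>Both energies have this form after the change of variables. The singular part is treated as a
  second energy whose integrand is the recession function; for superlinear growth it is absent.\<close>

lemma variation_differentiable:
 fixes \<rho> :: "'v::euclidean_space => real" and F g :: "real^'m => 'v" and L :: "real => real^'m => 'v => 'v"
  and k :: "real => real^'m => 'v" and J :: "real => real^'m => real"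
 assumes U: "open U" "bounded U" and dec: "decomp U F \<Lambda> N g"
  and t0: "0 < t0" "t0 <= 1"
  and J0: "!!t y. abs t < t0 ==> 0 <= J t y" and J1: "!!t y. abs t < t0 ==> \<bar>J t y - 1\<bar> <= abs t * c"
  and Jd: "!!y. \<exists>d. ((%t. (J t y - 1) / t) \<longlongrightarrow> d) (at 0)"
  and Jc: "!!t. abs t < t0 ==> continuous_on UNIV (J t)"
  and Lc: "!!t. abs t < t0 ==> continuous_on UNIV (%(y, M). L t y M)"
  and Lb: "!!t y M. abs t < t0 ==> norm (L t y M) <= l * norm M"
  and Ll: "!!y M. ((%t. L t y M) \<longlongrightarrow> L 0 y M) (at 0)"
  and km: "!!t. abs t < t0 ==> k t \<in> borel_measurable (Leb U)"
  and kG: "!!t y. abs t < t0 ==> norm (k t y) <= G y"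
  and G: "lp (Leb U) p G"
  and kl: "!!y. ((%t. k t y) \<longlongrightarrow> k 0 y) (at 0)"
  and conv: "convex_on UNIV \<rho>" and nn: "!!\<xi>. 0 <= \<rho> \<xi>"
  and p: "p \<ge> 1" and gr: "!!\<xi>. \<rho> \<xi> <= C * (norm \<xi> powr p + 1)"
  and Fp: "integrable (Leb U) (%x. norm (F x) powr p)"
  and dif: "AE x in Leb U. (%t. \<rho> (F x + t *\<^sub>R (L 0 x (F x) + k 0 x))) differentiable (at 0)"
  and sing: "(p = 1 \<and> (AE y in \<Lambda>. (%t. enn2real (recession \<rho> (g y + t *\<^sub>R L 0 y (g y)))) differentiable (at 0))) \<or> (AE y in \<Lambda>. g y = 0)"
 defines "val \<equiv> %t. (\<integral>\<^sup>+y. ennreal (J t y) * ennreal (\<rho> (F y + t *\<^sub>R (L t y (F y) + k t y))) \<partial>Leb U) +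
   (\<integral>\<^sup>+y. ennreal (J t y) * recession \<rho> (g y + t *\<^sub>R L t y (g y)) \<partial>\<Lambda>)"
 shows "abs t < t0 ==> val t < \<infinity>" and "(%t. enn2real (val t)) differentiable (at 0)"
proof -
 have Ub: "U \<in> sets borel" using U by simp
 have F: "integrable (Leb U) F" and \<Lambda>: "finite_measure \<Lambda>" "sets \<Lambda> = borel_subsets U" and g: "integrable \<Lambda> g"
  using dec unfolding decomp_def by auto
 have Fm: "F \<in> borel_measurable (Leb U)" and gm: "g \<in> borel_measurable \<Lambda>" using F g by auto
 have fin: "finite_measure (Leb U)"
  by (rule finite_measure_lebesgue_on) (use U in \<open>simp add: lmeasurable_open\<close>)
 have z00: "\<bar>0 :: real\<bar> < t0" using t0 by simp
 have l0: "0 <= l"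
 proof -
  obtain b :: 'v where "b \<in> Basis" using nonempty_Basis by blast
  then have "norm b = 1" by simp
  then show ?thesis using order_trans[OF norm_ge_zero Lb[OF z00, of 0 b]] by simp
 qed
 have idm: "(%y. y) \<in> borel_measurable (Leb U)" by (rule borel_lebesgue_on) simp
 have id\<Lambda>: "(%y. y) \<in> borel_measurable \<Lambda>" by (rule measurable_borel_subsets[OF \<Lambda>(2) Ub]) simp
 define a where "a t = (\<integral>\<^sup>+y. ennreal (J t y) * ennreal (\<rho> (F y + t *\<^sub>R (L t y (F y) + k t y))) \<partial>Leb U)" for t
 define b where "b t = (\<integral>\<^sup>+y. ennreal (J t y) * recession \<rho> (g y + t *\<^sub>R L t y (g y)) \<partial>\<Lambda>)" for t
 have Gm: "G \<in> borel_measurable (Leb U)" using G by (simp add: lp_def)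
 have Fl: "lp (Leb U) p (%y. norm (F y))" using Fp Fm by (simp add: lp_def)
 have "lp (Leb U) p (%y. l * norm (F y) + \<bar>G y\<bar>)"
  by (intro lp_add[OF _ _ p] lp_cmult Fl lp_abs G)
 then have G': "(%y. l * norm (F y) + \<bar>G y\<bar>) \<in> borel_measurable (Leb U)"
   "integrable (Leb U) (%y. (l * norm (F y) + \<bar>G y\<bar>) powr p)"
  using l0 by (simp_all add: lp_def)
 have Vm: "(%y. L t y (F y) + k t y) \<in> borel_measurable (Leb U)" if "abs t < t0" for t
  by (intro borel_measurable_add borel_measurable_op[OF Lc[OF that] idm Fm] km[OF that])
 have VG: "norm (L t y (F y) + k t y) <= l * norm (F y) + \<bar>G y\<bar>" if "abs t < t0" for t y
  using norm_triangle_ineq[of "L t y (F y)" "k t y"] Lb[OF that, of y "F y"] kG[OF that, of y] by linarith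
 have Vl: "((%t. L t y (F y) + k t y) \<longlongrightarrow> L 0 y (F y) + k 0 y) (at 0)" for y
  by (intro tendsto_add Ll kl)
 have Gn: "0 <= l * norm (F y) + \<bar>G y\<bar>" for y using l0 by simp
 have Jm: "J t \<in> borel_measurable (Leb U)" if "abs t < t0" for t
  by (rule continuous_lebesgue_on[OF Jc[OF that]])
 note e = energy_differentiable[where M = "Leb U" and \<rho> = \<rho> and p = p and f = F and V = "%t y. L t y (F y) + k t y"
   and J = J and G = "%y. l * norm (F y) + \<bar>G y\<bar>" and c = c,
   OF fin conv nn p gr Fm Fp G'(1) Gn G'(2) t0 Vm VG Vl dif Jm J0 J1 Jd]
 have a1: "a t < \<infinity>" if "abs t < t0" for t
  unfolding a_def by (rule e(1)) (use that in simp_all)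
 have a2: "(%t. enn2real (a t)) differentiable (at 0)"
  unfolding a_def by (rule e(2)) simp_all
 have b12: "(\<forall>t. abs t < t0 --> b t < \<infinity>) \<and> (%t. enn2real (b t)) differentiable (at 0)"
  using sing
 proof
  assume s: "p = 1 \<and> (AE y in \<Lambda>. (%t. enn2real (recession \<rho> (g y + t *\<^sub>R L 0 y (g y)))) differentiable (at 0))"
  have gr1: "\<rho> \<xi> <= C * (1 + norm \<xi>)" for \<xi> using gr[of \<xi>] s by (simp add: add.commute)
  define r where "r \<xi> = enn2real (recession \<rho> \<xi>)" for \<xi>
  note rl = recession_linear_growth[OF conv nn gr1]
  have rconv: "convex_on UNIV r" using rl(3) by (simp add: r_def[abs_def])
  have rnn: "0 <= r \<xi>" for \<xi> by (simp add: r_def)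
  have C0: "0 <= C" using gr1[of 0] nn[of 0] by simp
  have rgr: "r \<xi> <= C * (norm \<xi> powr 1 + 1)" for \<xi>
  proof -
   have "r \<xi> <= C * norm \<xi>" unfolding r_def by (rule rl(2))
   also have "... <= C * (norm \<xi> powr 1 + 1)" using C0 by (intro mult_left_mono) auto
   finally show ?thesis .
  qed
  have rr: "recession \<rho> \<xi> = ennreal (r \<xi>)" for \<xi> using rl(1)[of \<xi>] by (simp add: r_def)
  have gp: "integrable \<Lambda> (%y. norm (g y) powr 1)" using integrable_norm[OF g] by simp
  have Gp: "(%y. l * norm (g y)) \<in> borel_measurable \<Lambda>" "integrable \<Lambda> (%y. (l * norm (g y)) powr 1)"
   using gm integrable_norm[OF g] l0 by simp_all
  have Vm': "(%y. L t y (g y)) \<in> borel_measurable \<Lambda>" if "abs t < t0" for t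
   by (rule borel_measurable_op[OF Lc[OF that] id\<Lambda> gm])
  have dif': "AE y in \<Lambda>. (%t. r (g y + t *\<^sub>R L 0 y (g y))) differentiable (at 0)" using s by (simp add: r_def)
  have Gn': "0 <= l * norm (g y)" for y using l0 by simp
  have Jm': "J t \<in> borel_measurable \<Lambda>" if "abs t < t0" for t
   by (rule measurable_borel_subsets[OF \<Lambda>(2) Ub borel_measurable_continuous_onI[OF Jc[OF that]]])
  note e = energy_differentiable[where M = \<Lambda> and \<rho> = r and p = 1 and f = g and V = "%t y. L t y (g y)" and J = J and G = "%y. l * norm (g y)" and c = c,
    OF \<Lambda>(1) rconv rnn order_refl rgr gm gp Gp(1) Gn' Gp(2) t0 Vm' Lb Ll dif' Jm' J0 J1 Jd]
  have "b t < \<infinity>" if "abs t < t0" for t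
   unfolding b_def rr by (rule e(1)) (use that in simp_all)
  moreover have "(%t. enn2real (b t)) differentiable (at 0)"
   unfolding b_def rr by (rule e(2)) simp_all
  ultimately show ?thesis by blast
 next
  assume g0: "AE y in \<Lambda>. g y = 0"
  have bz: "b t = 0" if t: "abs t < t0" for t
  proof -
   have "b t = (\<integral>\<^sup>+y. 0 \<partial>\<Lambda>)" unfolding b_def
   proof (rule nn_integral_cong_AE)
    show "AE y in \<Lambda>. ennreal (J t y) * recession \<rho> (g y + t *\<^sub>R L t y (g y)) = 0"
     using g0
    proof eventually_elim
     case (elim y)
     have "L t y 0 = 0" using Lb[OF t, of y 0] by simp
     then show ?case by (simp add: elim recession_0[OF conv nn])
    qed
   qed
   then show ?thesis by simp
  qed
  have "(%t. enn2real (b t)) differentiable (at 0)"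
   by (rule differentiable_near_0[OF _ t0(1), of "%_. 0"]) (simp_all add: bz)
  then show ?thesis using bz by simp
 qed
 have v: "val t = a t + b t" for t by (simp add: val_def a_def b_def)
 show "abs t < t0 ==> val t < \<infinity>" using a1[of t] b12 by (simp add: v)
 have "(%t. enn2real (a t) + enn2real (b t)) differentiable (at 0)"
  using a2 b12 by (intro differentiable_add) auto
 then show "(%t. enn2real (val t)) differentiable (at 0)"
  by (rule differentiable_near_0[OF _ t0(1)]) (use a1 b12 in \<open>simp add: v enn2real_plus\<close>)
qed


text \<open>A family of diffeomorphisms \<open>x + t \<phi> x\<close> with all the uniform information about
  it that the energies need, see \<open>inner_variation_diffeo\<close>.\<close>

locale inner_variation =
 fixes U :: "(real^'m) set" and \<phi> :: "real^'m => real^'m" and t0 c :: real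
 assumes U: "open U" "bounded U" and \<phi>: "\<phi> \<in> test_functions U" and t0: "0 < t0" "t0 <= 1"
  and diffeo: "!!t. abs t < t0 ==>
   diffeo U (%x. x + t *\<^sub>R \<phi> x) (%x. mat 1 + t *\<^sub>R jacobian \<phi> (at x)) (inv (%x. x + t *\<^sub>R \<phi> x))"
  and jac_le: "!!t x. abs t < t0 ==> \<bar>1 / det (mat 1 + t *\<^sub>R jacobian \<phi> (at x)) - 1\<bar> <= abs t * c"
  and inverse_tendsto: "!!y. ((%t. inv (%x. x + t *\<^sub>R \<phi> x) y) \<longlongrightarrow> y) (at 0)"
  and jac_derivative: "!!y. \<exists>d. ((%t. (1 / det (mat 1 + t *\<^sub>R jacobian \<phi> (at (inv (%x. x + t *\<^sub>R \<phi> x) y))) - 1) / t) \<longlongrightarrow> d) (at 0)"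
begin

abbreviation \<Phi> :: "real => real^'m => real^'m" where "\<Phi> t x \<equiv> x + t *\<^sub>R \<phi> x"
abbreviation \<Psi> :: "real => real^'m => real^'m" where "\<Psi> t \<equiv> inv (\<Phi> t)"
abbreviation B :: "real^'m => real^'m^'m" where "B x \<equiv> jacobian \<phi> (at x)"
abbreviation A :: "real => real^'m => real^'m^'m" where "A t x \<equiv> mat 1 + t *\<^sub>R B x"

lemmas jacobian_facts = jacobian_test_function[OF \<phi>]

lemma open_borel: "U \<in> sets borel" using U by simp

lemma \<Psi>_0: "\<Psi> 0 y = y"
 using diffeoD(2)[OF diffeo[of 0], of y] t0 by simp

lemma A_bounded: "\<exists>b. \<forall>x. norm (A t x) <= b"
proof -
 obtain b where b: "!!x. norm (B x) <= b" using jacobian_facts(4) by blast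
 have "norm (A t x) <= norm (mat 1 :: real^'m^'m) + abs t * b" for x
  using norm_triangle_ineq[of "mat 1" "t *\<^sub>R B x"] mult_left_mono[OF b[of x], of "abs t"] by simp
 then show ?thesis by blast
qed

lemma A_continuous: "continuous_on UNIV (A t)"
 by (intro continuous_intros jacobian_facts(3))

lemma B_tendsto: "((%t. B (\<Psi> t y)) \<longlongrightarrow> B y) (at 0)"
proof -
 have "isCont B y" using jacobian_facts(3) continuous_on_eq_continuous_at[OF open_UNIV] by blast
 then show ?thesis using inverse_tendsto[of y] by (rule isCont_tendsto_compose)
qed

lemma J_nonneg: "abs t < t0 ==> 0 <= 1 / det (A t (\<Psi> t y))"
 using diffeoD(7)[OF diffeo, of t "\<Psi> t y"] by simp

lemma J_continuous: "abs t < t0 ==> continuous_on UNIV (%y. 1 / det (A t (\<Psi> t y)))"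
 using diffeo_jac_continuous(1)[OF diffeo] .

lemma vary_z_eq: "vary_z \<phi> t z = pullback_z (A t) (\<Phi> t) z"
 by (simp add: fun_eq_iff vary_z_def pullback_z_def)

lemma rowvector_vary_z: "rowvector (vary_z \<phi> t z x) = rowvector (z (\<Phi> t x)) ** A t x"
 by (simp add: vary_z_def rowvector_def vec_eq_iff matrix_matrix_mult_def matrix_vector_mult_def transpose_def mult.commute)

lemma bounded_linear_rowvector: "bounded_linear (rowvector :: real^'m => real^'m^1)"
proof -
 have "linear (rowvector :: real^'m => real^'m^1)" by (auto intro!: linearI simp: rowvector_def vec_eq_iff)
 then show ?thesis by (simp add: linear_linear)
qed

lemma absolutely_integrable_iff: "(u :: real^'m => 'v::euclidean_space) absolutely_integrable_on U \<longleftrightarrow> integrable (Leb U) u"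
 using set_integrable_lebesgue_on(1)[OF open_borel] .

lemma vary_z_integrable:
 assumes t: "abs t < t0" and z: "integrable (Leb U) z"
 shows "integrable (Leb U) (vary_z \<phi> t z)"
proof -
 obtain b where b: "!!x. norm (A t x) <= b" using A_bounded[of t] by blast
 note z\<Phi> = integrable_diffeo[OF U diffeo[OF t] z]
 have tc: "continuous_on UNIV (%x. transpose (A t x))"
  unfolding transpose_def by (intro continuous_on_vec_lambda continuous_intros A_continuous)
 have tv: "continuous_on UNIV (%(x, v). transpose (A t x) *v v)"
  unfolding case_prod_beta
  by (intro bounded_bilinear.continuous_on[OF bounded_bilinear_mv] continuous_intros continuous_on_compose2[OF tc]) auto
 have idm: "(%x. x) \<in> borel_measurable (Leb U)" by (rule borel_lebesgue_on) simp
 have m: "(%x. transpose (A t x) *v z (\<Phi> t x)) \<in> borel_measurable (Leb U)"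
  by (rule borel_measurable_op[OF tv idm borel_measurable_integrable[OF z\<Phi>]])
 have le: "norm (transpose (A t x) *v z (\<Phi> t x)) <= b * norm (z (\<Phi> t x))" for x
 proof -
  note nt = norm_transpose
  show ?thesis
   using norm_matrix_vector_le[of "transpose (A t x)" "z (\<Phi> t x)"] mult_right_mono[OF b[of x], of "norm (z (\<Phi> t x))"]
   unfolding nt by simp
 qed
 have "integrable (Leb U) (%x. transpose (A t x) *v z (\<Phi> t x))"
 proof (rule bint_bound[OF _ m])
  show "integrable (Leb U) (%x. b * norm (z (\<Phi> t x)))" by (intro integrable_mult_right integrable_norm z\<Phi>)
  show "AE x in Leb U. norm (transpose (A t x) *v z (\<Phi> t x)) <= norm (b * norm (z (\<Phi> t x)))"
   by (rule AE_I2) (rule order_trans[OF le], unfold real_norm_def, rule abs_ge_self)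
 qed
 then show ?thesis unfolding vary_z_def[abs_def] .
qed

lemma dmeas_minus_lebesgue_times:
 fixes a b :: "real^'m => 'v::euclidean_space"
 assumes a: "integrable (Leb U) a" and b: "integrable (Leb U) b"
 shows "(%E. dmeas U a \<Lambda> g E - lebesgue_times U b E) = dmeas U (%x. a x - b x) \<Lambda> g"
proof
 fix E
 have "lebesgue_times U a E - lebesgue_times U b E = lebesgue_times U (%x. a x - b x) E"
 proof (cases "E \<in> borel_subsets U")
  case True
  then have E: "E \<in> sets lebesgue" "E \<subseteq> U" by (auto simp: borel_subsets_def)
  have "set_integrable lebesgue E a" "set_integrable lebesgue E b"
   using a b absolutely_integrable_iff set_integrable_subset[OF _ E] by blast+
  then show ?thesis using True by (simp add: lebesgue_times_def set_integral_diff)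
 qed (simp add: lebesgue_times_def)
 then show "dmeas U a \<Lambda> g E - lebesgue_times U b E = dmeas U (%x. a x - b x) \<Lambda> g E"
  by (simp add: dmeas_def algebra_simps)
qed

lemma scalar_variation:
 assumes t: "abs t < t0" and w: "integrable (Leb U) (%x. vec (w x) :: real^1)"
  and dec: "decomp U f \<Lambda> N g" and rep: "represents U (distr_D U (%x. vec (w x) :: real^1)) (dmeas U f \<Lambda> g)"
 shows "vary_w \<phi> t w \<in> BV U"
  and "D_scalar U (vary_w \<phi> t w) = dmeas U (%x. f (\<Phi> t x) ** A t x + 0) (push U \<Lambda> (\<Psi> t)) (%x. (1 / det (A t x)) *\<^sub>R (g (\<Phi> t x) ** A t x))"
proof -
 obtain b where b: "!!x. norm (A t x) <= b" using A_bounded[of t] by blast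
 have r: "represents U (distr_D U (%x. vec (vary_w \<phi> t w x) :: real^1))
   (dmeas U (%x. f (\<Phi> t x) ** A t x + 0) (push U \<Lambda> (\<Psi> t)) (%x. (1 / det (A t x)) *\<^sub>R (g (\<Phi> t x) ** A t x)))"
  using composition_transport(1)[OF U diffeo[OF t] b A_continuous dec w rep] by (simp only: vary_w_def)
 have i: "integrable (Leb U) (%x. vec (vary_w \<phi> t w x) :: real^1)"
  using integrable_diffeo[OF U diffeo[OF t] w] by (simp only: vary_w_def)
 show "vary_w \<phi> t w \<in> BV U" using r i absolutely_integrable_iff unfolding BV_def BV_vec_def by blast
 show "D_scalar U (vary_w \<phi> t w) = dmeas U (%x. f (\<Phi> t x) ** A t x + 0) (push U \<Lambda> (\<Psi> t)) (%x. (1 / det (A t x)) *\<^sub>R (g (\<Phi> t x) ** A t x))"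
  unfolding D_scalar_def D_measure_def by (rule representing_measure_eq[OF U r])
qed

text \<open>The variation of \<open>z\<close> is chosen so that gradients are varied into gradients: if
  \<open>z^T = Du\<close>, then the varied field is the gradient of \<open>u \<circ>
  \<Phi>\<close>.\<close>

lemma gradient_variation:
 assumes t: "abs t < t0" and u: "u \<in> BV U" and z: "integrable (Leb U) z"
  and D: "D_scalar U u = lebesgue_times U (%x. rowvector (z x))"
 shows "vary_w \<phi> t u \<in> BV U"
  and "D_scalar U (vary_w \<phi> t u) = lebesgue_times U (%x. rowvector (vary_z \<phi> t z x))"
proof -
 have ui: "integrable (Leb U) (%x. vec (u x) :: real^1)" using u absolutely_integrable_iff unfolding BV_def BV_vec_def by blast
 obtain \<mu> where \<mu>: "represents U (distr_D U (%x. vec (u x) :: real^1)) \<mu>" using u unfolding BV_def BV_vec_def by blast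
 \<comment> \<open>the derivative of \<open>u\<close> has no singular part\<close>
 define \<Lambda> where "\<Lambda> = null_measure (LB U)"
 have dens0: "dens U M (%x. 0 :: real^'m^1) = (%E. 0)" for M :: "(real^'m) measure"
  by (simp add: dens_def fun_eq_iff set_lebesgue_integral_def)
 have dec: "decomp U (%x. rowvector (z x) :: real^'m^1) \<Lambda> {} (%x. 0)"
  unfolding decomp_def \<Lambda>_def
  using integrable_bounded_linear[OF bounded_linear_rowvector z] sets_LB[OF open_borel]
  by (auto simp: borel_subsets_def intro!: finite_measureI)
 have "\<mu> = dmeas U (%x. rowvector (z x)) \<Lambda> (%x. 0)"
  using representing_measure_eq[OF U \<mu>] D by (simp add: D_scalar_def D_measure_def dmeas_def dens0)
 note v = scalar_variation[OF t ui dec \<mu>[unfolded this]]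
 show "vary_w \<phi> t u \<in> BV U" by (rule v(1))
 show "D_scalar U (vary_w \<phi> t u) = lebesgue_times U (%x. rowvector (vary_z \<phi> t z x))"
  unfolding v(2) by (simp add: dmeas_def dens0 rowvector_vary_z matrix_matrix_mult_def[of 0] flip: zero_vec_def)
qed

text \<open>Both \<open>Dw\<close> and \<open>z^T\<close> are multiplied by \<open>A\<close> from the right,
  so the difference transforms without a lower order term, and differentiability of \<open>t
  \<mapsto> \<rho> (M (I + t B))\<close> is all that is required.\<close>

lemma first_energy:
 fixes \<rho> :: "real^'m^1 => real"
 assumes conv: "convex_on UNIV \<rho>" and nn: "!!\<xi>. 0 <= \<rho> \<xi>" and gr: "!!\<xi>. \<rho> \<xi> <= C * (1 + norm \<xi>)"
  and d1: "!!(M::real^'m^1) (B::real^'m^'m). (%t::real. \<rho> (M ** (mat 1 + t *\<^sub>R B))) differentiable (at 0)"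
  and d2: "!!(M::real^'m^1) (B::real^'m^'m). rank M = 1 ==>
     (%t::real. enn2real (recession \<rho> (M ** (mat 1 + t *\<^sub>R B)))) differentiable (at 0)"
  and w: "w \<in> BV U" and z: "integrable (Leb U) z"
 defines "fm \<equiv> %t. function_of_measure U \<rho> (%E. D_scalar U (vary_w \<phi> t w) E - lebesgue_times U (%x. rowvector (vary_z \<phi> t z x)) E) U"
 shows "abs t < t0 ==> vary_w \<phi> t w \<in> BV U" and "abs t < t0 ==> fm t < \<infinity>"
  and "(%t. enn2real (fm t)) differentiable (at 0)"
proof -
 have wi: "integrable (Leb U) (%x. vec (w x) :: real^1)" using w absolutely_integrable_iff unfolding BV_def BV_vec_def by blast
 obtain \<mu> where \<mu>: "represents U (distr_D U (%x. vec (w x) :: real^1)) \<mu>" using w unfolding BV_def BV_vec_def by blast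
 have "finite_vector_measure U \<mu>" using \<mu> by (simp add: represents_def)
 from fvm_decomp[OF U this] obtain f \<Lambda> N g where dec: "decomp U f \<Lambda> N g" and "\<mu> = dmeas U f \<Lambda> g" by blast
 then have rep: "represents U (distr_D U (%x. vec (w x) :: real^1)) (dmeas U f \<Lambda> g)" using \<mu> by simp
 \<comment> \<open>subtracting \<open>z^T\<close> changes only the absolutely continuous part\<close>
 define F where "F x = f x - rowvector (z x)" for x
 have fi: "integrable (Leb U) f" using dec by (simp add: decomp_def)
 have Fi: "integrable (Leb U) F" unfolding F_def
  by (rule bint_diff[OF fi integrable_bounded_linear[OF bounded_linear_rowvector z]])
 have decF: "decomp U F \<Lambda> N g" using dec Fi by (simp add: decomp_def)
 have C0: "0 <= C" using gr[of 0] nn[of 0] by simp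
 have gr1: "\<rho> \<xi> <= C * (norm \<xi> powr 1 + 1)" for \<xi> using gr[of \<xi>] by (simp add: add.commute)
 obtain cm where cm: "cm \<ge> 0" "!!(M :: real^'m^1) (A :: real^'m^'m). norm (M ** A) <= cm * norm A * norm M"
  by (rule bounded_mm) blast
 obtain b where b: "!!x. norm (B x) <= b" using jacobian_facts(4) by blast
 have lin: "M ** A t x = M + t *\<^sub>R (M ** B x)" for M :: "real^'m^1" and t x
  by (simp add: matrix_add_ldistrib bounded_bilinear.scaleR_right[OF bounded_bilinear_mm])
 define val where "val = (%t. (\<integral>\<^sup>+y. ennreal (1 / det (A t (\<Psi> t y))) * ennreal (\<rho> (F y + t *\<^sub>R (F y ** B (\<Psi> t y) + 0))) \<partial>Leb U) +
   (\<integral>\<^sup>+y. ennreal (1 / det (A t (\<Psi> t y))) * recession \<rho> (g y + t *\<^sub>R (g y ** B (\<Psi> t y))) \<partial>\<Lambda>))"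
 have fm: "fm t = val t" if t: "abs t < t0" for t
 proof -
  obtain b where b: "!!x. norm (A t x) <= b" using A_bounded[of t] by blast
  note st = composition_transport[OF U diffeo[OF t] b A_continuous dec wi rep]
  have cont: "continuous_on UNIV (%(x, M :: real^'m^1). M ** A t x)" by (rule st(2))
  obtain k where bd: "\<forall>x\<in>U. \<forall>M :: real^'m^1. norm (M ** A t x) <= k * norm M" using st(3) by blast
  have i0: "integrable (Leb U) (%x. 0 :: real^'m^1)" by simp
  have fA: "integrable (Leb U) (%x. f (\<Phi> t x) ** A t x + 0)"
   using decomp_transport(5)[where opr = "%x M. M ** A t x", OF U diffeo[OF t] dec cont bd i0] by simp
  have zA: "integrable (Leb U) (%x. rowvector (vary_z \<phi> t z x) :: real^'m^1)"
   by (rule integrable_bounded_linear[OF bounded_linear_rowvector vary_z_integrable[OF t z]])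
  have diff: "f (\<Phi> t x) ** A t x + 0 - rowvector (vary_z \<phi> t z x) = F (\<Phi> t x) ** A t x + 0" for x
   unfolding rowvector_vary_z F_def by (simp add: bounded_bilinear.diff_left[OF bounded_bilinear_mm])
  have "fm t = function_of_measure U \<rho> (dmeas U (%x. F (\<Phi> t x) ** A t x + 0) (push U \<Lambda> (\<Psi> t)) (%x. (1 / det (A t x)) *\<^sub>R (g (\<Phi> t x) ** A t x))) U"
   unfolding fm_def scalar_variation(2)[OF t wi dec rep] dmeas_minus_lebesgue_times[OF fA zA] diff ..
  also have "... = (\<integral>\<^sup>+y. ennreal (1 / det (A t (\<Psi> t y))) * ennreal (\<rho> (F y ** A t (\<Psi> t y) + 0)) \<partial>Leb U) +
   (\<integral>\<^sup>+y. ennreal (1 / det (A t (\<Psi> t y))) * recession \<rho> (g y ** A t (\<Psi> t y)) \<partial>\<Lambda>)"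
   by (rule function_of_measure_transport[where opr = "%x M. M ** A t x" and h = "%x. 0", OF U diffeo[OF t] decF cont bd i0])
    (use convex_on_continuous[OF open_UNIV conv] nn recession_measurable[OF conv nn] recession_scale[OF conv nn] in auto)
  also have "... = val t" unfolding val_def lin by (simp add: add.assoc)
  finally show ?thesis .
 qed
 have dif: "(%t. \<rho> (M + t *\<^sub>R (M ** B (\<Psi> 0 x) + 0))) differentiable (at 0)" for M x
  using d1[of M "B x"] unfolding lin \<Psi>_0 by simp
 have difs: "(%t. enn2real (recession \<rho> (M + t *\<^sub>R (M ** B (\<Psi> 0 x))))) differentiable (at 0)" for M x
 proof (cases "M = 0")
  case True
  have "(0 :: real^'m^1) ** B x = 0" by (simp add: bounded_bilinear.zero_left[OF bounded_bilinear_mm])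
  then show ?thesis by (simp add: True \<Psi>_0 recession_0[OF conv nn])
 next
  case False
  have "rank M = 1"
  proof -
   have "rank M <= 1" using rank_bound[of M] by simp
   moreover have "rank M \<noteq> 0" using False by (simp add: rank_eq_0)
   ultimately show ?thesis by simp
  qed
  from d2[OF this, of "B x"] show ?thesis unfolding lin \<Psi>_0 .
 qed
 have Lb: "norm ((M :: real^'m^1) ** B x) <= (cm * b) * norm M" for M x
  using cm(2)[of M "B x"] mult_right_mono[OF mult_left_mono[OF b[of x] cm(1)], of "norm M"] by simp
 have Lc: "continuous_on UNIV (%(y, M :: real^'m^1). M ** B (\<Psi> t y))" if "abs t < t0" for t
  unfolding case_prod_beta
  by (intro bounded_bilinear.continuous_on[OF bounded_bilinear_mm] continuous_intros
   continuous_on_compose2[OF continuous_on_compose2[OF jacobian_facts(3) diffeoD(8)[OF diffeo[OF that]]]]) auto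
 have Ll: "((%t. M ** B (\<Psi> t y)) \<longlongrightarrow> M ** B (\<Psi> 0 y)) (at 0)" for y and M :: "real^'m^1"
  unfolding \<Psi>_0 by (intro bounded_bilinear.tendsto[OF bounded_bilinear_mm] tendsto_const B_tendsto)
 have lp0: "lp (Leb U) 1 (%y. 0)" by (simp add: lp_def)
 have Fp: "integrable (Leb U) (%x. norm (F x) powr 1)" using integrable_norm[OF Fi] by simp
 have km: "(%y. 0 :: real^'m^1) \<in> borel_measurable (Leb U)" by simp
 have kG: "norm (0 :: real^'m^1) <= 0" by simp
 have difA: "AE x in Leb U. (%t. \<rho> (F x + t *\<^sub>R (F x ** B (\<Psi> 0 x) + 0))) differentiable (at 0)"
  by (rule AE_I2) (rule dif)
 have sing: "((1::real) = 1 \<and> (AE y in \<Lambda>. (%t. enn2real (recession \<rho> (g y + t *\<^sub>R (g y ** B (\<Psi> 0 y))))) differentiable (at 0))) \<or> (AE y in \<Lambda>. g y = 0)"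
  by (rule disjI1, rule conjI[OF refl], rule AE_I2) (rule difs)
 note v = variation_differentiable[where L = "%t y M. M ** B (\<Psi> t y)" and k = "%t y. 0" and G = "%y. 0" and p = 1
   and J = "%t y. 1 / det (A t (\<Psi> t y))" and c = c and \<rho> = \<rho> and l = "cm * b",
   OF U decF t0 J_nonneg jac_le jac_derivative J_continuous Lc Lb Ll km kG lp0 tendsto_const conv nn order_refl gr1 Fp difA sing]
 have v1: "val t < \<infinity>" if "abs t < t0" for t
  unfolding val_def by (rule v(1)) (use that in simp_all)
 have v2: "(%t. enn2real (val t)) differentiable (at 0)"
  unfolding val_def by (rule v(2)) simp_all
 show "vary_w \<phi> t w \<in> BV U" if "abs t < t0" by (rule scalar_variation(1)[OF that wi dec rep])
 show "fm t < \<infinity>" if "abs t < t0" using fm[OF that] v1[OF that] by simp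
 show "(%t. enn2real (fm t)) differentiable (at 0)"
  by (rule differentiable_near_0[OF v2 t0(1)]) (simp add: fm)
qed

end

lemma norm_matrix_le_sum: "norm (M :: real^'n^'m) <= (\<Sum>i\<in>UNIV. \<Sum>j\<in>UNIV. \<bar>M $ i $ j\<bar>)"
proof -
 have "norm M <= (\<Sum>i\<in>UNIV. norm (M $ i))" unfolding norm_vec_def[of M] by (rule L2_set_le_sum) simp
 also have "... <= (\<Sum>i\<in>UNIV. \<Sum>j\<in>UNIV. \<bar>M $ i $ j\<bar>)" by (intro sum_mono norm_le_l1_cart)
 finally show ?thesis .
qed

lemma symop_idem: "symop True (symop s M) = symop True M"
 by (simp add: symop_def sym_part_def transpose_def vec_eq_iff field_simps)

context inner_variation
begin

lemma test_B_entry: "(%x. B x $ k $ i) \<in> test_functions (supp \<phi>)"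
 by (rule test_functionsI[OF jacobian_facts(2) test_functionsD(2)[OF \<phi>] subset_refl]) (simp add: jacobian_facts(5))

lemma second_order_bound: "\<exists>K\<ge>0. \<forall>x v. norm (second_order B x v) <= K * norm v"
proof -
 have "\<forall>j k i. \<exists>b. \<forall>x. \<bar>pd j (%x. B x $ k $ i) x\<bar> <= b"
  using bounded_test[OF test_pd[OF test_B_entry]] unfolding real_norm_def by blast
 then obtain b where b: "!!j k i x. \<bar>pd j (%x. B x $ k $ i) x\<bar> <= b j k i" by metis
 have b0: "0 <= b j k i" for j k i using order_trans[OF abs_ge_zero b] .
 have "norm (second_order B x v) <= (\<Sum>i\<in>UNIV. \<Sum>j\<in>UNIV. \<Sum>k\<in>UNIV. b j k i) * norm v" for x v
 proof -
  have "norm (second_order B x v) <= (\<Sum>i\<in>UNIV. \<Sum>j\<in>UNIV. \<bar>second_order B x v $ i $ j\<bar>)" by (rule norm_matrix_le_sum)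
  also have "... <= (\<Sum>i\<in>UNIV. \<Sum>j\<in>UNIV. \<Sum>k\<in>UNIV. b j k i * norm v)"
  proof (intro sum_mono)
   fix i j
   have "\<bar>second_order B x v $ i $ j\<bar> <= (\<Sum>k\<in>UNIV. \<bar>v $ k * pd j (%x. B x $ k $ i) x\<bar>)"
    unfolding second_order_def by (simp add: sum_abs)
   also have "... <= (\<Sum>k\<in>UNIV. b j k i * norm v)"
    unfolding abs_mult using component_le_norm_cart[of v] b b0 by (intro sum_mono) (metis abs_ge_zero mult.commute mult_mono norm_ge_zero)
   finally show "\<bar>second_order B x v $ i $ j\<bar> <= (\<Sum>k\<in>UNIV. b j k i * norm v)" .
  qed
  finally show ?thesis by (simp add: sum_distrib_right)
 qed
 then show ?thesis using b0 by (intro exI[of _ "\<Sum>i\<in>UNIV. \<Sum>j\<in>UNIV. \<Sum>k\<in>UNIV. b j k i"]) (simp add: sum_nonneg)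
qed

lemma second_order_outside: "x \<notin> supp \<phi> ==> second_order B x v = 0"
 using test_0_outside[OF test_pd[OF test_B_entry]] by (simp add: second_order_def vec_eq_iff)

lemma second_order_continuous: "continuous_on UNIV (%(x, v). second_order B x v)"
 unfolding second_order_def case_prod_beta
 by (intro continuous_on_vec_lambda continuous_on_sum continuous_on_mult continuous_intros
   continuous_on_compose2[OF smooth_continuous[OF smooth_pd[OF jacobian_facts(2)], of UNIV]]) auto

lemma second_order_A: "second_order (A t) x v = t *\<^sub>R second_order B x v"
proof -
 have "pd j (%x. A t x $ k $ i) x = t * pd j (%x. B x $ k $ i) x" for j k i
 proof -
  have "((%x. B x $ k $ i) has_derivative (%v. \<Sum>l\<in>UNIV. pd l (%x. B x $ k $ i) x * v $ l)) (at x)"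
   by (rule has_derivative_pd[OF smooth_differentiable[OF jacobian_facts(2)]])
  then have "((%x. (mat 1 :: real^'m^'m) $ k $ i + t * B x $ k $ i) has_derivative
    (%v. 0 + t * (\<Sum>l\<in>UNIV. pd l (%x. B x $ k $ i) x * v $ l))) (at x)"
   by (intro derivative_intros)
  from pd_eqI[OF this, of j] show ?thesis
   by (simp add: axis_def if_distrib[of "%t. _ * t"] cong: if_cong)
 qed
 then show ?thesis by (simp add: second_order_def vec_eq_iff sum_distrib_left mult_ac)
qed

lemma \<Psi>_outside: "abs t < t0 ==> y \<notin> supp \<phi> ==> \<Psi> t y = y"
 using diffeoD(1)[OF diffeo, of t y] not_supp[of y \<phi>] by simp

text \<open>Finiteness of the energy gives \<open>p\<close>-integrability of the density and, for \<open>p >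
  1\<close>, the absence of a singular part. The latter makes the symmetric gradient a
  \<open>p\<close>-integrable function, and \<open>korn_higher_integrability\<close> then
  dominates the lower order term on the support of \<open>\<phi>\<close>.\<close>

lemma second_energy:
 fixes \<rho> :: "real^'m^'m => real" and s :: bool
 assumes conv: "convex_on UNIV \<rho>" and nn: "!!\<xi>. 0 <= \<rho> \<xi>" and p: "p \<ge> 1" and C1: "C1 > 0"
  and low: "!!M. C1 * (norm M powr p - 1) <= \<rho> M" and gr: "!!M. \<rho> M <= C2 * (norm M powr p + 1)"
  and d1: "!!M. \<rho> differentiable (at M)"
  and d2: "!!M. p = 1 ==> M \<noteq> 0 ==> (%M. enn2real (recession \<rho> M)) differentiable (at M)"
  and z: "integrable (Leb U) z" and \<mu>: "represents U (distr_op s U z) \<mu>"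
  and finite: "function_of_measure U \<rho> (representing_measure U (distr_op s U z)) U < \<infinity>"
 defines "fm \<equiv> %t. function_of_measure U \<rho> (representing_measure U (distr_op s U (vary_z \<phi> t z))) U"
 shows "abs t < t0 ==> \<exists>\<mu>. represents U (distr_op s U (vary_z \<phi> t z)) \<mu>" and "abs t < t0 ==> fm t < \<infinity>"
  and "(%t. enn2real (fm t)) differentiable (at 0)"
proof -
 have "finite_vector_measure U \<mu>" using \<mu> by (simp add: represents_def)
 from fvm_decomp[OF U this] obtain F \<Lambda> N g where dec: "decomp U F \<Lambda> N g" and \<mu>eq: "\<mu> = dmeas U F \<Lambda> g" by blast
 have rep: "represents U (distr_op s U z) (dmeas U F \<Lambda> g)" using \<mu> \<mu>eq by simp
 have Fi: "integrable (Leb U) F" and \<Lambda>: "sets \<Lambda> = borel_subsets U" and gi: "integrable \<Lambda> g" using dec by (simp_all add: decomp_def)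
 note rm = recession_measurable[OF conv nn] and rs = recession_scale[OF conv nn]
 have cont\<rho>: "continuous_on UNIV \<rho>" by (rule convex_on_continuous[OF open_UNIV conv])
 have \<rho>m: "\<rho> \<in> borel_measurable borel" by (rule borel_measurable_continuous_onI[OF cont\<rho>])
 have "function_of_measure U \<rho> (dmeas U F \<Lambda> g) U = (\<integral>\<^sup>+x. ennreal (\<rho> (F x)) \<partial>Leb U) + (\<integral>\<^sup>+x. recession \<rho> (g x) \<partial>\<Lambda>)"
  by (rule function_of_measure_dmeas[OF U dec rm rs])
 then have fins: "(\<integral>\<^sup>+x. ennreal (\<rho> (F x)) \<partial>Leb U) < \<infinity>" "(\<integral>\<^sup>+x. recession \<rho> (g x) \<partial>\<Lambda>) < \<infinity>"
  using finite unfolding representing_measure_eq[OF U rep] by simp_all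
 have finm: "finite_measure (Leb U)"
  by (rule finite_measure_lebesgue_on) (use U in \<open>simp add: lmeasurable_open\<close>)
 have Fm: "F \<in> borel_measurable (Leb U)" using Fi by auto
 have Fp: "integrable (Leb U) (%x. norm (F x) powr p)"
 proof (rule bint_bound[of _ "%x. \<rho> (F x) / C1 + 1"])
  have "integrable (Leb U) (%x. \<rho> (F x))"
  proof (rule integrableI_nonneg)
   show "(%x. \<rho> (F x)) \<in> borel_measurable (Leb U)" by (rule measurable_compose[OF Fm \<rho>m])
  qed (use nn fins(1) in simp_all)
  then show "integrable (Leb U) (%x. \<rho> (F x) / C1 + 1)"
   by (intro bint_add) (auto intro: finite_measure.integrable_const[OF finm])
  show "(%x. norm (F x) powr p) \<in> borel_measurable (Leb U)" using Fm by measurable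
  have "norm (F x) powr p <= \<rho> (F x) / C1 + 1" for x
   using low[of "F x"] C1 by (simp add: field_simps)
  then show "AE x in Leb U. norm (norm (F x) powr p) <= norm (\<rho> (F x) / C1 + 1)"
   by (intro AE_I2) (simp add: order_trans[OF _ abs_ge_self])
 qed
 have g0: "AE y in \<Lambda>. g y = 0" if p1: "p > 1"
 proof -
  have gm: "g \<in> borel_measurable \<Lambda>" using gi by auto
  have m: "(%x. recession \<rho> (g x)) \<in> borel_measurable \<Lambda>" by (rule measurable_compose[OF gm rm])
  have "AE x in \<Lambda>. recession \<rho> (g x) \<noteq> \<infinity>" using nn_integral_PInf_AE[OF m] fins(2) by simp
  then show ?thesis
  proof eventually_elim
   case (elim x)
   then show ?case using recession_superlinear[OF conv nn p1 C1 low, of "g x"] by blast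
  qed
 qed
 \<comment> \<open>the second derivatives of \<open>\<phi>\<close> vanish off its support, so only this truncation of \<open>z\<close> enters\<close>
 define Z where "Z y = indicat_real (supp \<phi>) y * norm (z y)" for y
 have sb: "supp \<phi> \<in> sets borel" by simp
 have Zm: "Z \<in> borel_measurable (Leb U)" unfolding Z_def
  using borel_measurable_integrable[OF z] borel_lebesgue_on[of "indicat_real (supp \<phi>)" U] sb by simp
 have Zp: "lp (Leb U) p Z"
 proof (cases "p = 1")
  case True
  have "integrable (Leb U) Z"
  proof (rule bint_bound[OF integrable_norm[OF z] Zm])
   show "AE x in Leb U. norm (Z x) <= norm (norm (z x))"
    by (rule AE_I2) (simp add: Z_def split: split_indicator)
  qed
  then show ?thesis using Zm True by (simp add: lp_def)
 next
  case False
  then have p1: "p > 1" using p by simp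
  have E: "distr_E U z \<psi> = (LINT x|Leb U. \<psi> x *\<^sub>R symop True (F x))" if \<psi>: "\<psi> \<in> test_functions U" for \<psi>
  proof -
   obtain b where b: "!!x. norm (\<psi> x) <= b" using bounded_test[OF \<psi>] by blast
   have i: "integrable (Leb U) (%x. \<psi> x *\<^sub>R F x)"
    by (rule integrable_test_scaleR[OF Fi borel_lebesgue_on[OF test_borel_measurable[OF \<psi>]] b])
   have "(LINT x|\<Lambda>. \<psi> x *\<^sub>R g x) = 0"
   proof (rule integral_eq_zero_AE)
    show "AE x in \<Lambda>. \<psi> x *\<^sub>R g x = 0" using g0[OF p1] by eventually_elim simp
   qed
   then have "distr_op s U z \<psi> = (LINT x|Leb U. \<psi> x *\<^sub>R F x)"
    using rep[unfolded represents_dmeas[OF U dec]] \<psi> by simp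
   then have "symop True (distr_op s U z \<psi>) = (LINT x|Leb U. symop True (\<psi> x *\<^sub>R F x))"
    using integral_bounded_linear[OF bounded_linear_symop i, of True] by simp
   moreover have "symop True (distr_op s U z \<psi>) = distr_E U z \<psi>"
    using distr_op_symop[of True U z \<psi>] by (simp add: distr_op_symop symop_idem distr_op_def)
   moreover have "symop True (\<psi> x *\<^sub>R F x) = \<psi> x *\<^sub>R symop True (F x)" for x
    by (rule linear_cmul[OF bounded_linear.linear[OF bounded_linear_symop]])
   ultimately show ?thesis by simp
  qed
  have si: "integrable (Leb U) (%x. symop True (F x))" by (rule integrable_bounded_linear[OF bounded_linear_symop Fi])
  have sp: "integrable (Leb U) (%x. norm (symop True (F x)) powr p)"
  proof -
   obtain K where K: "!!M :: real^'m^'m. norm (symop True M) <= norm M * K" "K > 0"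
    using bounded_linear.pos_bounded[OF bounded_linear_symop] by blast
   have Fl: "lp (Leb U) p (%x. K * norm (F x))" using Fp Fm by (intro lp_cmult) (simp add: lp_def)
   have "lp (Leb U) p (%x. norm (symop True (F x)))"
   proof (rule lp_mono[OF Fl _ _ p])
    show "(%x. norm (symop True (F x))) \<in> borel_measurable (Leb U)"
     using borel_measurable_integrable[OF si] by simp
    show "AE x in Leb U. \<bar>norm (symop True (F x))\<bar> <= \<bar>K * norm (F x)\<bar>"
     by (rule AE_I2) (use K in \<open>simp add: mult.commute\<close>)
   qed
   then show ?thesis by (simp add: lp_def)
  qed
  have "integrable (Leb U) (%x. indicat_real (supp \<phi>) x * norm (z x) powr p)"
   by (rule korn_higher_integrability[OF U test_functionsD(2,3)[OF \<phi>] p z si sp E])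
  moreover have "\<bar>Z x\<bar> powr p = indicat_real (supp \<phi>) x * norm (z x) powr p" for x
   by (simp add: Z_def split: split_indicator)
  ultimately show ?thesis using Zm by (simp add: lp_def)
 qed
 define S where "S x v = symop s (second_order B x v)" for x v
 have Sc: "continuous_on UNIV (%(x, v). S x v)"
  using continuous_on_compose2[OF linear_continuous_on[OF bounded_linear_symop, of UNIV s] second_order_continuous]
  unfolding S_def by (simp add: case_prod_beta)
 obtain KS where KS: "KS \<ge> 0" "!!x v. norm (S x v) <= KS * norm v"
 proof -
  obtain K where K: "K \<ge> 0" "!!x v. norm (second_order B x v) <= K * norm v" using second_order_bound by blast
  obtain K' where K': "!!M :: real^'m^'m. norm (symop s M) <= norm M * K'" "K' > 0"
   using bounded_linear.pos_bounded[OF bounded_linear_symop] by blast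
  have "norm (S x v) <= (K * K') * norm v" for x v
  proof -
   have "norm (S x v) <= norm (second_order B x v) * K'" unfolding S_def by (rule K'(1))
   also have "... <= (K * norm v) * K'" using K(2) K'(2) by (intro mult_right_mono) auto
   finally show ?thesis by (simp add: mult_ac)
  qed
  then show thesis using K(1) K'(2) by (intro that[of "K * K'"]) auto
 qed
 have Szero: "S x v = 0" if "x \<notin> supp \<phi>" for x v
  unfolding S_def second_order_outside[OF that] by (rule linear_0[OF bounded_linear.linear[OF bounded_linear_symop]])
 \<comment> \<open>\<open>A^T M A - M\<close> divided by \<open>t\<close>\<close>
 define L where "L t y M = transpose (B (\<Psi> t y)) ** M + M ** B (\<Psi> t y) + t *\<^sub>R (transpose (B (\<Psi> t y)) ** M ** B (\<Psi> t y))" for t y and M :: "real^'m^'m"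
 have lin: "transpose (A t (\<Psi> t y)) ** M ** A t (\<Psi> t y) = M + t *\<^sub>R L t y M" for M t y
 proof -
  have t: "transpose (A t x) = mat 1 + t *\<^sub>R transpose (B x)" for x
   by (simp add: transpose_def vec_eq_iff mat_def)
  show ?thesis unfolding t L_def
   by (simp add: matrix_add_ldistrib bounded_bilinear.add_left[OF bounded_bilinear_mm] bounded_bilinear.scaleR_right[OF bounded_bilinear_mm]
    bounded_bilinear.scaleR_left[OF bounded_bilinear_mm] scaleR_add_right algebra_simps)
 qed
 have h_eq: "symop s (second_order (A t) x v) = t *\<^sub>R S x v" for t x v
  unfolding second_order_A S_def by (rule linear_cmul[OF bounded_linear.linear[OF bounded_linear_symop]])
 have kmeas: "(%y. S (\<Psi> t y) (z y)) \<in> borel_measurable (Leb U)" if "abs t < t0" for t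
  by (rule borel_measurable_op[OF Sc continuous_lebesgue_on[OF diffeoD(8)[OF diffeo[OF that]]] borel_measurable_integrable[OF z]])
 have kG: "norm (S (\<Psi> t y) (z y)) <= KS * Z y" if "abs t < t0" for t y
 proof (cases "y \<in> supp \<phi>")
  case True
  then show ?thesis using KS(2)[of "\<Psi> t y" "z y"] by (simp add: Z_def)
 next
  case False
  then show ?thesis using Szero[OF False] \<Psi>_outside[OF that False] by (simp add: Z_def)
 qed
 have hint: "integrable (Leb U) (%x. t *\<^sub>R S x (z (\<Phi> t x)))" if "abs t < t0" for t
 proof (rule integrable_scaleR_right, rule bint_bound[of _ "%x. KS * norm (z (\<Phi> t x))"])
  note z\<Phi> = integrable_diffeo[OF U diffeo[OF that] z]
  show "integrable (Leb U) (%x. KS * norm (z (\<Phi> t x)))" by (intro integrable_mult_right integrable_norm z\<Phi>)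
  have idm: "(%x. x) \<in> borel_measurable (Leb U)" by (rule borel_lebesgue_on) simp
  show "(%x. S x (z (\<Phi> t x))) \<in> borel_measurable (Leb U)"
   by (rule borel_measurable_op[OF Sc idm borel_measurable_integrable[OF z\<Phi>]])
  show "AE x in Leb U. norm (S x (z (\<Phi> t x))) <= norm (KS * norm (z (\<Phi> t x)))"
   by (rule AE_I2) (rule order_trans[OF KS(2)], unfold real_norm_def, rule abs_ge_self)
 qed
 define val where "val = (%t. (\<integral>\<^sup>+y. ennreal (1 / det (A t (\<Psi> t y))) * ennreal (\<rho> (F y + t *\<^sub>R (L t y (F y) + S (\<Psi> t y) (z y)))) \<partial>Leb U) +
   (\<integral>\<^sup>+y. ennreal (1 / det (A t (\<Psi> t y))) * recession \<rho> (g y + t *\<^sub>R L t y (g y)) \<partial>\<Lambda>))"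
 have R: "represents U (distr_op s U (vary_z \<phi> t z)) (dmeas U (%x. transpose (A t x) ** F (\<Phi> t x) ** A t x + t *\<^sub>R S x (z (\<Phi> t x)))
    (push U \<Lambda> (\<Psi> t)) (%x. (1 / det (A t x)) *\<^sub>R (transpose (A t x) ** g (\<Phi> t x) ** A t x))) \<and> fm t = val t"
  if t: "abs t < t0" for t
 proof
  obtain b where b: "!!x. norm (A t x) <= b" using A_bounded[of t] by blast
  have h: "integrable (Leb U) (%x. symop s (second_order (A t) x (z (\<Phi> t x))))"
   unfolding h_eq by (rule hint[OF t])
  note ft = pullback_transport[OF U diffeo[OF t] b A_continuous dec z h rep]
  show r: "represents U (distr_op s U (vary_z \<phi> t z)) (dmeas U (%x. transpose (A t x) ** F (\<Phi> t x) ** A t x + t *\<^sub>R S x (z (\<Phi> t x)))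
    (push U \<Lambda> (\<Psi> t)) (%x. (1 / det (A t x)) *\<^sub>R (transpose (A t x) ** g (\<Phi> t x) ** A t x)))"
   using ft(1) unfolding vary_z_eq h_eq .
  obtain k where bd: "\<forall>x\<in>U. \<forall>M :: real^'m^'m. norm (transpose (A t x) ** M ** A t x) <= k * norm M" using ft(3) by blast
  have right_inv: "\<Phi> t (\<Psi> t y) = y" for y using diffeoD(2)[OF diffeo[OF t]] .
  have hm: "(%y. t *\<^sub>R S (\<Psi> t y) (z (\<Phi> t (\<Psi> t y)))) \<in> borel_measurable (Leb U)"
   unfolding right_inv by (intro borel_measurable_scaleR borel_measurable_const kmeas[OF t])
  have "fm t = (\<integral>\<^sup>+y. ennreal (1 / det (A t (\<Psi> t y))) * ennreal (\<rho> (transpose (A t (\<Psi> t y)) ** F y ** A t (\<Psi> t y) + t *\<^sub>R S (\<Psi> t y) (z (\<Phi> t (\<Psi> t y))))) \<partial>Leb U) +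
   (\<integral>\<^sup>+y. ennreal (1 / det (A t (\<Psi> t y))) * recession \<rho> (transpose (A t (\<Psi> t y)) ** g y ** A t (\<Psi> t y)) \<partial>\<Lambda>)"
   unfolding fm_def representing_measure_eq[OF U r]
   by (rule function_of_measure_transport[where opr = "%x M. transpose (A t x) ** M ** A t x" and h = "%x. t *\<^sub>R S x (z (\<Phi> t x))",
     OF U diffeo[OF t] dec ft(2) bd hint[OF t] hm cont\<rho> nn rm rs])
  also have "... = val t" unfolding val_def lin right_inv by (simp only: scaleR_add_right add.assoc)
  finally show "fm t = val t" .
 qed
 obtain cm where cm: "cm \<ge> 0" "!!(M :: real^'m^'m) (A :: real^'m^'m). norm (M ** A) <= cm * norm A * norm M"
  by (rule bounded_mm) blast
 obtain b where b: "!!x. norm (B x) <= b" using jacobian_facts(4) by blast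
 have b0: "0 <= b" using order_trans[OF norm_ge_zero b] .
 note nt = norm_transpose
 have mB: "norm (M ** B x) <= (cm * b) * norm M" for M :: "real^'m^'m" and x
  using cm(2)[of M "B x"] mult_right_mono[OF mult_left_mono[OF b[of x] cm(1)], of "norm M"] by simp
 have Bm: "norm (transpose (B x) ** M) <= (cm * b) * norm M" for M :: "real^'m^'m" and x
 proof -
  have "norm (transpose (B x) ** M) <= (cm * norm M) * norm (B x)" using cm(2)[of "transpose (B x)" M] by (simp add: nt)
  also have "... <= (cm * norm M) * b" using cm(1) b by (intro mult_left_mono) auto
  finally show ?thesis by (simp add: mult_ac)
 qed
 let ?l = "cm * b + cm * b + (cm * b) * (cm * b)"
 have cb0: "0 <= cm * b" using cm(1) b0 by simp
 have Lb: "norm (L t y M) <= ?l * norm M" if "abs t < t0" for t y M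
 proof -
  let ?B = "B (\<Psi> t y)"
  have "norm (transpose ?B ** M ** ?B) <= (cm * b) * norm (transpose ?B ** M)" by (rule mB)
  also have "... <= (cm * b) * ((cm * b) * norm M)" by (rule mult_left_mono[OF Bm cb0])
  finally have 1: "norm (transpose ?B ** M ** ?B) <= (cm * b) * ((cm * b) * norm M)" .
  have "norm (t *\<^sub>R (transpose ?B ** M ** ?B)) <= 1 * norm (transpose ?B ** M ** ?B)"
   unfolding norm_scaleR using that t0 by (intro mult_right_mono) auto
  then have 2: "norm (t *\<^sub>R (transpose ?B ** M ** ?B)) <= (cm * b) * ((cm * b) * norm M)" using 1 by simp
  have "norm (L t y M) <= norm (transpose ?B ** M) + norm (M ** ?B) + norm (t *\<^sub>R (transpose ?B ** M ** ?B))"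
   unfolding L_def by (rule order_trans[OF norm_triangle_ineq add_right_mono[OF norm_triangle_ineq]])
  also have "... <= (cm * b) * norm M + (cm * b) * norm M + (cm * b) * ((cm * b) * norm M)"
   by (intro add_mono Bm mB 2)
  finally show ?thesis by (simp add: algebra_simps)
 qed
 have tB: "continuous_on UNIV (%x. transpose (B x))"
  unfolding transpose_def by (intro continuous_on_vec_lambda continuous_intros jacobian_facts(3))
 have Lc: "continuous_on UNIV (%(y, M). L t y M)" if "abs t < t0" for t
 proof -
  note \<Psi>c = diffeoD(8)[OF diffeo[OF that]]
  have c1: "continuous_on UNIV (%q :: (real^'m) \<times> (real^'m^'m). B (\<Psi> t (fst q)))"
   by (rule continuous_on_compose2[OF jacobian_facts(3) continuous_on_compose2[OF \<Psi>c continuous_on_fst[OF continuous_on_id]]]) auto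
  have c2: "continuous_on UNIV (%q :: (real^'m) \<times> (real^'m^'m). transpose (B (\<Psi> t (fst q))))"
   by (rule continuous_on_compose2[OF tB continuous_on_compose2[OF \<Psi>c continuous_on_fst[OF continuous_on_id]]]) auto
  show ?thesis unfolding case_prod_beta L_def
   by (intro continuous_on_add continuous_on_scaleR continuous_on_const bounded_bilinear.continuous_on[OF bounded_bilinear_mm] c1 c2
     continuous_on_snd continuous_on_id)
 qed
 have tBl: "((%t. transpose (B (\<Psi> t y))) \<longlongrightarrow> transpose (B y)) (at 0)" for y
  unfolding transpose_def by (intro tendsto_vec_lambda tendsto_vec_nth B_tendsto)
 have Ll: "((%t. L t y M) \<longlongrightarrow> L 0 y M) (at 0)" for y M
  unfolding L_def \<Psi>_0
  by (intro tendsto_add tendsto_scaleR bounded_bilinear.tendsto[OF bounded_bilinear_mm] tendsto_const tendsto_ident_at B_tendsto tBl)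
 have kl: "((%t. S (\<Psi> t y) (z y)) \<longlongrightarrow> S (\<Psi> 0 y) (z y)) (at 0)" for y
 proof -
  have "continuous_on UNIV (%x. case (x, z y) of (x, v) => S x v)"
   by (rule continuous_on_compose2[OF Sc, of UNIV "%x. (x, z y)"]) (auto intro!: continuous_intros)
  then have "isCont (%x. S x (z y)) y" using continuous_on_eq_continuous_at[OF open_UNIV] by auto
  then show ?thesis unfolding \<Psi>_0 using inverse_tendsto[of y] by (rule isCont_tendsto_compose)
 qed
 have line: "(%t. q (M + t *\<^sub>R V)) differentiable (at (0::real))" if q: "q differentiable (at M)" for q :: "real^'m^'m => real" and M V
 proof -
  obtain D where D: "(q has_derivative D) (at M)" using q unfolding differentiable_def by blast
  have l: "((%t::real. M + t *\<^sub>R V) has_derivative (%r. r *\<^sub>R V)) (at 0)" by (auto intro!: derivative_eq_intros)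
  have "(q has_derivative D) (at (M + 0 *\<^sub>R V))" using D by simp
  from has_derivative_compose[OF l this] show ?thesis unfolding differentiable_def by blast
 qed
 have dif: "AE x in Leb U. (%t. \<rho> (F x + t *\<^sub>R (L 0 x (F x) + S (\<Psi> 0 x) (z x)))) differentiable (at 0)"
  by (rule AE_I2) (rule line[OF d1])
 have sing: "(p = 1 \<and> (AE y in \<Lambda>. (%t. enn2real (recession \<rho> (g y + t *\<^sub>R L 0 y (g y)))) differentiable (at 0))) \<or> (AE y in \<Lambda>. g y = 0)"
 proof (cases "p = 1")
  case True
  have "(%t. enn2real (recession \<rho> (M + t *\<^sub>R L 0 y M))) differentiable (at 0)" for y M
  proof (cases "M = 0")
   case True
   have "norm (L 0 y 0) <= ?l * norm (0 :: real^'m^'m)" by (rule Lb) (use t0 in simp)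
   then have "L 0 y 0 = 0" by simp
   then show ?thesis by (simp add: True)
  next
   case False
   show ?thesis by (rule line[of "%M. enn2real (recession \<rho> M)", OF d2[OF True False]])
  qed
  then show ?thesis using True by (intro disjI1 conjI AE_I2)
 next
  case False
  then show ?thesis using g0 p by simp
 qed
 note v = variation_differentiable[where L = L and k = "%t y. S (\<Psi> t y) (z y)" and G = "%y. KS * Z y" and p = p
   and J = "%t y. 1 / det (A t (\<Psi> t y))" and c = c and \<rho> = \<rho> and l = ?l,
   OF U dec t0 J_nonneg jac_le jac_derivative J_continuous Lc Lb Ll kmeas kG lp_cmult[OF Zp] kl conv nn p gr Fp dif sing]
 have v1: "val t < \<infinity>" if "abs t < t0" for t
  unfolding val_def by (rule v(1)) (use that in simp_all)
 have v2: "(%t. enn2real (val t)) differentiable (at 0)"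
  unfolding val_def by (rule v(2)) simp_all
 show "\<exists>\<mu>. represents U (distr_op s U (vary_z \<phi> t z)) \<mu>" if "abs t < t0" using R[OF that] by blast
 show "fm t < \<infinity>" if "abs t < t0" using R[OF that] v1[OF that] by simp
 show "(%t. enn2real (fm t)) differentiable (at 0)"
  by (rule differentiable_near_0[OF v2 t0(1)]) (simp add: R)
qed

end

text \<open>The three choices of the second energy are the symmetric gradient and, twice, the full gradient; in the last case
it remains to observe that the potential of \<open>z\<close> is varied into a potential of the varied field.\<close>

theorem theorem6p3:
  fixes \<Omega> :: "(real^'m) set"
    and \<rho>\<^sub>1 :: "real^'m^1 \<Rightarrow> real"
    and \<rho>\<^sub>2 :: "real^'m^'m \<Rightarrow> real"
    and C p C\<^sub>1 C\<^sub>2 :: real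
    and R\<^sub>2 :: "(real^'m \<Rightarrow> real^'m) \<Rightarrow> ennreal"
    and D\<^sub>2 :: "(real^'m \<Rightarrow> real^'m) set"
    and w :: "real^'m \<Rightarrow> real"
    and z \<phi> :: "real^'m \<Rightarrow> real^'m"
  assumes "open \<Omega>" and "bounded \<Omega>"
    and "convex_on UNIV \<rho>\<^sub>1" and "\<And>\<xi>. 0 \<le> \<rho>\<^sub>1 \<xi>"
    and "C > 0" and "\<And>\<xi>. \<rho>\<^sub>1 \<xi> \<le> C * (1 + norm \<xi>)"
    and "convex_on UNIV \<rho>\<^sub>2" and "\<And>M. 0 \<le> \<rho>\<^sub>2 M"
    and "p \<ge> 1" and "C\<^sub>1 > 0" and "C\<^sub>2 > 0"
    and "\<And>M. C\<^sub>1 * (norm M powr p - 1) \<le> \<rho>\<^sub>2 M"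
    and "\<And>M. \<rho>\<^sub>2 M \<le> C\<^sub>2 * (norm M powr p + 1)"
    and R\<^sub>2_D\<^sub>2:
      "(R\<^sub>2 = (\<lambda>z. function_of_measure \<Omega> \<rho>\<^sub>2 (E_measure \<Omega> z) \<Omega>) \<and> D\<^sub>2 = BD \<Omega>) \<or>
       (R\<^sub>2 = (\<lambda>z. function_of_measure \<Omega> \<rho>\<^sub>2 (D_measure \<Omega> z) \<Omega>) \<and> D\<^sub>2 = BV_vec \<Omega>) \<or>
       (R\<^sub>2 = (\<lambda>z. function_of_measure \<Omega> \<rho>\<^sub>2 (D_measure \<Omega> z) \<Omega>) \<and> D\<^sub>2 = BV_gradients \<Omega>)"
    and "\<And>(A::real^'m^1) (B::real^'m^'m).
           (\<lambda>\<tau>::real. \<rho>\<^sub>1 (A ** (mat 1 + \<tau> *\<^sub>R B))) differentiable (at 0)"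
    and "\<And>(A::real^'m^1) (B::real^'m^'m). rank A = 1 \<Longrightarrow>
           (\<lambda>\<tau>::real. enn2real (recession \<rho>\<^sub>1 (A ** (mat 1 + \<tau> *\<^sub>R B)))) differentiable (at 0)"
    and "\<And>M. \<rho>\<^sub>2 differentiable (at M)"
    and "\<And>M. p = 1 \<Longrightarrow> M \<noteq> 0 \<Longrightarrow> (\<lambda>M. enn2real (recession \<rho>\<^sub>2 M)) differentiable (at M)"
    and "w \<in> BV \<Omega>" and "z \<in> D\<^sub>2" and "R\<^sub>2 z < \<infinity>"
    and "\<phi> \<in> test_functions \<Omega>"
  shows "(\<forall>\<^sub>F \<tau> in nhds 0. vary_w \<phi> \<tau> w \<in> BV \<Omega> \<and> vary_z \<phi> \<tau> z \<in> D\<^sub>2 \<and>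
            R_tilde \<Omega> \<rho>\<^sub>1 R\<^sub>2 (vary_w \<phi> \<tau> w) (vary_z \<phi> \<tau> z) < \<infinity>) \<and>
         (\<lambda>\<tau>. enn2real (R_tilde \<Omega> \<rho>\<^sub>1 R\<^sub>2 (vary_w \<phi> \<tau> w) (vary_z \<phi> \<tau> z))) differentiable (at 0)"
proof -
 note \<Omega> = assms(1,2)
 obtain t0 c where t0: "0 < t0" "t0 <= 1"
  and d: "!!\<tau>. \<bar>\<tau>\<bar> < t0 ==> diffeo \<Omega> (%x. x + \<tau> *\<^sub>R \<phi> x) (%x. mat 1 + \<tau> *\<^sub>R jacobian \<phi> (at x)) (inv (%x. x + \<tau> *\<^sub>R \<phi> x))"
  and j: "!!\<tau> x. \<bar>\<tau>\<bar> < t0 ==> \<bar>1 / det (mat 1 + \<tau> *\<^sub>R jacobian \<phi> (at x)) - 1\<bar> <= \<bar>\<tau>\<bar> * c"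
  and inv: "!!y. ((%\<tau>. inv (%x. x + \<tau> *\<^sub>R \<phi> x) y) \<longlongrightarrow> y) (at 0)"
  and jd: "!!y. \<exists>d. ((%\<tau>. (1 / det (mat 1 + \<tau> *\<^sub>R jacobian \<phi> (at (inv (%x. x + \<tau> *\<^sub>R \<phi> x) y))) - 1) / \<tau>) \<longlongrightarrow> d) (at 0)"
  by (rule inner_variation_diffeo[OF assms(22)]) blast
 interpret inner_variation \<Omega> \<phi> t0 c
  by (rule inner_variation.intro[OF \<Omega> assms(22) t0 d j inv jd])
 obtain s where R2: "R\<^sub>2 = (%z. function_of_measure \<Omega> \<rho>\<^sub>2 (representing_measure \<Omega> (distr_op s \<Omega> z)) \<Omega>)"
  and rep: "\<exists>\<mu>. represents \<Omega> (distr_op s \<Omega> z) \<mu>" and zi: "integrable (Leb \<Omega>) z"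
  and pres: "!!\<tau>. \<bar>\<tau>\<bar> < t0 ==> \<exists>\<mu>. represents \<Omega> (distr_op s \<Omega> (vary_z \<phi> \<tau> z)) \<mu> ==> vary_z \<phi> \<tau> z \<in> D\<^sub>2"
  using R\<^sub>2_D\<^sub>2
 proof (elim disjE conjE)
  assume a: "R\<^sub>2 = (%z. function_of_measure \<Omega> \<rho>\<^sub>2 (E_measure \<Omega> z) \<Omega>)" "D\<^sub>2 = BD \<Omega>"
  have z: "integrable (Leb \<Omega>) z" "\<exists>\<mu>. represents \<Omega> (distr_E \<Omega> z) \<mu>"
   using assms(20) absolutely_integrable_iff unfolding a(2) BD_def by blast+
  show thesis
  proof (rule that[of True])
   show "R\<^sub>2 = (%z. function_of_measure \<Omega> \<rho>\<^sub>2 (representing_measure \<Omega> (distr_op True \<Omega> z)) \<Omega>)"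
    unfolding a(1) by (simp add: E_measure_def distr_op_def)
   show "\<exists>\<mu>. represents \<Omega> (distr_op True \<Omega> z) \<mu>" using z(2) by (simp add: distr_op_def)
   show "vary_z \<phi> \<tau> z \<in> D\<^sub>2" if "\<bar>\<tau>\<bar> < t0" "\<exists>\<mu>. represents \<Omega> (distr_op True \<Omega> (vary_z \<phi> \<tau> z)) \<mu>" for \<tau>
    using that absolutely_integrable_iff[THEN iffD2, OF vary_z_integrable[OF that(1) z(1)]] unfolding a(2) BD_def by (simp add: distr_op_def)
  qed (rule z(1))
 next
  assume a: "R\<^sub>2 = (%z. function_of_measure \<Omega> \<rho>\<^sub>2 (D_measure \<Omega> z) \<Omega>)" "D\<^sub>2 = BV_vec \<Omega>"
  have z: "integrable (Leb \<Omega>) z" "\<exists>\<mu>. represents \<Omega> (distr_D \<Omega> z) \<mu>"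
   using assms(20) absolutely_integrable_iff unfolding a(2) BV_vec_def by blast+
  show thesis
  proof (rule that[of False])
   show "R\<^sub>2 = (%z. function_of_measure \<Omega> \<rho>\<^sub>2 (representing_measure \<Omega> (distr_op False \<Omega> z)) \<Omega>)"
    unfolding a(1) by (simp add: D_measure_def distr_op_def)
   show "\<exists>\<mu>. represents \<Omega> (distr_op False \<Omega> z) \<mu>" using z(2) by (simp add: distr_op_def)
   show "vary_z \<phi> \<tau> z \<in> D\<^sub>2" if "\<bar>\<tau>\<bar> < t0" "\<exists>\<mu>. represents \<Omega> (distr_op False \<Omega> (vary_z \<phi> \<tau> z)) \<mu>" for \<tau>
    using that absolutely_integrable_iff[THEN iffD2, OF vary_z_integrable[OF that(1) z(1)]] unfolding a(2) BV_vec_def by (simp add: distr_op_def)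
  qed (rule z(1))
 next
  assume a: "R\<^sub>2 = (%z. function_of_measure \<Omega> \<rho>\<^sub>2 (D_measure \<Omega> z) \<Omega>)" "D\<^sub>2 = BV_gradients \<Omega>"
  have z: "integrable (Leb \<Omega>) z" "\<exists>\<mu>. represents \<Omega> (distr_D \<Omega> z) \<mu>"
   using assms(20) absolutely_integrable_iff unfolding a(2) BV_gradients_def BV_vec_def by blast+
  obtain u where u: "u \<in> BV \<Omega>" "D_scalar \<Omega> u = lebesgue_times \<Omega> (%x. rowvector (z x))"
   using assms(20) unfolding a(2) BV_gradients_def by blast
  show thesis
  proof (rule that[of False])
   show "R\<^sub>2 = (%z. function_of_measure \<Omega> \<rho>\<^sub>2 (representing_measure \<Omega> (distr_op False \<Omega> z)) \<Omega>)"
    unfolding a(1) by (simp add: D_measure_def distr_op_def)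
   show "\<exists>\<mu>. represents \<Omega> (distr_op False \<Omega> z) \<mu>" using z(2) by (simp add: distr_op_def)
   show "vary_z \<phi> \<tau> z \<in> D\<^sub>2" if "\<bar>\<tau>\<bar> < t0" "\<exists>\<mu>. represents \<Omega> (distr_op False \<Omega> (vary_z \<phi> \<tau> z)) \<mu>" for \<tau>
   proof -
    have "vary_z \<phi> \<tau> z \<in> BV_vec \<Omega>"
     using that absolutely_integrable_iff[THEN iffD2, OF vary_z_integrable[OF that(1) z(1)]] unfolding BV_vec_def by (simp add: distr_op_def)
    then show ?thesis unfolding a(2) BV_gradients_def
     using gradient_variation[OF that(1) u(1) z(1) u(2)] by blast
   qed
  qed (rule z(1))
 qed
 obtain \<mu> where \<mu>: "represents \<Omega> (distr_op s \<Omega> z) \<mu>" using rep by blast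
 have fin: "function_of_measure \<Omega> \<rho>\<^sub>2 (representing_measure \<Omega> (distr_op s \<Omega> z)) \<Omega> < \<infinity>"
  using assms(21) unfolding R2 .
 note E1 = first_energy[OF assms(3,4,6,15,16,19) zi]
 note E2 = second_energy[OF assms(7,8,9,10,12,13,17,18) zi \<mu> fin]
 define a where "a \<tau> = function_of_measure \<Omega> \<rho>\<^sub>1
   (%E. D_scalar \<Omega> (vary_w \<phi> \<tau> w) E - lebesgue_times \<Omega> (%x. rowvector (vary_z \<phi> \<tau> z x)) E) \<Omega>" for \<tau>
 define b where "b \<tau> = function_of_measure \<Omega> \<rho>\<^sub>2 (representing_measure \<Omega> (distr_op s \<Omega> (vary_z \<phi> \<tau> z))) \<Omega>" for \<tau>
 have R: "R_tilde \<Omega> \<rho>\<^sub>1 R\<^sub>2 (vary_w \<phi> \<tau> w) (vary_z \<phi> \<tau> z) = a \<tau> + b \<tau>" for \<tau>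
  by (simp add: R_tilde_def a_def b_def R2)
 have ab: "a \<tau> < \<infinity>" "b \<tau> < \<infinity>" if "\<bar>\<tau>\<bar> < t0" for \<tau>
  unfolding a_def b_def by (rule E1(2); use that in simp) (rule E2(2); use that in simp)
 have "vary_w \<phi> \<tau> w \<in> BV \<Omega> \<and> vary_z \<phi> \<tau> z \<in> D\<^sub>2 \<and> R_tilde \<Omega> \<rho>\<^sub>1 R\<^sub>2 (vary_w \<phi> \<tau> w) (vary_z \<phi> \<tau> z) < \<infinity>"
  if \<tau>: "\<bar>\<tau>\<bar> < t0" for \<tau>
 proof (intro conjI)
  show "vary_w \<phi> \<tau> w \<in> BV \<Omega>" by (rule E1(1)) (use \<tau> in simp_all)
  show "vary_z \<phi> \<tau> z \<in> D\<^sub>2" by (rule pres[OF \<tau>], rule E2(1)) (use \<tau> in simp_all)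
  show "R_tilde \<Omega> \<rho>\<^sub>1 R\<^sub>2 (vary_w \<phi> \<tau> w) (vary_z \<phi> \<tau> z) < \<infinity>" unfolding R using ab[OF \<tau>] by simp
 qed
 moreover have "\<forall>\<^sub>F \<tau>::real in nhds 0. \<bar>\<tau>\<bar> < t0"
  using t0 by (auto simp: eventually_nhds_metric dist_real_def intro!: exI[of _ t0])
 ultimately have ev: "\<forall>\<^sub>F \<tau> in nhds 0. vary_w \<phi> \<tau> w \<in> BV \<Omega> \<and> vary_z \<phi> \<tau> z \<in> D\<^sub>2 \<and>
   R_tilde \<Omega> \<rho>\<^sub>1 R\<^sub>2 (vary_w \<phi> \<tau> w) (vary_z \<phi> \<tau> z) < \<infinity>"
  by (rule eventually_mono[rotated])
 have "(%\<tau>. enn2real (a \<tau>)) differentiable (at 0)" unfolding a_def by (rule E1(3)) simp_all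
 moreover have "(%\<tau>. enn2real (b \<tau>)) differentiable (at 0)" unfolding b_def by (rule E2(3)) simp_all
 ultimately have "(%\<tau>. enn2real (a \<tau>) + enn2real (b \<tau>)) differentiable (at 0)" by (rule differentiable_add)
 then have "(%\<tau>. enn2real (R_tilde \<Omega> \<rho>\<^sub>1 R\<^sub>2 (vary_w \<phi> \<tau> w) (vary_z \<phi> \<tau> z))) differentiable (at 0)"
  by (rule differentiable_near_0[OF _ t0(1)]) (use ab in \<open>simp add: R enn2real_plus\<close>)
 with ev show ?thesis by blast
qed

end
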